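(* For any $(v,w)\in H^1(\Gamma_h)\times H^1(\Gamma_h)$, the following estimates hold: $$\left|\langle v^\ell,w^\ell\rangle_{L^2(\Gamma)}-\langle v,w\rangle_{L^2(\Gamma_h)}\right|\le Ch^2\|v^\ell\|_{L^2(\Gamma)}\|w^\ell\|_{L^2(\Gamma)},$$ $$\left|a(v^\ell,w^\ell)-\bar a(v,w)\right|\le Ch^2\|\nabla_\Gamma v^\ell\|_{L^2(\Gamma)}\|\nabla_\Gamma w^\ell\|_{L^2(\Gamma)},$$ where $a(\phi,\psi)=\int_\Gamma\nabla_\Gamma\phi\cdot\nabla_\Gamma\psi$, $\bar a(v,w)=\int_{\Gamma_h}\nabla_{\Gamma_h}v\cdot\nabla_{\Gamma_h}w$, and $C$ depends only on the geometry of $\Gamma$.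
   Context: Surface. $\Gamma\subset\mathbb{R}^3$ is a $\mathcal{C}^2$ surface without boundary, with unit normal field $\nu$; $\nabla_\Gamma f=\nabla f-(\nabla f\cdot\nu)\nu$ is the tangential gradient. Fermi coordinates. $U\subset\mathbb{R}^3$ (the Fermi stripe of $\Gamma$) is an open set, associated with $\Gamma$, such that every $\mathbf{x}\in U$ admits a unique decomposition $\mathbf{x}=\mathbf{a}(\mathbf{x})+d(\mathbf{x})\nu(\mathbf{a}(\mathbf{x}))$ with $\mathbf{a}(\mathbf{x})\in\Gamma$ and $d(\mathbf{x})\in\mathbb{R}$. Mesh. For $h>0$, $\Gamma_h=\bigcup_{E\in\mathcal{T}_h}E$, where $\mathcal{T}_h$ is a finite set of non-overlapping flat simple polygons (no holes, non-self-intersecting boundary) of diameter $h_E\le h$; $\Gamma_h\subset U$; $\mathbf{a}:\Gamma_h\to\Gamma$ is one-to-one (a bijection); the vertices (nodes) of $\Gamma_h$ lie on $\Gamma$. Nonconforming meshes are allowed (hanging nodes count as vertices). There are $\gamma_1,\gamma_2>0$ such that, for all $h$ and all $E\in\mathcal{T}_h$: (A) $E$ is star-shaped with respect to a ball of radius $\rho_E\ge\gamma_1h_E$; (B) any two distinct nodes $P,Q$ of $E$ satisfy $\|P-Q\|\ge\gamma_2h_E$. $H^1(\Gamma_h)$ is the space of functions on the polyhedral surface $\Gamma_h$ that are $H^1$ on each $E$ with matching traces across common edges; $\nabla_{\Gamma_h}$ is the elementwise gradient in the plane of each $E$. Lifts. For $\phi:\Gamma_h\to\mathbb{R}$, $\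phi^\ell:=\phi\circ(\mathbf{a}_{|\Gamma_h})^{-1}:\Gamma\to\mathbb{R}$.
   Formalization: The mesh size is required to be small, h ≤ h_0, where h_0 and C depend only on Γ and the shape-regularity constants γ_1, γ_2 (coarse meshes admit no uniform C); the Fermi decomposition is unique among |d| < δ, as uniqueness over all real d fails for compact Γ. *)

theory Defs
  imports "HOL-Analysis.Analysis"
begin

type_synonym point = "real ^ 3"


text \<open>Hausdorff measure.  The factor \<open>unit_ball_vol k / 2 ^ k\<close> normalises it so that it
  is arc length for \<open>k = 1\<close> and surface area for \<open>k = 2\<close>; only these two cases are used
  (for \<open>k = 0\<close> empty covering sets would be counted with weight 1).  Boundedness of the
  covering sets is required because \<^const>\<open>diameter\<close> is unspecified on unbounded sets.\<close>

definition hausdorff_pre :: "nat \<Rightarrow> real \<Rightarrow> 'a::metric_space set \<Rightarrow> ennreal" where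
  "hausdorff_pre k \<epsilon> A =
     (INF C \<in> {C :: nat \<Rightarrow> 'a set. A \<subseteq> (\<Union>i. C i) \<and> (\<forall>i. bounded (C i) \<and> diameter (C i) \<le> \<epsilon>)}.
        (\<Sum>i. ennreal (unit_ball_vol (real k) / 2 ^ k * diameter (C i) ^ k)))"

definition hausdorff_outer :: "nat \<Rightarrow> 'a::metric_space set \<Rightarrow> ennreal" where
  "hausdorff_outer k A = (SUP \<epsilon> \<in> {0<..}. hausdorff_pre k \<epsilon> A)"

text \<open>The measure lives on the Caratheodory-measurable sets, so it is complete.\<close>

definition hausdorff_measure :: "nat \<Rightarrow> 'a::metric_space measure" where
  "hausdorff_measure k =
     measure_of UNIV (lambda_system UNIV UNIV (hausdorff_outer k)) (hausdorff_outer k)"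

definition L2_on :: "nat \<Rightarrow> point set \<Rightarrow> (point \<Rightarrow> 'b::{real_inner, second_countable_topology, banach}) \<Rightarrow> bool" where
  "L2_on k S f \<longleftrightarrow>
     set_borel_measurable (hausdorff_measure k) S f \<and>
     set_integrable (hausdorff_measure k) S (\<lambda>x. (norm (f x))\<^sup>2)"

definition L2_inner :: "nat \<Rightarrow> point set \<Rightarrow> (point \<Rightarrow> 'b::real_inner) \<Rightarrow> (point \<Rightarrow> 'b) \<Rightarrow> real" where
  "L2_inner k S f g = (LINT x:S|hausdorff_measure k. f x \<bullet> g x)"

definition L2_norm :: "nat \<Rightarrow> point set \<Rightarrow> (point \<Rightarrow> 'b::real_inner) \<Rightarrow> real" where
  "L2_norm k S f = sqrt (L2_inner k S f f)"


text \<open>A \<open>C\<^sup>2\<close> surface is locally a regular level set of a \<open>C\<^sup>2\<close> function.  The local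
  function is oriented so that its normalised gradient is the given normal \<open>\<nu>\<close>, which
  makes \<open>\<nu>\<close> a \<open>C\<^sup>1\<close> unit normal field.  Closedness of \<open>\<Gamma>\<close> as a subset of space excludes
  missing boundary points, as for an open disc.\<close>

definition C2_on :: "point set \<Rightarrow> (point \<Rightarrow> real) \<Rightarrow> (point \<Rightarrow> point) \<Rightarrow> (point \<Rightarrow> point \<Rightarrow>\<^sub>L point) \<Rightarrow> bool" where
  "C2_on W \<phi> g H \<longleftrightarrow>
     (\<forall>x\<in>W. GDERIV \<phi> x :> g x) \<and>
     (\<forall>x\<in>W. (g has_derivative blinfun_apply (H x)) (at x)) \<and>
     continuous_on W H"

definition C2_surface :: "point set \<Rightarrow> (point \<Rightarrow> point) \<Rightarrow> bool" where
  "C2_surface \<Gamma> \<nu> \<longleftrightarrow> closed \<Gamma> \<and>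
     (\<forall>p\<in>\<Gamma>. \<exists>W \<phi> g H. open W \<and> p \<in> W \<and> C2_on W \<phi> g H \<and>
        \<Gamma> \<inter> W = {x\<in>W. \<phi> x = 0} \<and>
        (\<forall>x\<in>\<Gamma> \<inter> W. g x \<noteq> 0 \<and> \<nu> x = g x /\<^sub>R norm (g x)))"


text \<open>Fermi coordinates.  Uniqueness of the decomposition \<open>x = p + s \<nu>(p)\<close> is understood
  within a width \<open>\<delta>\<close>: without a bound on \<open>s\<close> it fails for every point off a compact surface,
  since nearest and farthest points of \<open>\<Gamma>\<close> both provide decompositions.\<close>

definition fermi_stripe :: "point set \<Rightarrow> (point \<Rightarrow> point) \<Rightarrow> real \<Rightarrow> point set \<Rightarrow> bool" where
  "fermi_stripe \<Gamma> \<nu> \<delta> U \<longleftrightarrow> open U \<and>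
     (\<forall>x\<in>U. \<exists>!(p, s). p \<in> \<Gamma> \<and> \<bar>s\<bar> < \<delta> \<and> x = p + s *\<^sub>R \<nu> p)"

definition fermi_proj :: "point set \<Rightarrow> (point \<Rightarrow> point) \<Rightarrow> real \<Rightarrow> point \<Rightarrow> point" where
  "fermi_proj \<Gamma> \<nu> \<delta> x = (THE p. p \<in> \<Gamma> \<and> (\<exists>s. \<bar>s\<bar> < \<delta> \<and> x = p + s *\<^sub>R \<nu> p))"


text \<open>A polygon is given by the cyclic list of its vertices; consecutive edges may be
  collinear, so hanging nodes can be listed.  Disjointness of the half-open edges says
  that the closed polygonal line does not intersect itself.\<close>

definition poly_edge :: "point list \<Rightarrow> nat \<Rightarrow> point set" where
  "poly_edge ps i = closed_segment (ps ! i) (ps ! (Suc i mod length ps))"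

definition poly_edges :: "point list \<Rightarrow> point set set" where
  "poly_edges ps = poly_edge ps ` {..<length ps}"

definition poly_boundary :: "point list \<Rightarrow> point set" where
  "poly_boundary ps = \<Union> (poly_edges ps)"

definition simple_polygon :: "point list \<Rightarrow> bool" where
  "simple_polygon ps \<longleftrightarrow> 3 \<le> length ps \<and> aff_dim (set ps) = 2 \<and>
     (\<forall>i<length ps. ps ! i \<noteq> ps ! (Suc i mod length ps)) \<and>
     (\<forall>i<length ps. \<forall>j<length ps. i \<noteq> j \<longrightarrow>
        (poly_edge ps i - {ps ! (Suc i mod length ps)}) \<inter>
        (poly_edge ps j - {ps ! (Suc j mod length ps)}) = {})"

text \<open>The polygon as a closed planar region: the boundary curve and what it encloses within
  its plane (the two-dimensional analogue of \<^const>\<open>inside\<close>).\<close>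

definition poly_region :: "point list \<Rightarrow> point set" where
  "poly_region ps = poly_boundary ps \<union>
     {x \<in> affine hull (set ps) - poly_boundary ps.
        bounded (connected_component_set (affine hull (set ps) - poly_boundary ps) x)}"

abbreviation poly_interior :: "point list \<Rightarrow> point set" where
  "poly_interior ps \<equiv> rel_interior (poly_region ps)"

text \<open>Nothing below depends on which of the two unit normals is chosen.\<close>

definition poly_normal :: "point list \<Rightarrow> point" where
  "poly_normal ps = (SOME n. norm n = 1 \<and> (\<forall>x\<in>set ps. \<forall>y\<in>set ps. n \<bullet> (x - y) = 0))"

definition star_shaped_wrt_ball :: "point set \<Rightarrow> real \<Rightarrow> bool" where
  "star_shaped_wrt_ball E \<rho> \<longleftrightarrow>
     (\<exists>c \<in> affine hull E. \<forall>z \<in> ball c \<rho> \<inter> affine hull E. \<forall>x\<in>E. closed_segment z x \<subseteq> E)"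

definition mesh_surface :: "point list set \<Rightarrow> point set" where
  "mesh_surface T = (\<Union>ps\<in>T. poly_region ps)"

text \<open>The condition on \<open>set qs \<inter> poly_region ps\<close> says that hanging nodes count as vertices.\<close>

definition surface_mesh ::
  "point set \<Rightarrow> (point \<Rightarrow> point) \<Rightarrow> real \<Rightarrow> point set \<Rightarrow> real \<Rightarrow> real \<Rightarrow> real \<Rightarrow> point list set \<Rightarrow> bool" where
  "surface_mesh \<Gamma> \<nu> \<delta> U \<gamma>\<^sub>1 \<gamma>\<^sub>2 h T \<longleftrightarrow>
     finite T \<and>
     (\<forall>ps\<in>T. simple_polygon ps \<and> set ps \<subseteq> \<Gamma> \<and> diameter (poly_region ps) \<le> h \<and>
        (\<exists>\<rho> \<ge> \<gamma>\<^sub>1 * diameter (poly_region ps). star_shaped_wrt_ball (poly_region ps) \<rho>) \<and>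
        (\<forall>P\<in>set ps. \<forall>Q\<in>set ps. P \<noteq> Q \<longrightarrow> norm (P - Q) \<ge> \<gamma>\<^sub>2 * diameter (poly_region ps))) \<and>
     (\<forall>ps\<in>T. \<forall>qs\<in>T. ps \<noteq> qs \<longrightarrow> poly_interior ps \<inter> poly_interior qs = {}) \<and>
     (\<forall>ps\<in>T. \<forall>qs\<in>T. set qs \<inter> poly_region ps \<subseteq> set ps) \<and>
     mesh_surface T \<subseteq> U \<and>
     bij_betw (fermi_proj \<Gamma> \<nu> \<delta>) (mesh_surface T) \<Gamma>"

definition lift :: "point set \<Rightarrow> (point \<Rightarrow> point) \<Rightarrow> real \<Rightarrow> point list set \<Rightarrow> (point \<Rightarrow> real) \<Rightarrow> point \<Rightarrow> real" where
  "lift \<Gamma> \<nu> \<delta> T \<phi> = \<phi> \<circ> inv_into (mesh_surface T) (fermi_proj \<Gamma> \<nu> \<delta>)"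


definition C1_function :: "(point \<Rightarrow> real) \<Rightarrow> (point \<Rightarrow> point) \<Rightarrow> bool" where
  "C1_function \<phi> g \<longleftrightarrow> (\<forall>x. GDERIV \<phi> x :> g x) \<and> continuous_on UNIV g"

definition tangential :: "point \<Rightarrow> point \<Rightarrow> point" where
  "tangential n z = z - (z \<bullet> n) *\<^sub>R n"

text \<open>Weak tangential gradients on a surface \<open>S\<close> with unit normal field \<open>n\<close>, used both for
  \<open>\<Gamma>\<close> and for the relative interior of a flat polygon.  Test fields are \<open>C\<^sup>1\<close>, tangential, and
  supported in a compact subset of \<open>S\<close>; for such \<open>X\<close> integration by parts on \<open>S\<close> has neither
  boundary nor curvature terms.  The surface divergence is the trace of the derivative over
  the tangent plane, i.e. the full trace minus the normal component.\<close>

definition tangential_test_field ::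
  "point set \<Rightarrow> (point \<Rightarrow> point) \<Rightarrow> (point \<Rightarrow> point) \<Rightarrow> (point \<Rightarrow> point \<Rightarrow>\<^sub>L point) \<Rightarrow> bool" where
  "tangential_test_field S n X D \<longleftrightarrow>
     (\<forall>x. (X has_derivative blinfun_apply (D x)) (at x)) \<and> continuous_on UNIV D \<and>
     compact (closure {x. X x \<noteq> 0}) \<and> closure {x. X x \<noteq> 0} \<inter> closure S \<subseteq> S \<and>
     (\<forall>x\<in>S. X x \<bullet> n x = 0)"

definition surface_div :: "(point \<Rightarrow> point) \<Rightarrow> (point \<Rightarrow> point \<Rightarrow>\<^sub>L point) \<Rightarrow> point \<Rightarrow> real" where
  "surface_div n D x = (\<Sum>b\<in>Basis. blinfun_apply (D x) b \<bullet> b) - blinfun_apply (D x) (n x) \<bullet> n x"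

definition is_weak_grad ::
  "point set \<Rightarrow> (point \<Rightarrow> point) \<Rightarrow> (point \<Rightarrow> real) \<Rightarrow> (point \<Rightarrow> point) \<Rightarrow> bool" where
  "is_weak_grad S n f G \<longleftrightarrow> L2_on 2 S G \<and> (\<forall>x\<in>S. G x \<bullet> n x = 0) \<and>
     (\<forall>X D. tangential_test_field S n X D \<longrightarrow>
        (LINT x:S|hausdorff_measure 2. f x * surface_div n D x) =
        - (LINT x:S|hausdorff_measure 2. G x \<bullet> X x))"

definition H1_on :: "point set \<Rightarrow> (point \<Rightarrow> point) \<Rightarrow> (point \<Rightarrow> real) \<Rightarrow> bool" where
  "H1_on S n f \<longleftrightarrow> L2_on 2 S f \<and> (\<exists>G. is_weak_grad S n f G)"

text \<open>Weak gradients are unique up to null sets, so which one is chosen is immaterial.\<close>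

definition weak_grad :: "point set \<Rightarrow> (point \<Rightarrow> point) \<Rightarrow> (point \<Rightarrow> real) \<Rightarrow> point \<Rightarrow> point" where
  "weak_grad S n f = (SOME G. is_weak_grad S n f G)"

definition poly_grad :: "point list \<Rightarrow> (point \<Rightarrow> real) \<Rightarrow> point \<Rightarrow> point" where
  "poly_grad ps v = weak_grad (poly_interior ps) (\<lambda>_. poly_normal ps) v"

text \<open>\<open>g\<close> is the trace on the boundary of a polygon of the \<open>H\<^sup>1\<close> function \<open>v\<close>: the limit in
  \<open>L\<^sup>2\<close> of the boundary values of \<open>C\<^sup>1\<close> functions converging to \<open>v\<close> in the \<open>H\<^sup>1\<close> norm.\<close>

definition has_trace :: "point list \<Rightarrow> (point \<Rightarrow> real) \<Rightarrow> (point \<Rightarrow> real) \<Rightarrow> bool" where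
  "has_trace ps v g \<longleftrightarrow> L2_on 1 (poly_boundary ps) g \<and>
     (\<exists>\<phi> D\<phi>. (\<forall>k::nat. C1_function (\<phi> k) (D\<phi> k)) \<and>
        (\<lambda>k. L2_norm 2 (poly_interior ps) (\<lambda>x. \<phi> k x - v x)) \<longlonglongrightarrow> 0 \<and>
        (\<lambda>k. L2_norm 2 (poly_interior ps)
               (\<lambda>x. tangential (poly_normal ps) (D\<phi> k x) - poly_grad ps v x)) \<longlonglongrightarrow> 0 \<and>
        (\<lambda>k. L2_norm 1 (poly_boundary ps) (\<lambda>x. \<phi> k x - g x)) \<longlonglongrightarrow> 0)"

definition H1_mesh :: "point list set \<Rightarrow> (point \<Rightarrow> real) \<Rightarrow> bool" where
  "H1_mesh T v \<longleftrightarrow>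
     (\<forall>ps\<in>T. H1_on (poly_interior ps) (\<lambda>_. poly_normal ps) v) \<and>
     (\<exists>g. (\<forall>ps\<in>T. has_trace ps v (g ps)) \<and>
        (\<forall>ps\<in>T. \<forall>qs\<in>T. ps \<noteq> qs \<longrightarrow>
           (\<forall>e \<in> poly_edges ps \<inter> poly_edges qs.
              AE x in hausdorff_measure 1. x \<in> e \<longrightarrow> g ps x = g qs x)))"

definition a_form :: "point set \<Rightarrow> (point \<Rightarrow> point) \<Rightarrow> (point \<Rightarrow> real) \<Rightarrow> (point \<Rightarrow> real) \<Rightarrow> real" where
  "a_form \<Gamma> \<nu> \<phi> \<psi> = L2_inner 2 \<Gamma> (weak_grad \<Gamma> \<nu> \<phi>) (weak_grad \<Gamma> \<nu> \<psi>)"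

definition a_bar :: "point list set \<Rightarrow> (point \<Rightarrow> real) \<Rightarrow> (point \<Rightarrow> real) \<Rightarrow> real" where
  "a_bar T v w = (\<Sum>ps\<in>T. L2_inner 2 (poly_interior ps) (poly_grad ps v) (poly_grad ps w))"

end

theory Submission
  imports Defs
begin

text \<open>On a polygon of diameter at most \<open>h\<close> with vertices on \<open>\<Gamma>\<close> the height over \<open>\<Gamma>\<close> is
\<open>O(h\<^sup>2)\<close> and, by shape regularity, the normals differ by \<open>O(h)\<close>. Hence the closest point map \<open>a\<close>
and its inverse are Lipschitz with constant \<open>L = 1 + O(h\<^sup>2)\<close>. They distort Hausdorff measure by at
most \<open>L\<^sup>2\<close>, which bounds the difference of the \<open>L\<^sup>2\<close> inner products. The gradient of the lift is
the adjoint of the derivative of \<open>a\<^sup>-\<^sup>1\<close> applied to the gradient, a near isometry between tangent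
planes, which bounds the difference of the energies.

It remains to see that the piecewise lifted gradient is the weak gradient of the lift. Cutting off
near the edges shows that the integral of \<open>div (v X)\<close> over a lifted polygon depends only on the
trace of \<open>v\<close>, up to a multiple of the \<open>L\<^sup>1\<close> distance of the traces, so no conormals enter. As the
traces of neighbouring polygons agree, all of them are approximated by one polynomial, for which the
sum of these integrals vanishes by the divergence theorem on \<open>\<Gamma>\<close>. Weak gradients are unique
because polynomials are dense in \<open>L\<^sup>2\<close>.\<close>

section \<open>Hausdorff measure\<close>

text \<open>Normals differ by O(h), yet lengths must agree up to O(h^2). The first-order error is
  almost orthogonal to the displacement that it perturbs, so it enters squared lengths only through
  its own square; this is the gain behind \<open>L\<close>, and it lets bi-Lipschitz bounds take the
  place of a Jacobian. \<open>K\<close> bounds the curvature, \<open>16 * K / \<gamma>\<close> the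
  tilt of a shape-regular polygon, and \<open>20 * M * h \<le> 1\<close> absorbs higher-order terms.
  The analytic difficulty is that a trace comes with a separate approximating sequence on every
  polygon, and these sequences need not match across an edge. Hence an estimate that sees boundary
  values only through an L^1 norm: the cutoff vanishes in balls of radius r around net points of the
  edges, its gradient has size 1/r on an area O(r^2) per ball, and the sum over about 1/r balls is a
  Riemann sum. Area growth of \<Gamma> and the divergence theorem are proved in graph charts.
  Compactness, on which the uniform constants rest, is forced by the bijection with a finite
  mesh.\<close>

notation hausdorff_outer ("\<H>")

definition hausdorff_weight :: "nat => 'a::metric_space set => ennreal" where
 "hausdorff_weight k C = ennreal (unit_ball_vol (real k) / 2 ^ k * diameter C ^ k)"

lemma hausdorff_weight_empty [simp]: "0 < k ==> hausdorff_weight k {} = 0"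
 by (simp add: hausdorff_weight_def)

lemma pre_le:
 assumes "A \<subseteq> (\<Union>i. C i)" "!!i. bounded (C i)" "!!i. diameter (C i) \<le> \<epsilon>"
 shows "hausdorff_pre k \<epsilon> A \<le> (\<Sum>i. hausdorff_weight k (C i))"
 unfolding hausdorff_pre_def hausdorff_weight_def
 by (rule INF_lower) (use assms in auto)

lemma pre_close:
 assumes "hausdorff_pre k \<epsilon> A < e"
 obtains C where "A \<subseteq> (\<Union>i. C i)" "!!i. bounded (C i)" "!!i. diameter (C i) \<le> \<epsilon>"
  "(\<Sum>i. hausdorff_weight k (C i)) < e"
 using assms unfolding hausdorff_pre_def hausdorff_weight_def INF_less_iff by auto

lemma pre_mono: "A \<subseteq> B ==> hausdorff_pre k \<epsilon> A \<le> hausdorff_pre k \<epsilon> B"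
 unfolding hausdorff_pre_def by (rule INF_superset_mono) auto

lemma pre_antimono: "\<epsilon> \<le> \<epsilon>' ==> hausdorff_pre k \<epsilon>' A \<le> hausdorff_pre k \<epsilon> A"
 unfolding hausdorff_pre_def by (rule INF_superset_mono) (auto intro: order_trans)

lemma pre_le_outer: "0 < \<epsilon> ==> hausdorff_pre k \<epsilon> A \<le> \<H> k A"
 unfolding hausdorff_outer_def by (rule SUP_upper) auto

lemma outer_leI: "(!!\<epsilon>. 0 < \<epsilon> ==> hausdorff_pre k \<epsilon> A \<le> M) ==> \<H> k A \<le> M"
 unfolding hausdorff_outer_def by (rule SUP_least) auto

lemma outer_mono: "A \<subseteq> B ==> \<H> k A \<le> \<H> k B"
 by (intro outer_leI order_trans[OF pre_mono pre_le_outer])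

lemma outer_empty [simp]: "0 < k ==> \<H> k {} = 0"
proof -
 assume k: "0 < k"
 have "\<H> k ({}::'a set) \<le> 0"
 proof (rule outer_leI)
  fix \<epsilon> :: real assume "0 < \<epsilon>"
  then show "hausdorff_pre k \<epsilon> ({}::'a set) \<le> 0"
   using pre_le[of "{}" "\<lambda>_. {}" \<epsilon> k] k by simp
 qed
 then show ?thesis by simp
qed

text \<open>Near-optimal covers of the sets \<open>A n\<close>, with excess
  \<open>e * (1/2) ^ Suc n\<close>, are merged into one sequence by
  \<open>prod_decode\<close>.\<close>

lemma pre_UN: "hausdorff_pre k \<epsilon> (\<Union>n::nat. A n) \<le> (\<Sum>n. hausdorff_pre k \<epsilon> (A n))"
proof (rule ennreal_le_epsilon)
 fix e :: real assume e: "0 < e" and fin: "(\<Sum>n. hausdorff_pre k \<epsilon> (A n)) < top"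
 then have *: "!!n. hausdorff_pre k \<epsilon> (A n) < hausdorff_pre k \<epsilon> (A n) + e * (1/2)^Suc n"
  by (auto simp add: less_top dest!: ennreal_suminf_lessD)
 have "\<exists>B. A n \<subseteq> (\<Union>i. B i) \<and> (\<forall>i. bounded (B i) \<and> diameter (B i) \<le> \<epsilon>) \<and>
   (\<Sum>i. hausdorff_weight k (B i)) \<le> hausdorff_pre k \<epsilon> (A n) + e * (1/2)^Suc n" for n
  using pre_close[OF *[of n]] by (metis less_imp_le)
 then obtain B where B: "!!n. A n \<subseteq> (\<Union>i. B n i)" "!!n i. bounded (B n i)"
   "!!n i. diameter (B n i) \<le> \<epsilon>"
   "!!n. (\<Sum>i. hausdorff_weight k (B n i)) \<le> hausdorff_pre k \<epsilon> (A n) + e * (1/2)^Suc n"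
  by metis
 define C where "C = case_prod B \<circ> prod_decode"
 have "(\<Union>n. A n) \<subseteq> (\<Union>i. C i)"
 proof
  fix x assume "x \<in> (\<Union>n. A n)"
  then obtain n i where "x \<in> B n i" using B(1) by blast
  then have "x \<in> C (prod_encode (n, i))" by (simp add: C_def)
  then show "x \<in> (\<Union>i. C i)" by auto
 qed
 then have "hausdorff_pre k \<epsilon> (\<Union>n. A n) \<le> (\<Sum>i. hausdorff_weight k (C i))"
  by (rule pre_le) (auto simp: C_def B split: prod.split)
 also have "... = (\<Sum>n. \<Sum>i. hausdorff_weight k (B n i))"
  using suminf_ennreal_2dimen[of "\<lambda>n. \<Sum>i. hausdorff_weight k (B n i)" "\<lambda>p. hausdorff_weight k (case_prod B p)"]
  unfolding C_def comp_def by simp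
 also have "... \<le> (\<Sum>n. hausdorff_pre k \<epsilon> (A n) + e * (1/2) ^ Suc n)"
  by (intro suminf_le B) auto
 also have "... = (\<Sum>n. hausdorff_pre k \<epsilon> (A n)) + (\<Sum>n. ennreal e * ennreal ((1/2) ^ Suc n))"
  using e by (subst suminf_add[symmetric]) (auto simp del: ennreal_suminf_cmult simp add: ennreal_mult[symmetric])
 also have "... = (\<Sum>n. hausdorff_pre k \<epsilon> (A n)) + e"
  unfolding ennreal_suminf_cmult
  by (subst suminf_ennreal_eq[OF zero_le_power power_half_series]) auto
 finally show "hausdorff_pre k \<epsilon> (\<Union>n. A n) \<le> (\<Sum>n. hausdorff_pre k \<epsilon> (A n)) + e" .
qed

lemma outer_UN: "\<H> k (\<Union>n::nat. A n) \<le> (\<Sum>n. \<H> k (A n))"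
 by (intro outer_leI order_trans[OF pre_UN] suminf_le pre_le_outer) auto

lemma outer_Un:
 assumes "0 < k" shows "\<H> k (A \<union> B) \<le> \<H> k A + \<H> k B"
proof -
 have "\<H> k (A \<union> B) \<le> (\<Sum>n. \<H> k (binaryset A B n))"
  unfolding UN_binaryset_eq[symmetric] by (rule outer_UN)
 also have "... = \<H> k A + \<H> k B"
  using assms by (intro suminf_binaryset_eq) auto
 finally show ?thesis .
qed

lemma outer_measure_space_hausdorff: "0 < k ==> outer_measure_space UNIV (\<H> k)"
 unfolding outer_measure_space_def positive_def increasing_def countably_subadditive_def
 by (auto intro: outer_mono outer_UN)

lemma measure_space_hausdorff:
 "0 < k ==> measure_space UNIV (lambda_system UNIV UNIV (\<H> k)) (\<H> k)"
proof -
 assume "0 < k"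
 interpret sigma_algebra UNIV "UNIV :: 'a set set"
  using sigma_algebra_Pow[of "UNIV :: 'a set"] by simp
 show ?thesis
  by (rule caratheodory_lemma) (rule outer_measure_space_hausdorff[OF \<open>0 < k\<close>])
qed

lemma space_hausdorff [simp]: "space (hausdorff_measure k) = UNIV"
 by (simp add: hausdorff_measure_def)

lemma sets_hausdorff: "0 < k ==> sets (hausdorff_measure k) = lambda_system UNIV UNIV (\<H> k)"
 using measure_space_hausdorff[of k] unfolding hausdorff_measure_def measure_space_def
 by (intro sigma_algebra.sets_measure_of_eq) auto

lemma emeasure_hausdorff:
 "0 < k ==> A \<in> sets (hausdorff_measure k) ==> emeasure (hausdorff_measure k) A = \<H> k A"
 unfolding sets_hausdorff
 using measure_space_hausdorff[of k] unfolding hausdorff_measure_def measure_space_def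
 by (intro emeasure_measure_of_sigma) auto

text \<open>The opposite inequality is subadditivity, and for test sets of infinite outer measure
  there is nothing to show.\<close>

lemma in_sets_hausdorffI:
 fixes A :: "'a::metric_space set"
 assumes "0 < k" "!!T. \<H> k T < top ==> \<H> k (T \<inter> A) + \<H> k (T - A) \<le> \<H> k T"
 shows "A \<in> sets (hausdorff_measure k)"
proof -
 have "\<H> k (A \<inter> T) + \<H> k ((UNIV - A) \<inter> T) = \<H> k T" for T
 proof -
  have "A \<inter> T = T \<inter> A" "(UNIV - A) \<inter> T = T - A" "T = (T \<inter> A) \<union> (T - A)" by auto
  moreover have "\<H> k T \<le> \<H> k (T \<inter> A) + \<H> k (T - A)"
   using outer_Un[OF assms(1), of "T \<inter> A" "T - A"] calculation(3) by simp
  moreover have "\<H> k (T \<inter> A) + \<H> k (T - A) \<le> \<H> k T"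
   using assms(2)[of T] by (cases "\<H> k T = top") (auto simp: less_top)
  ultimately show ?thesis by simp
 qed
 then show ?thesis unfolding sets_hausdorff[OF assms(1)] lambda_system_def by simp
qed

lemma hausdorff_null_sets:
 assumes "0 < k" "\<H> k A = 0" shows "A \<in> null_sets (hausdorff_measure k)"
proof -
 have "A \<in> sets (hausdorff_measure k)"
 proof (rule in_sets_hausdorffI[OF assms(1)])
  fix T
  have "\<H> k (T \<inter> A) \<le> 0" using outer_mono[of "T \<inter> A" A k] assms by simp
  then show "\<H> k (T \<inter> A) + \<H> k (T - A) \<le> \<H> k T"
   using outer_mono[of "T - A" T k] by auto
 qed
 then show ?thesis using emeasure_hausdorff[OF assms(1), of A] assms(2) by auto
qed

lemma complete_measure_hausdorff: "0 < k ==> complete_measure (hausdorff_measure k)"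
proof
 fix A B :: "'a set" assume k: "0 < k" and *: "B \<subseteq> A" "A \<in> null_sets (hausdorff_measure k)"
 then have "\<H> k A = 0" using emeasure_hausdorff[of k A] by force
 then have "\<H> k B \<le> 0" using outer_mono[OF *(1), of k] by simp
 then show "B \<in> sets (hausdorff_measure k)"
  using hausdorff_null_sets[OF k, of B] by auto
qed

text \<open>A set of diameter below \<open>d\<close> meets at most one of \<open>A\<close> and
  \<open>B\<close>, so a fine cover of the union splits into covers of each. Two scales
  \<open>\<epsilon>1\<close> and \<open>\<epsilon>2\<close> occur because the suprema defining the
  two outer measures run independently.\<close>

lemma outer_separated:
 assumes k: "0 < k" and d: "0 < d" "!!a b. a \<in> A ==> b \<in> B ==> d \<le> dist a b"
 shows "\<H> k A + \<H> k B \<le> \<H> k (A \<union> B)"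
proof -
 have *: "hausdorff_pre k \<epsilon>1 A + hausdorff_pre k \<epsilon>2 B \<le> \<H> k (A \<union> B)"
  if e: "0 < \<epsilon>1" "0 < \<epsilon>2" for \<epsilon>1 \<epsilon>2
 proof -
  define \<epsilon> where "\<epsilon> = min (min \<epsilon>1 \<epsilon>2) (d/2)"
  have \<epsilon>: "0 < \<epsilon>" "\<epsilon> \<le> \<epsilon>1" "\<epsilon> \<le> \<epsilon>2" "\<epsilon> < d" using e d unfolding \<epsilon>_def by auto
  have "hausdorff_pre k \<epsilon> A + hausdorff_pre k \<epsilon> B \<le> hausdorff_pre k \<epsilon> (A \<union> B)"
   unfolding hausdorff_pre_def[of k \<epsilon> "A \<union> B"]
  proof (rule INF_greatest)
   fix C assume "C \<in> {C. A \<union> B \<subseteq> \<Union>(range C) \<and> (\<forall>i::nat. bounded (C i) \<and> diameter (C i) \<le> \<epsilon>)}"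
   then have C: "A \<union> B \<subseteq> (\<Union>i. C i)" "!!i. bounded (C i)" "!!i. diameter (C i) \<le> \<epsilon>" by auto
   define CA where "CA i = (if C i \<inter> A = {} then {} else C i)" for i
   define CB where "CB i = (if C i \<inter> B = {} then {} else C i)" for i
   have A: "hausdorff_pre k \<epsilon> A \<le> (\<Sum>i. hausdorff_weight k (CA i))"
    using C \<epsilon> unfolding CA_def by (intro pre_le) (auto split: , blast)
   have B: "hausdorff_pre k \<epsilon> B \<le> (\<Sum>i. hausdorff_weight k (CB i))"
    using C \<epsilon> unfolding CB_def by (intro pre_le) (auto split: , blast)
   have "hausdorff_weight k (CA i) + hausdorff_weight k (CB i) \<le> hausdorff_weight k (C i)" for i
   proof -
    have "C i \<inter> A = {} \<or> C i \<inter> B = {}"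
    proof (rule ccontr)
     assume "\<not> ?thesis"
     then obtain a b where "a \<in> C i" "a \<in> A" "b \<in> C i" "b \<in> B" by auto
     then have "d \<le> \<epsilon>"
      using d(2)[of a b] diameter_bounded_bound[OF C(2), of a i b] C(3)[of i] by simp
     then show False using \<epsilon> by simp
    qed
    then show ?thesis using k by (auto simp: CA_def CB_def)
   qed
   then have "(\<Sum>i. hausdorff_weight k (CA i)) + (\<Sum>i. hausdorff_weight k (CB i)) \<le> (\<Sum>i. hausdorff_weight k (C i))"
    by (subst suminf_add) (auto intro!: suminf_le)
   then show "hausdorff_pre k \<epsilon> A + hausdorff_pre k \<epsilon> B
     \<le> (\<Sum>i. ennreal (unit_ball_vol (real k) / 2 ^ k * diameter (C i) ^ k))"
    using add_mono[OF A B] unfolding hausdorff_weight_def[symmetric] by auto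
  qed
  then show ?thesis
   using add_mono[OF pre_antimono[OF \<epsilon>(2), of k A] pre_antimono[OF \<epsilon>(3), of k B]]
    pre_le_outer[OF \<epsilon>(1), of k "A \<union> B"] by auto
 qed
 have ne: "{0<..} \<noteq> ({} :: real set)" by auto
 show ?thesis
  unfolding hausdorff_outer_def[of k A] hausdorff_outer_def[of k B]
  unfolding ennreal_SUP_add_left[OF ne, symmetric] ennreal_SUP_add_right[OF ne]
  by (intro SUP_least *) auto
qed

text \<open>Caratheodory's criterion for metric outer measures. \<open>B n\<close> keeps distance
  \<open>1 / Suc n\<close> from \<open>F\<close> and is separated from it; between
  \<open>B n\<close> and \<open>T - F\<close> there remain the shells \<open>R m\<close> with
  \<open>m \<ge> n\<close>. Shells whose indices have the same parity are separated from each other,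
  so their measures sum to at most the finite measure of \<open>T\<close>, and the tail tends to
  0.\<close>

lemma closed_in_sets_hausdorff:
 assumes k: "0 < k" and F: "closed F"
 shows "F \<in> sets (hausdorff_measure k)"
proof (cases "F = {}")
 case False
 show ?thesis
 proof (rule in_sets_hausdorffI[OF k])
  fix T :: "'a set" assume fin: "\<H> k T < top"
  let ?H = "\<H> k"
  define B where "B n = {x\<in>T - F. 1 / Suc n \<le> infdist x F}" for n
  define R where "R n = {x\<in>T - F. 1 / Suc (Suc n) \<le> infdist x F \<and> infdist x F < 1 / Suc n}" for n
  have pos: "0 < infdist x F" if "x \<in> T - F" for x
   using that infdist_nonneg[of x F] in_closed_iff_infdist_zero[OF F False, of x] by auto
  have BR: "T - F \<subseteq> B n \<union> (\<Union>m. R (m + n))" for n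
  proof
   fix x assume x: "x \<in> T - F"
   show "x \<in> B n \<union> (\<Union>m. R (m + n))"
   proof (cases "x \<in> B n")
    case False
    then have lt: "infdist x F < 1 / Suc n" using x by (auto simp: B_def)
    obtain N where N: "1 / Suc N \<le> infdist x F"
     using pos[OF x] by (meson less_imp_le nat_approx_posE)
    define M where "M = (LEAST M. 1 / Suc M \<le> infdist x F)"
    have M: "1 / Suc M \<le> infdist x F" unfolding M_def by (rule LeastI) (rule N)
    have "n < M"
    proof (rule ccontr)
     assume "\<not> n < M"
     then have "1 / real (Suc n) \<le> 1 / real (Suc M)" by (intro divide_left_mono) auto
     then show False using lt M by simp
    qed
    then obtain M' where M': "M = Suc M'" "n \<le> M'" by (cases M) auto
    have "infdist x F < 1 / Suc M'"
     using not_less_Least[of M' "\<lambda>M. 1 / Suc M \<le> infdist x F"] M' unfolding M_def by auto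
    then have "x \<in> R M'" using M M' x by (auto simp: R_def)
    then have "x \<in> R ((M' - n) + n)" using M' by simp
    then show ?thesis by auto
   qed simp
  qed
  have sum_le: "(\<Sum>j<N. ?H (R (2 * j + c))) \<le> ?H (\<Union>j<N. R (2 * j + c))" for N c
  proof (induction N)
   case (Suc N)
   \<comment> \<open>The gap between shell \<open>2 * N + c\<close> and all earlier shells of the
     same parity. The value 1 is for \<open>2 * N + c = 0\<close>, where there are no earlier
     shells.\<close>
   define d where "d = (if 0 < 2 * N + c then 1 / real (2 * N + c) - 1 / real (Suc (2 * N + c)) else 1)"
   have d0: "0 < d" by (auto simp: d_def field_simps)
   have "?H (\<Union>j<N. R (2 * j + c)) + ?H (R (2 * N + c)) \<le> ?H ((\<Union>j<N. R (2 * j + c)) \<union> R (2 * N + c))"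
   proof (rule outer_separated[OF k d0])
    fix a b assume a: "a \<in> (\<Union>j<N. R (2 * j + c))" and b: "b \<in> R (2 * N + c)"
    then obtain j where j: "j < N" "a \<in> R (2 * j + c)" by auto
    have "1 / real (2 * N + c) \<le> 1 / real (Suc (Suc (2 * j + c)))"
     using j by (intro divide_left_mono) auto
    then have "1 / real (2 * N + c) \<le> infdist a F" using j by (auto simp: R_def)
    moreover have "infdist b F < 1 / real (Suc (2 * N + c))" using b by (simp add: R_def)
    moreover have "infdist a F \<le> infdist b F + dist a b" by (rule infdist_triangle)
    ultimately show "d \<le> dist a b"
     using j unfolding d_def by auto
   qed
   then have "(\<Sum>j<N. ?H (R (2 * j + c))) + ?H (R (2 * N + c)) \<le> ?H ((\<Union>j<N. R (2 * j + c)) \<union> R (2 * N + c))"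
    using Suc by (meson add_right_mono order_trans)
   then show ?case by (simp add: lessThan_Suc Un_commute add.commute)
  qed simp
  have sum_le': "(\<Sum>j. ?H (R (2 * j + c))) \<le> ?H T" for c
   unfolding suminf_eq_SUP
   by (rule SUP_least, rule order_trans[OF sum_le], rule outer_mono) (auto simp: R_def)
  have "(\<Sum>j<n. ?H (R j)) \<le> ?H T + ?H T" for n
  proof -
   have "(\<Sum>j<n. ?H (R j)) \<le> (\<Sum>j<2 * n. ?H (R j))" by (rule sum_mono2) auto
   also have "... = (\<Sum>j<n. ?H (R (2 * j + 0))) + (\<Sum>j<n. ?H (R (2 * j + 1)))"
    by (induction n) auto
   also have "... \<le> ?H T + ?H T"
    by (rule add_mono; rule order_trans[OF sum_le_suminf sum_le']) auto
   finally show ?thesis .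
  qed
  then have fin': "(\<Sum>j. ?H (R j)) < top"
   unfolding suminf_eq_SUP using fin by (intro le_less_trans[OF SUP_least[of UNIV _ "?H T + ?H T"]]) auto
  have Rfin: "?H (R j) \<noteq> top" for j
   using outer_mono[of "R j" T k] fin by (auto simp: R_def)
  define r where "r j = enn2real (?H (R j))" for j
  have r: "?H (R j) = ennreal (r j)" "0 \<le> r j" for j
   using Rfin[of j] by (auto simp: r_def less_top)
  have sr: "summable r"
   using fin' r by (intro summable_suminf_not_top) auto
  show "?H (T \<inter> F) + ?H (T - F) \<le> ?H T"
  proof (rule ennreal_le_epsilon)
   fix e :: real assume e: "0 < e"
   obtain n where n: "norm (\<Sum>i. r (i + n)) < e"
    using suminf_exist_split[OF e sr] by auto
   have tail: "(\<Sum>m. ?H (R (m + n))) \<le> ennreal e"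
   proof -
    have "(\<Sum>m. ?H (R (m + n))) = ennreal (\<Sum>i. r (i + n))"
     unfolding r(1) using sr r(2) by (intro suminf_ennreal2) auto
    then show ?thesis using n by auto
   qed
   have "?H (T - F) \<le> ?H (B n) + (\<Sum>m. ?H (R (m + n)))"
    by (rule order_trans[OF outer_mono[OF BR] order_trans[OF outer_Un[OF k]
       add_left_mono[OF outer_UN]]])
   also have "... \<le> ?H (B n) + ennreal e" using tail by simp
   finally have "?H (T \<inter> F) + ?H (T - F) \<le> ?H (T \<inter> F) + ?H (B n) + ennreal e"
    by auto
   also have "?H (T \<inter> F) + ?H (B n) \<le> ?H ((T \<inter> F) \<union> B n)"
   proof (rule outer_separated[OF k, of "1 / Suc n"])
    fix a b assume "a \<in> T \<inter> F" "b \<in> B n"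
    then show "1 / Suc n \<le> dist a b"
     using infdist_le[of a F b] by (auto simp: B_def dist_commute)
   qed simp
   also have "?H ((T \<inter> F) \<union> B n) \<le> ?H T"
    by (rule outer_mono) (auto simp: B_def)
   finally show "?H (T \<inter> F) + ?H (T - F) \<le> ?H T + ennreal e"
    by auto
  qed
 qed
qed simp

lemma borel_in_sets_hausdorff: "0 < k ==> A \<in> sets borel ==> A \<in> sets (hausdorff_measure k)"
proof -
 assume k: "0 < k" and "A \<in> sets borel"
 then have "A \<in> sigma_sets UNIV {F. closed F}"
  unfolding borel_eq_closed by simp
 then have "A \<in> sigma_sets (space (hausdorff_measure k)) {F. closed F}" by simp
 then show ?thesis
  by (rule set_mp[OF sets.sigma_sets_subset, rotated]) (auto intro: closed_in_sets_hausdorff[OF k])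
qed

lemma borel_measurable_hausdorff:
 "0 < k ==> f \<in> borel_measurable borel ==> f \<in> borel_measurable (hausdorff_measure k)"
 by (intro measurableI) (auto intro!: borel_in_sets_hausdorff dest: measurable_sets)

text \<open>Nearly optimal covers at scale \<open>1 / Suc n\<close> are replaced by their closures,
  which have the same diameters, and intersected over \<open>n\<close>. The intersection is Borel
  and has the same covers as \<open>A\<close> at every scale.\<close>

lemma hausdorff_borel_hull:
 assumes k: "0 < k"
 obtains B where "B \<in> sets borel" "A \<subseteq> B" "\<H> k B = \<H> k A"
proof (cases "\<H> k A = top")
 case True
 then show ?thesis using outer_mono[of A UNIV k] that[of UNIV] by (auto simp: top_unique)
next
 case False
 have "\<exists>C. A \<subseteq> (\<Union>i. C i) \<and> (\<forall>i. bounded (C i) \<and> diameter (C i) \<le> 1 / Suc n) \<and>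
   (\<Sum>i. hausdorff_weight k (C i)) < \<H> k A + ennreal (1 / Suc n)" for n
 proof -
  have "hausdorff_pre k (1 / Suc n) A < \<H> k A + ennreal (1 / Suc n)"
  proof (rule le_less_trans[OF pre_le_outer])
   show "\<H> k A < \<H> k A + ennreal (1 / real (Suc n))"
    using False by simp
  qed simp
  then show ?thesis by (rule pre_close) blast
 qed
 then obtain C where C: "!!n. A \<subseteq> (\<Union>i. C n i)" "!!n i. bounded (C n i)"
   "!!n i. diameter (C n i) \<le> 1 / Suc n"
   "!!n. (\<Sum>i. hausdorff_weight k (C n i)) < \<H> k A + ennreal (1 / Suc n)"
  by metis
 define B where "B = (\<Inter>n. \<Union>i. closure (C n i))"
 have "A \<subseteq> (\<Union>i. closure (C n i))" for n
  by (rule order_trans[OF C(1)[of n]]) (intro UN_mono subset_refl closure_subset)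
 then have AB: "A \<subseteq> B" unfolding B_def by (rule INT_greatest)
 have "\<H> k B \<le> \<H> k A"
 proof (rule outer_leI, rule ennreal_le_epsilon)
  fix \<epsilon> e :: real assume e: "0 < \<epsilon>" "0 < e"
  obtain n where n: "1 / Suc n < min \<epsilon> e" using e by (meson min_less_iff_conj nat_approx_posE)
  have "hausdorff_pre k \<epsilon> B \<le> (\<Sum>i. hausdorff_weight k (closure (C n i)))"
  proof (rule pre_le)
   show "diameter (closure (C n i)) \<le> \<epsilon>" for i
    using C(2,3)[of n i] n by (simp add: diameter_closure)
  qed (use C(2) in \<open>auto simp: B_def\<close>)
  also have "... = (\<Sum>i. hausdorff_weight k (C n i))"
   by (simp add: hausdorff_weight_def diameter_closure[OF C(2)])
  also have "... \<le> \<H> k A + ennreal e"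
   using n by (intro order_trans[OF less_imp_le[OF C(4)]] add_left_mono ennreal_leI) auto
  finally show "hausdorff_pre k \<epsilon> B \<le> \<H> k A + ennreal e" .
 qed
 then have "\<H> k B = \<H> k A"
  using outer_mono[OF AB] by (rule antisym)
 moreover have "B \<in> sets borel" unfolding B_def by auto
 ultimately show ?thesis using AB that by simp
qed

section \<open>Lipschitz images and bi-Lipschitz changes of variables\<close>

lemma outer_lipschitz:
 fixes f :: "'a::metric_space => 'b::metric_space"
 assumes k: "0 < k" and L: "L-lipschitz_on A f"
 shows "\<H> k (f ` A) \<le> ennreal (L ^ k) * \<H> k A"
proof -
 have L0: "0 \<le> L" by (rule lipschitz_on_nonneg[OF L])
 have *: "hausdorff_pre k (L * \<epsilon>) (f ` A) \<le> ennreal (L ^ k) * hausdorff_pre k \<epsilon> A" if "0 < \<epsilon>" for \<epsilon>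
 proof (cases "hausdorff_pre k \<epsilon> A = top")
  case True
  show ?thesis
  proof (cases "L = 0")
   case False
   then show ?thesis using True L0 by simp
  next
   \<comment> \<open>Here \<open>0 * \<infinity> = 0\<close> in \<open>ennreal\<close>, so the bound
     is not void: the map is constant on \<open>A\<close>, and its image, at most one point, is
     covered by itself.\<close>
   case L: True
   have c: "f x = f y" if "x \<in> A" "y \<in> A" for x y
    using lipschitz_onD[OF assms(2) that] L by simp
   have "hausdorff_pre k (L * \<epsilon>) (f ` A) \<le> (\<Sum>i. hausdorff_weight k (if i = (0::nat) then f ` A else {}))"
   proof (rule pre_le)
    have "f ` A = {} \<or> (\<exists>x. f ` A = {x})" using c by blast
    then show "bounded (if i = (0::nat) then f ` A else {})" 
      "diameter (if i = (0::nat) then f ` A else {}) \<le> L * \<epsilon>" for i using L by auto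
   qed auto
   also have "... = (\<Sum>i. 0)"
   proof -
    have "f ` A = {} \<or> (\<exists>x. f ` A = {x})" using c by blast
    then show ?thesis using k by (intro suminf_cong) (auto simp: hausdorff_weight_def)
   qed
   finally show ?thesis by simp
  qed
 next
  case False
  show ?thesis
  proof (rule ennreal_le_epsilon)
   fix e :: real assume e: "0 < e"
   define e' where "e' = e / (L ^ k + 1)"
   have e': "0 < e'" "L ^ k * e' \<le> e"
    using e zero_le_power[OF L0, of k] unfolding e'_def by (auto simp: pos_divide_le_eq intro: add_nonneg_pos)
   have "hausdorff_pre k \<epsilon> A < hausdorff_pre k \<epsilon> A + ennreal e'" using False e' by auto
   then obtain C where C: "A \<subseteq> (\<Union>i. C i)" "!!i. bounded (C i)" "!!i. diameter (C i) \<le> \<epsilon>"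
    "(\<Sum>i. hausdorff_weight k (C i)) < hausdorff_pre k \<epsilon> A + ennreal e'"
    by (rule pre_close) blast
   have bd: "bounded (f ` (C i \<inter> A)) \<and> diameter (f ` (C i \<inter> A)) \<le> L * diameter (C i)" for i
   proof -
    have *: "dist x y \<le> L * diameter (C i)" if xy: "x \<in> f ` (C i \<inter> A)" "y \<in> f ` (C i \<inter> A)" for x y
    proof -
     obtain a b where ab: "a \<in> C i \<inter> A" "b \<in> C i \<inter> A" "x = f a" "y = f b" using xy by auto
     have "dist x y \<le> L * dist a b" using lipschitz_onD[OF L] ab by auto
     also have "... \<le> L * diameter (C i)"
      using diameter_bounded_bound[OF C(2)] ab L0 by (intro mult_left_mono) auto
     finally show ?thesis .
    qed
    have 1: "bounded (f ` (C i \<inter> A))" using * unfolding bounded_two_points by auto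
    have "diameter (f ` (C i \<inter> A)) \<le> L * diameter (C i)"
    proof (cases "f ` (C i \<inter> A) = {}")
     case True
     then show ?thesis using L0 diameter_ge_0[OF C(2)] by simp
    next
     case False
     show ?thesis unfolding diameter_def[of "f ` (C i \<inter> A)"] if_not_P[OF False] using False * by (intro cSUP_least) (auto simp only: case_prod_beta mem_Times_iff)
    qed
    with 1 show ?thesis ..
   qed
   have "hausdorff_pre k (L * \<epsilon>) (f ` A) \<le> (\<Sum>i. hausdorff_weight k (f ` (C i \<inter> A)))"
   proof (rule pre_le)
    show "f ` A \<subseteq> (\<Union>i. f ` (C i \<inter> A))" using C(1) by blast
    show "diameter (f ` (C i \<inter> A)) \<le> L * \<epsilon>" for i
     using bd[of i] C(3)[of i] L0 by (meson mult_left_mono order_trans)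
   qed (use bd in auto)
   also have "... \<le> (\<Sum>i. ennreal (L ^ k) * hausdorff_weight k (C i))"
   proof (intro suminf_le)
    fix i
    have "diameter (f ` (C i \<inter> A)) ^ k \<le> (L * diameter (C i)) ^ k"
     using bd[of i] by (intro power_mono diameter_ge_0) auto
    then show "hausdorff_weight k (f ` (C i \<inter> A)) \<le> ennreal (L ^ k) * hausdorff_weight k (C i)"
     unfolding hausdorff_weight_def using L0 diameter_ge_0[OF C(2)[of i]] by (subst ennreal_mult[symmetric]) (auto intro!: ennreal_leI mult_left_mono simp: divide_simps)
   qed auto
   also have "... = ennreal (L ^ k) * (\<Sum>i. hausdorff_weight k (C i))" by simp
   also have "... \<le> ennreal (L ^ k) * (hausdorff_pre k \<epsilon> A + ennreal e')"
    using C(4) by (intro mult_left_mono) auto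
   also have "... = ennreal (L ^ k) * hausdorff_pre k \<epsilon> A + ennreal (L ^ k * e')"
    using L0 e' by (simp add: distrib_left ennreal_mult)
   also have "... \<le> ennreal (L ^ k) * hausdorff_pre k \<epsilon> A + ennreal e"
    using e' by (intro add_left_mono ennreal_leI)
   finally show "hausdorff_pre k (L * \<epsilon>) (f ` A) \<le> ennreal (L ^ k) * hausdorff_pre k \<epsilon> A + ennreal e" .
  qed
 qed
 show ?thesis
 proof (rule outer_leI)
  fix \<epsilon> :: real assume e: "0 < \<epsilon>"
  define \<epsilon>' where "\<epsilon>' = \<epsilon> / (L + 1)"
  have \<epsilon>': "0 < \<epsilon>'" "L * \<epsilon>' \<le> \<epsilon>" using e L0 unfolding \<epsilon>'_def by (auto simp: field_simps)
  show "hausdorff_pre k \<epsilon> (f ` A) \<le> ennreal (L ^ k) * \<H> k A"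
   using pre_antimono[OF \<epsilon>'(2), of k "f ` A"] *[OF \<epsilon>'(1)]
    mult_left_mono[OF pre_le_outer[OF \<epsilon>'(1), of k A], of "ennreal (L ^ k)"] by auto
 qed
qed

locale bilipschitz_pair =
 fixes k :: nat and S :: "'a::metric_space set" and S' :: "'b::metric_space set"
  and f :: "'a => 'b" and g :: "'b => 'a" and L :: real
 assumes k: "0 < k" and S: "S \<in> sets borel" and S': "S' \<in> sets borel"
  and image: "f ` S = S'" and inverse: "!!x. x \<in> S ==> g (f x) = x"
  and lip: "L-lipschitz_on S f" and lip': "L-lipschitz_on S' g"
  and finite: "\<H> k S < top"
begin

lemma flip: "bilipschitz_pair k S' S g f L"
proof
 show "g ` S' = S" unfolding image[symmetric] image_image using inverse by simp
 show "f (g x) = x" if "x \<in> S'" for x using that inverse unfolding image[symmetric] by auto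
 have "\<H> k S' \<le> ennreal (L ^ k) * \<H> k S"
  using outer_lipschitz[OF k lip] image by simp
 also have "... < top" using finite by (simp add: ennreal_mult_less_top)
 finally show "\<H> k S' < top" .
qed (use k S S' lip lip' in auto)

lemma image_null: "A \<subseteq> S ==> \<H> k A = 0 ==> \<H> k (f ` A) = 0"
 using outer_lipschitz[OF k lipschitz_on_subset[OF lip, of A]] by simp

text \<open>A measurable set of finite measure is a Borel set minus a null set. The image of a Borel
  set is a Borel preimage under \<open>g\<close>, and a Lipschitz map keeps null sets null.\<close>

lemma image_sets:
 assumes A: "A \<subseteq> S" "A \<in> sets (hausdorff_measure k)"
 shows "f ` A \<in> sets (hausdorff_measure k)"
proof -
 obtain B where B: "B \<in> sets borel" "A \<subseteq> B" "\<H> k B = \<H> k A"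
  using hausdorff_borel_hull[OF k, of A] .
 let ?M = "hausdorff_measure k :: 'a measure"
 define B' where "B' = B \<inter> S"
 have B': "B' \<in> sets borel" "A \<subseteq> B'" "B' \<subseteq> S" using B A S by (auto simp: B'_def)
 have B'M: "B' \<in> sets ?M" by (rule borel_in_sets_hausdorff[OF k B'(1)])
 have eq: "\<H> k B' = \<H> k A"
  using outer_mono[of B' B k] outer_mono[OF B'(2), of k] B(3) by (auto simp: B'_def)
 have Afin: "\<H> k A \<noteq> top"
  using outer_mono[OF A(1), of k] finite by auto
 have "emeasure ?M (B' - A) = emeasure ?M B' - emeasure ?M A"
  using A B' B'M Afin by (intro emeasure_Diff) (auto simp: emeasure_hausdorff[OF k])
 also have "... = 0" using A B'M eq Afin by (simp add: emeasure_hausdorff[OF k])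
 finally have "\<H> k (B' - A) = 0"
  using A B'M by (subst emeasure_hausdorff[OF k, symmetric]) auto
 then have N: "f ` (B' - A) \<in> sets (hausdorff_measure k)"
  using hausdorff_null_sets[OF k image_null, of "B' - A"] B' by auto
 have "continuous_on S' g" using lip' by (rule lipschitz_on_continuous_on)
 then have "g -` B' \<inter> space (restrict_space borel S') \<in> sets (restrict_space borel S')"
  by (intro measurable_sets[OF borel_measurable_continuous_on_restrict B'(1)])
 then have "g -` B' \<inter> S' \<in> sets borel"
  using S' by (subst (asm) sets_restrict_space_iff) auto
 also have "g -` B' \<inter> S' = f ` B'" using B'(3) inverse unfolding image[symmetric] by auto
 finally have "f ` B' \<in> sets (hausdorff_measure k)" by (rule borel_in_sets_hausdorff[OF k])
 moreover have "f ` A = f ` B' - f ` (B' - A)"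
  using B'(2,3) inverse by auto (metis subsetD)
 ultimately show ?thesis using N by auto
qed

lemma Sk: "S \<in> sets (hausdorff_measure k)" "S' \<in> sets (hausdorff_measure k)"
 using S S' borel_in_sets_hausdorff[OF k] by auto

lemma measurable_map: "f \<in> restrict_space (hausdorff_measure k) S \<rightarrow>\<^sub>M restrict_space (hausdorff_measure k) S'"
proof (rule measurableI)
 interpret I: bilipschitz_pair k S' S g f L by (rule flip)
 fix A assume "A \<in> sets (restrict_space (hausdorff_measure k) S')"
 then have A: "A \<subseteq> S'" "A \<in> sets (hausdorff_measure k)" using Sk
  by (auto simp: sets_restrict_space_iff)
 have "f -` A \<inter> S = g ` A" using A(1) inverse unfolding image[symmetric] by force
 then show "f -` A \<inter> space (restrict_space (hausdorff_measure k) S) \<in> sets (restrict_space (hausdorff_measure k) S)"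
  using I.image_sets[OF A] Sk A by (auto simp: sets_restrict_space_iff)
qed (use image in \<open>auto simp: space_restrict_space\<close>)

lemma measure_le:
 "restrict_space (hausdorff_measure k) S' \<le>
  scale_measure (ennreal (L ^ k)) (distr (restrict_space (hausdorff_measure k) S) (restrict_space (hausdorff_measure k) S') f)"
proof (subst le_measure, simp, safe)
 fix A assume A: "A \<in> sets (restrict_space (hausdorff_measure k) S')"
 then have A': "A \<subseteq> S'" "A \<in> sets (hausdorff_measure k)" using Sk
  by (auto simp: sets_restrict_space_iff)
 have pre: "f -` A \<inter> S \<in> sets (hausdorff_measure k)"
  using measurable_sets[OF measurable_map A] Sk by (auto simp: sets_restrict_space_iff)
 have "A = f ` (f -` A \<inter> S)" using A' image by auto
 then have "\<H> k A \<le> ennreal (L ^ k) * \<H> k (f -` A \<inter> S)"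
  using outer_lipschitz[OF k lipschitz_on_subset[OF lip], of "f -` A \<inter> S"] by simp
 then show "emeasure (restrict_space (hausdorff_measure k) S') A
  \<le> emeasure (scale_measure (ennreal (L ^ k)) (distr (restrict_space (hausdorff_measure k) S) (restrict_space (hausdorff_measure k) S') f)) A"
  using A A' Sk pre by (simp add: emeasure_distr[OF measurable_map] emeasure_restrict_space emeasure_hausdorff[OF k])
qed

lemma nn_integral_le:
 assumes "h \<in> borel_measurable (restrict_space (hausdorff_measure k) S')"
 shows "(\<integral>\<^sup>+y. h y \<partial>restrict_space (hausdorff_measure k) S')
  \<le> ennreal (L ^ k) * (\<integral>\<^sup>+x. h (f x) \<partial>restrict_space (hausdorff_measure k) S)"
proof -
 have "(\<integral>\<^sup>+y. h y \<partial>restrict_space (hausdorff_measure k) S')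
  \<le> (\<integral>\<^sup>+y. h y \<partial>scale_measure (ennreal (L ^ k)) (distr (restrict_space (hausdorff_measure k) S) (restrict_space (hausdorff_measure k) S') f))"
  by (rule nn_integral_mono_measure[OF _ measure_le]) simp
 also have "... = ennreal (L ^ k) * (\<integral>\<^sup>+x. h (f x) \<partial>restrict_space (hausdorff_measure k) S)"
  using assms measurable_map by (simp add: nn_integral_scale_measure nn_integral_distr)
 finally show ?thesis .
qed

lemma measurable_comp:
 "h \<in> borel_measurable (restrict_space (hausdorff_measure k) S') ==>
  (\<lambda>x. h (f x)) \<in> borel_measurable (restrict_space (hausdorff_measure k) S)"
 using measurable_compose[OF measurable_map] .

lemma integrable_comp:
 fixes h :: "'b => 'c::{banach, second_countable_topology}"
 assumes "integrable (restrict_space (hausdorff_measure k) S') h"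
 shows "integrable (restrict_space (hausdorff_measure k) S) (\<lambda>x. h (f x))"
proof (rule integrableI_bounded)
 interpret I: bilipschitz_pair k S' S g f L by (rule flip)
 show m: "(\<lambda>x. h (f x)) \<in> borel_measurable (restrict_space (hausdorff_measure k) S)"
  using assms by (intro measurable_comp) auto
 have "(\<integral>\<^sup>+x. norm (h (f x)) \<partial>restrict_space (hausdorff_measure k) S)
  \<le> ennreal (L ^ k) * (\<integral>\<^sup>+y. norm (h (f (g y))) \<partial>restrict_space (hausdorff_measure k) S')"
  using m by (intro I.nn_integral_le) auto
 also have "(\<integral>\<^sup>+y. norm (h (f (g y))) \<partial>restrict_space (hausdorff_measure k) S')
  = (\<integral>\<^sup>+y. norm (h y) \<partial>restrict_space (hausdorff_measure k) S')"
  using I.inverse by (intro nn_integral_cong) (auto simp: space_restrict_space)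
 also have "ennreal (L ^ k) * ... < top"
  using assms by (auto simp: ennreal_mult_less_top integrable_iff_bounded)
 finally show "(\<integral>\<^sup>+x. norm (h (f x)) \<partial>restrict_space (hausdorff_measure k) S) < \<infinity>" by simp
qed

lemma integral_le:
 fixes h :: "'b => real"
 assumes "integrable (restrict_space (hausdorff_measure k) S') h" "!!y. 0 \<le> h y"
 shows "(\<integral>y. h y \<partial>restrict_space (hausdorff_measure k) S')
  \<le> L ^ k * (\<integral>x. h (f x) \<partial>restrict_space (hausdorff_measure k) S)"
proof -
 have "ennreal (\<integral>y. h y \<partial>restrict_space (hausdorff_measure k) S') = (\<integral>\<^sup>+y. h y \<partial>restrict_space (hausdorff_measure k) S')"
  using assms by (simp add: nn_integral_eq_integral)
 also have "... \<le> ennreal (L ^ k) * (\<integral>\<^sup>+x. h (f x) \<partial>restrict_space (hausdorff_measure k) S)"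
  using assms by (intro nn_integral_le) auto
 also have "(\<integral>\<^sup>+x. h (f x) \<partial>restrict_space (hausdorff_measure k) S) = ennreal (\<integral>x. h (f x) \<partial>restrict_space (hausdorff_measure k) S)"
  using assms by (intro nn_integral_eq_integral integrable_comp) auto
 also have "ennreal (L ^ k) * ... = ennreal (L ^ k * (\<integral>x. h (f x) \<partial>restrict_space (hausdorff_measure k) S))"
  using assms lipschitz_on_nonneg[OF lip] by (intro ennreal_mult[symmetric]) auto
 finally show ?thesis
  using assms lipschitz_on_nonneg[OF lip] by auto
qed

text \<open>Each integral is at most \<open>L ^ k\<close> times the other, so they differ by at most
  \<open>L ^ k - 1\<close> times the smaller one, hence also times the one over
  \<open>S'\<close>.\<close>

lemma integral_diff_nonneg:
 fixes h :: "'b => real"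
 assumes "integrable (restrict_space (hausdorff_measure k) S') h" "!!y. 0 \<le> h y" "1 \<le> L"
 shows "\<bar>(\<integral>y. h y \<partial>restrict_space (hausdorff_measure k) S') - (\<integral>x. h (f x) \<partial>restrict_space (hausdorff_measure k) S)\<bar>
  \<le> (L ^ k - 1) * (\<integral>y. h y \<partial>restrict_space (hausdorff_measure k) S')" (is "\<bar>?A - ?B\<bar> \<le> _")
proof -
 interpret I: bilipschitz_pair k S' S g f L by (rule flip)
 have 1: "?A \<le> L ^ k * ?B" using assms by (intro integral_le)
 have "?B \<le> L ^ k * (\<integral>y. h (f (g y)) \<partial>restrict_space (hausdorff_measure k) S')"
  using assms by (intro I.integral_le integrable_comp) auto
 also have "(\<integral>y. h (f (g y)) \<partial>restrict_space (hausdorff_measure k) S') = ?A"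
  using I.inverse by (intro Bochner_Integration.integral_cong) (auto simp: space_restrict_space)
 finally have 2: "?B \<le> L ^ k * ?A" .
 have A: "0 \<le> ?A" "0 \<le> ?B" using assms by auto
 have q: "1 \<le> L ^ k" using assms by simp
 show ?thesis
 proof (cases "?A \<le> ?B")
  case True
  then show ?thesis using 2 by (simp add: algebra_simps)
 next
  case False
  have "?A - ?B \<le> (L ^ k - 1) * ?B" using 1 by (simp add: algebra_simps)
  also have "... \<le> (L ^ k - 1) * ?A" using False q by (intro mult_left_mono) auto
  finally show ?thesis using False by simp
 qed
qed

lemma integral_diff:
 fixes h :: "'b => real"
 assumes h: "integrable (restrict_space (hausdorff_measure k) S') h" and L: "1 \<le> L"
 shows "\<bar>(\<integral>y. h y \<partial>restrict_space (hausdorff_measure k) S') - (\<integral>x. h (f x) \<partial>restrict_space (hausdorff_measure k) S)\<bar>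
  \<le> (L ^ k - 1) * (\<integral>y. \<bar>h y\<bar> \<partial>restrict_space (hausdorff_measure k) S')"
proof -
 let ?R' = "restrict_space (hausdorff_measure k) S'" and ?R = "restrict_space (hausdorff_measure k) S"
 define p where "p y = max 0 (h y)" for y
 define m where "m y = max 0 (- h y)" for y
 have pm: "h y = p y - m y" "\<bar>h y\<bar> = p y + m y" "0 \<le> p y" "0 \<le> m y" for y by (auto simp: p_def m_def)
 have i: "integrable ?R' p" "integrable ?R' m" using h unfolding p_def m_def by auto
 have i': "integrable ?R (\<lambda>x. p (f x))" "integrable ?R (\<lambda>x. m (f x))" using i by (auto intro: integrable_comp)
 have "(\<integral>y. h y \<partial>?R') - (\<integral>x. h (f x) \<partial>?R) = ((\<integral>y. p y \<partial>?R') - (\<integral>x. p (f x) \<partial>?R)) - ((\<integral>y. m y \<partial>?R') - (\<integral>x. m (f x) \<partial>?R))"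
  unfolding pm(1) using i i' by simp
 also have "\<bar>...\<bar> \<le> (L ^ k - 1) * (\<integral>y. p y \<partial>?R') + (L ^ k - 1) * (\<integral>y. m y \<partial>?R')"
  using integral_diff_nonneg[OF i(1) pm(3) L] integral_diff_nonneg[OF i(2) pm(4) L] by simp
 also have "... = (L ^ k - 1) * (\<integral>y. \<bar>h y\<bar> \<partial>?R')" unfolding pm(2) using i by (simp add: algebra_simps)
 finally show ?thesis .
qed

end

section \<open>Hausdorff measure of intervals and planar sets\<close>

lemma pre_finite_cover:
 fixes C :: "nat => 'a::metric_space set"
 assumes k: "0 < k" and "0 \<le> \<epsilon>" "A \<subseteq> (\<Union>i<n. C i)"
  "!!i. i < n ==> bounded (C i)" "!!i. i < n ==> diameter (C i) \<le> \<epsilon>"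
 shows "hausdorff_pre k \<epsilon> A \<le> (\<Sum>i<n. hausdorff_weight k (C i))"
proof -
 define C' where "C' i = (if i < n then C i else {})" for i
 have "A \<subseteq> (\<Union>i. C' i)" using assms(3) by (fastforce simp: C'_def)
 then have "hausdorff_pre k \<epsilon> A \<le> (\<Sum>i. hausdorff_weight k (C' i))"
  by (rule pre_le) (use assms in \<open>auto simp: C'_def\<close>)
 also have "... = (\<Sum>i<n. hausdorff_weight k (C' i))"
  using k by (intro suminf_finite) (auto simp: C'_def)
 finally show ?thesis by (simp add: C'_def)
qed

text \<open>Uniform subdivision into \<open>n\<close> intervals. The bound is constant in
  \<open>n\<close> for \<open>k = 1\<close> and tends to 0 for \<open>k = 2\<close>, which yields
  finite length and zero area.\<close>

lemma pre_unit_interval: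
 assumes k: "0 < k" and n: "0 < n" "1 / real n \<le> \<epsilon>"
 shows "hausdorff_pre k \<epsilon> {0..1::real} \<le> ennreal (unit_ball_vol (real k) / 2 ^ k * (real n * (1 / real n) ^ k))"
proof -
 define C where "C i = {real i / n .. (real i + 1) / n}" for i
 have cov: "{0..1::real} \<subseteq> (\<Union>i<n. C i)"
 proof
  fix x :: real assume x: "x \<in> {0..1}"
  show "x \<in> (\<Union>i<n. C i)"
  proof (cases "x = 1")
   case True
   then have "x \<in> C (n - 1)" using n by (auto simp: C_def)
   then show ?thesis using n by auto
  next
   case False
   define i where "i = nat \<lfloor>x * n\<rfloor>"
   have xn: "0 \<le> x * n" "x * n < n" using x False n by auto
   then have "real i \<le> x * n" "x * n < real i + 1" unfolding i_def by auto
   then have "x \<in> C i" "i < n" using xn by (auto simp: C_def field_simps)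
   then show ?thesis by auto
  qed
 qed
 have bd: "bounded (C i)" for i by (simp add: C_def)
 have dm: "diameter (C i) \<le> 1 / n" for i
  using n by (intro diameter_le) (auto simp: C_def field_simps abs_le_iff)
 have "hausdorff_pre k \<epsilon> {0..1::real} \<le> (\<Sum>i<n. hausdorff_weight k (C i))"
  using dm n by (intro pre_finite_cover[OF k _ cov] bd) (auto intro: order_trans[rotated])
 also have "... \<le> (\<Sum>i<n. ennreal (unit_ball_vol (real k) / 2 ^ k * (1 / n) ^ k))"
  unfolding hausdorff_weight_def
  by (intro sum_mono ennreal_leI mult_left_mono power_mono dm diameter_ge_0 bd) auto
 also have "... = ennreal (unit_ball_vol (real k) / 2 ^ k * (real n * (1 / real n) ^ k))"
  by (simp add: ennreal_of_nat_eq_real_of_nat ennreal_mult[symmetric])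
 finally show ?thesis .
qed

lemma outer_1_unit_interval: "\<H> 1 {0..1::real} < top"
proof -
 have "\<H> 1 {0..1::real} \<le> ennreal (unit_ball_vol 1 / 2)"
 proof (rule outer_leI)
  fix \<epsilon> :: real assume "0 < \<epsilon>"
  then obtain n where n: "1 / real (Suc n) < \<epsilon>" by (meson nat_approx_posE)
  show "hausdorff_pre 1 \<epsilon> {0..1::real} \<le> ennreal (unit_ball_vol 1 / 2)"
   using pre_unit_interval[of 1 "Suc n" \<epsilon>] n by simp
 qed
 then show ?thesis by (rule le_less_trans) simp
qed

lemma outer_2_unit_interval: "\<H> 2 {0..1::real} = 0"
proof -
 have "\<H> 2 {0..1::real} \<le> 0"
 proof (rule outer_leI, rule ennreal_le_epsilon)
  fix \<epsilon> e :: real assume e: "0 < \<epsilon>" "0 < e"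
  define m where "m = min \<epsilon> (e / (unit_ball_vol 2 / 4 + 1))"
  have V: "0 \<le> unit_ball_vol 2" by simp
  then have "0 < m" using e unfolding m_def by (simp add: add_nonneg_pos)
  then obtain n where n: "1 / real (Suc n) < m" by (meson nat_approx_posE)
  have "hausdorff_pre 2 \<epsilon> {0..1::real} \<le> ennreal (unit_ball_vol 2 / 4 * (1 / Suc n))"
   using pre_unit_interval[of 2 "Suc n" \<epsilon>] n by (simp add: m_def power2_eq_square)
  also have "unit_ball_vol 2 / 4 * (1 / Suc n) \<le> e"
  proof -
   have "(unit_ball_vol 2 / 4) * (1 / Suc n) \<le> (unit_ball_vol 2 / 4 + 1) * (e / (unit_ball_vol 2 / 4 + 1))"
    using n by (intro mult_mono) (auto simp: m_def)
   also have "... = e" using V by (smt (verit) divide_nonneg_nonneg nonzero_mult_div_cancel_left times_divide_eq_right)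
   finally show ?thesis .
  qed
  finally show "hausdorff_pre 2 \<epsilon> {0..1::real} \<le> 0 + ennreal e" by (simp add: ennreal_leI)
 qed
 then show ?thesis by simp
qed

text \<open>Each covering set fits into a closed interval no longer than its diameter, so countable
  subadditivity of Lebesgue measure applies. The normalisation factor for \<open>k = 1\<close>
  equals 1.\<close>

lemma outer_1_interval_ge:
 assumes "a \<le> b" shows "ennreal (b - a) \<le> \<H> 1 {a..b::real}"
proof (rule order_trans[OF _ pre_le_outer[of 1]])
 show "ennreal (b - a) \<le> hausdorff_pre 1 1 {a..b}"
  unfolding hausdorff_pre_def
 proof (rule INF_greatest)
  fix C :: "nat => real set" assume "C \<in> {C. {a..b} \<subseteq> \<Union>(range C) \<and> (\<forall>i. bounded (C i) \<and> diameter (C i) \<le> 1)}"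
  then have C: "{a..b} \<subseteq> (\<Union>i. C i)" "!!i. bounded (C i)" by auto
  define I where "I i = (if C i = {} then {} else {Inf (C i)..Sup (C i)})" for i
  have CI: "C i \<subseteq> I i" for i
   using cInf_lower[OF _ bounded_imp_bdd_below[OF C(2)]] cSup_upper[OF _ bounded_imp_bdd_above[OF C(2)]]
   by (auto simp: I_def)
  have le: "emeasure lborel (I i) \<le> ennreal (diameter (C i))" for i
  proof (cases "C i = {}")
   case False
   have bd: "bdd_above (C i)" "bdd_below (C i)" using C(2)[of i] bounded_imp_bdd_above bounded_imp_bdd_below by auto
   have "Sup (C i) \<le> diameter (C i) + Inf (C i)"
   proof (rule cSup_least[OF False])
    fix x assume x: "x \<in> C i"
    have "x - diameter (C i) \<le> Inf (C i)"
    proof (rule cInf_greatest[OF False])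
     fix y assume "y \<in> C i"
     then show "x - diameter (C i) \<le> y"
      using diameter_bounded_bound[OF C(2) x, of y] by (simp add: dist_real_def)
    qed
    then show "x \<le> diameter (C i) + Inf (C i)" by simp
   qed
   moreover have "Inf (C i) \<le> Sup (C i)" using False bd cInf_le_cSup by blast
   ultimately show ?thesis by (simp add: I_def)
  qed (simp add: I_def)
  have "ennreal (b - a) = emeasure lborel {a..b}" using assms by simp
  also have "... \<le> emeasure lborel (\<Union>i. I i)"
  proof (rule emeasure_mono)
   show "{a..b} \<subseteq> (\<Union>i. I i)" using C(1) CI by blast
  qed (auto simp: I_def)
  also have "... \<le> (\<Sum>i. emeasure lborel (I i))"
   by (intro emeasure_subadditive_countably) (auto simp: I_def)
  also have "... \<le> (\<Sum>i. ennreal (diameter (C i)))" by (intro suminf_le le) auto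
  finally show "ennreal (b - a) \<le> (\<Sum>i. ennreal (unit_ball_vol (real 1) / 2 ^ 1 * diameter (C i) ^ 1))"
   by auto
 qed
qed simp

text \<open>Only finiteness matters, so the diameter of a subsquare is bounded crudely by
  \<open>2 / n\<close>.\<close>

lemma outer_unit_square: "\<H> 2 ({0..1} \<times> {0..1} :: (real \<times> real) set) < top"
proof -
 have "\<H> 2 ({0..1} \<times> {0..1} :: (real \<times> real) set) \<le> ennreal (unit_ball_vol 2)"
 proof (rule outer_leI)
  fix \<epsilon> :: real assume "0 < \<epsilon>"
  then have "0 < \<epsilon> / 2" by simp
  then obtain n' where n': "1 / real (Suc n') < \<epsilon> / 2" by (meson nat_approx_posE)
  define n where "n = Suc n'"
  have n: "0 < n" "2 / real n \<le> \<epsilon>" using n' by (auto simp: n_def)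
  define I where "I i = {real i / n .. (real i + 1) / n}" for i :: nat
  define C where "C j = I (j mod n) \<times> I (j div n)" for j
  have I: "\<exists>i<n. x \<in> I i" if x: "x \<in> {0..1}" for x
  proof (cases "x = 1")
   case True
   then have "x \<in> I (n - 1)" using n by (auto simp: I_def)
   then show ?thesis using n by (intro exI[of _ "n - 1"]) auto
  next
   case False
   define i where "i = nat \<lfloor>x * n\<rfloor>"
   have xn: "0 \<le> x * n" "x * n < n" using x False n by auto
   then have "real i \<le> x * n" "x * n < real i + 1" unfolding i_def by auto
   then have "x \<in> I i" "i < n" using xn by (auto simp: I_def field_simps)
   then show ?thesis by auto
  qed
  have cov: "{0..1} \<times> {0..1} \<subseteq> (\<Union>j<n*n. C j)"
  proof safe
   fix x y :: real assume "x \<in> {0..1}" "y \<in> {0..1}"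
   then obtain i j where ij: "i < n" "x \<in> I i" "j < n" "y \<in> I j" using I by meson
   have "j * n + i < n * n"
    using ij mult_le_mono1[of "Suc j" n n] by simp
   moreover have "(x, y) \<in> C (j * n + i)" using ij by (simp add: C_def)
   ultimately show "(x, y) \<in> (\<Union>j<n*n. C j)" by auto
  qed
  have bd: "bounded (C j)" for j by (auto simp: C_def I_def intro!: bounded_Times)
  have dm: "diameter (C j) \<le> 2 / n" for j
  proof (rule diameter_le)
   fix p q assume pq: "p \<in> C j" "q \<in> C j"
   have "norm (p - q) \<le> norm (fst (p - q)) + norm (snd (p - q))"
    by (metis norm_Pair_le prod.collapse)
   also have "... \<le> 1 / n + 1 / n"
    using pq n by (intro add_mono) (auto simp: C_def I_def field_simps abs_le_iff)
   finally show "norm (p - q) \<le> 2 / n" by simp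
  qed simp
  have "hausdorff_pre 2 \<epsilon> ({0..1} \<times> {0..1} :: (real \<times> real) set) \<le> (\<Sum>i<n*n. hausdorff_weight 2 (C i))"
   using \<open>0 < \<epsilon>\<close> n by (intro pre_finite_cover[OF _ _ cov] bd order_trans[OF dm]) auto
  also have "... \<le> (\<Sum>i<n*n. ennreal (unit_ball_vol (real 2) / 2 ^ 2 * (2 / n) ^ 2))"
   unfolding hausdorff_weight_def
   by (intro sum_mono ennreal_leI mult_left_mono power_mono dm diameter_ge_0 bd) auto
  also have "... = ennreal (real (n * n) * (unit_ball_vol (real 2) / 2 ^ 2 * (2 / n) ^ 2))"
   by (simp only: sum_constant ennreal_of_nat_eq_real_of_nat, subst ennreal_mult[symmetric]) auto
  also have "real (n * n) * (unit_ball_vol (real 2) / 2 ^ 2 * (2 / n) ^ 2) = unit_ball_vol 2"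
   using n by (simp add: power2_eq_square)
  finally show "hausdorff_pre 2 \<epsilon> ({0..1} \<times> {0..1} :: (real \<times> real) set) \<le> ennreal (unit_ball_vol 2)" .
 qed
 then show ?thesis by (rule le_less_trans) simp
qed

lemma outer_bounded_plane:
 fixes A :: "(real \<times> real) set"
 assumes "bounded A" shows "\<H> 2 A < top"
proof -
 obtain b where b: "!!x. x \<in> A ==> norm x \<le> b" "0 < b" using assms bounded_pos by blast
 define f where "f x = (2 * b) *\<^sub>R x - (b, b)" for x :: "real \<times> real"
 have f: "(2 * b)-lipschitz_on X f" for X
  using b by (intro lipschitz_onI) (auto simp: f_def dist_norm scaleR_diff_right[symmetric])
 have "A \<subseteq> f ` ({0..1} \<times> {0..1})"
 proof
  fix x assume "x \<in> A"
  then have n: "\<bar>fst x\<bar> \<le> b" "\<bar>snd x\<bar> \<le> b"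
   using b(1)[of x] norm_fst_le[of "fst x" "snd x"] norm_snd_le[of "snd x" "fst x"] by auto
  have "x = f ((fst x + b) / (2 * b), (snd x + b) / (2 * b))" using b by (simp add: f_def)
  moreover have "((fst x + b) / (2 * b), (snd x + b) / (2 * b)) \<in> {0..1} \<times> {0..1}"
   using n b by auto
  ultimately show "x \<in> f ` ({0..1} \<times> {0..1})" by auto
 qed
 then have "\<H> 2 A \<le> ennreal ((2 * b) ^ 2) * \<H> 2 ({0..1} \<times> {0..1} :: (real \<times> real) set)"
  using outer_mono outer_lipschitz[OF _ f] by (meson order_trans zero_less_numeral)
 also have "... < top" using outer_unit_square by (simp add: ennreal_mult_less_top)
 finally show ?thesis .
qed

text \<open>Uniqueness of Haar measure: evaluate the integral of \<open>1\<^sub>A(x) 1\<^sub>Q(x + y)\<close> in both orders.\<close>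

lemma translation_invariant_eq_lborel:
 fixes M :: "'a::euclidean_space measure"
 assumes sets [measurable_cong]: "sets M = sets borel" and "sigma_finite_measure M"
  and inv: "!!t A. A \<in> sets borel ==> emeasure M {x. x + t \<in> A} = emeasure M A"
  and A [measurable]: "A \<in> sets borel" and Q [measurable]: "Q \<in> sets borel"
 shows "emeasure M A * emeasure lborel Q = emeasure M Q * emeasure lborel A"
proof -
 interpret M: sigma_finite_measure M by fact
 interpret P: pair_sigma_finite M "lborel :: 'a measure" ..
 have dM: "distr M borel (\<lambda>x. x + t) = M" for t
  by (intro measure_eqI) (auto simp: sets emeasure_distr inv vimage_def)
 have dL: "distr lborel borel (\<lambda>y. x + (-1) *\<^sub>R y) = lborel" for x :: 'a
  using lborel_affine[of "-1" x] by (simp add: density_1)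
 have pl: "distr lborel borel (\<lambda>y. x + 1 *\<^sub>R y) = lborel" for x :: 'a
  using lborel_affine[of "1" x] by (simp add: density_1)
 have 1: "(\<integral>\<^sup>+x. \<integral>\<^sup>+y. indicator A x * indicator Q (x + y) \<partial>lborel \<partial>M) = emeasure M A * emeasure lborel Q"
 proof -
  have "(\<integral>\<^sup>+y. indicator Q (x + y) \<partial>lborel) = emeasure lborel Q" for x
   by (subst (2) pl[of x, symmetric]) (simp add: nn_integral_distr flip: nn_integral_indicator)
  then show ?thesis by (simp add: nn_integral_cmult nn_integral_multc)
 qed
 have 2: "(\<integral>\<^sup>+x. indicator A x * indicator Q (x + y) \<partial>M) = (\<integral>\<^sup>+x. indicator A (x - y) * indicator Q x \<partial>M)" for y
  by (subst (2) dM[of y, symmetric]) (simp add: nn_integral_distr)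
 have 3: "(\<integral>\<^sup>+x. \<integral>\<^sup>+y. indicator A (x - y) * indicator Q x \<partial>lborel \<partial>M) = emeasure M Q * emeasure lborel A"
 proof -
  have "(\<integral>\<^sup>+y. indicator A (x - y) \<partial>lborel) = emeasure lborel A" for x
   by (subst (2) dL[of x, symmetric]) (simp add: nn_integral_distr flip: nn_integral_indicator)
  then show ?thesis by (simp add: nn_integral_cmult nn_integral_multc mult.commute)
 qed
 have "(\<integral>\<^sup>+x. \<integral>\<^sup>+y. indicator A x * indicator Q (x + y) \<partial>lborel \<partial>M)
   = (\<integral>\<^sup>+y. \<integral>\<^sup>+x. indicator A x * indicator Q (x + y) \<partial>M \<partial>lborel)"
  by (rule P.Fubini'[symmetric]) measurable
 also have "... = (\<integral>\<^sup>+y. \<integral>\<^sup>+x. indicator A (x - y) * indicator Q x \<partial>M \<partial>lborel)" by (simp add: 2)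
 also have "... = (\<integral>\<^sup>+x. \<integral>\<^sup>+y. indicator A (x - y) * indicator Q x \<partial>lborel \<partial>M)"
  by (rule P.Fubini') measurable
 finally show ?thesis unfolding 1 3 .
qed

definition plane_const :: real where
 "plane_const = enn2real (\<H> 2 ({0..1} \<times> {0..1} :: (real \<times> real) set))"

lemma plane_const_nonneg [simp]: "0 \<le> plane_const" by (simp add: plane_const_def)

text \<open>The isodiametric inequality would give \<open>plane_const = 1\<close>; the value is never needed.\<close>

lemma outer_plane:
 fixes A :: "(real \<times> real) set"
 assumes A: "A \<in> sets borel"
 shows "\<H> 2 A = ennreal plane_const * emeasure lborel A"
proof -
 \<comment> \<open>Pushing forward to the Borel sets gives a measure to which
   \<open>translation_invariant_eq_lborel\<close> applies.\<close>
 define M where "M = distr (hausdorff_measure 2) borel (\<lambda>x::real\<times>real. x)"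
 have sM: "sets M = sets borel" by (simp add: M_def)
 have eM: "emeasure M B = \<H> 2 B" if B: "B \<in> sets borel" for B
  using B borel_in_sets_hausdorff[of 2] unfolding M_def
  by (subst emeasure_distr) (auto intro!: measurableI emeasure_hausdorff)
 have sf: "sigma_finite_measure M"
 proof
  show "\<exists>A. countable A \<and> A \<subseteq> sets M \<and> \<Union>A = space M \<and> (\<forall>a\<in>A. emeasure M a \<noteq> \<infinity>)"
  proof (intro exI conjI)
   show "countable (range (\<lambda>n. cball (0::real\<times>real) (real n)))" by simp
   show "\<Union>(range (\<lambda>n. cball (0::real\<times>real) (real n))) = space M"
    by (auto simp: M_def intro: real_arch_simple)
   show "\<forall>a\<in>range (\<lambda>n. cball (0::real\<times>real) (real n)). emeasure M a \<noteq> \<infinity>"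
   proof
    fix a assume "a \<in> range (\<lambda>n. cball (0::real\<times>real) (real n))"
    then have a: "a \<in> sets borel" "bounded a" by auto
    show "emeasure M a \<noteq> \<infinity>"
     using outer_bounded_plane[OF a(2)] unfolding eM[OF a(1)] by simp
   qed
  qed (auto simp: sM)
 qed
 have lip1: "\<H> 2 ((\<lambda>x. x + t) ` B) \<le> \<H> 2 B" for t and B :: "(real \<times> real) set"
 proof -
  have "1-lipschitz_on B (\<lambda>x. x + t)" by (auto intro!: lipschitz_onI)
  from outer_lipschitz[OF _ this, of 2] show ?thesis by simp
 qed
 have inv: "emeasure M {x. x + t \<in> B} = emeasure M B" if B: "B \<in> sets borel" for t B
 proof -
  have m: "{x. x + t \<in> B} \<in> sets borel" using B by simp
  have e1: "{x. x + t \<in> B} = (\<lambda>x. x + (- t)) ` B"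
  by force
  have e2: "B = (\<lambda>x. x + t) ` {x. x + t \<in> B}"
   unfolding e1 image_image by simp
  show ?thesis unfolding eM[OF m] eM[OF B] using lip1[of "-t" B] lip1[of t "{x. x + t \<in> B}"] unfolding e1[symmetric] e2[symmetric] by auto
 qed
 let ?Q = "{0..1} \<times> {0..1} :: (real \<times> real) set"
 have Q: "?Q \<in> sets borel" by (intro borel_closed closed_Times) auto
 have lQ: "emeasure lborel ?Q = 1"
  unfolding lborel_prod[symmetric] by (subst lborel.emeasure_pair_measure_Times) auto
 have "emeasure M A * emeasure lborel ?Q = emeasure M ?Q * emeasure lborel A"
  by (rule translation_invariant_eq_lborel[OF sM sf inv A Q])
 then show ?thesis using lQ outer_unit_square by (simp add: eM A Q plane_const_def)
qed

section \<open>Charts of a surface\<close>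

text \<open>The mean value theorem in direction \<open>u\<close> turns the second difference into an
  increment of the gradient along \<open>v\<close>; a second application turns this into a value of
  \<open>H\<close>. Exchanging \<open>u\<close> and \<open>v\<close> leaves the second difference
  unchanged, whence Schwarz's theorem.\<close>

lemma second_difference:
 fixes x u v :: point
 assumes C2: "C2_on W \<phi> g H" and t: "0 < t" and W: "ball x (2 * r) \<subseteq> W" and "t * norm u < r" "t * norm v < r"
 obtains \<xi> where "dist \<xi> x < 2 * r"
  "\<phi> (x + t *\<^sub>R u + t *\<^sub>R v) - \<phi> (x + t *\<^sub>R u) - \<phi> (x + t *\<^sub>R v) + \<phi> x = t\<^sup>2 * (H \<xi> v \<bullet> u)"
proof -
 have inW: "dist (x + s *\<^sub>R u + \<tau> *\<^sub>R v) x < 2 * r" if s: "0 \<le> s" "s \<le> t" "0 \<le> \<tau>" "\<tau> \<le> t" for s \<tau>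
 proof -
  have "norm (s *\<^sub>R u + \<tau> *\<^sub>R v) \<le> s * norm u + \<tau> * norm v"
   using s norm_triangle_ineq[of "s *\<^sub>R u" "\<tau> *\<^sub>R v"] by simp
  also have "... \<le> t * norm u + t * norm v" using s by (intro add_mono mult_right_mono) auto
  finally show ?thesis using assms by (simp add: dist_norm)
 qed
 then have inW': "x + s *\<^sub>R u + \<tau> *\<^sub>R v \<in> W" if "0 \<le> s" "s \<le> t" "0 \<le> \<tau>" "\<tau> \<le> t" for s \<tau>
  using that W by (auto simp: dist_commute)
 have g: "(\<phi> has_derivative (\<lambda>h. h \<bullet> g y)) (at y)" "(g has_derivative H y) (at y)" if "y \<in> W" for y
  using C2 that by (auto simp: C2_on_def gderiv_def)
 have d\<phi>: "((\<lambda>s. \<phi> (x + s *\<^sub>R u + \<tau> *\<^sub>R v)) has_real_derivative g (x + s *\<^sub>R u + \<tau> *\<^sub>R v) \<bullet> u) (at s)"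
  if "x + s *\<^sub>R u + \<tau> *\<^sub>R v \<in> W" for s \<tau>
 proof -
  have "((\<lambda>s. x + s *\<^sub>R u + \<tau> *\<^sub>R v) has_derivative (\<lambda>s. s *\<^sub>R u)) (at s)" by (auto intro!: derivative_eq_intros)
  from has_derivative_compose[OF this g(1)[OF that]] show ?thesis
   unfolding has_field_derivative_def by (simp add: inner_commute mult.commute[of _ "u \<bullet> _"])
 qed
 have "\<exists>s>0. s < t \<and> (\<phi> (x + t *\<^sub>R u + t *\<^sub>R v) - \<phi> (x + t *\<^sub>R u + 0 *\<^sub>R v)) - (\<phi> (x + 0 *\<^sub>R u + t *\<^sub>R v) - \<phi> (x + 0 *\<^sub>R u + 0 *\<^sub>R v))
  = (t - 0) * (g (x + s *\<^sub>R u + t *\<^sub>R v) \<bullet> u - g (x + s *\<^sub>R u + 0 *\<^sub>R v) \<bullet> u)"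
  using t by (intro MVT2) (auto intro!: DERIV_diff d\<phi> inW' simp del: scaleR_zero_left)
 then obtain s where s: "0 < s" "s < t" and
  e1: "(\<phi> (x + t *\<^sub>R u + t *\<^sub>R v) - \<phi> (x + t *\<^sub>R u)) - (\<phi> (x + t *\<^sub>R v) - \<phi> x)
   = t * (g (x + s *\<^sub>R u + t *\<^sub>R v) \<bullet> u - g (x + s *\<^sub>R u + 0 *\<^sub>R v) \<bullet> u)" by auto
 have dg: "((\<lambda>\<tau>. g (x + s *\<^sub>R u + \<tau> *\<^sub>R v) \<bullet> u) has_real_derivative H (x + s *\<^sub>R u + \<tau> *\<^sub>R v) v \<bullet> u) (at \<tau>)"
  if "x + s *\<^sub>R u + \<tau> *\<^sub>R v \<in> W" for \<tau>
 proof -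
  have "((\<lambda>\<tau>. x + s *\<^sub>R u + \<tau> *\<^sub>R v) has_derivative (\<lambda>\<tau>. \<tau> *\<^sub>R v)) (at \<tau>)" by (auto intro!: derivative_eq_intros)
  from has_derivative_inner_left[OF has_derivative_compose[OF this g(2)[OF that]], of u] show ?thesis
   unfolding has_field_derivative_def by (simp add: blinfun.scaleR_right mult.commute[of _ "_ \<bullet> u"])
 qed
 have "\<exists>\<tau>>0. \<tau> < t \<and> g (x + s *\<^sub>R u + t *\<^sub>R v) \<bullet> u - g (x + s *\<^sub>R u + 0 *\<^sub>R v) \<bullet> u = (t - 0) * (H (x + s *\<^sub>R u + \<tau> *\<^sub>R v) v \<bullet> u)"
  using s by (intro MVT2) (auto intro!: dg inW' simp del: add_0_right)
 then obtain \<tau> where \<tau>: "0 < \<tau>" "\<tau> < t" and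
  e2: "g (x + s *\<^sub>R u + t *\<^sub>R v) \<bullet> u - g (x + s *\<^sub>R u + 0 *\<^sub>R v) \<bullet> u = t * (H (x + s *\<^sub>R u + \<tau> *\<^sub>R v) v \<bullet> u)" by auto
 show ?thesis
 proof (rule that[of "x + s *\<^sub>R u + \<tau> *\<^sub>R v"])
  show "dist (x + s *\<^sub>R u + \<tau> *\<^sub>R v) x < 2 * r" by (rule inW) (use s \<tau> in auto)
  show "\<phi> (x + t *\<^sub>R u + t *\<^sub>R v) - \<phi> (x + t *\<^sub>R u) - \<phi> (x + t *\<^sub>R v) + \<phi> x = t\<^sup>2 * (H (x + s *\<^sub>R u + \<tau> *\<^sub>R v) v \<bullet> u)"
   using e1 unfolding e2 by (simp add: power2_eq_square)
 qed
qed

lemma hessian_symmetric: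
 fixes x u v :: point
 assumes C2: "C2_on W \<phi> g H" and W: "open W" "x \<in> W"
 shows "H x u \<bullet> v = H x v \<bullet> u"
proof (rule ccontr)
 assume ne: "H x u \<bullet> v \<noteq> H x v \<bullet> u"
 \<comment> \<open>Chosen so that an error of \<open>e * (norm u * norm v)\<close> in each of two
   Hessian values cannot account for the gap; the \<open>+ 1\<close> covers zero vectors.\<close>
 define e where "e = \<bar>H x u \<bullet> v - H x v \<bullet> u\<bar> / (2 * (norm u * norm v + 1))"
 have den: "0 < 2 * (norm u * norm v + 1)" by (simp add: add_nonneg_pos)
 have e: "0 < e" using ne den by (simp add: e_def)
 have "continuous_on W H" using C2 by (simp add: C2_on_def)
 then obtain d where d: "0 < d" "!!y. y \<in> W ==> dist y x < d ==> dist (H y) (H x) < e"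
  using W e unfolding continuous_on_iff by meson
 obtain r0 where r0: "0 < r0" "ball x r0 \<subseteq> W" using W open_contains_ball by blast
 define r where "r = min d r0 / 2"
 have r: "0 < r" "ball x (2 * r) \<subseteq> W" "2 * r \<le> d" using d(1) r0 by (auto simp: r_def)
 define t where "t = r / (norm u + norm v + 1)"
 have nn: "0 < norm u + norm v + 1" by (simp add: add_nonneg_pos)
 have t: "0 < t" "t * norm u < r" "t * norm v < r"
 proof -
  show "0 < t" using r nn by (simp add: t_def)
  have "t * (norm u + norm v + 1) = r" using nn by (simp add: t_def)
  moreover have "0 \<le> t * norm u" "0 \<le> t * norm v" using \<open>0 < t\<close> by auto
  ultimately show "t * norm u < r" "t * norm v < r" using \<open>0 < t\<close>
   unfolding distrib_left mult_1_right by linarith+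
 qed
 have close: "\<bar>H \<xi> a \<bullet> b - H x a \<bullet> b\<bar> \<le> e * (norm a * norm b)" if "dist \<xi> x < 2 * r" for \<xi> a b
 proof -
  have "\<xi> \<in> W" using r(2) that by (auto simp: dist_commute)
  then have "norm (H \<xi> - H x) \<le> e"
   using d(2)[of \<xi>] that r(3) by (simp add: dist_norm)
  have "\<bar>H \<xi> a \<bullet> b - H x a \<bullet> b\<bar> = \<bar>(H \<xi> - H x) a \<bullet> b\<bar>" by (simp add: blinfun.diff_left inner_diff_left)
  also have "... \<le> norm ((H \<xi> - H x) a) * norm b" by (rule Cauchy_Schwarz_ineq2)
  also have "... \<le> norm (H \<xi> - H x) * norm a * norm b" by (intro mult_right_mono norm_blinfun) auto
  also have "... \<le> e * norm a * norm b" using \<open>norm (H \<xi> - H x) \<le> e\<close> by (intro mult_right_mono) auto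
  finally show ?thesis by auto
 qed
 obtain \<xi> where \<xi>: "dist \<xi> x < 2 * r" 
  "\<phi> (x + t *\<^sub>R u + t *\<^sub>R v) - \<phi> (x + t *\<^sub>R u) - \<phi> (x + t *\<^sub>R v) + \<phi> x = t\<^sup>2 * (H \<xi> v \<bullet> u)"
  by (rule second_difference[OF C2 t(1) r(2) t(2,3)])
 obtain \<xi>' where \<xi>': "dist \<xi>' x < 2 * r" 
  "\<phi> (x + t *\<^sub>R v + t *\<^sub>R u) - \<phi> (x + t *\<^sub>R v) - \<phi> (x + t *\<^sub>R u) + \<phi> x = t\<^sup>2 * (H \<xi>' u \<bullet> v)"
  by (rule second_difference[OF C2 t(1) r(2) t(3,2)])
 have "x + t *\<^sub>R v + t *\<^sub>R u = x + t *\<^sub>R u + t *\<^sub>R v" by simp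
 then have "t\<^sup>2 * (H \<xi> v \<bullet> u) = t\<^sup>2 * (H \<xi>' u \<bullet> v)"
  unfolding \<xi>(2)[symmetric] \<xi>'(2)[symmetric] by (simp add: add_ac)
 then have eq: "H \<xi> v \<bullet> u = H \<xi>' u \<bullet> v" using t(1) by simp
 have "\<bar>H x u \<bullet> v - H x v \<bullet> u\<bar> \<le> 2 * (e * (norm u * norm v))"
  using close[OF \<xi>(1), of v u] close[OF \<xi>'(1), of u v] eq by (simp add: mult.commute[of "norm v"])
 moreover have "\<bar>H x u \<bullet> v - H x v \<bullet> u\<bar> = e * (2 * (norm u * norm v + 1))" using den by (simp add: e_def)
 ultimately show False using e by simp
qed

definition frame :: "point => point => point => bool" where
 "frame e1 e2 n \<longleftrightarrow> e1 \<bullet> e1 = 1 \<and> e2 \<bullet> e2 = 1 \<and> n \<bullet> n = 1 \<and> e1 \<bullet> e2 = 0 \<and> e1 \<bullet> n = 0 \<and> e2 \<bullet> n = 0 \<and>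
   (\<forall>x. x = (x \<bullet> e1) *\<^sub>R e1 + (x \<bullet> e2) *\<^sub>R e2 + (x \<bullet> n) *\<^sub>R n)"

lemma frame_exists:
 assumes n: "norm n = 1" obtains e1 e2 where "frame e1 e2 n"
proof -
 have nz: "n \<noteq> 0" using n by auto
 obtain B where B: "B \<subseteq> {x. n \<bullet> x = 0}" "pairwise orthogonal B" "!!x. x \<in> B ==> norm x = 1"
   "card B = dim {x. n \<bullet> x = 0}" "span B = {x. n \<bullet> x = 0}"
  using orthonormal_basis_subspace[OF subspace_hyperplane[of n]] by metis
 have "card B = 2" using B(4) dim_hyperplane[OF nz] by simp
 then obtain e1 e2 where e: "B = {e1, e2}" "e1 \<noteq> e2" by (auto simp: card_2_iff)
 have ip: "e1 \<bullet> e1 = 1" "e2 \<bullet> e2 = 1" "n \<bullet> n = 1" "e1 \<bullet> e2 = 0" "e1 \<bullet> n = 0" "e2 \<bullet> n = 0"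
  using B e n by (auto simp: norm_eq_1 pairwise_insert orthogonal_def inner_commute)
 have "x = (x \<bullet> e1) *\<^sub>R e1 + (x \<bullet> e2) *\<^sub>R e2 + (x \<bullet> n) *\<^sub>R n" for x
 proof -
  have "x - (x \<bullet> n) *\<^sub>R n \<in> span {e1, e2}" 
   using B(5) e ip by (auto simp: inner_diff_right inner_commute)
  then obtain a b where ab: "x - (x \<bullet> n) *\<^sub>R n = a *\<^sub>R e1 + b *\<^sub>R e2"
   by (auto simp: span_insert) (metis add.commute diff_add_cancel)
  then have x: "x = a *\<^sub>R e1 + b *\<^sub>R e2 + (x \<bullet> n) *\<^sub>R n" by (simp add: algebra_simps)
  have "x \<bullet> e1 = a" "x \<bullet> e2 = b"
   using arg_cong[OF x, of "\<lambda>z. z \<bullet> e1"] arg_cong[OF x, of "\<lambda>z. z \<bullet> e2"] ip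
   by (simp_all add: inner_simps inner_commute)
  then show ?thesis using x by simp
 qed
 then show ?thesis using that ip unfolding frame_def by auto
qed

lemma frame_inner:
 assumes "frame e1 e2 n"
 shows "x \<bullet> y = (x \<bullet> e1) * (y \<bullet> e1) + (x \<bullet> e2) * (y \<bullet> e2) + (x \<bullet> n) * (y \<bullet> n)"
proof -
 have "y = (y \<bullet> e1) *\<^sub>R e1 + (y \<bullet> e2) *\<^sub>R e2 + (y \<bullet> n) *\<^sub>R n"
  using assms unfolding frame_def by simp
 then have "x \<bullet> y = x \<bullet> ((y \<bullet> e1) *\<^sub>R e1 + (y \<bullet> e2) *\<^sub>R e2 + (y \<bullet> n) *\<^sub>R n)" by simp
 then show ?thesis by (simp add: inner_add_right)
qed

lemma trace_frame:
 assumes f: "frame e1 e2 n" and "linear L"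
 shows "(\<Sum>b\<in>Basis. L b \<bullet> b) = L e1 \<bullet> e1 + L e2 \<bullet> e2 + L n \<bullet> n"
proof -
 interpret linear L by fact
 have b: "L b = (b \<bullet> e1) *\<^sub>R L e1 + (b \<bullet> e2) *\<^sub>R L e2 + (b \<bullet> n) *\<^sub>R L n" for b
 proof -
  have "b = (b \<bullet> e1) *\<^sub>R e1 + (b \<bullet> e2) *\<^sub>R e2 + (b \<bullet> n) *\<^sub>R n"
   using f unfolding frame_def by auto
  then have "L b = L ((b \<bullet> e1) *\<^sub>R e1 + (b \<bullet> e2) *\<^sub>R e2 + (b \<bullet> n) *\<^sub>R n)" by simp
  then show ?thesis by (simp add: add scaleR)
 qed
 have s: "(\<Sum>b\<in>Basis. (b \<bullet> e) * (w \<bullet> b)) = w \<bullet> e" for e w :: point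
  by (subst euclidean_inner[of w e]) (simp add: inner_commute mult.commute)
 show ?thesis by (subst b) (simp add: inner_add_left sum.distrib s)
qed

lemma surface_div_frame:
 assumes f: "frame e1 e2 (n x)"
 shows "surface_div n D x = D x e1 \<bullet> e1 + D x e2 \<bullet> e2"
 unfolding surface_div_def by (subst trace_frame[OF f]) (auto simp: blinfun.bounded_linear_right bounded_linear.linear)

lemma C2_surface_norm: "C2_surface G \<nu> ==> p \<in> G ==> norm (\<nu> p) = 1"
 unfolding C2_surface_def by force

lemma C2_surface_local:
 assumes "C2_surface G \<nu>" "p \<in> G"
 obtains W \<phi> g H where "open W" "p \<in> W" "C2_on W \<phi> g H" "G \<inter> W = {x\<in>W. \<phi> x = 0}"
  "\<forall>x\<in>G \<inter> W. g x \<noteq> 0 \<and> \<nu> x = g x /\<^sub>R norm (g x)"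
proof -
 have "\<exists>W \<phi> g H. open W \<and> p \<in> W \<and> C2_on W \<phi> g H \<and>
    G \<inter> W = {x\<in>W. \<phi> x = 0} \<and>
    (\<forall>x\<in>G \<inter> W. g x \<noteq> 0 \<and> \<nu> x = g x /\<^sub>R norm (g x))"
  using assms unfolding C2_surface_def by simp
 then show ?thesis using that by auto
qed

lemma has_derivative_within_cong:
 assumes "(f has_derivative L) (at p within G)" "open W" "p \<in> W" "p \<in> G" "!!x. x \<in> G \<inter> W ==> f x = f' x"
 shows "(f' has_derivative L) (at p within G)"
 using assms(1)
 by (rule has_derivative_transform_eventually)
   (use assms in \<open>auto simp: eventually_at_topological\<close>)

text \<open>The level set function vanishes on \<open>G\<close>, so subtracting a multiple of it
  does not change \<open>f\<close> there; the multiple is chosen to cancel the derivative in the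
  normal direction.\<close>

lemma has_derivative_within_tangential:
 fixes f :: "point => 'b::real_normed_vector"
 assumes C: "C2_surface G \<nu>" and p: "p \<in> G" and d: "(f has_derivative L) (at p within G)"
 shows "(f has_derivative (\<lambda>v. L (tangential (\<nu> p) v))) (at p within G)"
proof -
 obtain W \<phi> g H where W: "open W" "p \<in> W" "C2_on W \<phi> g H" "G \<inter> W = {x\<in>W. \<phi> x = 0}"
  "\<forall>x\<in>G \<inter> W. g x \<noteq> 0 \<and> \<nu> x = g x /\<^sub>R norm (g x)"
  by (rule C2_surface_local[OF C p])
 have g: "(\<phi> has_derivative (\<lambda>h. h \<bullet> g p)) (at p within G)"
  using W(2,3) by (auto simp: C2_on_def gderiv_def intro: has_derivative_at_withinI)
 have "linear L" using d has_derivative_linear by auto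
 then interpret linear L .
 have "((\<lambda>x. f x - \<phi> x *\<^sub>R (L (\<nu> p) /\<^sub>R norm (g p))) has_derivative
   (\<lambda>v. L v - (v \<bullet> g p) *\<^sub>R (L (\<nu> p) /\<^sub>R norm (g p)))) (at p within G)"
  by (intro derivative_intros d g)
 moreover have "(\<lambda>v. L v - (v \<bullet> g p) *\<^sub>R (L (\<nu> p) /\<^sub>R norm (g p))) = (\<lambda>v. L (tangential (\<nu> p) v))"
  unfolding tangential_def diff scaleR using W(5) p W(2) by auto
 ultimately have "((\<lambda>x. f x - \<phi> x *\<^sub>R (L (\<nu> p) /\<^sub>R norm (g p))) has_derivative (\<lambda>v. L (tangential (\<nu> p) v))) (at p within G)"
  by simp
 then show ?thesis
  by (rule has_derivative_within_cong[OF _ W(1,2) p]) (use W(4) in auto)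
qed

text \<open>Charts are graphs over the tangent plane at \<open>p0\<close>; the parameter of a point is read off
 by orthogonal projection.\<close>

definition chart_coord :: "point => point => point => point => real \<times> real" where
 "chart_coord e1 e2 p0 x = ((x - p0) \<bullet> e1, (x - p0) \<bullet> e2)"

text \<open>The vector with coordinates \<open>v\<close> in the plane of \<open>e1\<close> and
  \<open>e2\<close>, moved along \<open>n0\<close> until it is orthogonal to \<open>m\<close>: the
  derivative of a graph with normal \<open>m\<close>.\<close>

definition chart_deriv :: "point => point => point => point => real \<times> real => point" where
 "chart_deriv e1 e2 n0 m v = fst v *\<^sub>R (e1 - ((m \<bullet> e1) / (m \<bullet> n0)) *\<^sub>R n0) + snd v *\<^sub>R (e2 - ((m \<bullet> e2) / (m \<bullet> n0)) *\<^sub>R n0)"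

text \<open>The derivative is expressed by the normal of the surface, so that the level set function
  disappears from later arguments. The angle bound keeps the area element at most 2.\<close>

definition surface_chart :: "point set => (point => point) => point => point => point => point set => (real \<times> real) set => (real \<times> real => point) => bool" where
 "surface_chart G \<nu> p0 e1 e2 U V F \<longleftrightarrow> p0 \<in> G \<and> p0 \<in> U \<and> open U \<and> open V \<and>
   frame e1 e2 (\<nu> p0) \<and> F ` V = G \<inter> U \<and>
   (\<forall>y\<in>V. chart_coord e1 e2 p0 (F y) = y) \<and>
   (\<forall>p\<in>G \<inter> U. \<nu> p \<bullet> \<nu> p0 > 1/2) \<and>
   (\<forall>y\<in>V. (F has_derivative chart_deriv e1 e2 (\<nu> p0) (\<nu> (F y))) (at y))"

text \<open>The inverse function theorem is applied to \<open>\<Psi>\<close>, which keeps the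
  coordinates along the tangent plane and replaces the height over it by the value of
  \<open>\<phi>\<close>. It flattens the surface into the plane, and the chart is its inverse on
  that plane.\<close>

lemma surface_chart_exists:
 assumes C: "C2_surface G \<nu>" and p0: "p0 \<in> G"
 obtains e1 e2 U V F where "surface_chart G \<nu> p0 e1 e2 U V F"
proof -
 obtain W0 \<phi> g H where W0: "open W0" "p0 \<in> W0" "C2_on W0 \<phi> g H" "G \<inter> W0 = {x\<in>W0. \<phi> x = 0}"
  "\<forall>x\<in>G \<inter> W0. g x \<noteq> 0 \<and> \<nu> x = g x /\<^sub>R norm (g x)"
  by (rule C2_surface_local[OF C p0])
 define n0 where "n0 = \<nu> p0"
 have n0: "norm n0 = 1" using C2_surface_norm[OF C p0] by (simp add: n0_def)
 obtain e1 e2 where f: "frame e1 e2 n0" using frame_exists[OF n0] .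
 then have ip: "e1 \<bullet> e1 = 1" "e2 \<bullet> e2 = 1" "n0 \<bullet> n0 = 1" "e1 \<bullet> e2 = 0" "e1 \<bullet> n0 = 0" "e2 \<bullet> n0 = 0"
   "e2 \<bullet> e1 = 0" "n0 \<bullet> e1 = 0" "n0 \<bullet> e2 = 0"
  and ex: "!!x. x = (x \<bullet> e1) *\<^sub>R e1 + (x \<bullet> e2) *\<^sub>R e2 + (x \<bullet> n0) *\<^sub>R n0"
  unfolding frame_def by (auto simp: inner_commute)
 have dg: "(\<phi> has_derivative (\<lambda>h. h \<bullet> g x)) (at x)" "(g has_derivative H x) (at x)" if "x \<in> W0" for x
  using W0(3) that by (auto simp: C2_on_def gderiv_def)
 have cg: "continuous_on W0 g"
  using dg(2) by (meson has_derivative_continuous continuous_at_imp_continuous_on)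
 have gp0: "g p0 = norm (g p0) *\<^sub>R n0" "0 < norm (g p0)"
  using W0(5) p0 W0(2) by (auto simp: n0_def)
 have "continuous_on W0 (\<lambda>x. g x \<bullet> n0 - 1/2 * norm (g x))" by (intro continuous_intros cg)
 then have op: "open ((\<lambda>x. g x \<bullet> n0 - 1/2 * norm (g x)) -` {0<..} \<inter> W0)"
  by (simp add: continuous_on_open_vimage[OF W0(1)])
 define W where "W = (\<lambda>x. g x \<bullet> n0 - 1/2 * norm (g x)) -` {0<..} \<inter> W0"
 have p0W: "p0 \<in> W"
 proof -
  have "g p0 \<bullet> n0 = norm (g p0)" by (subst gp0(1)) (simp add: ip)
  then show ?thesis using gp0(2) W0(2) by (simp add: W_def)
 qed
 have gn: "1/2 * norm (g x) < g x \<bullet> n0" "0 < g x \<bullet> n0" if "x \<in> W" for x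
  using that norm_ge_zero[of "g x"] unfolding W_def by (auto simp del: norm_ge_zero)
 define \<Psi> where "\<Psi> x = x + (\<phi> x - (x - p0) \<bullet> n0) *\<^sub>R n0" for x
 define \<Psi>' where "\<Psi>' x = id_blinfun + (blinfun_scaleR_left n0 o\<^sub>L (blinfun_inner_left (g x) - blinfun_inner_left n0))" for x
 have \<Psi>'_apply: "\<Psi>' x v = v + (g x \<bullet> v - n0 \<bullet> v) *\<^sub>R n0" for x v
  by (simp add: \<Psi>'_def blinfun.add_left blinfun.diff_left inner_commute)
 have d\<Psi>: "(\<Psi> has_derivative blinfun_apply (\<Psi>' x)) (at x)" if "x \<in> W" for x
 proof -
  have "x \<in> W0" using that by (simp add: W_def)
  have "((\<lambda>x. x + (\<phi> x - (x - p0) \<bullet> n0) *\<^sub>R n0) has_derivative (\<lambda>v. v + (v \<bullet> g x - (v - 0) \<bullet> n0) *\<^sub>R n0)) (at x)"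
   by (intro derivative_intros dg(1) \<open>x \<in> W0\<close>)
  moreover have "(\<lambda>v. v + (v \<bullet> g x - (v - 0) \<bullet> n0) *\<^sub>R n0) = blinfun_apply (\<Psi>' x)"
   by (simp add: fun_eq_iff \<Psi>'_apply inner_commute)
  ultimately show ?thesis unfolding \<Psi>_def[abs_def] by simp
 qed
 have c\<Psi>: "continuous_on W \<Psi>'"
  by (rule continuous_on_blinfun_componentwise) 
    (auto simp: \<Psi>'_apply W_def intro!: continuous_intros continuous_on_subset[OF cg])
 \<comment> \<open>The derivative of \<open>\<Psi>\<close> at \<open>p0\<close> is the identity on
   the tangent plane and multiplies \<open>n0\<close> by \<open>norm (g p0)\<close>;
   \<open>A\<close> is its inverse.\<close>
 define A where "A = id_blinfun + (blinfun_scaleR_left n0 o\<^sub>L ((1 / norm (g p0) - 1) *\<^sub>R blinfun_inner_left n0))"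
 have A_apply: "A v = v + ((1 / norm (g p0) - 1) * (n0 \<bullet> v)) *\<^sub>R n0" for v
  by (simp add: A_def blinfun.add_left blinfun.scaleR_left inner_commute)
 have inv: "A o\<^sub>L \<Psi>' p0 = id_blinfun"
 proof (rule blinfun_eqI)
  fix v
  have "g p0 \<bullet> v = norm (g p0) * (n0 \<bullet> v)" by (subst gp0(1)) simp
  then show "(A o\<^sub>L \<Psi>' p0) v = id_blinfun v"
   using gp0(2) by (simp add: A_apply \<Psi>'_apply ip algebra_simps)
 qed
 obtain U V' Y Y' where IF: "open U" "U \<subseteq> W" "p0 \<in> U" "open V'" "\<Psi> p0 \<in> V'" "homeomorphism U V' \<Psi> Y"
  "!!y. y \<in> V' ==> (Y has_derivative (Y' y)) (at y)"
  using inverse_function_theorem[OF op[folded W_def] d\<Psi> c\<Psi> p0W inv] by metis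
 have GU: "Y y \<in> U" "\<Psi> (Y y) = y" if "y \<in> V'" for y
  using IF(6) that by (auto simp: homeomorphism_def)
 have GP: "\<Psi> x \<in> V'" "Y (\<Psi> x) = x" if "x \<in> U" for x
  using IF(6) that by (auto simp: homeomorphism_def)
 define \<iota> where "\<iota> y = p0 + fst y *\<^sub>R e1 + snd y *\<^sub>R e2" for y :: "real \<times> real"
 have c\<iota>: "continuous_on UNIV \<iota>" unfolding \<iota>_def[abs_def] by (intro continuous_intros)
 define V where "V = \<iota> -` V'"
 define F where "F y = Y (\<iota> y)" for y
 have \<iota>ip: "(\<iota> y - p0) \<bullet> e1 = fst y" "(\<iota> y - p0) \<bullet> e2 = snd y" "(\<iota> y - p0) \<bullet> n0 = 0" for y
  by (simp_all add: \<iota>_def inner_add_left ip)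
 have \<Psi>ip: "(\<Psi> x - p0) \<bullet> e1 = (x - p0) \<bullet> e1" "(\<Psi> x - p0) \<bullet> e2 = (x - p0) \<bullet> e2" "(\<Psi> x - p0) \<bullet> n0 = \<phi> x" for x
  by (simp_all add: \<Psi>_def inner_add_left inner_diff_left ip)
 have oV: "open V" unfolding V_def using c\<iota> IF(4) by (metis open_vimage)
 have FU: "F y \<in> U" "\<Psi> (F y) = \<iota> y" if "y \<in> V" for y using GU[of "\<iota> y"] that by (auto simp: F_def V_def)
 have \<phi>F: "\<phi> (F y) = 0" if "y \<in> V" for y using FU[OF that] \<Psi>ip(3)[of "F y"] \<iota>ip(3)[of y] by simp
 have UW0: "U \<subseteq> W0" using IF(2) by (auto simp: W_def)
 have FG: "F y \<in> G" if "y \<in> V" for y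
  using \<phi>F[OF that] FU[OF that] W0(4) UW0 by auto
 have coord: "chart_coord e1 e2 p0 (F y) = y" if "y \<in> V" for y
  using FU[OF that] \<Psi>ip(1,2)[of "F y"] \<iota>ip(1,2)[of y] by (simp add: chart_coord_def prod_eq_iff)
 have img: "F ` V = G \<inter> U"
 proof
  show "F ` V \<subseteq> G \<inter> U" using FG FU by auto
  show "G \<inter> U \<subseteq> F ` V"
  proof
   fix x assume x: "x \<in> G \<inter> U"
   then have "\<phi> x = 0" using W0(4) UW0 by auto
   then have z: "(\<Psi> x - p0) \<bullet> n0 = 0" using \<Psi>ip(3) by simp
   have "\<Psi> x = \<iota> (chart_coord e1 e2 p0 x)"
    using ex[of "\<Psi> x - p0"] z \<Psi>ip(1,2)[of x] unfolding chart_coord_def \<iota>_def by (simp add: algebra_simps)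
   then show "x \<in> F ` V" using GP[of x] x by (auto simp: F_def V_def image_iff intro!: bexI[of _ "chart_coord e1 e2 p0 x"])
  qed
 qed
 have \<nu>g: "\<nu> x = g x /\<^sub>R norm (g x)" "0 < norm (g x)" if "x \<in> G" "x \<in> U" for x
  using W0(5) that UW0 by auto
 have half: "1/2 < \<nu> x \<bullet> n0" if "x \<in> G \<inter> U" for x
  using \<nu>g[of x] gn(1)[of x] that IF(2) by (auto simp: field_simps)
 have dF: "(F has_derivative chart_deriv e1 e2 n0 (\<nu> (F y))) (at y)" if y: "y \<in> V" for y
 proof -
  have yV': "\<iota> y \<in> V'" using y by (simp add: V_def)
  define T where "T v = Y' (\<iota> y) (fst v *\<^sub>R e1 + snd v *\<^sub>R e2)" for v
  have d\<iota>: "(\<iota> has_derivative (\<lambda>v. fst v *\<^sub>R e1 + snd v *\<^sub>R e2)) (at y)"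
   unfolding \<iota>_def[abs_def] by (rule has_derivative_eq_rhs, (rule derivative_intros)+) auto
  have T: "(F has_derivative T) (at y)"
   unfolding F_def[abs_def] T_def[abs_def] by (rule has_derivative_compose[OF d\<iota> IF(7)[OF yV']])
  have "((\<lambda>y. (F y - p0) \<bullet> e1) has_derivative (\<lambda>v. T v \<bullet> e1)) (at y)" 
   "((\<lambda>y. (F y - p0) \<bullet> e2) has_derivative (\<lambda>v. T v \<bullet> e2)) (at y)"
   using T by (auto intro!: derivative_eq_intros)
  moreover have "((\<lambda>y. (F y - p0) \<bullet> e1) has_derivative fst) (at y)" 
   by (rule has_derivative_transform_within_open[OF _ oV y, of fst]) 
     (use coord in \<open>auto intro!: derivative_eq_intros simp: chart_coord_def prod_eq_iff\<close>)
  moreover have "((\<lambda>y. (F y - p0) \<bullet> e2) has_derivative snd) (at y)" 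
   by (rule has_derivative_transform_within_open[OF _ oV y, of snd]) 
     (use coord in \<open>auto intro!: derivative_eq_intros simp: chart_coord_def prod_eq_iff\<close>)
  ultimately have T12: "T v \<bullet> e1 = fst v" "T v \<bullet> e2 = snd v" for v
   using has_derivative_unique by (metis (no_types, lifting))+
  have FyW: "F y \<in> W0" "F y \<in> W" "F y \<in> G" using FU[OF y] UW0 IF(2) FG[OF y] by auto
  have "((\<lambda>y. \<phi> (F y)) has_derivative (\<lambda>v. T v \<bullet> g (F y))) (at y)"
   by (rule has_derivative_compose[OF T dg(1)[OF FyW(1)]])
  moreover have "((\<lambda>y. \<phi> (F y)) has_derivative (\<lambda>v. 0)) (at y)"
   by (rule has_derivative_transform_within_open[OF _ oV y, of "\<lambda>_. 0"]) (auto simp: \<phi>F)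
  ultimately have "T v \<bullet> g (F y) = 0" for v using has_derivative_unique by metis
  then have T\<nu>: "T v \<bullet> \<nu> (F y) = 0" for v using \<nu>g[of "F y"] FyW FU[OF y] by simp
  have mn: "\<nu> (F y) \<bullet> n0 \<noteq> 0" using half[of "F y"] FyW FU[OF y] by auto
  have "T v = chart_deriv e1 e2 n0 (\<nu> (F y)) v" for v
  proof -
   have "0 = (T v \<bullet> e1) * (\<nu> (F y) \<bullet> e1) + (T v \<bullet> e2) * (\<nu> (F y) \<bullet> e2) + (T v \<bullet> n0) * (\<nu> (F y) \<bullet> n0)"
    using T\<nu>[of v] frame_inner[OF f, of "T v" "\<nu> (F y)"] by simp
   then have "T v \<bullet> n0 = - (fst v * (\<nu> (F y) \<bullet> e1) + snd v * (\<nu> (F y) \<bullet> e2)) / (\<nu> (F y) \<bullet> n0)"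
    using mn T12[of v] by (simp add: field_simps)
   then have "T v = fst v *\<^sub>R e1 + snd v *\<^sub>R e2 + (- (fst v * (\<nu> (F y) \<bullet> e1) + snd v * (\<nu> (F y) \<bullet> e2)) / (\<nu> (F y) \<bullet> n0)) *\<^sub>R n0"
    using ex[of "T v"] T12[of v] by simp
   then show ?thesis unfolding chart_deriv_def by (simp add: algebra_simps diff_divide_distrib)
  qed
  then have "T = chart_deriv e1 e2 n0 (\<nu> (F y))" by auto
  then show ?thesis using T by simp
 qed
 have "surface_chart G \<nu> p0 e1 e2 U V F"
  unfolding surface_chart_def n0_def[symmetric] using p0 IF(1,3) oV f img coord half dF by auto
 then show ?thesis by (rule)
qed

section \<open>Tangential derivatives and the area formula\<close>

lemma surface_chartD:
 assumes "surface_chart G \<nu> p0 e1 e2 U V F"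
 shows "p0 \<in> G" "p0 \<in> U" "open U" "open V" "frame e1 e2 (\<nu> p0)" "F ` V = G \<inter> U"
  "!!y. y \<in> V ==> chart_coord e1 e2 p0 (F y) = y"
  "!!p. p \<in> G ==> p \<in> U ==> \<nu> p \<bullet> \<nu> p0 > 1/2"
  "!!y. y \<in> V ==> (F has_derivative chart_deriv e1 e2 (\<nu> p0) (\<nu> (F y))) (at y)"
  "!!y. y \<in> V ==> F y \<in> G" "!!y. y \<in> V ==> F y \<in> U"
 using assms unfolding surface_chart_def by auto

lemma surface_chart_inverse:
 assumes c: "surface_chart G \<nu> p0 e1 e2 U V F" and x: "x \<in> G" "x \<in> U"
 shows "chart_coord e1 e2 p0 x \<in> V" "F (chart_coord e1 e2 p0 x) = x"
proof -
 have "x \<in> F ` V" using surface_chartD(6)[OF c] x by simp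
 then obtain y where "y \<in> V" "x = F y" by auto
 then show "chart_coord e1 e2 p0 x \<in> V" "F (chart_coord e1 e2 p0 x) = x"
  using surface_chartD(7)[OF c] by auto
qed

lemma continuous_chart_coord [continuous_intros]: "continuous_on S (chart_coord e1 e2 p0)"
 unfolding chart_coord_def[abs_def] by (intro continuous_intros)

lemma chart_coord_dist:
 assumes "frame e1 e2 n"
 shows "dist (chart_coord e1 e2 p0 x) (chart_coord e1 e2 p0 x') \<le> dist x x'"
proof -
 have 0: "chart_coord e1 e2 p0 x - chart_coord e1 e2 p0 x' = ((x - x') \<bullet> e1, (x - x') \<bullet> e2)"
  by (simp add: chart_coord_def inner_diff_left)
 have "(norm (chart_coord e1 e2 p0 x - chart_coord e1 e2 p0 x'))\<^sup>2 \<le> (norm (x - x'))\<^sup>2"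
  unfolding 0 norm_Pair power2_norm_eq_inner frame_inner[OF assms, of "x - x'" "x - x'"] by simp
 then show ?thesis unfolding dist_norm by auto
qed

lemma surface_chart_compose:
 assumes c: "surface_chart G \<nu> p0 e1 e2 U V F" and y: "y \<in> V"
  and f: "(f has_derivative L) (at (F y) within G)"
 shows "((\<lambda>y. f (F y)) has_derivative (\<lambda>v. L (chart_deriv e1 e2 (\<nu> p0) (\<nu> (F y)) v))) (at y)"
proof -
 have "(F has_derivative chart_deriv e1 e2 (\<nu> p0) (\<nu> (F y))) (at y within V)"
  using surface_chartD(9)[OF c y] by (rule has_derivative_at_withinI)
 moreover have "(f has_derivative L) (at (F y) within F ` V)"
  using f by (rule has_derivative_subset) (use surface_chartD(6)[OF c] in auto)
 ultimately have "((f \<circ> F) has_derivative (L \<circ> chart_deriv e1 e2 (\<nu> p0) (\<nu> (F y)))) (at y within V)"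
  by (rule diff_chain_within)
 then show ?thesis unfolding o_def at_within_open[OF y surface_chartD(4)[OF c]] .
qed

text \<open>Derivatives within \<open>G\<close> are not unique as maps on the whole space.
  Composition with a chart turns them into derivatives on an open subset of the plane, which are
  unique, and the chart derivative reaches every tangent vector.\<close>

lemma tangential_derivative_unique:
 assumes C: "C2_surface G \<nu>" and p: "p \<in> G" and v: "v \<bullet> \<nu> p = 0"
  and f: "(f has_derivative L) (at p within G)" "(f has_derivative L') (at p within G)"
 shows "L v = L' v"
proof -
 obtain e1 e2 U V F where c: "surface_chart G \<nu> p e1 e2 U V F" using surface_chart_exists[OF C p] .
 define y where "y = chart_coord e1 e2 p p"
 have y: "y \<in> V" "F y = p"
  using surface_chart_inverse[OF c p surface_chartD(2)[OF c]] by (auto simp: y_def)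
 have f': "(f has_derivative L) (at (F y) within G)" "(f has_derivative L') (at (F y) within G)"
  using f y by auto
 have eq: "(\<lambda>w. L (chart_deriv e1 e2 (\<nu> p) (\<nu> (F y)) w)) = (\<lambda>w. L' (chart_deriv e1 e2 (\<nu> p) (\<nu> (F y)) w))"
  using surface_chart_compose[OF c y(1) f'(1)] surface_chart_compose[OF c y(1) f'(2)]
  by (rule has_derivative_unique)
 have fr: "frame e1 e2 (\<nu> p)" by (rule surface_chartD(5)[OF c])
 then have "v = (v \<bullet> e1) *\<^sub>R e1 + (v \<bullet> e2) *\<^sub>R e2 + (v \<bullet> \<nu> p) *\<^sub>R \<nu> p"
  unfolding frame_def by auto
 also have "... = chart_deriv e1 e2 (\<nu> p) (\<nu> (F y)) (v \<bullet> e1, v \<bullet> e2)"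
  using fr v y unfolding chart_deriv_def frame_def by (simp add: inner_commute)
 finally have "v = chart_deriv e1 e2 (\<nu> p) (\<nu> (F y)) (v \<bullet> e1, v \<bullet> e2)" .
 then show ?thesis using fun_cong[OF eq, of "(v \<bullet> e1, v \<bullet> e2)"] by simp
qed

lemma inner_tangential_left: "n \<bullet> n = 1 ==> tangential n v \<bullet> n = 0"
 by (simp add: tangential_def inner_diff_left)

lemma inner_tangential_sym: "tangential n u \<bullet> v = u \<bullet> tangential n v"
 by (simp add: tangential_def inner_diff_right inner_commute)

lemma tangential_tangent: "v \<bullet> n = 0 ==> tangential n v = v"
 by (simp add: tangential_def)

lemma tangential_normal: "n \<bullet> n = 1 ==> tangential n n = 0"
 by (simp add: tangential_def)

definition tangential_blinfun :: "point => point \<Rightarrow>\<^sub>L point" where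
 "tangential_blinfun n = id_blinfun - (blinfun_scaleR_left n o\<^sub>L blinfun_inner_left n)"

lemma tangential_blinfun_apply [simp]: "tangential_blinfun n v = tangential n v"
 by (simp add: tangential_blinfun_def blinfun.diff_left tangential_def)

lemma linear_tangential: "linear (tangential n)"
 by (rule linearI) (simp_all add: tangential_def algebra_simps)

text \<open>The derivative of the normal is only determined on tangent vectors; it is normalised to
 vanish on the normal.\<close>

definition is_shape_op :: "point set => (point => point) => point => (point \<Rightarrow>\<^sub>L point) => bool" where
 "is_shape_op G \<nu> p S \<longleftrightarrow> (\<nu> has_derivative blinfun_apply S) (at p within G) \<and> S (\<nu> p) = 0"

lemma shape_op_unique:
 assumes C: "C2_surface G \<nu>" and p: "p \<in> G" and S: "is_shape_op G \<nu> p S" "is_shape_op G \<nu> p S'"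
 shows "S = S'"
proof (rule blinfun_eqI)
 fix v
 have n: "\<nu> p \<bullet> \<nu> p = 1" using C2_surface_norm[OF C p] by (simp add: norm_eq_1)
 have v: "v = tangential (\<nu> p) v + (v \<bullet> \<nu> p) *\<^sub>R \<nu> p" by (simp add: tangential_def)
 have "S (tangential (\<nu> p) v) = S' (tangential (\<nu> p) v)"
  by (rule tangential_derivative_unique[OF C p inner_tangential_left[OF n]]) (use S in \<open>auto simp: is_shape_op_def\<close>)
 then show "S v = S' v"
  using S unfolding is_shape_op_def by (subst v, subst (2) v, simp add: blinfun.add_right blinfun.scaleR_right)
qed

text \<open>Differentiating the normalised gradient gives the Hessian divided by
  \<open>norm (g p)\<close> and projected to the tangent plane. Projecting its argument as well
  changes nothing on tangent vectors and makes the operator symmetric.\<close>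

lemma shape_op_local:
 assumes C: "C2_surface G \<nu>" and p0: "p0 \<in> G"
 obtains W S where "open W" "p0 \<in> W" "continuous_on (G \<inter> W) S"
  "!!p. p \<in> G \<inter> W ==> is_shape_op G \<nu> p (S p)"
  "!!p v. p \<in> G \<inter> W ==> S p v \<bullet> \<nu> p = 0"
  "!!p u v. p \<in> G \<inter> W ==> S p u \<bullet> v = S p v \<bullet> u"
proof -
 obtain W \<phi> g H where W: "open W" "p0 \<in> W" "C2_on W \<phi> g H" "G \<inter> W = {x\<in>W. \<phi> x = 0}"
  "\<forall>x\<in>G \<inter> W. g x \<noteq> 0 \<and> \<nu> x = g x /\<^sub>R norm (g x)"
  by (rule C2_surface_local[OF C p0])
 have dg: "(g has_derivative H x) (at x)" if "x \<in> W" for x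
  using W(3) that by (auto simp: C2_on_def)
 have cg: "continuous_on W g"
  using dg by (meson has_derivative_continuous continuous_at_imp_continuous_on)
 have cH: "continuous_on W H" using W(3) by (simp add: C2_on_def)
 have c\<nu>: "continuous_on (G \<inter> W) \<nu>"
 proof (rule continuous_on_eq)
  show "continuous_on (G \<inter> W) (\<lambda>x. g x /\<^sub>R norm (g x))"
   using W(5) by (intro continuous_intros continuous_on_subset[OF cg]) auto
 qed (use W(5) in auto)
 define S where "S p = (1 / norm (g p)) *\<^sub>R (tangential_blinfun (\<nu> p) o\<^sub>L (H p o\<^sub>L tangential_blinfun (\<nu> p)))" for p
 have S_apply: "S p v = (1 / norm (g p)) *\<^sub>R tangential (\<nu> p) (H p (tangential (\<nu> p) v))" for p v
  by (simp add: S_def blinfun.scaleR_left)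
 have cS: "continuous_on (G \<inter> W) S"
 proof (rule continuous_on_blinfun_componentwise)
  fix i :: point
  show "continuous_on (G \<inter> W) (\<lambda>p. S p i)"
   unfolding S_apply tangential_def using W(5)
   by (intro continuous_intros continuous_on_subset[OF cg] continuous_on_subset[OF cH] c\<nu>) auto
 qed
 have n: "\<nu> p \<bullet> \<nu> p = 1" if "p \<in> G \<inter> W" for p using C2_surface_norm[OF C, of p] that by (simp add: norm_eq_1)
 have shp: "is_shape_op G \<nu> p (S p)" if p: "p \<in> G \<inter> W" for p
 proof -
  have gp: "g p \<noteq> 0" "\<nu> p = g p /\<^sub>R norm (g p)" using W(5) p by auto
  have dn: "((\<lambda>x. norm (g x)) has_derivative (\<lambda>v. H p v \<bullet> sgn (g p))) (at p)"
   using has_derivative_compose[OF dg[of p] has_derivative_norm[OF gp(1)]] p by auto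
  have "((\<lambda>x. inverse (norm (g x)) *\<^sub>R g x) has_derivative
    (\<lambda>v. inverse (norm (g p)) *\<^sub>R H p v + (- (inverse (norm (g p)) * (H p v \<bullet> sgn (g p)) * inverse (norm (g p)))) *\<^sub>R g p)) (at p)"
   by (rule has_derivative_scaleR[OF Deriv.has_derivative_inverse[OF _ dn] dg]) (use p gp in auto)
  moreover have "(\<lambda>v. inverse (norm (g p)) *\<^sub>R H p v + (- (inverse (norm (g p)) * (H p v \<bullet> sgn (g p)) * inverse (norm (g p)))) *\<^sub>R g p)
   = (\<lambda>v. (1 / norm (g p)) *\<^sub>R tangential (\<nu> p) (H p v))"
   unfolding tangential_def gp(2) sgn_div_norm by (simp add: algebra_simps divide_inverse)
  ultimately have "((\<lambda>x. inverse (norm (g x)) *\<^sub>R g x) has_derivative (\<lambda>v. (1 / norm (g p)) *\<^sub>R tangential (\<nu> p) (H p v))) (at p within G)"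
   by (simp add: has_derivative_at_withinI)
  then have "(\<nu> has_derivative (\<lambda>v. (1 / norm (g p)) *\<^sub>R tangential (\<nu> p) (H p v))) (at p within G)"
   by (rule has_derivative_within_cong[OF _ W(1)]) (use p W(5) in auto)
  then have "(\<nu> has_derivative (\<lambda>v. (1 / norm (g p)) *\<^sub>R tangential (\<nu> p) (H p (tangential (\<nu> p) v)))) (at p within G)"
   using p by (intro has_derivative_within_tangential[OF C]) auto
  moreover have "S p (\<nu> p) = 0"
   unfolding S_apply tangential_normal[OF n[OF p]] by (simp add: tangential_def)
  ultimately show ?thesis unfolding is_shape_op_def S_apply[symmetric] by simp
 qed
 have "S p v \<bullet> \<nu> p = 0" if p: "p \<in> G \<inter> W" for p v
  unfolding S_apply using inner_tangential_left[OF n[OF p]] by simp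
 moreover have "S p u \<bullet> v = S p v \<bullet> u" if p: "p \<in> G \<inter> W" for p u v
  unfolding S_apply inner_scaleR_left inner_tangential_sym
  using hessian_symmetric[OF W(3,1), of p "tangential (\<nu> p) u" "tangential (\<nu> p) v"] p by simp
 ultimately show ?thesis using that[OF W(1,2) cS shp] by auto
qed

definition shape_op :: "point set => (point => point) => point => point \<Rightarrow>\<^sub>L point" where
 "shape_op G \<nu> p = (SOME S. is_shape_op G \<nu> p S)"

lemma shape_op_eq:
 assumes "C2_surface G \<nu>" "p \<in> G" "is_shape_op G \<nu> p S" shows "shape_op G \<nu> p = S"
 unfolding shape_op_def by (rule shape_op_unique[OF assms(1,2) someI assms(3)]) (rule assms(3))

text \<open>Uniqueness identifies \<open>shape_op\<close> with each local operator, so continuity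
  and symmetry are inherited although the level set functions differ from place to place.\<close>

lemma
 assumes C: "C2_surface G \<nu>"
 shows shape_op_derivative: "p \<in> G ==> (\<nu> has_derivative shape_op G \<nu> p) (at p within G)"
  and shape_op_normal: "p \<in> G ==> shape_op G \<nu> p (\<nu> p) = 0"
  and shape_op_tangential: "p \<in> G ==> shape_op G \<nu> p v \<bullet> \<nu> p = 0"
  and shape_op_symmetric: "p \<in> G ==> shape_op G \<nu> p u \<bullet> v = shape_op G \<nu> p v \<bullet> u"
  and shape_op_continuous: "continuous_on G (shape_op G \<nu>)"
proof -
 have loc: "is_shape_op G \<nu> p (shape_op G \<nu> p) \<and> shape_op G \<nu> p v \<bullet> \<nu> p = 0 \<and>
   shape_op G \<nu> p u \<bullet> v = shape_op G \<nu> p v \<bullet> u \<and> continuous (at p within G) (shape_op G \<nu>)"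
  if p: "p \<in> G" for p u v
 proof -
  obtain W S where W: "open W" "p \<in> W" "continuous_on (G \<inter> W) S"
   "!!p. p \<in> G \<inter> W ==> is_shape_op G \<nu> p (S p)"
   "!!p v. p \<in> G \<inter> W ==> S p v \<bullet> \<nu> p = 0"
   "!!p u v. p \<in> G \<inter> W ==> S p u \<bullet> v = S p v \<bullet> u"
   using shape_op_local[OF C p] by auto
  have eq: "shape_op G \<nu> x = S x" if "x \<in> G \<inter> W" for x
   using shape_op_eq[OF C _ W(4)[OF that]] that by simp
  have "continuous_on (G \<inter> W) (shape_op G \<nu>)"
   by (rule continuous_on_eq[OF W(3)]) (simp add: eq)
  then have "continuous (at p within (G \<inter> W)) (shape_op G \<nu>)"
   using p W(2) by (simp add: continuous_on_eq_continuous_within)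
  moreover have "at p within (G \<inter> W) = at p within G"
   by (rule at_within_nhd[OF W(2,1)]) auto
  ultimately show ?thesis using W(2,4-6) p eq[of p] by auto
 qed
 show "p \<in> G ==> (\<nu> has_derivative shape_op G \<nu> p) (at p within G)" "p \<in> G ==> shape_op G \<nu> p (\<nu> p) = 0"
  "p \<in> G ==> shape_op G \<nu> p v \<bullet> \<nu> p = 0" "p \<in> G ==> shape_op G \<nu> p u \<bullet> v = shape_op G \<nu> p v \<bullet> u"
  using loc unfolding is_shape_op_def by auto
 show "continuous_on G (shape_op G \<nu>)"
  using loc by (simp add: continuous_on_eq_continuous_within)
qed

lemma continuous_on_normal: "C2_surface G \<nu> ==> continuous_on G \<nu>"
 using shape_op_derivative has_derivative_continuous by (metis continuous_on_eq_continuous_within)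

subsection \<open>Area formula\<close>

text \<open>Fubini, with a one-dimensional affine substitution in each variable.\<close>

lemma emeasure_lborel_triangular:
 fixes A :: "(real \<times> real) set"
 assumes A [measurable]: "A \<in> sets borel" and \<alpha>: "0 < \<alpha>" and \<gamma>: "0 < \<gamma>"
 shows "(\<lambda>v. (\<alpha> * fst v + \<beta> * snd v, \<gamma> * snd v)) ` A \<in> sets borel"
  and "emeasure lborel ((\<lambda>v. (\<alpha> * fst v + \<beta> * snd v, \<gamma> * snd v)) ` A) = ennreal (\<alpha> * \<gamma>) * emeasure lborel A"
proof -
 define T where "T p = ((fst p - \<beta> * (snd p / \<gamma>)) / \<alpha>, snd p / \<gamma>)" for p :: "real \<times> real"
 have T[measurable]: "T \<in> borel_measurable borel"
  unfolding T_def[abs_def] by (intro borel_measurable_continuous_onI continuous_intros) (use \<alpha> \<gamma> in auto)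
 have img: "(\<lambda>v. (\<alpha> * fst v + \<beta> * snd v, \<gamma> * snd v)) ` A = T -` A" (is "?M ` A = _")
 proof
  show "?M ` A \<subseteq> T -` A" using \<alpha> \<gamma> by (auto simp: T_def)
  show "T -` A \<subseteq> ?M ` A"
  proof
   fix p assume "p \<in> T -` A"
   moreover have "p = ?M (T p)" using \<alpha> \<gamma> by (simp add: T_def)
   ultimately show "p \<in> ?M ` A" by auto
  qed
 qed
 have TA: "T -` A \<in> sets borel" using measurable_sets[OF T A] by simp
 then show "?M ` A \<in> sets borel" unfolding img .
 have ind: "indicator (T -` A) p = (indicator A (T p) :: ennreal)" for p by (simp add: indicator_def)
 have "emeasure lborel (T -` A) = (\<integral>\<^sup>+p. indicator A (T p) \<partial>(lborel \<Otimes>\<^sub>M lborel))"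
  using TA unfolding lborel_prod ind[symmetric] by simp
 also have "... = (\<integral>\<^sup>+w. \<integral>\<^sup>+u. indicator A (T (u, w)) \<partial>lborel \<partial>lborel)"
  by (rule lborel_pair.nn_integral_snd[symmetric]) (simp add: lborel_prod)
 also have "... = (\<integral>\<^sup>+w. ennreal \<alpha> * \<integral>\<^sup>+x. indicator A (x, w / \<gamma>) \<partial>lborel \<partial>lborel)"
 proof (rule nn_integral_cong)
  fix w
  have "(\<lambda>u. T (u, w)) \<in> borel_measurable borel"
   by auto
  then have m: "(\<lambda>u. indicator A (T (u, w)) :: ennreal) \<in> borel_measurable borel" by auto
  have "(\<integral>\<^sup>+u. indicator A (T (u, w)) \<partial>lborel) = ennreal \<alpha> * (\<integral>\<^sup>+x. indicator A (T (\<beta> * (w / \<gamma>) + \<alpha> * x, w)) \<partial>lborel)"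
   using \<alpha> by (subst nn_integral_real_affine[OF m, of \<alpha> "\<beta> * (w / \<gamma>)"]) auto
  then show "(\<integral>\<^sup>+u. indicator A (T (u, w)) \<partial>lborel) = ennreal \<alpha> * (\<integral>\<^sup>+x. indicator A (x, w / \<gamma>) \<partial>lborel)"
   using \<alpha> by (simp add: T_def)
 qed
 also have "... = ennreal \<gamma> * (\<integral>\<^sup>+w. ennreal \<alpha> * \<integral>\<^sup>+x. indicator A (x, w) \<partial>lborel \<partial>lborel)"
  using \<gamma> by (subst nn_integral_real_affine[where c = \<gamma> and t = 0]) auto
 also have "... = ennreal (\<alpha> * \<gamma>) * (\<integral>\<^sup>+w. \<integral>\<^sup>+x. indicator A (x, w) \<partial>lborel \<partial>lborel)"
  using \<alpha> \<gamma> by (subst nn_integral_cmult) (auto simp: ennreal_mult ac_simps)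
 also have "(\<integral>\<^sup>+w. \<integral>\<^sup>+x. indicator A (x, w) \<partial>lborel \<partial>lborel) = (\<integral>\<^sup>+p. indicator A p \<partial>(lborel \<Otimes>\<^sub>M lborel))"
  by (rule lborel_pair.nn_integral_snd) (simp add: lborel_prod)
 also have "... = emeasure lborel A" unfolding lborel_prod by simp
 finally show "emeasure lborel (?M ` A) = ennreal (\<alpha> * \<gamma>) * emeasure lborel A" unfolding img .
qed

text \<open>The upper triangular factor \<open>M\<close> with \<open>M\<^sup>T M = I + a a\<^sup>T\<close>: it has the same metric as the
 derivative of a graph with slopes \<open>a\<close>, \<open>b\<close>.\<close>

definition graph_factor :: "real => real => real \<times> real => real \<times> real" where
 "graph_factor a b v = (sqrt (1 + a\<^sup>2) * fst v + (a * b / sqrt (1 + a\<^sup>2)) * snd v, sqrt ((1 + a\<^sup>2 + b\<^sup>2) / (1 + a\<^sup>2)) * snd v)"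

lemma norm_graph_factor: "(norm (graph_factor a b v))\<^sup>2 = (fst v)\<^sup>2 + (snd v)\<^sup>2 + (a * fst v + b * snd v)\<^sup>2"
proof -
 have p: "0 < 1 + a\<^sup>2" "0 \<le> 1 + a\<^sup>2 + b\<^sup>2" by (simp_all add: add_pos_nonneg)
 define s where "s = sqrt (1 + a\<^sup>2)"
 have s: "0 < s" "s\<^sup>2 = 1 + a\<^sup>2" using p by (auto simp: s_def)
 have "(norm (graph_factor a b v))\<^sup>2 = (s * fst v + (a * b / s) * snd v)\<^sup>2 + (1 + a\<^sup>2 + b\<^sup>2) / s\<^sup>2 * (snd v)\<^sup>2"
  unfolding graph_factor_def norm_Pair s_def[symmetric] by (simp add: power_mult_distrib s(2))
 also have "... = s\<^sup>2 * (fst v)\<^sup>2 + 2 * (a * b) * (fst v * snd v) + (a\<^sup>2 * b\<^sup>2 + 1 + a\<^sup>2 + b\<^sup>2) / s\<^sup>2 * (snd v)\<^sup>2"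
  using s(1) by (simp add: power2_sum power_divide add_divide_distrib algebra_simps)
 also have "(a\<^sup>2 * b\<^sup>2 + 1 + a\<^sup>2 + b\<^sup>2) / s\<^sup>2 = 1 + b\<^sup>2"
  using p unfolding s(2) by (simp add: field_simps)
 finally show ?thesis unfolding s(2) by (simp add: power2_eq_square algebra_simps)
qed

lemma norm_le_graph_factor: "norm v \<le> norm (graph_factor a b v)"
proof (rule power2_le_imp_le)
 show "(norm v)\<^sup>2 \<le> (norm (graph_factor a b v))\<^sup>2"
  unfolding norm_graph_factor by (cases v) (simp add: norm_Pair)
qed simp

lemma graph_factor_diff: "graph_factor a b (v - w) = graph_factor a b v - graph_factor a b w"
 by (simp add: graph_factor_def algebra_simps diff_divide_distrib)

lemma inj_graph_factor: "graph_factor a b v = graph_factor a b w ==> v = w"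
 using norm_le_graph_factor[of "v - w" a b] by (simp add: graph_factor_diff)

text \<open>Since the chart derivative and the planar map \<open>graph_factor\<close> induce the
  same norm, the chart can be compared near a point with a linear map of the plane, whose effect on
  area is known.\<close>

lemma norm_chart_deriv:
 assumes f: "frame e1 e2 n0"
 shows "norm (chart_deriv e1 e2 n0 m v) = norm (graph_factor (- (m \<bullet> e1) / (m \<bullet> n0)) (- (m \<bullet> e2) / (m \<bullet> n0)) v)"
proof -
 have "(norm (chart_deriv e1 e2 n0 m v))\<^sup>2 = (fst v)\<^sup>2 + (snd v)\<^sup>2 + (- (m \<bullet> e1) / (m \<bullet> n0) * fst v + - (m \<bullet> e2) / (m \<bullet> n0) * snd v)\<^sup>2"
  unfolding power2_norm_eq_inner frame_inner[OF f, of "chart_deriv e1 e2 n0 m v" "chart_deriv e1 e2 n0 m v"] using f unfolding chart_deriv_def frame_def by (simp add: inner_commute power2_eq_square algebra_simps)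
 then show ?thesis unfolding norm_graph_factor[symmetric] by simp
qed

text \<open>The area element of a graph as the reciprocal cosine of the angle between normals;
  \<open>chart_density_eq\<close> relates it to the usual form with slopes.\<close>

definition chart_density :: "(point => point) => point => (real \<times> real => point) => real \<times> real => real" where
 "chart_density \<nu> p0 F y = 1 / (\<nu> (F y) \<bullet> \<nu> p0)"

lemma outer_graph_factor:
 assumes A: "A \<in> sets borel"
 shows "\<H> 2 (graph_factor a b ` A) = ennreal (plane_const * sqrt (1 + a\<^sup>2 + b\<^sup>2)) * emeasure lborel A"
proof -
 have p: "0 < 1 + a\<^sup>2" "0 < 1 + a\<^sup>2 + b\<^sup>2" by (simp_all add: add_pos_nonneg)
 have e: "graph_factor a b = (\<lambda>v. (sqrt (1 + a\<^sup>2) * fst v + (a * b / sqrt (1 + a\<^sup>2)) * snd v, sqrt ((1 + a\<^sup>2 + b\<^sup>2) / (1 + a\<^sup>2)) * snd v))"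
  by (simp add: fun_eq_iff graph_factor_def)
 have q: "0 < sqrt (1 + a\<^sup>2)" "0 < sqrt ((1 + a\<^sup>2 + b\<^sup>2) / (1 + a\<^sup>2))" using p by auto
 have "sqrt (1 + a\<^sup>2) * sqrt ((1 + a\<^sup>2 + b\<^sup>2) / (1 + a\<^sup>2)) = sqrt (1 + a\<^sup>2 + b\<^sup>2)"
  using p by (subst real_sqrt_mult[symmetric]) simp
 then show ?thesis
  using emeasure_lborel_triangular[OF A q, of "a * b / sqrt (1 + a\<^sup>2)"] unfolding e[symmetric]
  by (simp add: outer_plane ennreal_mult mult.assoc)
qed

text \<open>Lindelof's theorem cuts \<open>A\<close> into countably many disjoint Borel pieces on
  which the comparison holds with factor \<open>q\<close>; additivity gives it for \<open>A\<close>,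
  and then \<open>q\<close> tends to 1.\<close>

lemma measure_le_locally:
 fixes \<mu> \<rho> :: "'a::euclidean_space set => ennreal"
 assumes V: "open V"
  and \<mu>: "!!A::nat => 'a set. (!!i. A i \<in> sets borel) ==> (!!i. A i \<subseteq> V) ==> disjoint_family A ==> \<mu> (\<Union>i. A i) = (\<Sum>i. \<mu> (A i))"
  and \<rho>: "!!A::nat => 'a set. (!!i. A i \<in> sets borel) ==> (!!i. A i \<subseteq> V) ==> disjoint_family A ==> \<rho> (\<Union>i. A i) = (\<Sum>i. \<rho> (A i))"
  and empty: "\<mu> {} = 0"
  and loc: "!!q y. 1 < q ==> y \<in> V ==> \<exists>N. open N \<and> y \<in> N \<and> N \<subseteq> V \<and> (\<forall>A\<in>sets borel. A \<subseteq> N --> \<mu> A \<le> ennreal q * \<rho> A)"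
  and A: "A \<in> sets borel" "A \<subseteq> V"
 shows "\<mu> A \<le> \<rho> A"
proof -
 have q: "\<mu> A \<le> ennreal q * \<rho> A" if q: "1 < q" for q
 proof -
  obtain N where N: "!!y. y \<in> V ==> open (N y) \<and> y \<in> N y \<and> N y \<subseteq> V \<and> (\<forall>A\<in>sets borel. A \<subseteq> N y --> \<mu> A \<le> ennreal q * \<rho> A)"
   using loc[OF q] by metis
  obtain F where F: "F \<subseteq> N ` V" "countable F" "\<Union>F = (\<Union>y\<in>V. N y)"
   using Lindelof[of "N ` V"] N by auto
  show ?thesis
  proof (cases "F = {}")
   case True
   then have "A = {}" using A(2) F(3) N by auto
   then show ?thesis using empty by simp
  next
   case False
   define G where "G = from_nat_into F"
   have G: "G i \<in> F" "range G = F" for i using False F(2) by (auto simp: G_def from_nat_into)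
   have Gi: "open (G i)" "G i \<subseteq> V" "!!B. B \<in> sets borel ==> B \<subseteq> G i ==> \<mu> B \<le> ennreal q * \<rho> B" for i
    using G(1)[of i] F(1) N by auto
   define B where "B i = A \<inter> disjointed G i" for i
   have "range (disjointed G) \<subseteq> sets borel" by (rule sets.range_disjointed_sets) (use Gi(1) in auto)
   then have B: "B i \<in> sets borel" "B i \<subseteq> G i" "B i \<subseteq> V" for i
    unfolding B_def using A disjointed_subset[of G i] by auto
   have dB: "disjoint_family B" unfolding B_def
    using disjoint_family_disjointed[of G] by (auto simp: disjoint_family_on_def)
   have UB: "(\<Union>i. B i) = A"
   proof -
    have "(\<Union>i. B i) = A \<inter> (\<Union>i. G i)" unfolding B_def using UN_disjointed_eq[of G] by auto
    also have "(\<Union>i. G i) = \<Union>F" using G(2) by auto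
    also have "A \<inter> \<Union>F = A"
    proof -
     have "V \<subseteq> \<Union>F" unfolding F(3) using N by auto
     then show ?thesis using A(2) by auto
    qed
    finally show ?thesis .
   qed
   have "\<mu> A = (\<Sum>i. \<mu> (B i))" using \<mu>[OF B(1,3) dB] UB by simp
   also have "... \<le> (\<Sum>i. ennreal q * \<rho> (B i))" by (intro suminf_le Gi(3)[OF B(1) B(2)]) auto
   also have "... = ennreal q * \<rho> A" using \<rho>[OF B(1,3) dB] UB by simp
   finally show ?thesis .
  qed
 qed
 show ?thesis
 proof (cases "\<rho> A = top")
  case False
  then obtain r where r: "0 \<le> r" "\<rho> A = ennreal r" by (cases "\<rho> A") auto
  show ?thesis
  proof (rule ennreal_le_epsilon)
   fix e :: real assume e: "0 < e"
   have "\<mu> A \<le> ennreal (1 + e / (r + 1)) * \<rho> A" using e r by (intro q) simp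
   also have "... = ennreal ((1 + e / (r + 1)) * r)" using e r by (simp add: ennreal_mult)
   also have "(1 + e / (r + 1)) * r \<le> r + e" using e r by (simp add: field_simps)
   then have "ennreal ((1 + e / (r + 1)) * r) \<le> \<rho> A + ennreal e"
    using e r by (simp add: ennreal_plus[symmetric] del: ennreal_plus)
   finally show "\<mu> A \<le> \<rho> A + ennreal e" .
  qed
 qed simp
qed

lemma chart_density_pos:
 assumes c: "surface_chart G \<nu> p0 e1 e2 U V F" and y: "y \<in> V"
 shows "0 < chart_density \<nu> p0 F y" "chart_density \<nu> p0 F y \<le> 2"
proof -
 have "1/2 < \<nu> (F y) \<bullet> \<nu> p0" by (rule surface_chartD(8)[OF c surface_chartD(10,11)[OF c y]])
 then show "0 < chart_density \<nu> p0 F y" "chart_density \<nu> p0 F y \<le> 2"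
  by (auto simp: chart_density_def field_simps)
qed

lemma chart_continuous:
 assumes C: "C2_surface G \<nu>" and c: "surface_chart G \<nu> p0 e1 e2 U V F"
 shows "continuous_on V F" "continuous_on V (\<lambda>y. \<nu> (F y))" "continuous_on V (chart_density \<nu> p0 F)"
proof -
 show F: "continuous_on V F"
  using surface_chartD(9)[OF c] by (meson has_derivative_continuous continuous_at_imp_continuous_on)
 show n: "continuous_on V (\<lambda>y. \<nu> (F y))"
  by (rule continuous_on_compose2[OF continuous_on_normal[OF C] F]) (use surface_chartD(10)[OF c] in auto)
 have "\<nu> (F y) \<bullet> \<nu> p0 \<noteq> 0" if "y \<in> V" for y
  using surface_chartD(8)[OF c surface_chartD(10,11)[OF c that]] by auto
 then show "continuous_on V (chart_density \<nu> p0 F)"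
  unfolding chart_density_def[abs_def] by (intro continuous_intros n) auto
qed

lemma chart_density_eq:
 assumes C: "C2_surface G \<nu>" and c: "surface_chart G \<nu> p0 e1 e2 U V F" and y: "y \<in> V"
 shows "sqrt (1 + (- (\<nu> (F y) \<bullet> e1) / (\<nu> (F y) \<bullet> \<nu> p0))\<^sup>2 + (- (\<nu> (F y) \<bullet> e2) / (\<nu> (F y) \<bullet> \<nu> p0))\<^sup>2) = chart_density \<nu> p0 F y"
proof -
 let ?n = "\<nu> (F y)"
 have m: "0 < ?n \<bullet> \<nu> p0" using surface_chartD(8)[OF c surface_chartD(10,11)[OF c y]] by simp
 have "?n \<bullet> ?n = 1" using C2_surface_norm[OF C surface_chartD(10)[OF c y]] by (simp add: norm_eq_1)
 then have "(?n \<bullet> e1)\<^sup>2 + (?n \<bullet> e2)\<^sup>2 + (?n \<bullet> \<nu> p0)\<^sup>2 = 1"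
  using frame_inner[OF surface_chartD(5)[OF c], of ?n ?n] by (simp add: power2_eq_square)
 then have "1 + (- (?n \<bullet> e1) / (?n \<bullet> \<nu> p0))\<^sup>2 + (- (?n \<bullet> e2) / (?n \<bullet> \<nu> p0))\<^sup>2 = (1 / (?n \<bullet> \<nu> p0))\<^sup>2"
  using m by (simp add: field_simps)
 then show ?thesis using m by (simp add: chart_density_def)
qed

text \<open>The chart derivative is continuous, so on a small ball the chart differs from its
  linearisation by at most \<open>e\<close> times the distance in the parameter plane, and
  \<open>graph_factor\<close> does not shrink that distance.\<close>

lemma chart_local_bilipschitz:
 assumes C: "C2_surface G \<nu>" and c: "surface_chart G \<nu> p0 e1 e2 U V F" and y0: "y0 \<in> V" and e: "0 < e" "e < 1"
 obtains d a b where "0 < d" "ball y0 d \<subseteq> V" "sqrt (1 + a\<^sup>2 + b\<^sup>2) = chart_density \<nu> p0 F y0"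
  "!!y z. y \<in> ball y0 d ==> z \<in> ball y0 d ==> dist (F y) (F z) \<le> (1 + e) * dist (graph_factor a b y) (graph_factor a b z)"
  "!!y z. y \<in> ball y0 d ==> z \<in> ball y0 d ==> (1 - e) * dist (graph_factor a b y) (graph_factor a b z) \<le> dist (F y) (F z)"
  "!!y. y \<in> ball y0 d ==> \<bar>chart_density \<nu> p0 F y - chart_density \<nu> p0 F y0\<bar> \<le> e * chart_density \<nu> p0 F y0"
proof -
 define a where "a y = - (\<nu> (F y) \<bullet> e1) / (\<nu> (F y) \<bullet> \<nu> p0)" for y
 define b where "b y = - (\<nu> (F y) \<bullet> e2) / (\<nu> (F y) \<bullet> \<nu> p0)" for y
 let ?J = "chart_density \<nu> p0 F"
 have fr: "frame e1 e2 (\<nu> p0)" by (rule surface_chartD(5)[OF c])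
 have nz: "\<nu> (F y) \<bullet> \<nu> p0 \<noteq> 0" if "y \<in> V" for y
  using surface_chartD(8)[OF c surface_chartD(10,11)[OF c that]] by auto
 have cab: "continuous_on V (\<lambda>y. \<bar>a y - a y0\<bar> + \<bar>b y - b y0\<bar>)"
  unfolding a_def b_def using nz by (intro continuous_intros chart_continuous[OF C c]) auto
 have "isCont (\<lambda>y. \<bar>a y - a y0\<bar> + \<bar>b y - b y0\<bar>) y0" "isCont ?J y0"
  using cab chart_continuous(3)[OF C c] surface_chartD(4)[OF c] y0 by (auto simp: continuous_on_eq_continuous_at)
 then have "((\<lambda>y. \<bar>a y - a y0\<bar> + \<bar>b y - b y0\<bar>) \<longlongrightarrow> 0) (at y0)" "(?J \<longlongrightarrow> ?J y0) (at y0)"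
  by (auto simp: isCont_def)
 then have "eventually (\<lambda>y. \<bar>a y - a y0\<bar> + \<bar>b y - b y0\<bar> < e) (at y0)"
   "eventually (\<lambda>y. dist (?J y) (?J y0) < e * ?J y0) (at y0)"
  using e chart_density_pos(1)[OF c y0] by (auto intro: order_tendstoD tendstoD)
 then have "eventually (\<lambda>y. (\<bar>a y - a y0\<bar> + \<bar>b y - b y0\<bar> < e \<and> dist (?J y) (?J y0) < e * ?J y0)) (at y0)"
  by eventually_elim simp
 then have "eventually (\<lambda>y. (\<bar>a y - a y0\<bar> + \<bar>b y - b y0\<bar> < e \<and> dist (?J y) (?J y0) < e * ?J y0)) (nhds y0)"
  unfolding eventually_at_filter
  by (rule eventually_mono) (use e chart_density_pos(1)[OF c y0] in auto)
 then obtain d1 where d1: "0 < d1" "!!y. dist y y0 < d1 ==> \<bar>a y - a y0\<bar> + \<bar>b y - b y0\<bar> < e \<and> dist (?J y) (?J y0) < e * ?J y0"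
  unfolding eventually_nhds_metric by auto
 obtain d2 where d2: "0 < d2" "ball y0 d2 \<subseteq> V" using surface_chartD(4)[OF c] y0 open_contains_ball by blast
 define d where "d = min d1 d2"
 have d: "0 < d" "ball y0 d \<subseteq> V" using d1 d2 by (auto simp: d_def)
 have lin: "norm (F z - F y - chart_deriv e1 e2 (\<nu> p0) (\<nu> (F y0)) (z - y)) \<le> norm (z - y) * e"
  if yz: "y \<in> ball y0 d" "z \<in> ball y0 d" for y z
 proof (rule differentiable_bound_linearization[where S = "ball y0 d" and ?x0.0 = y0 and f = F
    and f' = "\<lambda>x. chart_deriv e1 e2 (\<nu> p0) (\<nu> (F x))"])
  show "y + t *\<^sub>R (z - y) \<in> ball y0 d" if "t \<in> {0..1}" for t
   using convexD_alt[OF convex_ball yz, of t] that by (simp add: algebra_simps)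
  show "(F has_derivative chart_deriv e1 e2 (\<nu> p0) (\<nu> (F x))) (at x within ball y0 d)" if "x \<in> ball y0 d" for x
   using surface_chartD(9)[OF c subsetD[OF d(2) that]] by (rule has_derivative_at_withinI)
  show "onorm (chart_deriv e1 e2 (\<nu> p0) (\<nu> (F x)) - chart_deriv e1 e2 (\<nu> p0) (\<nu> (F y0))) \<le> e"
   if x: "x \<in> ball y0 d" for x
  proof (unfold fun_diff_def, rule onorm_le)
   fix v :: "real \<times> real"
   have "chart_deriv e1 e2 (\<nu> p0) (\<nu> (F x)) v - chart_deriv e1 e2 (\<nu> p0) (\<nu> (F y0)) v
    = (fst v * (a x - a y0) + snd v * (b x - b y0)) *\<^sub>R \<nu> p0"
    by (simp add: chart_deriv_def a_def b_def algebra_simps)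
   moreover have "norm (\<nu> p0) = 1" using fr by (simp add: frame_def norm_eq_1)
   ultimately have "norm (chart_deriv e1 e2 (\<nu> p0) (\<nu> (F x)) v - chart_deriv e1 e2 (\<nu> p0) (\<nu> (F y0)) v)
    = \<bar>fst v * (a x - a y0) + snd v * (b x - b y0)\<bar>" by simp
   also have "... \<le> \<bar>fst v\<bar> * \<bar>a x - a y0\<bar> + \<bar>snd v\<bar> * \<bar>b x - b y0\<bar>"
    by (metis abs_mult abs_triangle_ineq)
   also have "... \<le> norm v * \<bar>a x - a y0\<bar> + norm v * \<bar>b x - b y0\<bar>"
    using norm_fst_le[of "fst v" "snd v"] norm_snd_le[of "snd v" "fst v"]
    by (intro add_mono mult_right_mono) auto
   also have "... \<le> e * norm v"
   proof -
    have "\<bar>a x - a y0\<bar> + \<bar>b x - b y0\<bar> \<le> e" using d1(2)[of x] x by (auto simp: d_def dist_commute)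
    then have "(\<bar>a x - a y0\<bar> + \<bar>b x - b y0\<bar>) * norm v \<le> e * norm v" by (rule mult_right_mono) simp
    then show ?thesis by (simp add: algebra_simps)
   qed
   finally show "norm (chart_deriv e1 e2 (\<nu> p0) (\<nu> (F x)) v - chart_deriv e1 e2 (\<nu> p0) (\<nu> (F y0)) v) \<le> e * norm v" .
  qed
  show "y0 \<in> ball y0 d" using d by simp
 qed
 have M: "norm (chart_deriv e1 e2 (\<nu> p0) (\<nu> (F y0)) (z - y)) = dist (graph_factor (a y0) (b y0) y) (graph_factor (a y0) (b y0) z)" for y z
  unfolding norm_chart_deriv[OF fr] graph_factor_diff dist_norm a_def[symmetric] b_def[symmetric]
  by (rule norm_minus_commute)
 have n: "norm (z - y) * e \<le> e * dist (graph_factor (a y0) (b y0) y) (graph_factor (a y0) (b y0) z)" for y z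
  using norm_le_graph_factor[of "y - z" "a y0" "b y0"] e
  by (simp add: graph_factor_diff dist_norm norm_minus_commute)
 show ?thesis
 proof (rule that[OF d])
  show "sqrt (1 + (a y0)\<^sup>2 + (b y0)\<^sup>2) = ?J y0"
   unfolding a_def b_def by (rule chart_density_eq[OF C c y0])
  show "dist (F y) (F z) \<le> (1 + e) * dist (graph_factor (a y0) (b y0) y) (graph_factor (a y0) (b y0) z)"
   "(1 - e) * dist (graph_factor (a y0) (b y0) y) (graph_factor (a y0) (b y0) z) \<le> dist (F y) (F z)"
   if yz: "y \<in> ball y0 d" "z \<in> ball y0 d" for y z
   using lin[OF yz] n[of z y] M[of z y] norm_triangle_ineq2[of "F z - F y" "chart_deriv e1 e2 (\<nu> p0) (\<nu> (F y0)) (z - y)"]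
    norm_triangle_ineq2[of "chart_deriv e1 e2 (\<nu> p0) (\<nu> (F y0)) (z - y)" "F z - F y"]
   by (auto simp: dist_norm norm_minus_commute algebra_simps)
  show "\<bar>?J y - ?J y0\<bar> \<le> e * ?J y0" if "y \<in> ball y0 d" for y
   using d1(2)[of y] that by (auto simp: d_def dist_commute dist_real_def)
 qed
qed

lemma chart_image_borel:
 assumes C: "C2_surface G \<nu>" and c: "surface_chart G \<nu> p0 e1 e2 U V F" and A: "A \<in> sets borel" "A \<subseteq> V"
 shows "F ` A \<in> sets borel"
proof -
 have m: "chart_coord e1 e2 p0 \<in> borel_measurable borel"
  by (intro borel_measurable_continuous_onI continuous_intros)
 have "F ` A = G \<inter> U \<inter> chart_coord e1 e2 p0 -` A"
 proof
  show "F ` A \<subseteq> G \<inter> U \<inter> chart_coord e1 e2 p0 -` A"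
   using A(2) surface_chartD(7,10,11)[OF c] by auto
  show "G \<inter> U \<inter> chart_coord e1 e2 p0 -` A \<subseteq> F ` A"
  proof
   fix x assume x: "x \<in> G \<inter> U \<inter> chart_coord e1 e2 p0 -` A"
   then show "x \<in> F ` A"
    using surface_chart_inverse(2)[OF c, of x] by force
  qed
 qed
 moreover have "G \<in> sets borel" using C by (simp add: C2_surface_def)
 moreover have "U \<in> sets borel" using surface_chartD(3)[OF c] by simp
 moreover have "chart_coord e1 e2 p0 -` A \<in> sets borel" using measurable_sets[OF m A(1)] by simp
 ultimately show ?thesis by auto
qed

lemma chart_inj_on:
 assumes "surface_chart G \<nu> p0 e1 e2 U V F" shows "inj_on F V"
 using surface_chartD(7)[OF assms] by (metis inj_onI)

definition chart_measure :: "(point => point) => point => (real \<times> real) set => (real \<times> real => point) => (real \<times> real) measure" where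
 "chart_measure \<nu> p0 V F = density lborel (\<lambda>y. ennreal (plane_const * (indicator V y *\<^sub>R chart_density \<nu> p0 F y)))"

lemma chart_density_measurable:
 assumes C: "C2_surface G \<nu>" and c: "surface_chart G \<nu> p0 e1 e2 U V F"
 shows "(\<lambda>y. indicator V y *\<^sub>R chart_density \<nu> p0 F y) \<in> borel_measurable borel"
 using borel_measurable_continuous_on_indicator[OF _ chart_continuous(3)[OF C c]] surface_chartD(4)[OF c] by simp

lemma emeasure_chart_measure:
 assumes C: "C2_surface G \<nu>" and c: "surface_chart G \<nu> p0 e1 e2 U V F" and A: "A \<in> sets borel" "A \<subseteq> V"
 shows "emeasure (chart_measure \<nu> p0 V F) A = (\<integral>\<^sup>+y. ennreal (plane_const * chart_density \<nu> p0 F y) * indicator A y \<partial>lborel)"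
proof -
 have [measurable]: "(\<lambda>y. indicator V y *\<^sub>R chart_density \<nu> p0 F y) \<in> borel_measurable borel"
  by (rule chart_density_measurable[OF C c])
 then have [measurable]: "(\<lambda>y. indicat_real V y * chart_density \<nu> p0 F y) \<in> borel_measurable borel" by simp
 have "emeasure (chart_measure \<nu> p0 V F) A = (\<integral>\<^sup>+y. ennreal (plane_const * (indicator V y *\<^sub>R chart_density \<nu> p0 F y)) * indicator A y \<partial>lborel)"
  unfolding chart_measure_def using A by (intro emeasure_density) auto
 also have "... = (\<integral>\<^sup>+y. ennreal (plane_const * chart_density \<nu> p0 F y) * indicator A y \<partial>lborel)"
  using A(2) by (intro nn_integral_cong) (auto simp: indicator_def)
 finally show ?thesis .
qed

lemma emeasure_chart_measure_bounds:
 assumes C: "C2_surface G \<nu>" and c: "surface_chart G \<nu> p0 e1 e2 U V F" and A: "A \<in> sets borel" "A \<subseteq> V"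
  and J: "!!y. y \<in> A ==> l \<le> chart_density \<nu> p0 F y" "!!y. y \<in> A ==> chart_density \<nu> p0 F y \<le> u"
 shows "ennreal (plane_const * l) * emeasure lborel A \<le> emeasure (chart_measure \<nu> p0 V F) A"
  and "emeasure (chart_measure \<nu> p0 V F) A \<le> ennreal (plane_const * u) * emeasure lborel A"
proof -
 have "ennreal (plane_const * l) * emeasure lborel A = (\<integral>\<^sup>+y. ennreal (plane_const * l) * indicator A y \<partial>lborel)"
  using A by (simp add: nn_integral_cmult_indicator)
 also have "... \<le> emeasure (chart_measure \<nu> p0 V F) A"
  unfolding emeasure_chart_measure[OF C c A] using J(1)
  by (intro nn_integral_mono) (auto simp: indicator_def intro!: ennreal_leI mult_left_mono)
 finally show "ennreal (plane_const * l) * emeasure lborel A \<le> emeasure (chart_measure \<nu> p0 V F) A" .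
 have "emeasure (chart_measure \<nu> p0 V F) A \<le> (\<integral>\<^sup>+y. ennreal (plane_const * u) * indicator A y \<partial>lborel)"
  unfolding emeasure_chart_measure[OF C c A] using J(2)
  by (intro nn_integral_mono) (auto simp: indicator_def intro!: ennreal_leI mult_left_mono)
 also have "... = ennreal (plane_const * u) * emeasure lborel A"
  using A by (simp add: nn_integral_cmult_indicator)
 finally show "emeasure (chart_measure \<nu> p0 V F) A \<le> ennreal (plane_const * u) * emeasure lborel A" .
qed

lemma chart_local_area:
 assumes C: "C2_surface G \<nu>" and c: "surface_chart G \<nu> p0 e1 e2 U V F" and y0: "y0 \<in> V" and q: "1 < q"
 shows "\<exists>N. open N \<and> y0 \<in> N \<and> N \<subseteq> V \<and> (\<forall>A\<in>sets borel. A \<subseteq> N -->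
  \<H> 2 (F ` A) \<le> ennreal q * emeasure (chart_measure \<nu> p0 V F) A \<and>
  emeasure (chart_measure \<nu> p0 V F) A \<le> ennreal q * \<H> 2 (F ` A))"
proof -
 \<comment> \<open>Lengths enter squared and the density once, so three factors of size
   \<open>(1 + e) / (1 - e)\<close> have to stay below \<open>q\<close>.\<close>
 define r where "r = root 3 q"
 have r: "1 < r" "r ^ 3 = q" using q by (auto simp: r_def)
 define e where "e = (r - 1) / (r + 1)"
 have e: "0 < e" "e < 1" "(1 + e) / (1 - e) = r" using r by (auto simp: e_def field_simps)
 obtain d a b where d: "0 < d" "ball y0 d \<subseteq> V" "sqrt (1 + a\<^sup>2 + b\<^sup>2) = chart_density \<nu> p0 F y0"
  and up: "!!y z. y \<in> ball y0 d ==> z \<in> ball y0 d ==> dist (F y) (F z) \<le> (1 + e) * dist (graph_factor a b y) (graph_factor a b z)"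
  and lo: "!!y z. y \<in> ball y0 d ==> z \<in> ball y0 d ==> (1 - e) * dist (graph_factor a b y) (graph_factor a b z) \<le> dist (F y) (F z)"
  and J: "!!y. y \<in> ball y0 d ==> \<bar>chart_density \<nu> p0 F y - chart_density \<nu> p0 F y0\<bar> \<le> e * chart_density \<nu> p0 F y0"
  by (rule chart_local_bilipschitz[OF C c y0 e(1,2)]) blast
 define K where "K = chart_density \<nu> p0 F y0"
 have K: "0 < K" using chart_density_pos[OF c y0] by (simp add: K_def)
 let ?\<mu> = "\<lambda>A. \<H> 2 (F ` A)" and ?\<rho> = "emeasure (chart_measure \<nu> p0 V F)"
 let ?M = "graph_factor a b"
 have "?\<mu> A \<le> ennreal q * ?\<rho> A \<and> ?\<rho> A \<le> ennreal q * ?\<mu> A" if A: "A \<in> sets borel" "A \<subseteq> ball y0 d" for A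
 proof -
  define lam where "lam = ennreal plane_const * (ennreal K * emeasure lborel A)"
  have M: "\<H> 2 (?M ` A) = lam"
   using outer_graph_factor[OF A(1), of a b] d(3) K
   by (simp add: lam_def K_def[symmetric] ennreal_mult mult.assoc)
  have AV: "A \<subseteq> V" using A d by auto
  have invM: "inv ?M (?M y) = y" for y by (rule inv_f_f) (auto intro!: injI dest: inj_graph_factor)
  have "(1 + e)-lipschitz_on (?M ` A) (\<lambda>w. F (inv ?M w))"
   using up A(2) e by (intro lipschitz_onI) (auto simp: invM subset_iff)
  then have "\<H> 2 ((\<lambda>w. F (inv ?M w)) ` ?M ` A) \<le> ennreal ((1 + e)\<^sup>2) * \<H> 2 (?M ` A)"
   by (intro outer_lipschitz) auto
  then have 1: "?\<mu> A \<le> ennreal ((1 + e)\<^sup>2) * lam" unfolding M by (simp add: image_image invM)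
  have "(1 / (1 - e))-lipschitz_on (F ` A) (\<lambda>x. ?M (chart_coord e1 e2 p0 x))"
  proof (rule lipschitz_onI)
   fix x x' assume "x \<in> F ` A" "x' \<in> F ` A"
   then obtain y y' where y: "y \<in> A" "y' \<in> A" "x = F y" "x' = F y'" by auto
   then have "y \<in> ball y0 d" "y' \<in> ball y0 d" "y \<in> V" "y' \<in> V" using A(2) AV by auto
   then show "dist (?M (chart_coord e1 e2 p0 x)) (?M (chart_coord e1 e2 p0 x')) \<le> 1 / (1 - e) * dist x x'"
    using lo[of y y'] e unfolding y surface_chartD(7)[OF c \<open>y \<in> V\<close>] surface_chartD(7)[OF c \<open>y' \<in> V\<close>]
    by (simp add: field_simps)
  qed (use e in simp)
  then have "\<H> 2 ((\<lambda>x. ?M (chart_coord e1 e2 p0 x)) ` F ` A) \<le> ennreal ((1 / (1 - e))\<^sup>2) * ?\<mu> A"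
   by (intro outer_lipschitz) auto
  moreover have "(\<lambda>x. ?M (chart_coord e1 e2 p0 x)) ` F ` A = ?M ` A"
   unfolding image_image by (rule image_cong) (use AV surface_chartD(7)[OF c] in auto)
  ultimately have 2: "lam \<le> ennreal ((1 / (1 - e))\<^sup>2) * ?\<mu> A" using M by simp
  have bd: "(1 - e) * K \<le> chart_density \<nu> p0 F y" "chart_density \<nu> p0 F y \<le> (1 + e) * K" if "y \<in> A" for y
   using J[of y] that A(2) by (auto simp: K_def[symmetric] algebra_simps)
  have 3: "ennreal (1 - e) * lam \<le> ?\<rho> A" "?\<rho> A \<le> ennreal (1 + e) * lam"
   using emeasure_chart_measure_bounds[OF C c A(1) AV bd] e K
   by (simp_all add: lam_def ennreal_mult mult.assoc mult.left_commute)
  have e3: "(1 + e)\<^sup>2 / (1 - e) \<le> q" "(1 + e) * (1 / (1 - e))\<^sup>2 \<le> q"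
  proof -
   have q3: "q = (1 + e) ^ 3 / (1 - e) ^ 3" using e(3) r(2) by (simp add: power_divide[symmetric])
   have "(1 + e)\<^sup>2 \<le> (1 + e) ^ 3" "1 + e \<le> (1 + e) ^ 3" "(1 - e) ^ 3 \<le> 1 - e" "(1 - e) ^ 3 \<le> (1 - e)\<^sup>2"
    using e power_increasing[of 1 3 "1 + e"] power_decreasing[of 1 3 "1 - e"] by auto
   moreover have "0 < (1 - e) ^ 3" using e by simp
   ultimately have "(1 + e)\<^sup>2 / (1 - e) \<le> q" "(1 + e) / (1 - e)\<^sup>2 \<le> q"
    unfolding q3 using e by (auto intro!: frac_le)
   then show "(1 + e)\<^sup>2 / (1 - e) \<le> q" "(1 + e) * (1 / (1 - e))\<^sup>2 \<le> q"
    by (simp_all add: power_divide)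
  qed
  have "?\<mu> A \<le> ennreal ((1 + e)\<^sup>2 / (1 - e)) * (ennreal (1 - e) * lam)"
   using 1 e by (simp add: mult.assoc[symmetric] ennreal_mult[symmetric])
  also have "... \<le> ennreal q * ?\<rho> A" using 3(1) e3(1) by (intro mult_mono ennreal_leI) auto
  finally have A1: "?\<mu> A \<le> ennreal q * ?\<rho> A" .
  have "?\<rho> A \<le> ennreal (1 + e) * (ennreal ((1 / (1 - e))\<^sup>2) * ?\<mu> A)"
   using 3(2) 2 by (meson mult_left_mono order_trans zero_le)
  also have "... = ennreal ((1 + e) * (1 / (1 - e))\<^sup>2) * ?\<mu> A" using e by (simp add: ennreal_mult mult.assoc)
  also have "... \<le> ennreal q * ?\<mu> A" using e3(2) by (intro mult_right_mono ennreal_leI) auto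
  finally show ?thesis using A1 by simp
 qed
 then show ?thesis using d by (intro exI[of _ "ball y0 d"]) auto
qed

lemma area_formula:
 assumes C: "C2_surface G \<nu>" and c: "surface_chart G \<nu> p0 e1 e2 U V F" and A: "A \<in> sets borel" "A \<subseteq> V"
 shows "\<H> 2 (F ` A) = emeasure (chart_measure \<nu> p0 V F) A"
proof -
 have add1: "\<H> 2 (F ` (\<Union>i. B i)) = (\<Sum>i. \<H> 2 (F ` B i))"
  if B: "!!i. B i \<in> sets borel" "!!i. B i \<subseteq> V" "disjoint_family B" for B :: "nat => _"
 proof -
  have m: "F ` B i \<in> sets (hausdorff_measure 2)" for i
   by (intro borel_in_sets_hausdorff chart_image_borel[OF C c] B) simp
  have "disjoint_family (\<lambda>i. F ` B i)"
   using B(3) inj_on_image_Int[OF chart_inj_on[OF c] B(2) B(2)] unfolding disjoint_family_on_def by blast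
  then have "(\<Sum>i. emeasure (hausdorff_measure 2) (F ` B i)) = emeasure (hausdorff_measure 2) (\<Union>i. F ` B i)"
   using m by (intro suminf_emeasure) auto
  moreover have "(\<Union>i. F ` B i) \<in> sets (hausdorff_measure 2)" using m by auto
  ultimately show ?thesis using m by (simp add: emeasure_hausdorff image_UN)
 qed
 have add2: "emeasure (chart_measure \<nu> p0 V F) (\<Union>i. B i) = (\<Sum>i. emeasure (chart_measure \<nu> p0 V F) (B i))"
  if "!!i. B i \<in> sets borel" "!!i. B i \<subseteq> V" "disjoint_family B" for B :: "nat => _"
  using that by (intro suminf_emeasure[symmetric]) (auto simp: chart_measure_def)
 show ?thesis
 proof (rule antisym)
  show "\<H> 2 (F ` A) \<le> emeasure (chart_measure \<nu> p0 V F) A"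
   by (rule measure_le_locally[where \<mu> = "\<lambda>A. \<H> 2 (F ` A)" and \<rho> = "emeasure (chart_measure \<nu> p0 V F)",
      OF surface_chartD(4)[OF c] add1 add2 _ _ A])
     (use chart_local_area[OF C c] in \<open>simp_all, meson\<close>)
  show "emeasure (chart_measure \<nu> p0 V F) A \<le> \<H> 2 (F ` A)"
   by (rule measure_le_locally[where \<rho> = "\<lambda>A. \<H> 2 (F ` A)" and \<mu> = "emeasure (chart_measure \<nu> p0 V F)",
      OF surface_chartD(4)[OF c] add2 add1 _ _ A])
     (use chart_local_area[OF C c] in \<open>simp_all, meson\<close>)
 qed
qed

text \<open>By the area formula two measures agree on Borel sets after being pushed forward to
  space, and so do the integrals of a Borel function.\<close>

lemma chart_integral:
 fixes h :: "point => real"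
 assumes C: "C2_surface G \<nu>" and c: "surface_chart G \<nu> p0 e1 e2 U V F" and h [measurable]: "h \<in> borel_measurable borel"
 shows "(LINT x:G \<inter> U|hausdorff_measure 2. h x)
  = plane_const * (LINT y:V|lborel. chart_density \<nu> p0 F y * h (F y))"
proof -
 let ?H = "hausdorff_measure 2 :: point measure" and ?S = "G \<inter> U"
 have S: "?S \<in> sets borel" using C surface_chartD(3)[OF c] by (simp add: C2_surface_def)
 have SH: "?S \<in> sets ?H" by (rule borel_in_sets_hausdorff[OF _ S]) simp
 have V: "V \<in> sets borel" using surface_chartD(4)[OF c] by simp
 have id_meas: "(\<lambda>x. x) \<in> measurable (restrict_space ?H ?S) borel"
  by (intro measurable_restrict_space1 measurableI) (auto intro: borel_in_sets_hausdorff)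
 define w where "w y = plane_const * (indicator V y *\<^sub>R chart_density \<nu> p0 F y)" for y
 have w[measurable]: "w \<in> borel_measurable borel"
  unfolding w_def[abs_def] using chart_density_measurable[OF C c] by auto
 have w0: "0 \<le> w y" for y using chart_density_pos(1)[OF c, of y] by (auto simp: w_def indicator_def)
 define F' where "F' y = indicator V y *\<^sub>R F y" for y
 have F'[measurable]: "F' \<in> borel_measurable borel"
  unfolding F'_def[abs_def] by (rule borel_measurable_continuous_on_indicator[OF V chart_continuous(1)[OF C c]])
 have "distr (restrict_space ?H ?S) borel (\<lambda>x. x) = distr (density lborel (\<lambda>y. ennreal (w y))) borel F'"
 proof (rule measure_eqI)
  fix B assume "B \<in> sets (distr (restrict_space ?H ?S) borel (\<lambda>x. x))"
  then have B: "B \<in> sets borel" by simp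
  define A where "A = V \<inter> F' -` B"
  have A: "A \<in> sets borel" "A \<subseteq> V" using V measurable_sets[OF F' B] by (auto simp: A_def)
  have "x \<in> F ` A" if "x \<in> ?S" "x \<in> B" for x
   using surface_chart_inverse[OF c, of x] that
   by (intro image_eqI[of x F "chart_coord e1 e2 p0 x"]) (auto simp: A_def F'_def)
  then have FA: "F ` A = B \<inter> ?S" using surface_chartD(10,11)[OF c] by (auto simp: A_def F'_def)
  have "emeasure (distr (restrict_space ?H ?S) borel (\<lambda>x. x)) B = emeasure (restrict_space ?H ?S) (B \<inter> ?S)"
   using B id_meas by (simp add: emeasure_distr space_restrict_space)
  also have "... = \<H> 2 (F ` A)"
   using B S unfolding FA by (subst emeasure_restrict_space) (auto intro!: emeasure_hausdorff borel_in_sets_hausdorff)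
  also have "... = emeasure (chart_measure \<nu> p0 V F) A" by (rule area_formula[OF C c A])
  also have "... = emeasure (density lborel (\<lambda>y. ennreal (w y))) (F' -` B)"
  proof -
   have m: "F' -` B \<in> sets borel" using measurable_sets[OF F' B] by simp
   have eq: "chart_measure \<nu> p0 V F = density lborel (\<lambda>y. ennreal (w y))" by (simp add: chart_measure_def w_def)
   have "emeasure (density lborel (\<lambda>y. ennreal (w y))) (F' -` B) = (\<integral>\<^sup>+y. ennreal (w y) * indicator (F' -` B) y \<partial>lborel)"
    using m by (intro emeasure_density) auto
   also have "... = (\<integral>\<^sup>+y. ennreal (w y) * indicator A y \<partial>lborel)"
    by (intro nn_integral_cong) (auto simp: A_def w_def indicator_def)
   also have "... = emeasure (density lborel (\<lambda>y. ennreal (w y))) A"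
    using A by (intro emeasure_density[symmetric]) auto
   finally show ?thesis by (simp add: eq)
  qed
  also have "... = emeasure (distr (density lborel (\<lambda>y. ennreal (w y))) borel F') B"
   using B by (simp add: emeasure_distr)
  finally show "emeasure (distr (restrict_space ?H ?S) borel (\<lambda>x. x)) B
   = emeasure (distr (density lborel (\<lambda>y. ennreal (w y))) borel F') B" .
 qed simp
 then have "integral\<^sup>L (distr (restrict_space ?H ?S) borel (\<lambda>x. x)) h = integral\<^sup>L (distr (density lborel (\<lambda>y. ennreal (w y))) borel F') h"
  by simp
 moreover have "integral\<^sup>L (distr (restrict_space ?H ?S) borel (\<lambda>x. x)) h = (LINT x:?S|?H. h x)"
  using SH by (subst integral_distr[OF id_meas h]) (simp add: integral_restrict_space set_lebesgue_integral_def)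
 moreover have "integral\<^sup>L (distr (density lborel (\<lambda>y. ennreal (w y))) borel F') h = (LINT y|lborel. w y *\<^sub>R h (F' y))"
  by (subst integral_distr, simp, simp) (rule integral_density, auto simp: w0)
 moreover have "(LINT y|lborel. w y *\<^sub>R h (F' y)) = plane_const * (LINT y:V|lborel. chart_density \<nu> p0 F y * h (F y))"
  unfolding set_lebesgue_integral_def integral_mult_right_zero[symmetric]
  by (intro Bochner_Integration.integral_cong) (auto simp: w_def F'_def indicator_def)
 ultimately show ?thesis by simp
qed

text \<open>The density is at most 2, and orthogonal projection does not increase distances, so the
  parameters of points in the ball lie in a square of side \<open>2 * r\<close>. The centre may lie
  off the surface.\<close>

lemma hausdorff_surface_ball_local:
 assumes C: "C2_surface G \<nu>" and c: "surface_chart G \<nu> p0 e1 e2 U V F" and r: "0 \<le> r"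
 shows "\<H> 2 (G \<inter> U \<inter> ball p r) \<le> ennreal (8 * plane_const * r\<^sup>2)"
proof -
 define A where "A = {y\<in>V. F y \<in> ball p r}"
 have "open ((\<lambda>y. F y) -` ball p r \<inter> V)"
  using chart_continuous(1)[OF C c] surface_chartD(4)[OF c] continuous_on_open_vimage by auto
 then have A: "A \<in> sets borel" "A \<subseteq> V" by (auto simp: A_def Int_def conj_commute)
 have "x \<in> F ` A" if "x \<in> G \<inter> U" "x \<in> ball p r" for x
  using surface_chart_inverse[OF c, of x] that
  by (intro image_eqI[of x F "chart_coord e1 e2 p0 x"]) (auto simp: A_def)
 then have "G \<inter> U \<inter> ball p r = F ` A" using surface_chartD(10,11)[OF c] by (auto simp: A_def)
 then have "\<H> 2 (G \<inter> U \<inter> ball p r) = emeasure (chart_measure \<nu> p0 V F) A"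
  using area_formula[OF C c A] by simp
 also have "... \<le> ennreal (plane_const * 2) * emeasure lborel A"
  using chart_density_pos[OF c] subsetD[OF A(2)]
  by (intro emeasure_chart_measure_bounds(2)[OF C c A, of 0] less_imp_le[OF chart_density_pos(1)[OF c]]) auto
 also have "emeasure lborel A \<le> ennreal (4 * r\<^sup>2)"
 proof -
  define q where "q = chart_coord e1 e2 p0 p"
  have "A \<subseteq> {fst q - r..fst q + r} \<times> {snd q - r..snd q + r}"
  proof
   fix y assume y: "y \<in> A"
   then have "dist q y \<le> r"
    using chart_coord_dist[OF surface_chartD(5)[OF c], of p0 p "F y"] surface_chartD(7)[OF c, of y]
    by (auto simp: A_def q_def)
   then have "dist (fst q) (fst y) \<le> r" "dist (snd q) (snd y) \<le> r"
    using dist_fst_le dist_snd_le by (meson order_trans)+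
   then show "y \<in> {fst q - r..fst q + r} \<times> {snd q - r..snd q + r}"
    by (auto simp: dist_real_def mem_Times_iff)
  qed
  then have "emeasure lborel A \<le> emeasure (lborel \<Otimes>\<^sub>M lborel) ({fst q - r..fst q + r} \<times> {snd q - r..snd q + r})"
   unfolding lborel_prod by (intro emeasure_mono) (auto intro!: borel_closed closed_Times)
  also have "... = ennreal (2 * r) * ennreal (2 * r)"
   using r by (subst lborel.emeasure_pair_measure_Times) auto
  finally show ?thesis using r by (simp add: ennreal_mult[symmetric] power2_eq_square)
 qed
 then have "ennreal (plane_const * 2) * emeasure lborel A \<le> ennreal (plane_const * 2) * ennreal (4 * r\<^sup>2)"
  by (rule mult_left_mono) simp
 also have "... = ennreal (8 * plane_const * r\<^sup>2)" by (simp add: ennreal_mult[symmetric])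
 finally show ?thesis .
qed

text \<open>This quadratic growth compensates, in \<open>cutoff_estimate\<close>, the gradient of a
  cutoff, which has size proportional to \<open>1 / r\<close> on a ball of radius
  \<open>2 * r\<close>.\<close>

lemma hausdorff_surface_ball:
 assumes C: "C2_surface G \<nu>" and "compact G"
 obtains K where "0 \<le> K" "!!p r. 0 \<le> r ==> \<H> 2 (G \<inter> ball p r) \<le> ennreal (K * r\<^sup>2)"
proof -
 have "\<forall>p\<in>G. \<exists>U. open U \<and> p \<in> U \<and> (\<forall>x r. 0 \<le> r --> \<H> 2 (G \<inter> U \<inter> ball x r) \<le> ennreal (8 * plane_const * r\<^sup>2))"
 proof
  fix p assume "p \<in> G"
  then obtain e1 e2 U V F where c: "surface_chart G \<nu> p e1 e2 U V F" using surface_chart_exists[OF C] by metis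
  show "\<exists>U. open U \<and> p \<in> U \<and> (\<forall>x r. 0 \<le> r --> \<H> 2 (G \<inter> U \<inter> ball x r) \<le> ennreal (8 * plane_const * r\<^sup>2))"
   using surface_chartD(2,3)[OF c] hausdorff_surface_ball_local[OF C c] by auto
 qed
 then obtain U where U: "!!p. p \<in> G ==> open (U p)" "!!p. p \<in> G ==> p \<in> U p"
  "!!p x r. p \<in> G ==> 0 \<le> r ==> \<H> 2 (G \<inter> U p \<inter> ball x r) \<le> ennreal (8 * plane_const * r\<^sup>2)"
  by metis
 obtain P where P: "P \<subseteq> G" "finite P" "G \<subseteq> (\<Union>p\<in>P. U p)"
  by (rule compactE_image[OF \<open>compact G\<close>, of G U]) (use U in auto)
 have fin: "\<H> 2 (\<Union>i\<in>I. B i) \<le> (\<Sum>i\<in>I. \<H> 2 (B i))" if "finite I" for I and B :: "point => point set"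
  using that
 proof induction
  case (insert i I)
  have "\<H> 2 (\<Union>i\<in>insert i I. B i) \<le> \<H> 2 (B i) + \<H> 2 (\<Union>i\<in>I. B i)"
   using outer_Un[of 2 "B i"] by simp
  also have "... \<le> \<H> 2 (B i) + (\<Sum>i\<in>I. \<H> 2 (B i))" using insert by auto
  finally show ?case using insert by simp
 qed simp
 show ?thesis
 proof (rule that[of "real (card P) * (8 * plane_const)"])
  fix x :: point and r :: real assume r: "0 \<le> r"
  have "G \<inter> ball x r \<subseteq> (\<Union>p\<in>P. G \<inter> U p \<inter> ball x r)" using P(3) by auto
  then have "\<H> 2 (G \<inter> ball x r) \<le> (\<Sum>p\<in>P. \<H> 2 (G \<inter> U p \<inter> ball x r))"
   using outer_mono fin[OF P(2)] by (meson order_trans)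
  also have "... \<le> (\<Sum>p\<in>P. ennreal (8 * plane_const * r\<^sup>2))" using P(1) r by (intro sum_mono U(3)) auto
  also have "... = ennreal (real (card P) * (8 * plane_const) * r\<^sup>2)"
   by (simp add: ennreal_of_nat_eq_real_of_nat ennreal_mult[symmetric])
  finally show "\<H> 2 (G \<inter> ball x r) \<le> ennreal (real (card P) * (8 * plane_const) * r\<^sup>2)" .
 qed simp
qed

lemma hausdorff_surface_finite:
 assumes "C2_surface G \<nu>" and "compact G" shows "\<H> 2 G < top"
proof -
 obtain K where K: "!!p r. 0 \<le> r ==> \<H> 2 (G \<inter> ball p r) \<le> ennreal (K * r\<^sup>2)"
  using hausdorff_surface_ball[OF assms] by metis
 obtain R where "0 < R" "G \<subseteq> ball 0 R" using assms(2) compact_imp_bounded bounded_subset_ballD by metis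
 then have "\<H> 2 G \<le> ennreal (K * R\<^sup>2)" using K[of R 0] by (simp add: Int_absorb2)
 then show ?thesis by (rule le_less_trans) simp
qed

section \<open>The divergence theorem on a compact surface\<close>

lemma integral_derivative_zero:
 fixes g g' :: "real => real"
 assumes d: "!!t. DERIV g t :> g' t" and c: "continuous_on UNIV g'" and R: "0 \<le> R" "!!t. R \<le> \<bar>t\<bar> ==> g t = 0"
  "!!t. R < \<bar>t\<bar> ==> g' t = 0"
 shows "(LINT t|lborel. g' t) = 0"
proof -
 have "(LINT t|lborel. indicator {-R..R} t *\<^sub>R g' t) = g R - g (-R)"
  using R(1) c by (intro integral_FTC_Icc) 
   (auto intro: continuous_on_subset has_field_derivative_at_within[OF d] simp flip: has_real_derivative_iff_has_vector_derivative)
 moreover have "(LINT t|lborel. indicator {-R..R} t *\<^sub>R g' t) = (LINT t|lborel. g' t)"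
 proof (intro Bochner_Integration.integral_cong refl)
  fix t
  show "indicator {-R..R} t *\<^sub>R g' t = g' t"
   using R(3)[of t] by (cases "R < \<bar>t\<bar>") (auto simp: abs_le_iff not_less)
 qed
 ultimately show ?thesis using R(1,2) by simp
qed

text \<open>The fundamental theorem of calculus on every line parallel to \<open>b\<close>, then
  Fubini.\<close>

lemma integral_partial_derivative_zero:
 fixes u :: "real \<times> real => real"
 assumes d: "!!y. (u has_derivative u' y) (at y)" and K: "compact K" "!!y. y \<notin> K ==> u y = 0"
  and b: "b = (1, 0) \<or> b = (0, 1)" and c: "continuous_on UNIV (\<lambda>y. u' y b)"
 shows "integrable lborel (\<lambda>y. u' y b)" "(LINT y|lborel. u' y b) = 0"
proof -
 have 0: "u' y b = 0" if y: "y \<notin> K" for y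
 proof -
  have "open (- K)" using K(1) compact_imp_closed by auto
  then have "(u has_derivative (\<lambda>_. 0)) (at y)"
   by (rule has_derivative_transform_within_open[OF has_derivative_const]) (use y K(2) in auto)
  then show ?thesis using has_derivative_unique[OF d] by auto
 qed
 have "integrable lborel (\<lambda>y. indicator K y *\<^sub>R u' y b)"
  by (rule borel_integrable_compact[OF K(1) continuous_on_subset[OF c]]) simp
 moreover have "(\<lambda>y. indicator K y *\<^sub>R u' y b) = (\<lambda>y. u' y b)"
  using 0 by force
 ultimately show i: "integrable lborel (\<lambda>y. u' y b)" by simp
 obtain R where R: "0 < R" "!!y. y \<in> K ==> norm y < R"
  using compact_imp_bounded[OF K(1)] bounded_pos_less by blast
 have out: "(x, t) \<notin> K" if "R \<le> \<bar>x\<bar> \<or> R \<le> \<bar>t\<bar>" for x t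
  using R(2)[of "(x, t)"] that norm_fst_le[of x t] norm_snd_le[of t x] by auto
 have i2: "integrable (lborel \<Otimes>\<^sub>M lborel) (\<lambda>y. u' y b)" using i by (simp add: lborel_prod)
 show "(LINT y|lborel. u' y b) = 0"
  using b
 proof
  assume b: "b = (0, 1)"
  have "(LINT t|lborel. u' (x, t) b) = 0" for x
  proof (rule integral_derivative_zero[where g = "\<lambda>t. u (x, t)" and R = R])
   fix t :: real
   have "((\<lambda>t. (x, t)) has_derivative (\<lambda>s. (0, s))) (at t)" by (auto intro!: derivative_eq_intros)
   from has_derivative_compose[OF this d[of "(x, t)"]]
   have "((\<lambda>t. u (x, t)) has_derivative (\<lambda>s. u' (x, t) (0, s))) (at t)" .
   moreover have "u' (x, t) (0, s) = u' (x, t) b * s" for s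
    using linear_scale[OF has_derivative_linear[OF d[of "(x, t)"]], of s "(0, 1)"] b by simp
   ultimately show "DERIV (\<lambda>t. u (x, t)) t :> u' (x, t) b"
    by (simp add: has_field_derivative_def)
  qed (use R out 0 K(2) in \<open>auto intro!: continuous_on_compose2[OF c] continuous_intros\<close>)
  then show ?thesis
   using lborel_pair.integral_fst'[OF i2] by (simp add: lborel_prod)
 next
  assume b: "b = (1, 0)"
  have "(LINT t|lborel. u' (t, x) b) = 0" for x
  proof (rule integral_derivative_zero[where g = "\<lambda>t. u (t, x)" and R = R])
   fix t :: real
   have "((\<lambda>t. (t, x)) has_derivative (\<lambda>s. (s, 0))) (at t)" by (auto intro!: derivative_eq_intros)
   from has_derivative_compose[OF this d[of "(t, x)"]]
   have "((\<lambda>t. u (t, x)) has_derivative (\<lambda>s. u' (t, x) (s, 0))) (at t)" .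
   moreover have "u' (t, x) (s, 0) = u' (t, x) b * s" for s
    using linear_scale[OF has_derivative_linear[OF d[of "(t, x)"]], of s "(1, 0)"] b by simp
   ultimately show "DERIV (\<lambda>t. u (t, x)) t :> u' (t, x) b"
    by (simp add: has_field_derivative_def)
  qed (use R out 0 K(2) in \<open>auto intro!: continuous_on_compose2[OF c] continuous_intros\<close>)
  then show ?thesis
   using lborel_pair.integral_snd[of "\<lambda>x t. u' (x, t) b"] i2 by (simp add: lborel_prod case_prod_unfold)
 qed
qed

text \<open>The left side is, by the quotient rule, the planar divergence of the field with
  components \<open>(Y \<bullet> e1) / (n \<bullet> n0)\<close> and
  \<open>(Y \<bullet> e2) / (n \<bullet> n0)\<close>; the right side is the area element times the
  surface divergence. The curvature terms with \<open>S\<close> cancel because of its symmetry and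
  of \<open>rel\<close>, which is the derivative of \<open>Y \<bullet> n = 0\<close>.\<close>

lemma divergence_algebra:
 fixes D S :: "point \<Rightarrow>\<^sub>L point"
 assumes fr: "frame e1 e2 n0" and n: "n \<bullet> n = 1" and m: "n \<bullet> n0 \<noteq> 0" and Y: "Y \<bullet> n = 0"
  and sym: "!!u v. S u \<bullet> v = S v \<bullet> u" and Sn: "!!v. S v \<bullet> n = 0"
  and rel: "!!w. w \<bullet> n = 0 ==> D w \<bullet> n + Y \<bullet> S w = 0"
  and t1: "t1 = e1 - ((n \<bullet> e1) / (n \<bullet> n0)) *\<^sub>R n0" and t2: "t2 = e2 - ((n \<bullet> e2) / (n \<bullet> n0)) *\<^sub>R n0"
 shows "((D t1 \<bullet> e1) / (n \<bullet> n0) - (Y \<bullet> e1) * (S t1 \<bullet> n0) / (n \<bullet> n0)\<^sup>2) + ((D t2 \<bullet> e2) / (n \<bullet> n0) - (Y \<bullet> e2) * (S t2 \<bullet> n0) / (n \<bullet> n0)\<^sup>2)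
  = 1 / (n \<bullet> n0) * ((\<Sum>b\<in>Basis. D b \<bullet> b) - D n \<bullet> n)"
proof -
 define m where "m = n \<bullet> n0"
 have m0: "m \<noteq> 0" using m by (simp add: m_def)
 have tr: "(\<Sum>b\<in>Basis. D b \<bullet> b) = D e1 \<bullet> e1 + D e2 \<bullet> e2 + D n0 \<bullet> n0"
  by (rule trace_frame[OF fr]) (simp add: blinfun.bounded_linear_right bounded_linear.linear)
 have Dn0: "D n0 \<bullet> n = (n \<bullet> e1) * (D n0 \<bullet> e1) + (n \<bullet> e2) * (D n0 \<bullet> e2) + m * (D n0 \<bullet> n0)"
  using frame_inner[OF fr, of "D n0" n] by (simp add: m_def)
 have Sn0: "S n = 0"
 proof -
  have "S n \<bullet> S n = 0" using sym[of n "S n"] Sn by simp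
  then show ?thesis by simp
 qed
 have w: "D n0 \<bullet> n = m * (D n \<bullet> n) - Y \<bullet> S n0"
 proof -
  \<comment> \<open>The tangential part of \<open>n0\<close> is the vector to which
    \<open>rel\<close> has to be applied.\<close>
  have "(n0 - m *\<^sub>R n) \<bullet> n = 0" by (simp add: inner_diff_right n m_def inner_commute)
  from rel[OF this] show ?thesis
   by (simp add: blinfun.diff_right blinfun.scaleR_right Sn0 inner_diff_left)
 qed
 have Yn0: "Y \<bullet> n0 = - ((Y \<bullet> e1) * (n \<bullet> e1) + (Y \<bullet> e2) * (n \<bullet> e2)) / m"
  using frame_inner[OF fr, of Y n] Y m0 by (simp add: m_def field_simps)
 have "Y = (Y \<bullet> e1) *\<^sub>R e1 + (Y \<bullet> e2) *\<^sub>R e2 + (Y \<bullet> n0) *\<^sub>R n0"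
  using fr unfolding frame_def by simp
 then have Yt: "Y = (Y \<bullet> e1) *\<^sub>R t1 + (Y \<bullet> e2) *\<^sub>R t2"
  unfolding Yn0 t1 t2 m_def[symmetric] by (simp add: algebra_simps diff_divide_distrib)
 have "S n0 \<bullet> Y = S Y \<bullet> n0" by (rule sym)
 also have "... = S ((Y \<bullet> e1) *\<^sub>R t1 + (Y \<bullet> e2) *\<^sub>R t2) \<bullet> n0" using Yt by simp
 also have "... = (Y \<bullet> e1) * (S t1 \<bullet> n0) + (Y \<bullet> e2) * (S t2 \<bullet> n0)"
  by (simp add: blinfun.add_right blinfun.scaleR_right inner_add_left)
 finally have sec: "(Y \<bullet> e1) * (S t1 \<bullet> n0) + (Y \<bullet> e2) * (S t2 \<bullet> n0) = S n0 \<bullet> Y" by simp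
 have "D t1 \<bullet> e1 + D t2 \<bullet> e2 = D e1 \<bullet> e1 + D e2 \<bullet> e2 - ((n \<bullet> e1) * (D n0 \<bullet> e1) + (n \<bullet> e2) * (D n0 \<bullet> e2)) / m"
  unfolding t1 t2 m_def[symmetric]
  by (simp add: blinfun.diff_right blinfun.scaleR_right inner_diff_left add_divide_distrib)
 also have "... = (\<Sum>b\<in>Basis. D b \<bullet> b) - (D n0 \<bullet> n) / m"
  unfolding tr Dn0 using m0 by (simp add: add_divide_distrib)
 finally have fst: "D t1 \<bullet> e1 + D t2 \<bullet> e2 = (\<Sum>b\<in>Basis. D b \<bullet> b) - D n \<bullet> n + (S n0 \<bullet> Y) / m"
  unfolding w using m0 by (simp add: diff_divide_distrib inner_commute)
 have "((D t1 \<bullet> e1) / m - (Y \<bullet> e1) * (S t1 \<bullet> n0) / m\<^sup>2) + ((D t2 \<bullet> e2) / m - (Y \<bullet> e2) * (S t2 \<bullet> n0) / m\<^sup>2)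
  = (D t1 \<bullet> e1 + D t2 \<bullet> e2) / m - ((Y \<bullet> e1) * (S t1 \<bullet> n0) + (Y \<bullet> e2) * (S t2 \<bullet> n0)) / m\<^sup>2"
  by (simp add: add_divide_distrib)
 also have "... = 1 / m * ((\<Sum>b\<in>Basis. D b \<bullet> b) - D n \<bullet> n)"
  unfolding sec fst using m0 by (simp add: field_simps power2_eq_square)
 finally show ?thesis unfolding m_def .
qed

text \<open>Derivatives within \<open>G\<close> suffice throughout, so that functions on \<open>G\<close> need no extension
 to a neighbourhood.\<close>

definition C1_within :: "point set => (point => 'b::real_normed_vector) => (point => point \<Rightarrow>\<^sub>L 'b) => bool" where
 "C1_within G Y D \<longleftrightarrow> (\<forall>p\<in>G. (Y has_derivative blinfun_apply (D p)) (at p within G)) \<and> continuous_on G D"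

lemma C1_withinD:
 assumes "C1_within G Y D"
 shows "p \<in> G ==> (Y has_derivative blinfun_apply (D p)) (at p within G)" "continuous_on G D" "continuous_on G Y"
 using assms unfolding C1_within_def
 by (auto simp: continuous_on_eq_continuous_within intro: has_derivative_continuous)

lemma continuous_on_surface_div:
 assumes "continuous_on G D" "continuous_on G \<nu>" shows "continuous_on G (surface_div \<nu> D)"
 unfolding surface_div_def[abs_def] by (intro continuous_intros assms)

lemma surface_div_eq_0:
 assumes C: "C2_surface G \<nu>" and p: "p \<in> G" and D: "(Y has_derivative blinfun_apply (D p)) (at p within G)"
  and W: "open W" "p \<in> W" "!!x. x \<in> G \<inter> W ==> Y x = 0"
 shows "surface_div \<nu> D p = 0"
proof -
 have Y0: "(Y has_derivative (\<lambda>_. 0)) (at p within G)"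
  by (rule has_derivative_within_cong[OF has_derivative_const W(1,2) p]) (use W(3) in auto)
 obtain e1 e2 where fr: "frame e1 e2 (\<nu> p)"
  using frame_exists[OF C2_surface_norm[OF C p]] .
 have "D p e1 = 0" "D p e2 = 0"
  using fr tangential_derivative_unique[OF C p _ D Y0] by (auto simp: frame_def)
 then show ?thesis using surface_div_frame[where n = \<nu> and x = p, OF fr] by simp
qed

lemma set_integral_hausdorff_cong:
 assumes "!!x. x \<in> A ==> x \<in> B ==> f x = g x" "!!x. x \<in> A - B ==> f x = 0" "!!x. x \<in> B - A ==> g x = 0"
 shows "(LINT x:A|M. f x) = (LINT x:B|M. g x)"
 unfolding set_lebesgue_integral_def using assms
 by (intro Bochner_Integration.integral_cong) (auto simp: indicator_def)

lemma divergence_local: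
 assumes C: "C2_surface G \<nu>" and c: "surface_chart G \<nu> p0 e1 e2 U V F"
  and Y: "C1_within G Y D" and tan: "!!x. x \<in> G ==> Y x \<bullet> \<nu> x = 0"
  and K: "compact K" "K \<subseteq> U" "!!x. x \<in> G - K ==> Y x = 0"
 shows "(LINT x:G|hausdorff_measure 2. surface_div \<nu> D x) = 0"
proof -
 note ch = surface_chartD[OF c]
 let ?n0 = "\<nu> p0"
 have clG: "closed G" using C by (simp add: C2_surface_def)
 have S: "is_shape_op G \<nu> x (shape_op G \<nu> x)" if "x \<in> G" for x
  using shape_op_derivative[OF C that] shape_op_normal[OF C that] by (simp add: is_shape_op_def)
 define S where "S = shape_op G \<nu>"
 have dS: "(\<nu> has_derivative blinfun_apply (S x)) (at x within G)" if "x \<in> G" for x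
  using S[OF that] by (simp add: is_shape_op_def S_def)
 have cS: "continuous_on G S" using shape_op_continuous[OF C] by (simp add: S_def)
 have c\<nu>: "continuous_on G \<nu>" by (rule continuous_on_normal[OF C])
 have div0: "surface_div \<nu> D x = 0" if "x \<in> G - K" for x
  by (rule surface_div_eq_0[where Y = Y and D = D and p = x and W = "- K", OF C _ C1_withinD(1)[OF Y]])
    (use that K compact_imp_closed in \<open>auto simp: open_Compl\<close>)
 have "(LINT x:G|hausdorff_measure 2. surface_div \<nu> D x)
   = (LINT x:G \<inter> U|hausdorff_measure 2. indicator G x *\<^sub>R surface_div \<nu> D x)"
  using div0 K(2) by (intro set_integral_hausdorff_cong) auto
 also have "... = plane_const * (LINT y:V|lborel. chart_density \<nu> p0 F y * (indicator G (F y) *\<^sub>R surface_div \<nu> D (F y)))"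
  by (rule chart_integral[OF C c]) 
    (intro borel_measurable_continuous_on_indicator continuous_on_surface_div C1_withinD(2)[OF Y] c\<nu>, use clG in simp)
 also have "(LINT y:V|lborel. chart_density \<nu> p0 F y * (indicator G (F y) *\<^sub>R surface_div \<nu> D (F y))) = 0"
 proof -
  define T where "T y = chart_deriv e1 e2 ?n0 (\<nu> (F y))" for y
  have m: "\<nu> (F y) \<bullet> ?n0 \<noteq> 0" if "y \<in> V" for y using ch(8)[OF ch(10,11)[OF that]] by simp
  \<comment> \<open>Components of the field divided by the cosine of the angle, extended by 0.
    Compact support inside the chart makes the extension C1 on the whole plane.\<close>
  define u where "u e y = (if y \<in> V then (Y (F y) \<bullet> e) / (\<nu> (F y) \<bullet> ?n0) else 0)" for e y
  define u' where "u' e y v = (if y \<in> V then (D (F y) (T y v) \<bullet> e) / (\<nu> (F y) \<bullet> ?n0)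
    - (Y (F y) \<bullet> e) * (S (F y) (T y v) \<bullet> ?n0) / (\<nu> (F y) \<bullet> ?n0)\<^sup>2 else 0)" for e y v
  define K' where "K' = chart_coord e1 e2 p0 ` (G \<inter> K)"
  have K': "compact K'" unfolding K'_def by (intro compact_continuous_image continuous_chart_coord closed_Int_compact clG K(1))
  have K'V: "K' \<subseteq> V" using surface_chart_inverse(1)[OF c] K(2) by (auto simp: K'_def)
  have FK: "F y \<notin> K" if "y \<in> V" "y \<notin> K'" for y
   using that ch(7)[OF that(1)] ch(10)[OF that(1)] by (force simp: K'_def)
  have u0: "u e y = 0" if "y \<notin> K'" for e y
   using FK[OF _ that] K(3)[of "F y"] ch(10)[of y] by (auto simp: u_def)
  have oK': "open (- K')" using K' compact_imp_closed by auto
  have du: "(u e has_derivative u' e y) (at y)" for e y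
  proof (cases "y \<in> V")
   case True
   have 1: "((\<lambda>y. Y (F y)) has_derivative (\<lambda>v. D (F y) (T y v))) (at y)"
    unfolding T_def by (rule surface_chart_compose[OF c True C1_withinD(1)[OF Y ch(10)[OF True]]])
   have 2: "((\<lambda>y. \<nu> (F y)) has_derivative (\<lambda>v. S (F y) (T y v))) (at y)"
    unfolding T_def by (rule surface_chart_compose[OF c True dS[OF ch(10)[OF True]]])
   have "((\<lambda>y. (Y (F y) \<bullet> e) / (\<nu> (F y) \<bullet> ?n0)) has_derivative
     (\<lambda>v. - (Y (F y) \<bullet> e) * (inverse (\<nu> (F y) \<bullet> ?n0) * (S (F y) (T y v) \<bullet> ?n0) * inverse (\<nu> (F y) \<bullet> ?n0)) + (D (F y) (T y v) \<bullet> e) / (\<nu> (F y) \<bullet> ?n0))) (at y)"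
    by (rule has_derivative_divide[OF has_derivative_inner_left[OF 1] has_derivative_inner_left[OF 2] m[OF True]])
   moreover have "(\<lambda>v. - (Y (F y) \<bullet> e) * (inverse (\<nu> (F y) \<bullet> ?n0) * (S (F y) (T y v) \<bullet> ?n0) * inverse (\<nu> (F y) \<bullet> ?n0)) + (D (F y) (T y v) \<bullet> e) / (\<nu> (F y) \<bullet> ?n0)) = u' e y"
    using True by (simp add: u'_def fun_eq_iff divide_inverse power2_eq_square)
   ultimately have "((\<lambda>y. (Y (F y) \<bullet> e) / (\<nu> (F y) \<bullet> ?n0)) has_derivative u' e y) (at y)" by simp
   then show ?thesis
    by (rule has_derivative_transform_within_open[OF _ ch(4) True]) (simp add: u_def)
  next
   case False
   have "(u e has_derivative (\<lambda>_. 0)) (at y)"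
    by (rule has_derivative_transform_within_open[OF has_derivative_const oK', of _ 0]) (use False K'V u0 in auto)
   moreover have "u' e y = (\<lambda>_. 0)" using False by (simp add: u'_def fun_eq_iff)
   ultimately show ?thesis by simp
  qed
  have cu: "continuous_on UNIV (\<lambda>y. u' e y b)" for e b
  proof -
   have cF: "continuous_on V F" by (rule chart_continuous(1)[OF C c])
   have "continuous_on V (\<lambda>y. (D (F y) (T y b) \<bullet> e) / (\<nu> (F y) \<bullet> ?n0)
    - (Y (F y) \<bullet> e) * (S (F y) (T y b) \<bullet> ?n0) / (\<nu> (F y) \<bullet> ?n0)\<^sup>2)"
    unfolding T_def chart_deriv_def using m
    by (intro continuous_intros continuous_on_compose2[OF C1_withinD(2)[OF Y] cF] continuous_on_compose2[OF C1_withinD(3)[OF Y] cF]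
     continuous_on_compose2[OF cS cF] continuous_on_compose2[OF c\<nu> cF]) (use ch(10) in auto)
   then have "continuous_on V (\<lambda>y. u' e y b)"
    by (rule continuous_on_eq) (simp add: u'_def)
   moreover have "continuous_on (- K') (\<lambda>y. u' e y b)"
   proof (rule continuous_on_eq[OF continuous_on_const])
    fix y assume y: "y \<in> - K'"
    have "(u e has_derivative (\<lambda>_. 0)) (at y)"
     by (rule has_derivative_transform_within_open[OF has_derivative_const oK' y, of 0]) (use u0 in auto)
    then show "0 = u' e y b" using has_derivative_unique[OF du] by auto
   qed
   ultimately have "continuous_on (V \<union> - K') (\<lambda>y. u' e y b)"
    using continuous_on_open_Un[OF ch(4) oK'] by auto
   moreover have "V \<union> - K' = UNIV" using K'V by auto
   ultimately show ?thesis by simp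
  qed
  have I1: "integrable lborel (\<lambda>y. u' e1 y (1, 0))" "(LINT y|lborel. u' e1 y (1, 0)) = 0"
   by (rule integral_partial_derivative_zero[OF du K' u0 _ cu]; simp)+
  have I2: "integrable lborel (\<lambda>y. u' e2 y (0, 1))" "(LINT y|lborel. u' e2 y (0, 1)) = 0"
   by (rule integral_partial_derivative_zero[OF du K' u0 _ cu]; simp)+
  have eq: "indicator V y *\<^sub>R (chart_density \<nu> p0 F y * (indicator G (F y) *\<^sub>R surface_div \<nu> D (F y))) = u' e1 y (1, 0) + u' e2 y (0, 1)" for y
  proof (cases "y \<in> V")
   case True
   let ?N = "\<nu> (F y)"
   have nn: "?N \<bullet> ?N = 1" using C2_surface_norm[OF C ch(10)[OF True]] by (simp add: norm_eq_1)
   have rel: "D (F y) w \<bullet> ?N + Y (F y) \<bullet> S (F y) w = 0" if w: "w \<bullet> ?N = 0" for w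
   proof -
    have d1: "((\<lambda>x. Y x \<bullet> \<nu> x) has_derivative (\<lambda>w. Y (F y) \<bullet> S (F y) w + D (F y) w \<bullet> ?N)) (at (F y) within G)"
     by (rule has_derivative_inner[OF C1_withinD(1)[OF Y ch(10)[OF True]] dS[OF ch(10)[OF True]]])
    have d2: "((\<lambda>x. Y x \<bullet> \<nu> x) has_derivative (\<lambda>_. 0)) (at (F y) within G)"
     by (rule has_derivative_within_cong[OF has_derivative_const open_UNIV _ ch(10)[OF True]]) (use tan in auto)
    show ?thesis using tangential_derivative_unique[OF C ch(10)[OF True] w d1 d2] by simp
   qed
   have T1: "T y (1, 0) = e1 - ((?N \<bullet> e1) / (?N \<bullet> ?n0)) *\<^sub>R ?n0" "T y (0, 1) = e2 - ((?N \<bullet> e2) / (?N \<bullet> ?n0)) *\<^sub>R ?n0"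
    by (simp_all add: T_def chart_deriv_def)
   have "u' e1 y (1, 0) + u' e2 y (0, 1) = 1 / (?N \<bullet> ?n0) * ((\<Sum>b\<in>Basis. D (F y) b \<bullet> b) - D (F y) ?N \<bullet> ?N)"
    unfolding u'_def using True
    by (simp only: if_True, intro divergence_algebra[OF ch(5) nn m[OF True] tan[OF ch(10)[OF True]] _ _ rel T1])
      (use shape_op_symmetric[OF C ch(10)[OF True]] shape_op_tangential[OF C ch(10)[OF True]] in \<open>auto simp: S_def\<close>)
   then show ?thesis using True ch(10)[OF True] by (simp add: chart_density_def surface_div_def)
  qed (simp add: u'_def)
  show ?thesis unfolding set_lebesgue_integral_def eq using I1 I2 by simp
 qed
 finally show ?thesis by simp
qed

section \<open>C1 bump functions and the product rule for the surface divergence\<close>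

definition sq_pos :: "real => real" where "sq_pos t = (max 0 t)\<^sup>2"

lemma sq_pos_deriv: "DERIV sq_pos t :> 2 * max 0 t"
proof -
 consider "0 < t" | "t < 0" | "t = 0" by force
 then show ?thesis
 proof cases
  case 1
  have "DERIV (\<lambda>t::real. t\<^sup>2) t :> 2 * max 0 t" using 1 by (auto intro!: derivative_eq_intros)
  then show ?thesis
   by (rule has_field_derivative_transform_within_open[where S = "{0<..}"]) (use 1 in \<open>auto simp: sq_pos_def\<close>)
 next
  case 2
  have "DERIV (\<lambda>t::real. 0) t :> 2 * max 0 t" using 2 by simp
  then show ?thesis
   by (rule has_field_derivative_transform_within_open[where S = "{..<0}"]) (use 2 in \<open>auto simp: sq_pos_def\<close>)
 next
  case 3
  have "((\<lambda>h. sq_pos h / h) \<longlongrightarrow> 0) (at 0)"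
  proof (rule Lim_null_comparison)
   show "\<forall>\<^sub>F h in at 0. norm (sq_pos h / h) \<le> \<bar>h\<bar>"
    by (intro always_eventually) (auto simp: sq_pos_def max_def power2_eq_square)
   show "((\<lambda>h::real. \<bar>h\<bar>) \<longlongrightarrow> 0) (at 0)" by (rule tendsto_eq_intros)+ auto
  qed
  then show ?thesis using 3 by (simp add: DERIV_def sq_pos_def)
 qed
qed

lemma continuous_on_sq_pos [continuous_intros]: "continuous_on S f ==> continuous_on S (\<lambda>x. sq_pos (f x))"
 unfolding sq_pos_def by (intro continuous_intros)

text \<open>The inner square is flat at \<open>norm (x - p) = r\<close> and the outer one at
  \<open>norm (x - p) = sqrt 2 * r\<close>, so the function is C1, equal to 1 inside and to 0
  outside; the radius \<open>2 * r\<close> used below is a rounder bound.\<close>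

definition bump :: "point => real => point => real" where
 "bump p r x = sq_pos (1 - sq_pos ((norm (x - p))\<^sup>2 / r\<^sup>2 - 1))"

definition bump_grad :: "point => real => point => point" where
 "bump_grad p r x = (- 2 * max 0 (1 - sq_pos ((norm (x - p))\<^sup>2 / r\<^sup>2 - 1)) * (2 * max 0 ((norm (x - p))\<^sup>2 / r\<^sup>2 - 1)) * (2 / r\<^sup>2)) *\<^sub>R (x - p)"

lemma bump_deriv: "(bump p r has_derivative (\<lambda>v. v \<bullet> bump_grad p r x)) (at x)"
proof -
 let ?u = "\<lambda>x. (norm (x - p))\<^sup>2 / r\<^sup>2 - 1"
 have "((\<lambda>x. (x - p) \<bullet> (x - p)) has_derivative (\<lambda>v. (x - p) \<bullet> (v - 0) + (v - 0) \<bullet> (x - p))) (at x)"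
  by (intro derivative_intros)
 then have "((\<lambda>x. ((x - p) \<bullet> (x - p)) / r\<^sup>2 - 1) has_derivative (\<lambda>v. ((x - p) \<bullet> (v - 0) + (v - 0) \<bullet> (x - p)) / r\<^sup>2 - 0)) (at x)"
  by (intro has_derivative_diff has_derivative_const bounded_linear.has_derivative[OF bounded_linear_divide])
 then have u: "(?u has_derivative (\<lambda>v. 2 / r\<^sup>2 * (v \<bullet> (x - p)))) (at x)"
  by (simp add: power2_norm_eq_inner inner_commute)
 have s: "(sq_pos has_derivative (\<lambda>h. h * (2 * max 0 t))) (at t)" for t
 proof -
  have "(\<lambda>h. h * (2 * max 0 t)) = (*) (2 * max 0 t)" by auto
  then show ?thesis using sq_pos_deriv[of t] by (simp add: has_field_derivative_def)
 qed
 have "((\<lambda>x. 1 - sq_pos (?u x)) has_derivative (\<lambda>v. 0 - (2 / r\<^sup>2 * (v \<bullet> (x - p))) * (2 * max 0 (?u x)))) (at x)"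
  by (intro has_derivative_diff has_derivative_const has_derivative_compose[OF u s])
 from has_derivative_compose[OF this s]
 have "(bump p r has_derivative (\<lambda>v. (0 - (2 / r\<^sup>2 * (v \<bullet> (x - p))) * (2 * max 0 (?u x))) * (2 * max 0 (1 - sq_pos (?u x))))) (at x)"
  unfolding bump_def[abs_def] .
 then show ?thesis
  by (rule has_derivative_eq_rhs) (simp add: bump_grad_def mult_ac)
qed

lemma continuous_on_bump_grad: "continuous_on S (bump_grad p r)"
 unfolding bump_grad_def[abs_def] by (cases "r = 0") (auto intro!: continuous_intros)

lemma bump_eq_1: "dist x p \<le> r ==> bump p r x = 1"
proof -
 assume d: "dist x p \<le> r"
 then have r: "0 \<le> r" by (meson order_trans zero_le_dist)
 have "(norm (x - p))\<^sup>2 \<le> r\<^sup>2" using d by (simp add: dist_norm power_mono)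
 then have "(norm (x - p))\<^sup>2 / r\<^sup>2 \<le> 1" by (cases "r = 0") auto
 then show ?thesis by (simp add: bump_def sq_pos_def)
qed

lemma bump_eq_0:
 assumes "0 < r" "2 * r \<le> dist x p" shows "bump p r x = 0" "bump_grad p r x = 0"
proof -
 have "(2 * r)\<^sup>2 \<le> (norm (x - p))\<^sup>2" using assms by (intro power_mono) (auto simp: dist_norm)
 then have "4 \<le> (norm (x - p))\<^sup>2 / r\<^sup>2" using assms(1) by (simp add: field_simps)
 then have "1 \<le> sq_pos ((norm (x - p))\<^sup>2 / r\<^sup>2 - 1)"
  unfolding sq_pos_def by auto
 then have "max 0 (1 - sq_pos ((norm (x - p))\<^sup>2 / r\<^sup>2 - 1)) = 0" by simp
 then show "bump p r x = 0" "bump_grad p r x = 0" unfolding bump_def bump_grad_def sq_pos_def[of "1 - _"] by auto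
qed

lemma bump_bounds: "0 \<le> bump p r x" "bump p r x \<le> 1"
 unfolding bump_def sq_pos_def[of "1 - _"] by (auto intro!: power_le_one simp: sq_pos_def)

lemma bump_grad_bound:
 assumes r: "0 < r" shows "norm (bump_grad p r x) \<le> 16 / r"
proof (cases "2 * r \<le> dist x p")
 case False
 let ?u = "(norm (x - p))\<^sup>2 / r\<^sup>2 - 1"
 show ?thesis
 proof (cases "1 \<le> sq_pos ?u")
  case True
  then have "bump_grad p r x = 0" by (simp add: bump_grad_def)
  then show ?thesis using r by simp
 next
  case F: False
  then have "(max 0 ?u)\<^sup>2 \<le> 1\<^sup>2" by (simp add: sq_pos_def)
  then have 1: "max 0 ?u \<le> 1" by (rule power2_le_imp_le) simp
  have 2: "max 0 (1 - sq_pos ?u) \<le> 1" by (simp add: sq_pos_def)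
  have "norm (bump_grad p r x) = (8 / r\<^sup>2) * (max 0 (1 - sq_pos ?u) * max 0 ?u) * norm (x - p)"
   by (simp add: bump_grad_def)
  also have "... \<le> (8 / r\<^sup>2) * (1 * 1) * (2 * r)"
   using 1 2 False by (intro mult_mono) (auto simp: dist_norm)
  also have "... = 16 / r" by (simp add: power2_eq_square)
  finally show ?thesis .
 qed
qed (use bump_eq_0(2)[OF r] r in auto)

definition product_deriv :: "(point => real) => (point => point \<Rightarrow>\<^sub>L real) => (point => point) => (point => point \<Rightarrow>\<^sub>L point) => point => point \<Rightarrow>\<^sub>L point" where
 "product_deriv f Df Y D x = f x *\<^sub>R D x + (blinfun_scaleR_left (Y x) o\<^sub>L Df x)"

lemma product_deriv_apply: "product_deriv f Df Y D x v = f x *\<^sub>R D x v + Df x v *\<^sub>R Y x"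
 by (simp add: product_deriv_def blinfun.add_left blinfun.scaleR_left)

lemma product_deriv_has_derivative:
 assumes "(f has_derivative blinfun_apply (Df x)) (at x within S)" "(Y has_derivative blinfun_apply (D x)) (at x within S)"
 shows "((\<lambda>x. f x *\<^sub>R Y x) has_derivative blinfun_apply (product_deriv f Df Y D x)) (at x within S)"
 by (rule has_derivative_eq_rhs[OF has_derivative_scaleR[OF assms]]) (simp add: product_deriv_apply fun_eq_iff)

lemma continuous_on_product_deriv:
 assumes "continuous_on S f" "continuous_on S Df" "continuous_on S Y" "continuous_on S D"
 shows "continuous_on S (product_deriv f Df Y D)"
 by (rule continuous_on_blinfun_componentwise) (auto simp: product_deriv_apply intro!: continuous_intros assms)

lemma C1_within_product:
 assumes "C1_within G f Df" "C1_within G Y D"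
 shows "C1_within G (\<lambda>x. f x *\<^sub>R Y x) (product_deriv f Df Y D)"
 unfolding C1_within_def using product_deriv_has_derivative C1_withinD[OF assms(1)] C1_withinD[OF assms(2)] continuous_on_product_deriv by simp

lemma sum_blinfun_inner_Basis:
 fixes L :: "point \<Rightarrow>\<^sub>L real" shows "(\<Sum>b\<in>Basis. L b * (w \<bullet> b)) = L w"
proof -
 have "L w = L (\<Sum>b\<in>Basis. (w \<bullet> b) *\<^sub>R b)" by (simp add: euclidean_representation)
 also have "... = (\<Sum>b\<in>Basis. L b * (w \<bullet> b))" by (simp add: blinfun.sum_right blinfun.scaleR_right mult.commute)
 finally show ?thesis by simp
qed

lemma surface_div_product:
 "surface_div n (product_deriv f Df Y D) x = f x * surface_div n D x + Df x (Y x) - Df x (n x) * (Y x \<bullet> n x)"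
 unfolding surface_div_def product_deriv_apply by (simp add: sum.distrib sum_distrib_left[symmetric] sum_blinfun_inner_Basis algebra_simps)

lemma C1_within_gradient:
 assumes "!!x. (f has_derivative (\<lambda>v. v \<bullet> g x)) (at x)" "continuous_on UNIV g"
 shows "C1_within G f (\<lambda>x. blinfun_inner_left (g x))"
 unfolding C1_within_def
proof safe
 fix p
 have "(\<lambda>v. v \<bullet> g p) = blinfun_inner_left (g p)" by auto
 then show "(f has_derivative blinfun_apply (blinfun_inner_left (g p))) (at p within G)"
  using assms(1)[of p] by (simp add: has_derivative_at_withinI)
 show "continuous_on G (\<lambda>x. blinfun_inner_left (g x))"
  by (rule continuous_on_blinfun_componentwise)
    (auto intro!: continuous_intros continuous_on_subset[OF assms(2)])
qed

lemma set_integrable_hausdorff_continuous: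
 fixes h :: "'a::metric_space => 'b::{banach, second_countable_topology}"
 assumes k: "0 < k" and S: "compact S" "\<H> k S < top" and h: "continuous_on S h"
 shows "set_integrable (hausdorff_measure k) S h"
proof -
 have SM: "S \<in> sets borel" "S \<in> sets (hausdorff_measure k)"
  using borel_closed[OF compact_imp_closed[OF S(1)]] borel_in_sets_hausdorff[OF k] by auto
 have "compact (h ` S)" by (rule compact_continuous_image[OF h S(1)])
 then have "bounded (h ` S)" by (rule compact_imp_bounded)
 then obtain B where B: "!!x. x \<in> S ==> norm (h x) \<le> B" unfolding bounded_iff by auto
 have m: "(\<lambda>x. indicator S x *\<^sub>R h x) \<in> borel_measurable (hausdorff_measure k)"
  by (rule borel_measurable_hausdorff[OF k borel_measurable_continuous_on_indicator[OF SM(1) h]])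
 show ?thesis unfolding set_integrable_def
 proof (rule Bochner_Integration.integrable_bound[OF _ m])
  show "integrable (hausdorff_measure k) (\<lambda>x. indicator S x *\<^sub>R B)"
   using SM S(2) by (intro integrable_scaleR_left) (auto simp: emeasure_hausdorff[OF k])
  show "AE x in hausdorff_measure k. norm (indicator S x *\<^sub>R h x) \<le> norm (indicator S x *\<^sub>R B)"
   using B by (intro AE_I2) (auto simp: indicator_def intro: order_trans[OF _ abs_ge_self])
 qed
qed

text \<open>Instead of a partition of unity, one ball is peeled off at a time: with a bump
  \<open>b\<close> the field splits into \<open>b Y\<close>, handled in a single chart, and
  \<open>(1 - b) Y\<close>, which vanishes off the remaining balls. The divergence is additive along
  the split because the gradients of the two factors are opposite.\<close>

theorem divergence_surface:
 assumes C: "C2_surface G \<nu>" and comp: "compact G"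
  and Y: "C1_within G Y D" and tan: "!!x. x \<in> G ==> Y x \<bullet> \<nu> x = 0"
 shows "(LINT x:G|hausdorff_measure 2. surface_div \<nu> D x) = 0"
proof -
 have fin: "\<H> 2 G < top" by (rule hausdorff_surface_finite[OF C comp])
 have c\<nu>: "continuous_on G \<nu>" by (rule continuous_on_normal[OF C])
 have "\<forall>p\<in>G. \<exists>r>0. \<forall>Y D. C1_within G Y D --> (\<forall>x\<in>G. Y x \<bullet> \<nu> x = 0) --> (\<forall>x\<in>G - cball p (2 * r). Y x = 0) -->
   (LINT x:G|hausdorff_measure 2. surface_div \<nu> D x) = 0"
 proof
  fix p assume "p \<in> G"
  then obtain e1 e2 U V F where c: "surface_chart G \<nu> p e1 e2 U V F" using surface_chart_exists[OF C] by metis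
  obtain r where r: "0 < r" "cball p r \<subseteq> U"
   using surface_chartD(2,3)[OF c] open_contains_cball by blast
  show "\<exists>r>0. \<forall>Y D. C1_within G Y D --> (\<forall>x\<in>G. Y x \<bullet> \<nu> x = 0) --> (\<forall>x\<in>G - cball p (2 * r). Y x = 0) -->
   (LINT x:G|hausdorff_measure 2. surface_div \<nu> D x) = 0"
  proof (intro exI[of _ "r / 2"] conjI allI impI)
   fix Y D assume "C1_within G Y D" "\<forall>x\<in>G. Y x \<bullet> \<nu> x = 0" "\<forall>x\<in>G - cball p (2 * (r / 2)). Y x = 0"
   then show "(LINT x:G|hausdorff_measure 2. surface_div \<nu> D x) = 0"
    using r by (intro divergence_local[OF C c _ _ compact_cball[of p r], where Y = Y]) auto
  qed (use r in simp)
 qed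
 then obtain r where r: "!!p. p \<in> G ==> 0 < r p" and
  loc: "!!p Y D. p \<in> G ==> C1_within G Y D ==> (\<forall>x\<in>G. Y x \<bullet> \<nu> x = 0) ==> (\<forall>x\<in>G - cball p (2 * r p). Y x = 0) ==>
   (LINT x:G|hausdorff_measure 2. surface_div \<nu> D x) = 0" by metis
 obtain P where P: "P \<subseteq> G" "finite P" "G \<subseteq> (\<Union>p\<in>P. ball p (r p))"
  by (rule compactE_image[OF comp, of G "\<lambda>p. ball p (r p)"]) (use r in force)+
 have "(LINT x:G|hausdorff_measure 2. surface_div \<nu> D x) = 0"
  if "finite Q" "Q \<subseteq> G" "C1_within G Y D" "\<forall>x\<in>G. Y x \<bullet> \<nu> x = 0" "\<forall>x\<in>G. x \<notin> (\<Union>p\<in>Q. ball p (r p)) --> Y x = 0" for Q Y D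
  using that
 proof (induction Q arbitrary: Y D)
  case empty
  then have "surface_div \<nu> D x = 0" if "x \<in> G" for x
   using surface_div_eq_0[where Y = Y and D = D and p = x and W = UNIV, OF C that C1_withinD(1)[OF empty(2) that]] by auto
  then have "(LINT x:G|hausdorff_measure 2. surface_div \<nu> D x) = (LINT x|(hausdorff_measure 2 :: point measure). 0)"
   unfolding set_lebesgue_integral_def by (intro Bochner_Integration.integral_cong) (auto simp: indicator_def)
  then show ?case by simp
 next
  case (insert q Q)
  let ?b = "bump q (r q)" and ?Db = "\<lambda>x. blinfun_inner_left (bump_grad q (r q) x)"
  have q: "q \<in> G" "0 < r q" using insert r by auto
  have b: "C1_within G ?b ?Db" by (rule C1_within_gradient[OF bump_deriv continuous_on_bump_grad])
  have b': "C1_within G (\<lambda>x. 1 - ?b x) (\<lambda>x. - ?Db x)"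
   using b unfolding C1_within_def
   by (auto intro!: derivative_eq_intros continuous_intros simp: blinfun.minus_left)
  have Y1: "C1_within G (\<lambda>x. ?b x *\<^sub>R Y x) (product_deriv ?b ?Db Y D)"
   by (rule C1_within_product[OF b insert(5)])
  have Y2: "C1_within G (\<lambda>x. (1 - ?b x) *\<^sub>R Y x) (product_deriv (\<lambda>x. 1 - ?b x) (\<lambda>x. - ?Db x) Y D)"
   by (rule C1_within_product[OF b' insert(5)])
  have i1: "(LINT x:G|hausdorff_measure 2. surface_div \<nu> (product_deriv ?b ?Db Y D) x) = 0"
   by (rule loc[OF q(1) Y1]) (use insert(6) bump_eq_0(1)[OF q(2)] in \<open>auto simp: dist_commute\<close>)
  have i2: "(LINT x:G|hausdorff_measure 2. surface_div \<nu> (product_deriv (\<lambda>x. 1 - ?b x) (\<lambda>x. - ?Db x) Y D) x) = 0"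
  proof (rule insert.IH[OF _ Y2])
   show "\<forall>x\<in>G. x \<notin> (\<Union>p\<in>Q. ball p (r p)) --> (1 - ?b x) *\<^sub>R Y x = 0"
   proof (intro ballI impI)
    fix x assume x: "x \<in> G" "x \<notin> (\<Union>p\<in>Q. ball p (r p))"
    show "(1 - ?b x) *\<^sub>R Y x = 0"
    proof (cases "x \<in> ball q (r q)")
     case True
     then have "?b x = 1" by (intro bump_eq_1) (simp add: dist_commute)
     then show ?thesis by simp
    next
     case False
     then have "x \<notin> (\<Union>p\<in>insert q Q. ball p (r p))" using x(2) by simp
     then show ?thesis using insert.prems(4) x(1) by simp
    qed
   qed
  qed (use insert in auto)
  have eq: "surface_div \<nu> D x = surface_div \<nu> (product_deriv ?b ?Db Y D) x + surface_div \<nu> (product_deriv (\<lambda>x. 1 - ?b x) (\<lambda>x. - ?Db x) Y D) x" for x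
   unfolding surface_div_product by (simp add: blinfun.minus_left algebra_simps)
  have I: "set_integrable (hausdorff_measure 2) G (surface_div \<nu> (product_deriv ?b ?Db Y D))"
   "set_integrable (hausdorff_measure 2) G (surface_div \<nu> (product_deriv (\<lambda>x. 1 - ?b x) (\<lambda>x. - ?Db x) Y D))"
   by (intro set_integrable_hausdorff_continuous comp fin continuous_on_surface_div C1_withinD(2)[OF Y1] C1_withinD(2)[OF Y2] c\<nu>; simp)+
  show ?case unfolding eq using set_integral_add(2)[OF I] i1 i2 by simp
 qed
 from this[OF P(2,1) Y] show ?thesis using tan P(3) by blast
qed

section \<open>Square integrable functions\<close>

definition sq_int :: "'a measure => ('a => 'b::{real_inner, second_countable_topology, banach}) => bool" where
 "sq_int M f \<longleftrightarrow> f \<in> borel_measurable M \<and> integrable M (\<lambda>x. (norm (f x))\<^sup>2)"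

lemma sq_int_bound:
 assumes "sq_int M f" "h \<in> borel_measurable M" "AE x in M. norm (h x) \<le> norm (f x)"
 shows "sq_int M h"
 unfolding sq_int_def
proof
 show "integrable M (\<lambda>x. (norm (h x))\<^sup>2)"
  by (rule Bochner_Integration.integrable_bound[of M "\<lambda>x. (norm (f x))\<^sup>2"]) (use assms in \<open>auto simp: sq_int_def elim!: eventually_mono\<close>)
qed fact

lemma norm_sq_add_le: "(norm (a + b))\<^sup>2 \<le> 2 * (norm a)\<^sup>2 + 2 * (norm (b::'a::real_normed_vector))\<^sup>2"
proof -
 have "(norm (a + b))\<^sup>2 \<le> (norm a + norm b)\<^sup>2" by (intro power_mono norm_triangle_ineq) simp
 also have "... \<le> 2 * (norm a)\<^sup>2 + 2 * (norm b)\<^sup>2"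
  using sum_squares_bound[of "norm a" "norm b"] by (simp add: power2_sum)
 finally show ?thesis .
qed

lemma sq_int_add:
 assumes f: "sq_int M f" and g: "sq_int M g"
 shows "sq_int M (\<lambda>x. f x + g x)"
 unfolding sq_int_def
proof
 show "(\<lambda>x. f x + g x) \<in> borel_measurable M" using f g by (auto simp: sq_int_def)
 then have m: "(\<lambda>x. (norm (f x + g x))\<^sup>2) \<in> borel_measurable M" by simp
 have "integrable M (\<lambda>x. 2 * (norm (f x))\<^sup>2 + 2 * (norm (g x))\<^sup>2)" using f g by (auto simp: sq_int_def)
 then show "integrable M (\<lambda>x. (norm (f x + g x))\<^sup>2)"
  by (rule Bochner_Integration.integrable_bound[OF _ m]) (intro AE_I2, simp add: norm_sq_add_le)
qed

lemma sq_int_scaleR: "sq_int M f ==> sq_int M (\<lambda>x. c *\<^sub>R f x)"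
 by (auto simp: sq_int_def power_mult_distrib)

lemma sq_int_diff:
 "sq_int M f ==> sq_int M g ==> sq_int M (\<lambda>x. f x - g x)"
 using sq_int_add[of M f "\<lambda>x. (-1) *\<^sub>R g x"] sq_int_scaleR[of M g "-1"] by simp

lemma sq_int_inner:
 assumes f: "sq_int M f" and g: "sq_int M g"
 shows "integrable M (\<lambda>x. f x \<bullet> g x)" "integrable M (\<lambda>x. norm (f x) * norm (g x))"
proof -
 have i: "integrable M (\<lambda>x. (norm (f x))\<^sup>2 + (norm (g x))\<^sup>2)" using f g by (auto simp: sq_int_def)
 have b: "norm (f x) * norm (g x) \<le> (norm (f x))\<^sup>2 + (norm (g x))\<^sup>2" for x
  using sum_squares_bound[of "norm (f x)" "norm (g x)"]
   mult_nonneg_nonneg[OF norm_ge_zero[of "f x"] norm_ge_zero[of "g x"]] by linarith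
 show "integrable M (\<lambda>x. norm (f x) * norm (g x))"
  by (rule Bochner_Integration.integrable_bound[OF i]) (use f g b in \<open>auto simp: sq_int_def\<close>)
 show "integrable M (\<lambda>x. f x \<bullet> g x)"
 proof (rule Bochner_Integration.integrable_bound[OF i])
  show "AE x in M. norm (f x \<bullet> g x) \<le> norm ((norm (f x))\<^sup>2 + (norm (g x))\<^sup>2)"
   using order_trans[OF Cauchy_Schwarz_ineq2 b] by auto
 qed (use f g in \<open>auto simp: sq_int_def\<close>)
qed

lemma Cauchy_Schwarz_integral:
 fixes f g :: "'a => 'b::{real_inner, second_countable_topology, banach}"
 assumes f: "sq_int M f" and g: "sq_int M g"
 shows "(LINT x|M. norm (f x) * norm (g x)) \<le> sqrt (LINT x|M. (norm (f x))\<^sup>2) * sqrt (LINT x|M. (norm (g x))\<^sup>2)"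
proof -
 define A where "A = (LINT x|M. (norm (f x))\<^sup>2)"
 define B where "B = (LINT x|M. (norm (g x))\<^sup>2)"
 have if': "integrable M (\<lambda>x. (norm (f x))\<^sup>2)" "integrable M (\<lambda>x. (norm (g x))\<^sup>2)" using f g by (auto simp: sq_int_def)
 have AB: "0 \<le> A" "0 \<le> B" by (auto simp: A_def B_def)
 show ?thesis
 proof (cases "A = 0 \<or> B = 0")
  case True
  then have "AE x in M. norm (f x) * norm (g x) = 0"
  proof
   assume "A = 0"
   then have "AE x in M. (norm (f x))\<^sup>2 = 0" using if' by (simp add: A_def integral_nonneg_eq_0_iff_AE)
   then show ?thesis by auto
  next
   assume "B = 0"
   then have "AE x in M. (norm (g x))\<^sup>2 = 0" using if' by (simp add: B_def integral_nonneg_eq_0_iff_AE)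
   then show ?thesis by auto
  qed
  then have "(LINT x|M. norm (f x) * norm (g x)) = 0" by (rule integral_eq_zero_AE)
  then show ?thesis by simp
 next
  case False
  then have p: "0 < A" "0 < B" using AB by auto
  \<comment> \<open>The weight for which the two terms of the pointwise Young inequality have equal
    integrals.\<close>
  define s where "s = sqrt (B / A)"
  have s: "0 < s" "s * s = B / A" using p by (auto simp: s_def)
  have pw: "norm (f x) * norm (g x) \<le> (s / 2) * (norm (f x))\<^sup>2 + (1 / (2 * s)) * (norm (g x))\<^sup>2" for x
  proof -
   have "0 \<le> (s * norm (f x) - norm (g x))\<^sup>2" by simp
   then have "2 * s * (norm (f x) * norm (g x)) \<le> s\<^sup>2 * (norm (f x))\<^sup>2 + (norm (g x))\<^sup>2"
    by (simp add: power2_diff algebra_simps)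
   then show ?thesis using s(1) by (simp add: field_simps power2_eq_square)
  qed
  have "(LINT x|M. norm (f x) * norm (g x)) \<le> (LINT x|M. (s / 2) * (norm (f x))\<^sup>2 + (1 / (2 * s)) * (norm (g x))\<^sup>2)"
   using if' by (intro integral_mono sq_int_inner(2)[OF f g] pw) auto
  also have "... = (s / 2) * A + (1 / (2 * s)) * B" using if' by (simp add: A_def B_def)
  also have "... = sqrt A * sqrt B"
  proof -
   have "sqrt A * sqrt B = s * A" using p by (simp add: s_def real_sqrt_divide) (metis mult.commute real_sqrt_mult_self abs_of_pos nonzero_mult_div_cancel_right real_sqrt_eq_zero_cancel_iff less_irrefl times_divide_eq_left)
   moreover have "B = s * s * A" using s(2) p by simp
   ultimately show ?thesis by simp
  qed
  finally show ?thesis by (simp add: A_def B_def)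
 qed
qed

abbreviation haus :: "nat => 'a::metric_space set => 'a measure" where
 "haus k S \<equiv> restrict_space (hausdorff_measure k) S"

lemma
 fixes S :: "point set"
 assumes S: "S \<in> sets (hausdorff_measure k)"
 shows L2_on_iff: "L2_on k S f \<longleftrightarrow> sq_int (haus k S) f"
  and L2_inner_eq: "L2_inner k S f g = (LINT x|haus k S. f x \<bullet> g x)"
  and L2_norm_eq: "L2_norm k S f = sqrt (LINT x|haus k S. (norm (f x))\<^sup>2)"
 using S unfolding L2_on_def L2_norm_def L2_inner_def sq_int_def set_borel_measurable_def set_integrable_def set_lebesgue_integral_def
 by (simp_all add: borel_measurable_restrict_space_iff integrable_restrict_space integral_restrict_space power2_norm_eq_inner)

lemma set_integral_haus:
 fixes h :: "'a::metric_space => 'b::{banach, second_countable_topology}"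
 assumes "S \<in> sets (hausdorff_measure k)"
 shows "(LINT x:S|hausdorff_measure k. h x) = (LINT x|haus k S. h x)"
 unfolding set_lebesgue_integral_def using assms by (subst integral_restrict_space) auto

lemma L2_inner_le:
 fixes f g :: "point => 'b::{real_inner, second_countable_topology, banach}"
 assumes S: "S \<in> sets (hausdorff_measure k)" and "L2_on k S f" "L2_on k S g"
 shows "(LINT x|haus k S. norm (f x) * norm (g x)) \<le> L2_norm k S f * L2_norm k S g"
 using Cauchy_Schwarz_integral[of "haus k S" f g] assms(2,3) by (simp add: L2_on_iff[OF S] L2_norm_eq[OF S])

lemma finite_measure_haus:
 assumes "0 < k" "S \<in> sets (hausdorff_measure k)" "\<H> k S < top"
 shows "finite_measure (haus k S)"
 using assms by (intro finite_measureI) (simp add: emeasure_restrict_space emeasure_hausdorff)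

lemma sq_int_bounded:
 assumes "finite_measure M" "h \<in> borel_measurable M" "!!x. x \<in> space M ==> norm (h x) \<le> B"
 shows "sq_int M h"
proof -
 interpret finite_measure M by fact
 have "sq_int M (\<lambda>_. B)" by (simp add: sq_int_def)
 then have "integrable M (\<lambda>x. (norm (h x))\<^sup>2)"
  by (intro integrable_const_bound[of _ "B\<^sup>2"]) (use assms in \<open>auto intro!: power_mono\<close>)
 then show ?thesis using assms by (simp add: sq_int_def)
qed

lemma cont_measurable_haus:
 assumes "0 < k" "S \<in> sets borel" "continuous_on S h"
 shows "(h :: 'a::metric_space => 'b::topological_space) \<in> borel_measurable (haus k S)"
proof -
 have "h \<in> borel_measurable (restrict_space borel S)" by (rule borel_measurable_continuous_on_restrict[OF assms(3)])
 moreover have "sets (restrict_space borel S) \<subseteq> sets (haus k S)"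
  using borel_in_sets_hausdorff[OF assms(1)] by (auto simp: sets_restrict_space)
 ultimately show ?thesis
  by (auto simp: measurable_def space_restrict_space)
qed

lemma sq_int_continuous:
 fixes h :: "'a::metric_space => 'b::{real_inner, second_countable_topology, banach}"
 assumes k: "0 < k" and K: "compact K" "continuous_on K h" and S: "S \<subseteq> K" "S \<in> sets borel" "\<H> k S < top"
 shows "sq_int (haus k S) h"
proof -
 have "bounded (h ` K)" by (intro compact_imp_bounded compact_continuous_image K)
 then obtain B where B: "!!x. x \<in> K ==> norm (h x) \<le> B" unfolding bounded_iff by auto
 show ?thesis
  by (rule sq_int_bounded[OF finite_measure_haus[OF k borel_in_sets_hausdorff[OF k S(2)] S(3)]
     cont_measurable_haus[OF k S(2) continuous_on_subset[OF K(2) S(1)]]])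
    (use B S(1) in \<open>auto simp: space_restrict_space\<close>)
qed

subsection \<open>Density of polynomials\<close>

text \<open>The hypothesis \<open>reg\<close> admits complete measures, whose \<open>\<sigma>\<close>-algebra is larger than the Borel one.\<close>

lemma polynomials_dense:
 fixes M :: "'a::euclidean_space measure" and u :: "'a => real"
 assumes M: "finite_measure M" and S: "compact S" "space M \<subseteq> S" and id: "(\<lambda>x. x) \<in> measurable M borel"
  and reg: "!!A. A \<in> sets M ==> \<exists>A'\<in>sets borel. AE x in M. x \<in> A \<longleftrightarrow> x \<in> A'"
  and u: "integrable M u" and e: "0 < e"
 obtains q where "real_polynomial_function q" "integrable M q" "(LINT x|M. \<bar>u x - q x\<bar>) < e"
proof -
 interpret finite_measure M by (rule M)
 \<comment> \<open>The class of approximable functions is closed under sums, multiples and L^1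
   limits. It is enlarged from polynomials to continuous functions (Stone-Weierstrass), to
   indicators of closed and then of Borel sets, and finally to integrable functions, where
   \<open>reg\<close> replaces measurable sets by Borel ones.\<close>
 define ap where "ap u \<longleftrightarrow> integrable M u \<and> (\<forall>e>0. \<exists>q. real_polynomial_function q \<and> (LINT x|M. \<bar>u x - q x\<bar>) < e)" for u
 have cont: "integrable M f" if f: "continuous_on UNIV f" for f :: "'a => real"
 proof -
  obtain K where K: "!!x. x \<in> S ==> \<bar>f x\<bar> \<le> K"
   using compact_imp_bounded[OF compact_continuous_image[OF continuous_on_subset[OF f subset_UNIV] S(1)]] by (auto simp: bounded_iff)
  show ?thesis
   by (rule integrable_const_bound[of _ K])
     (use K S(2) measurable_compose[OF id borel_measurable_continuous_onI[OF f]] in \<open>auto intro!: AE_I2\<close>)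
 qed
 have poly: "integrable M q" if "real_polynomial_function q" for q
  by (intro cont continuous_at_imp_continuous_on ballI continuous_real_polymonial_function that)
 have ind: "integrable M (indicator A :: 'a => real)" if "A \<in> sets borel" for A
 proof -
  have "(\<lambda>x. indicator A x :: real) \<in> borel_measurable M" using measurable_compose[OF id borel_measurable_indicator[OF that]] .
  then show ?thesis by (intro integrable_const_bound[of _ 1]) auto
 qed
 have limit: "ap f" if f: "integrable M f" and s: "!!i::nat. ap (s i)"
  and l: "(\<lambda>i. LINT x|M. \<bar>f x - s i x\<bar>) \<longlonglongrightarrow> 0" for f s
  unfolding ap_def
 proof (intro conjI allI impI f)
  fix e :: real assume "0 < e"
  then obtain i where i: "(LINT x|M. \<bar>f x - s i x\<bar>) < e / 2"
   using order_tendstoD(2)[OF l, of "e / 2"] by force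
  obtain q where q: "real_polynomial_function q" "(LINT x|M. \<bar>s i x - q x\<bar>) < e / 2"
   using s[of i] \<open>0 < e\<close> unfolding ap_def by (meson half_gt_zero)
  have si: "integrable M (s i)" using s by (simp add: ap_def)
  have "(LINT x|M. \<bar>f x - q x\<bar>) \<le> (LINT x|M. \<bar>f x - s i x\<bar> + \<bar>s i x - q x\<bar>)"
   using f si poly[OF q(1)] by (intro integral_mono) auto
  also have "... = (LINT x|M. \<bar>f x - s i x\<bar>) + (LINT x|M. \<bar>s i x - q x\<bar>)" using f si poly[OF q(1)] by simp
  finally show "\<exists>q. real_polynomial_function q \<and> (LINT x|M. \<bar>f x - q x\<bar>) < e" using q i by auto
 qed
 have dom: "(\<lambda>i. LINT x|M. \<bar>f x - s i x\<bar>) \<longlonglongrightarrow> 0"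
  if "integrable M f" "!!i. integrable M (s i)" "integrable M w" "!!x. x \<in> space M ==> (\<lambda>i. s i x) \<longlonglongrightarrow> f x"
   "!!i x. x \<in> space M ==> \<bar>f x - s i x\<bar> \<le> w x" for f w and s :: "nat => 'a => real"
 proof -
  have "(\<lambda>i. LINT x|M. \<bar>f x - s i x\<bar>) \<longlonglongrightarrow> (LINT x|M. 0)"
  proof (rule integral_dominated_convergence[where w=w], goal_cases)
   case 4
   show ?case
   proof (rule AE_I2)
    fix x assume "x \<in> space M"
    from tendsto_rabs[OF tendsto_diff[OF tendsto_const[of "f x"] that(4)[OF this]]]
    show "(\<lambda>i. \<bar>f x - s i x\<bar>) \<longlonglongrightarrow> 0" by simp
   qed
  qed (use that in \<open>auto intro!: AE_I2\<close>)
  then show ?thesis by simp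
 qed
 have add: "ap (\<lambda>x. f x + g x)" if f: "ap f" and g: "ap g" for f g
  unfolding ap_def
 proof (intro conjI allI impI)
  fix e :: real assume "0 < e"
  then have e: "0 < e / 2" by simp
  obtain q q' where q: "real_polynomial_function q" "(LINT x|M. \<bar>f x - q x\<bar>) < e / 2"
   and q': "real_polynomial_function q'" "(LINT x|M. \<bar>g x - q' x\<bar>) < e / 2"
   using f g e unfolding ap_def by meson
  have i: "integrable M f" "integrable M g" using f g by (auto simp: ap_def)
  have "(LINT x|M. \<bar>f x + g x - (q x + q' x)\<bar>) \<le> (LINT x|M. \<bar>f x - q x\<bar> + \<bar>g x - q' x\<bar>)"
   using i poly[OF q(1)] poly[OF q'(1)] by (intro integral_mono) auto
  also have "... = (LINT x|M. \<bar>f x - q x\<bar>) + (LINT x|M. \<bar>g x - q' x\<bar>)" using i poly[OF q(1)] poly[OF q'(1)] by simp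
  finally show "\<exists>q. real_polynomial_function q \<and> (LINT x|M. \<bar>f x + g x - q x\<bar>) < e"
   using q q' by (intro exI[of _ "\<lambda>x. q x + q' x"]) auto
 qed (use f g in \<open>auto simp: ap_def\<close>)
 have scale: "ap (\<lambda>x. c * f x)" if f: "ap f" for f c
  unfolding ap_def
 proof (intro conjI allI impI)
  fix e :: real assume e: "0 < e"
  then obtain q where q: "real_polynomial_function q" "(LINT x|M. \<bar>f x - q x\<bar>) < e / (\<bar>c\<bar> + 1)"
   using f unfolding ap_def by (metis add_nonneg_pos abs_ge_zero divide_pos_pos zero_less_one)
  have "(LINT x|M. \<bar>c * f x - c * q x\<bar>) = \<bar>c\<bar> * (LINT x|M. \<bar>f x - q x\<bar>)" by (simp add: abs_mult flip: right_diff_distrib)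
  also have "... \<le> \<bar>c\<bar> * (e / (\<bar>c\<bar> + 1))" using q(2) by (intro mult_left_mono) auto
  also have "... < e" using e by (simp add: field_simps)
  finally show "\<exists>q. real_polynomial_function q \<and> (LINT x|M. \<bar>c * f x - q x\<bar>) < e"
   using q(1) by auto
 qed (use f in \<open>auto simp: ap_def\<close>)
 have ap_cont: "ap f" if f: "continuous_on UNIV f" for f
  unfolding ap_def
 proof (intro conjI allI impI cont f)
  fix e :: real assume e: "0 < e"
  define m where "m = measure M (space M) + 1"
  have m: "0 < m" "measure M (space M) < m" by (simp_all add: m_def add_nonneg_pos)
  then have em: "0 < e / m" using e by simp
  obtain q where q: "real_polynomial_function q" "!!x. x \<in> S ==> \<bar>f x - q x\<bar> < e / m"
   using Stone_Weierstrass_real_polynomial_function[OF S(1) continuous_on_subset[OF f subset_UNIV] em] by auto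
  have "(LINT x|M. \<bar>f x - q x\<bar>) \<le> (LINT x|M. e / m)"
   using q S(2) cont[OF f] poly[OF q(1)] by (intro integral_mono) (auto intro: less_imp_le)
  also have "... = measure M (space M) * (e / m)" by simp
  also have "... < m * (e / m)" using m(2) em by (rule mult_strict_right_mono)
  also have "... = e" using m(1) by simp
  finally show "\<exists>q. real_polynomial_function q \<and> (LINT x|M. \<bar>f x - q x\<bar>) < e" using q(1) by auto
 qed
 have ap_closed: "ap (indicator A)" if A: "closed A" "A \<noteq> {}" for A
 proof (rule limit[where s = "\<lambda>n x. max 0 (1 - real n * infdist x A)"])
  have c: "continuous_on UNIV (\<lambda>x. max 0 (1 - real n * infdist x A))" for n by (intro continuous_intros)
  show "ap (\<lambda>x. max 0 (1 - real n * infdist x A))" for n by (rule ap_cont[OF c])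
  show i: "integrable M (indicator A :: 'a => real)" using A by (intro ind) simp
  show "(\<lambda>n. LINT x|M. \<bar>indicator A x - max 0 (1 - real n * infdist x A)\<bar>) \<longlonglongrightarrow> 0"
  proof (rule dom[OF i cont[OF c], of "\<lambda>_. 1"])
   fix x
   have "eventually (\<lambda>n. indicator A x = max 0 (1 - real n * infdist x A)) sequentially"
   proof (cases "x \<in> A")
    case False
    then have d: "0 < infdist x A" using infdist_pos_not_in_closed[OF A] by simp
    obtain N :: nat where N: "1 / infdist x A \<le> real N" using real_arch_simple by auto
    have "1 \<le> real n * infdist x A" if "N \<le> n" for n
     using order_trans[OF N, of "real n"] that d by (simp add: pos_divide_le_eq)
    then show ?thesis using False by (intro eventually_sequentiallyI[of N]) simp
   qed simp
   then show "(\<lambda>n. max 0 (1 - real n * infdist x A)) \<longlonglongrightarrow> indicator A x"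
    by (rule Lim_transform_eventually[OF tendsto_const])
  qed (auto simp: indicator_def infdist_nonneg max_def)
 qed
 have ap_borel: "ap (indicator A)" if "A \<in> sets borel" for A
 proof -
  have "Int_stable (Collect closed :: 'a set set)" "Collect closed \<subseteq> Pow (UNIV :: 'a set)" "A \<in> sigma_sets UNIV (Collect closed)"
   using that by (auto simp: Int_stable_def borel_eq_closed)
  then show ?thesis
  proof (induction rule: sigma_sets_induct_disjoint)
   case (basic A)
   then show ?case using ap_closed[of A] ap_cont[of "\<lambda>_. 0"] by force
  next
   case empty
   show ?case using ap_cont[of "\<lambda>_. 0"] by simp
  next
   case (compl A)
   have "indicator (UNIV - A) = (\<lambda>x. 1 + (-1) * indicator A x :: real)" by (auto simp: indicator_def)
   then show ?case using add[OF ap_cont[of "\<lambda>_. 1"] scale[OF compl(2), of "-1"]] by simp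
  next
   case (union A)
   have b: "A i \<in> sets borel" for i using union(2) by (auto simp: borel_eq_closed)
   have s: "ap (indicator (\<Union>i<n. A i))" for n
   proof (induction n)
    case (Suc n)
    have "A i \<inter> A n = {}" if "i < n" for i using union(1) that by (simp add: disjoint_family_on_def)
    then have "indicator (\<Union>i<Suc n. A i) = (\<lambda>x. indicator (\<Union>i<n. A i) x + indicator (A n) x :: real)"
     by (fastforce simp: indicator_def lessThan_Suc)
    then show ?case using add[OF Suc union(3)[of n]] by simp
   qed (use ap_cont[of "\<lambda>_. 0"] in simp)
   show ?case
   proof (rule limit[OF ind s dom[OF ind ind, of _ _ "\<lambda>_. 1"]])
    fix x
    have "eventually (\<lambda>n. indicator (\<Union>i. A i) x = (indicator (\<Union>i<n. A i) x :: real)) sequentially"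
    proof (cases "x \<in> (\<Union>i. A i)")
     case True
     then obtain j where "x \<in> A j" by auto
     then show ?thesis by (intro eventually_sequentiallyI[of "Suc j"]) (auto simp: indicator_def)
    qed (auto simp: indicator_def)
    then show "(\<lambda>n. indicator (\<Union>i<n. A i) x :: real) \<longlonglongrightarrow> indicator (\<Union>i. A i) x"
     by (rule Lim_transform_eventually[OF tendsto_const])
   qed (use b in \<open>auto simp: indicator_def\<close>)
  qed
 qed
 have "ap u"
  using u
 proof (induction rule: integrable_induct)
  case (base A c)
  obtain A' where A': "A' \<in> sets borel" "AE x in M. x \<in> A \<longleftrightarrow> x \<in> A'" using reg[OF base(1)] by auto
  have i: "integrable M (indicator A :: 'a => real)" using base by simp
  have "AE x in M. \<bar>indicator A x - indicator A' x\<bar> = (0 :: real)" using A'(2) by auto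
  from integral_eq_zero_AE[OF this] have "ap (indicator A)" by (intro limit[OF i ap_borel[OF A'(1)]]) simp
  from scale[OF this, of c] show ?case by (simp add: mult.commute)
 next
  case (lim f s)
  have "\<bar>f x - s i x\<bar> \<le> 3 * \<bar>f x\<bar>" if "x \<in> space M" for i x
   using lim(3)[OF that, of i] by simp
  then show ?case
   by (intro limit[OF lim(4,5)] dom[OF lim(4,1), of "\<lambda>x. 3 * \<bar>f x\<bar>"]) (use lim in auto)
 qed (rule add)
 then obtain q where q: "real_polynomial_function q" "(LINT x|M. \<bar>u x - q x\<bar>) < e" using e unfolding ap_def by auto
 show ?thesis by (rule that[OF q(1) poly[OF q(1)] q(2)])
qed

text \<open>Apply density with respect to the measure \<open>|u| M\<close> to the sign of \<open>u\<close>.\<close>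

lemma orthogonal_polynomials_eq_0:
 fixes M :: "'a::euclidean_space measure" and u :: "'a => real"
 assumes S: "compact S" "space M \<subseteq> S" and id: "(\<lambda>x. x) \<in> measurable M borel"
  and reg: "!!A. A \<in> sets M ==> \<exists>A'\<in>sets borel. AE x in M. x \<in> A \<longleftrightarrow> x \<in> A'"
  and u: "integrable M u" and orth: "!!q. real_polynomial_function q ==> (LINT x|M. u x * q x) = 0"
 shows "AE x in M. u x = 0"
proof -
 have [measurable]: "u \<in> borel_measurable M" using u by simp
 let ?N = "density M (\<lambda>x. ennreal \<bar>u x\<bar>)"
 have "(\<integral>\<^sup>+x. ennreal \<bar>u x\<bar> \<partial>M) < \<infinity>" using u by (simp add: integrable_iff_bounded)
 then have N: "finite_measure ?N"
  by (intro finite_measureI) (simp add: emeasure_density cong:)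
 have reg': "\<exists>A'\<in>sets borel. AE x in ?N. x \<in> A \<longleftrightarrow> x \<in> A'" if "A \<in> sets ?N" for A
  using reg[of A] that by (force simp: AE_density)
 have sgn: "integrable ?N (\<lambda>x. sgn (u x))" by (intro finite_measure.integrable_const_bound[OF N, of _ 1]) auto
 have "(LINT x|M. \<bar>u x\<bar>) \<le> 0 + e" if e: "0 < e" for e
 proof -
  obtain q where q: "real_polynomial_function q" "integrable ?N q" "(LINT x|?N. \<bar>sgn (u x) - q x\<bar>) < e"
   by (rule polynomials_dense[OF N S(1) _ _ reg' sgn e]) (use S(2) id in auto)
  have [measurable]: "q \<in> borel_measurable M" using q(2) by simp
  have i: "integrable M (\<lambda>x. \<bar>u x\<bar> * q x)" using q(2) by (simp add: integrable_density)
  then have i': "integrable M (\<lambda>x. u x * q x)" by (rule Bochner_Integration.integrable_bound) auto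
  have "(LINT x|M. \<bar>u x\<bar>) = (LINT x|M. \<bar>u x\<bar> - u x * q x)" using u i' orth[OF q(1)] by simp
  also have "... \<le> (LINT x|M. \<bar>u x\<bar> * \<bar>sgn (u x) - q x\<bar>)"
  proof (rule integral_mono)
   show "integrable M (\<lambda>x. \<bar>u x\<bar> * \<bar>sgn (u x) - q x\<bar>)"
    using integrable_abs[OF Bochner_Integration.integrable_diff[OF sgn q(2)]] by (simp add: integrable_density)
   show "\<bar>u x\<bar> - u x * q x \<le> \<bar>u x\<bar> * \<bar>sgn (u x) - q x\<bar>" for x
    using mult_left_mono[of "1 + q x" "\<bar>- 1 - q x\<bar>" "- u x"] mult_left_mono[of "1 - q x" "\<bar>1 - q x\<bar>" "u x"]
    by (cases "u x" "0 :: real" rule: linorder_cases) (simp_all add: algebra_simps)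
  qed (use u i' in auto)
  also have "... < e" using q(3) by (simp add: integral_density)
  finally show ?thesis by simp
 qed
 then have "(LINT x|M. \<bar>u x\<bar>) \<le> 0" by (rule field_le_epsilon)
 moreover have "0 \<le> (LINT x|M. \<bar>u x\<bar>)" by simp
 ultimately have "(LINT x|M. \<bar>u x\<bar>) = 0" by auto
 then show ?thesis using u by (simp add: integral_nonneg_eq_0_iff_AE)
qed

text \<open>Supplies the hypothesis \<open>reg\<close> for Hausdorff measure: a set of finite
  measure differs from its Borel hull by a null set.\<close>

lemma haus_regular:
 fixes S :: "'a::metric_space set"
 assumes k: "0 < k" and S: "S \<in> sets (hausdorff_measure k)" "\<H> k S < top" and A: "A \<in> sets (haus k S)"
 shows "\<exists>A'\<in>sets borel. AE x in haus k S. x \<in> A \<longleftrightarrow> x \<in> A'"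
proof -
 let ?H = "hausdorff_measure k :: 'a measure"
 have A': "A \<subseteq> S" "A \<in> sets ?H" using A S by (auto simp: sets_restrict_space_iff)
 obtain B where B: "B \<in> sets borel" "A \<subseteq> B" "\<H> k B = \<H> k A"
  using hausdorff_borel_hull[OF k, of A] .
 have fin: "\<H> k A \<noteq> top" using outer_mono[OF A'(1), of k] S(2) by auto
 have BH: "B \<in> sets ?H" by (rule borel_in_sets_hausdorff[OF k B(1)])
 have "emeasure ?H (B - A) = emeasure ?H B - emeasure ?H A"
  using A' B BH fin by (intro emeasure_Diff) (auto simp: emeasure_hausdorff[OF k])
 then have "B - A \<in> null_sets ?H" using A' BH B(3) fin by (simp add: emeasure_hausdorff[OF k] null_sets_def)
 from AE_not_in[OF this] have "AE x in haus k S. x \<in> A \<longleftrightarrow> x \<in> B"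
  using B(2) S(1) by (auto simp: AE_restrict_space_iff)
 then show ?thesis using B(1) by auto
qed

section \<open>Uniqueness of weak gradients\<close>

lemma real_polynomial_C1:
 fixes q :: "point => real"
 shows "real_polynomial_function q ==> \<exists>D. \<forall>G. C1_within G q D"
proof (induction rule: real_polynomial_function.induct)
 case (linear f)
 then show ?case
  by (intro exI[of _ "\<lambda>_. Blinfun f"]) (auto simp: C1_within_def bounded_linear_Blinfun_apply intro: bounded_linear_imp_has_derivative)
next
 case (const c)
 show ?case by (intro exI[of _ "\<lambda>_. 0"]) (auto simp: C1_within_def zero_blinfun.rep_eq)
next
 case (add f g)
 then obtain Df Dg where D: "\<forall>G. C1_within G f Df" "\<forall>G. C1_within G g Dg" by auto
 show ?case
 proof (intro exI allI)
  fix G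
  show "C1_within G (\<lambda>x. f x + g x) (\<lambda>x. Df x + Dg x)"
   using D unfolding C1_within_def by (auto simp: plus_blinfun.rep_eq intro!: continuous_intros)
 qed
next
 case (mult f g)
 then obtain Df Dg where D: "\<forall>G. C1_within G f Df" "\<forall>G. C1_within G g Dg" by auto
 show ?case
 proof (intro exI allI)
  fix G
  have e: "blinfun_apply (f x *\<^sub>R Dg x + g x *\<^sub>R Df x) = (\<lambda>h. f x * Dg x h + Df x h * g x)" for x
   by (simp add: fun_eq_iff blinfun.add_left blinfun.scaleR_left)
  show "C1_within G (\<lambda>x. f x * g x) (\<lambda>x. f x *\<^sub>R Dg x + g x *\<^sub>R Df x)"
   unfolding C1_within_def e using C1_withinD(1)[OF D(1)[rule_format]] C1_withinD(1)[OF D(2)[rule_format]] C1_withinD(2,3)[OF D(1)[rule_format]] C1_withinD(2,3)[OF D(2)[rule_format]] by (auto intro!: continuous_intros)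
 qed
qed

text \<open>Test fields are C1 on the whole space, while \<open>\<nu>\<close> is controlled only on
  \<open>G\<close>. The gradient \<open>g\<close> of a local level set function is C1 on an open set
  and normal to \<open>G\<close>, so its cross products with constant vectors are tangential; the
  bump makes them global.\<close>

lemma tangential_test_exists:
 assumes C: "C2_surface G \<nu>" and p: "p \<in> G"
 obtains r g where "0 < r" "!!x. x \<in> G \<inter> ball p r ==> g x \<noteq> 0 \<and> \<nu> x = g x /\<^sub>R norm (g x)"
  "!!q e. real_polynomial_function q ==>
   \<exists>X D. tangential_test_field G \<nu> X D \<and> (\<forall>x. X x = (bump p r x * q x) *\<^sub>R cross3 (g x) e)"
proof -
 obtain W \<phi> g H where W: "open W" "p \<in> W" "C2_on W \<phi> g H" "\<forall>x\<in>G \<inter> W. g x \<noteq> 0 \<and> \<nu> x = g x /\<^sub>R norm (g x)"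
  by (rule C2_surface_local[OF C p])
 obtain d where d: "0 < d" "cball p d \<subseteq> W" using W(1,2) open_contains_cball by blast
 define r where "r = d / 2"
 have r: "0 < r" "cball p (2 * r) \<subseteq> W" using d by (auto simp: r_def)
 have at: "at x within W = at x" if "x \<in> W" for x by (rule at_within_open[OF that W(1)])
 have g: "C1_within W g H" using W(3) at by (auto simp: C1_within_def C2_on_def)
 show ?thesis
 proof (rule that[OF r(1), of g])
  show "g x \<noteq> 0 \<and> \<nu> x = g x /\<^sub>R norm (g x)" if "x \<in> G \<inter> ball p r" for x
   using that r W(4) by force
  fix q :: "point => real" and e :: point assume "real_polynomial_function q"
  then obtain Dq where Dq: "C1_within W q Dq" using real_polynomial_C1 by auto
  have bl: "bounded_linear (\<lambda>v. cross3 v e)"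
   by (simp add: linear_conv_bounded_linear[symmetric] linear_iff cross_add_left cross_mult_left)
  define Z where "Z x = q x *\<^sub>R cross3 (g x) e" for x
  define DZ where "DZ = product_deriv q Dq (\<lambda>x. cross3 (g x) e) (\<lambda>x. Blinfun (\<lambda>v. cross3 v e) o\<^sub>L H x)"
  have "C1_within W (\<lambda>x. cross3 (g x) e) (\<lambda>x. Blinfun (\<lambda>v. cross3 v e) o\<^sub>L H x)"
   unfolding C1_within_def
  proof (intro conjI ballI)
   show "((\<lambda>x. cross3 (g x) e) has_derivative blinfun_apply (Blinfun (\<lambda>v. cross3 v e) o\<^sub>L H x)) (at x within W)" if "x \<in> W" for x
    using bounded_linear.has_derivative[OF bl C1_withinD(1)[OF g that]]
    by (rule has_derivative_eq_rhs) (simp add: fun_eq_iff bounded_linear_Blinfun_apply[OF bl])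
  qed (intro continuous_intros C1_withinD(2)[OF g])
  then have Z: "C1_within W Z DZ" unfolding Z_def[abs_def] DZ_def by (rule C1_within_product[OF Dq])
  define X where "X x = bump p r x *\<^sub>R Z x" for x
  define DX where "DX = product_deriv (bump p r) (\<lambda>x. blinfun_inner_left (bump_grad p r x)) Z DZ"
  define D where "D x = (if x \<in> W then DX x else 0)" for x
  have X: "C1_within W X DX" unfolding X_def[abs_def] DX_def
   by (rule C1_within_product[OF C1_within_gradient[OF bump_deriv continuous_on_bump_grad] Z])
  let ?O = "- cball p (2 * r)"
  have off: "2 * r \<le> dist x p" if "x \<in> ?O" for x using that by (simp add: dist_commute)
  have X0: "X x = 0" and D0: "D x = 0" if "x \<in> ?O" for x
   using bump_eq_0[OF r(1) off[OF that]] by (auto simp: X_def D_def DX_def intro!: blinfun_eqI simp: product_deriv_apply)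
  have UN: "W \<union> ?O = UNIV" using r(2) by auto
  have dX: "(X has_derivative blinfun_apply (D x)) (at x)" for x
  proof (cases "x \<in> W")
   case True
   then show ?thesis using C1_withinD(1)[OF X True] by (simp add: D_def at)
  next
   case False
   then have x: "x \<in> ?O" using r(2) by auto
   have "(X has_derivative (\<lambda>_. 0)) (at x)"
    by (rule has_derivative_transform_within_open[OF has_derivative_const open_Compl[OF closed_cball] x, of 0]) (use X0 in auto)
   then show ?thesis using False by (simp add: D_def zero_blinfun.rep_eq)
  qed
  have cD: "continuous_on UNIV D"
   unfolding UN[symmetric]
  proof (rule continuous_on_open_Un[OF W(1)])
   show "continuous_on W D" by (rule continuous_on_eq[OF C1_withinD(2)[OF X]]) (simp add: D_def)
   show "continuous_on ?O D" by (rule) (use D0 in auto)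
  qed (intro open_Compl closed_cball)
  have "closure {x. X x \<noteq> 0} \<subseteq> cball p (2 * r)" by (rule closure_minimal) (use X0 in blast, simp)
  then have cl: "compact (closure {x. X x \<noteq> 0})"
   by (meson bounded_cball bounded_subset closed_closure compact_eq_bounded_closed)
  have "X x \<bullet> \<nu> x = 0" if x: "x \<in> G" for x
  proof (cases "x \<in> W")
   case True
   then show ?thesis using W(4) x by (simp add: X_def Z_def dot_cross_self)
  next
   case False
   then have "x \<in> ?O" using r(2) by auto
   then show ?thesis using X0 by simp
  qed
  then have "tangential_test_field G \<nu> X D"
   unfolding tangential_test_field_def using dX cD cl C by (auto simp: C2_surface_def)
  then show "\<exists>X D. tangential_test_field G \<nu> X D \<and> (\<forall>x. X x = (bump p r x * q x) *\<^sub>R cross3 (g x) e)"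
   by (intro exI[of _ X] exI[of _ D]) (simp add: X_def Z_def)
 qed
qed

lemma test_field_C1_within:
 "tangential_test_field G \<nu> X D ==> C1_within G X D" "tangential_test_field G \<nu> X D ==> p \<in> G ==> X p \<bullet> \<nu> p = 0"
 by (auto simp: tangential_test_field_def C1_within_def intro: has_derivative_at_withinI continuous_on_subset)

text \<open>Testing shows that all polynomial moments of
  \<open>bump p r x * (Y x \<bullet> cross3 (g x) e)\<close> vanish, hence this function does almost
  everywhere. Over all basis vectors \<open>e\<close> this makes \<open>Y\<close> parallel to the
  normal, and a tangential vector with that property is 0.\<close>

lemma tangential_field_eq_0:
 assumes C: "C2_surface G \<nu>" and comp: "compact G" and Y: "sq_int (haus 2 G) Y"
  and tan: "!!x. x \<in> G ==> Y x \<bullet> \<nu> x = 0"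
  and test: "!!X D. tangential_test_field G \<nu> X D ==> (LINT x|haus 2 G. Y x \<bullet> X x) = 0"
 shows "AE x in haus 2 G. Y x = 0"
proof -
 let ?R = "haus 2 G"
 have fin: "\<H> 2 G < top" by (rule hausdorff_surface_finite[OF C comp])
 have Gb: "G \<in> sets borel" using comp by (simp add: compact_imp_closed)
 have sp: "space ?R = G" by (simp add: space_restrict_space)
 have "\<forall>p\<in>G. \<exists>r>0. AE x in ?R. x \<in> ball p r --> Y x = 0"
 proof
  fix p assume p: "p \<in> G"
  obtain r g where r: "0 < r" and g: "!!x. x \<in> G \<inter> ball p r ==> g x \<noteq> 0 \<and> \<nu> x = g x /\<^sub>R norm (g x)"
   and ex: "!!q e. real_polynomial_function q ==>
    \<exists>X D. tangential_test_field G \<nu> X D \<and> (\<forall>x. X x = (bump p r x * q x) *\<^sub>R cross3 (g x) e)"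
   by (rule tangential_test_exists[OF C p]) blast
  have "AE x in ?R. bump p r x * (Y x \<bullet> cross3 (g x) e) = 0" for e
  proof (rule orthogonal_polynomials_eq_0[OF comp])
   obtain X D where X: "tangential_test_field G \<nu> X D" "!!x. X x = (bump p r x * 1) *\<^sub>R cross3 (g x) e"
    using ex[of "\<lambda>_. 1"] by blast
   have "sq_int ?R X"
    by (rule sq_int_continuous[OF _ comp C1_withinD(3)[OF test_field_C1_within(1)[OF X(1)]] order_refl Gb fin]) simp
   from sq_int_inner(1)[OF Y this] show "integrable ?R (\<lambda>x. bump p r x * (Y x \<bullet> cross3 (g x) e))" by (simp add: X(2))
   fix q :: "point => real" assume "real_polynomial_function q"
   from ex[OF this, of e] obtain X D where X: "tangential_test_field G \<nu> X D" "!!x. X x = (bump p r x * q x) *\<^sub>R cross3 (g x) e"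
    by auto
   have "(\<lambda>x. bump p r x * (Y x \<bullet> cross3 (g x) e) * q x) = (\<lambda>x. Y x \<bullet> X x)" by (simp add: X(2) mult_ac)
   then show "(LINT x|?R. bump p r x * (Y x \<bullet> cross3 (g x) e) * q x) = 0" using test[OF X(1)] by simp
  qed (use Gb sp in \<open>auto intro: cont_measurable_haus haus_regular[OF pos2 borel_in_sets_hausdorff fin]\<close>)
  then have "AE x in ?R. \<forall>e\<in>Basis. bump p r x * (Y x \<bullet> cross3 (g x) e) = 0" by (intro AE_finite_allI finite_Basis)
  then have "AE x in ?R. x \<in> ball p r --> Y x = 0"
  proof (rule AE_mp, intro AE_I2 impI)
   fix x assume x: "x \<in> space ?R" "\<forall>e\<in>Basis. bump p r x * (Y x \<bullet> cross3 (g x) e) = 0" "x \<in> ball p r"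
   then have gx: "g x \<noteq> 0" "\<nu> x = g x /\<^sub>R norm (g x)" using g[of x] sp by auto
   have "cross3 (Y x) (g x) \<bullet> e = 0" if "e \<in> Basis" for e
    using x(2,3) that cross_triple[of "Y x" "g x" e] by (simp add: bump_eq_1 dist_commute inner_commute)
   then have "cross3 (Y x) (g x) = 0" using euclidean_all_zero_iff by auto
   moreover have "Y x \<bullet> g x = 0" using tan[of x] x(1) gx sp by simp
   ultimately show "Y x = 0" using norm_cross_dot[of "Y x" "g x"] gx(1) by simp
  qed
  then show "\<exists>r>0. AE x in ?R. x \<in> ball p r --> Y x = 0" using r by auto
 qed
 from bchoice[OF this] obtain r where "\<forall>p\<in>G. 0 < r p \<and> (AE x in ?R. x \<in> ball p (r p) --> Y x = 0)" by auto
 then have r: "!!p. p \<in> G ==> 0 < r p" "!!p. p \<in> G ==> AE x in ?R. x \<in> ball p (r p) --> Y x = 0" by auto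
 obtain P where P: "P \<subseteq> G" "finite P" "G \<subseteq> (\<Union>p\<in>P. ball p (r p))"
  by (rule compactE_image[OF comp, of G "\<lambda>p. ball p (r p)"]) (use r(1) in force)+
 have "AE x in ?R. \<forall>p\<in>P. x \<in> ball p (r p) --> Y x = 0" using P(1) r(2) by (intro AE_finite_allI P(2)) auto
 then show ?thesis by (rule) (use P(3) sp in \<open>auto intro!: AE_I2\<close>)
qed

lemma weak_grad_unique:
 assumes C: "C2_surface G \<nu>" and comp: "compact G" and Y: "is_weak_grad G \<nu> f Y" "is_weak_grad G \<nu> f Y'"
 shows "AE x in haus 2 G. Y x = Y' x"
proof -
 let ?R = "haus 2 G"
 have SH: "G \<in> sets (hausdorff_measure 2)" using comp by (auto intro!: borel_in_sets_hausdorff simp: compact_imp_closed)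
 have sq: "sq_int ?R Y" "sq_int ?R Y'"
  using Y by (auto simp: is_weak_grad_def L2_on_iff[OF SH])
 have "AE x in ?R. Y x - Y' x = 0"
 proof (rule tangential_field_eq_0[OF C comp sq_int_diff[OF sq]])
  show "(Y x - Y' x) \<bullet> \<nu> x = 0" if "x \<in> G" for x using Y that by (simp add: is_weak_grad_def inner_diff_left)
  fix X D assume X: "tangential_test_field G \<nu> X D"
  have "sq_int ?R X"
   using comp by (intro sq_int_continuous[OF _ comp C1_withinD(3)[OF test_field_C1_within(1)[OF X]]]
    hausdorff_surface_finite[OF C comp]) (auto simp: compact_imp_closed)
  then have i: "integrable ?R (\<lambda>x. Y x \<bullet> X x)" "integrable ?R (\<lambda>x. Y' x \<bullet> X x)" using sq by (auto intro: sq_int_inner)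
  have "(LINT x:G|hausdorff_measure 2. f x * surface_div \<nu> D x) = - (LINT x|?R. Y x \<bullet> X x)"
   "(LINT x:G|hausdorff_measure 2. f x * surface_div \<nu> D x) = - (LINT x|?R. Y' x \<bullet> X x)"
   using Y X unfolding is_weak_grad_def set_integral_haus[OF SH, symmetric] by auto
  then show "(LINT x|?R. (Y x - Y' x) \<bullet> X x) = 0" using i by (simp add: inner_diff_left)
 qed
 then show ?thesis by auto
qed

section \<open>Distances between a surface and an inscribed polygon\<close>

lemma normalize_lipschitz:
 fixes a b :: "'a::real_normed_vector"
 assumes "a \<noteq> 0" "b \<noteq> 0" shows "norm (a /\<^sub>R norm a - b /\<^sub>R norm b) \<le> 2 * norm (a - b) / norm b"
proof -
 have "a /\<^sub>R norm a - b /\<^sub>R norm b = ((norm b - norm a) / norm b) *\<^sub>R (a /\<^sub>R norm a) + (a - b) /\<^sub>R norm b"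
  using assms by (simp add: algebra_simps divide_inverse)
 then have "norm (a /\<^sub>R norm a - b /\<^sub>R norm b) \<le> norm (((norm b - norm a) / norm b) *\<^sub>R (a /\<^sub>R norm a)) + norm ((a - b) /\<^sub>R norm b)"
  by (simp add: norm_triangle_ineq del: norm_scaleR)
 also have "... = (\<bar>norm b - norm a\<bar> + norm (a - b)) / norm b"
 proof -
  have 1: "norm (a /\<^sub>R norm a) = 1" using assms by simp
  show ?thesis unfolding norm_scaleR[of "(norm b - norm a) / norm b"] 1 by (simp add: divide_inverse mult.commute abs_mult distrib_left)
 qed
 also have "... \<le> 2 * norm (a - b) / norm b"
  using norm_triangle_ineq3[of b a] by (intro divide_right_mono) (auto simp: norm_minus_commute)
 finally show ?thesis .
qed

definition normal_bound :: "(point => point) => real => point => point => bool" where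
 "normal_bound \<nu> K p q \<longleftrightarrow> norm (\<nu> p - \<nu> q) \<le> K * norm (p - q) \<and> \<bar>(p - q) \<bullet> \<nu> q\<bar> \<le> K * (norm (p - q))\<^sup>2"

text \<open>The gradient is Lipschitz on a ball and bounded away from 0, which bounds the change of
  the normal. For the second estimate the mean value theorem on the chord gives a point where the
  gradient is orthogonal to the chord, as \<open>\<phi>\<close> vanishes at both ends.\<close>

lemma normal_bound_local:
 assumes C: "C2_surface G \<nu>" and p0: "p0 \<in> G"
 shows "\<exists>r K. 0 < r \<and> 0 \<le> K \<and> (\<forall>p \<in> G \<inter> ball p0 r. \<forall>q \<in> G \<inter> ball p0 r. normal_bound \<nu> K p q)"
proof -
 obtain W \<phi> g H where W: "open W" "p0 \<in> W" "C2_on W \<phi> g H" "G \<inter> W = {x\<in>W. \<phi> x = 0}"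
  "\<forall>x\<in>G \<inter> W. g x \<noteq> 0 \<and> \<nu> x = g x /\<^sub>R norm (g x)"
  by (rule C2_surface_local[OF C p0])
 have d\<phi>: "(\<phi> has_derivative (\<lambda>h. h \<bullet> g x)) (at x)" and dg: "(g has_derivative H x) (at x)" if "x \<in> W" for x
  using W(3) that by (auto simp: C2_on_def gderiv_def)
 have cg: "continuous_on W g" using dg by (meson has_derivative_continuous continuous_at_imp_continuous_on)
 have cH: "continuous_on W H" using W(3) by (simp add: C2_on_def)
 have gp0: "0 < norm (g p0)" using W(2,5) p0 by auto
 obtain r1 where r1: "0 < r1" "cball p0 r1 \<subseteq> W" using W(1,2) open_contains_cball by blast
 obtain r2 where r2: "0 < r2" "!!y. y \<in> W ==> dist y p0 < r2 ==> dist (g y) (g p0) < norm (g p0) / 2"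
  using cg W(2) gp0 unfolding continuous_on_iff by (meson half_gt_zero)
 define r where "r = min r1 r2"
 have r: "0 < r" "cball p0 r \<subseteq> W" using r1 r2 by (auto simp: r_def)
 define m where "m = norm (g p0) / 2"
 have m: "0 < m" using gp0 by (simp add: m_def)
 have gm: "m \<le> norm (g x)" if "x \<in> ball p0 r" for x
 proof -
  have "dist (g x) (g p0) < m" using r2(2)[of x] r that by (auto simp: r_def m_def dist_commute subset_iff)
  then show ?thesis using norm_triangle_ineq2[of "g p0" "g p0 - g x"] by (simp add: dist_norm m_def norm_minus_commute)
 qed
 have "compact (H ` cball p0 r)" by (rule compact_continuous_image[OF continuous_on_subset[OF cH r(2)] compact_cball])
 then have "bounded (H ` cball p0 r)" by (rule compact_imp_bounded)
 then obtain B where B: "0 < B" "!!x. x \<in> cball p0 r ==> norm (H x) \<le> B" unfolding bounded_pos by auto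
 have g_lip: "norm (g x - g y) \<le> B * norm (x - y)" if "x \<in> ball p0 r" "y \<in> ball p0 r" for x y
 proof (rule differentiable_bound[OF convex_ball, of p0 r g "\<lambda>x. blinfun_apply (H x)"])
  show "(g has_derivative blinfun_apply (H x)) (at x within ball p0 r)" if "x \<in> ball p0 r" for x
   by (rule has_derivative_at_withinI[OF dg]) (use that r(2) in auto)
  show "onorm (blinfun_apply (H x)) \<le> B" if "x \<in> ball p0 r" for x
   using B(2)[of x] that by (simp add: norm_blinfun.rep_eq)
 qed (use that in auto)
 show ?thesis
 proof (rule exI[of _ r], rule exI[of _ "2 * B / m"], intro conjI ballI)
  show "0 < r" "0 \<le> 2 * B / m" using r B m by auto
  fix p q assume "p \<in> G \<inter> ball p0 r" "q \<in> G \<inter> ball p0 r"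
  then have pq: "p \<in> G" "q \<in> G" "p \<in> ball p0 r" "q \<in> ball p0 r" by auto
  then have W': "p \<in> W" "q \<in> W" using r(2) by auto
  have \<nu>: "\<nu> p = g p /\<^sub>R norm (g p)" "\<nu> q = g q /\<^sub>R norm (g q)" "g p \<noteq> 0" "g q \<noteq> 0"
   using W(5) pq W' by auto
  have "norm (\<nu> p - \<nu> q) \<le> 2 * norm (g p - g q) / norm (g q)"
   unfolding \<nu>(1,2) by (rule normalize_lipschitz[OF \<nu>(3,4)])
  also have "... \<le> 2 * (B * norm (p - q)) / m"
   using g_lip[OF pq(3,4)] gm[OF pq(4)] m B by (intro frac_le) auto
  finally have 1: "norm (\<nu> p - \<nu> q) \<le> 2 * B / m * norm (p - q)" by simp
  define z where "z t = q + t *\<^sub>R (p - q)" for t :: real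
  have zin: "z t \<in> ball p0 r" if "0 \<le> t" "t \<le> 1" for t
   using convexD_alt[OF convex_ball pq(4,3), of t] that by (simp add: z_def algebra_simps)
  have dz: "((\<lambda>t. \<phi> (z t)) has_real_derivative (p - q) \<bullet> g (z t)) (at t)" if "0 \<le> t" "t \<le> 1" for t
  proof -
   have "(z has_derivative (\<lambda>s. s *\<^sub>R (p - q))) (at t)" unfolding z_def[abs_def] by (auto intro!: derivative_eq_intros)
   moreover have "z t \<in> W" using zin[OF that] r(2) by auto
   ultimately show ?thesis using has_derivative_compose[of z _ t UNIV \<phi>] d\<phi>
    by (fastforce simp: has_field_derivative_def mult.commute[of _ "(p - q) \<bullet> _"])
  qed
  have "\<exists>t>0. t < 1 \<and> \<phi> (z 1) - \<phi> (z 0) = (1 - 0) * ((p - q) \<bullet> g (z t))"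
   by (rule MVT2) (use dz in auto)
  then obtain t where t: "0 < t" "t < 1" "\<phi> (z 1) - \<phi> (z 0) = (p - q) \<bullet> g (z t)" by auto
  have "\<phi> p = 0" "\<phi> q = 0" using W(4) W' pq by auto
  then have 0: "(p - q) \<bullet> g (z t) = 0" using t by (simp add: z_def)
  have "\<bar>(p - q) \<bullet> g q\<bar> = \<bar>(p - q) \<bullet> (g q - g (z t))\<bar>" using 0 by (simp add: inner_diff_right)
  also have "... \<le> norm (p - q) * norm (g q - g (z t))" by (rule Cauchy_Schwarz_ineq2)
  also have "... \<le> norm (p - q) * (B * norm (p - q))"
  proof (rule mult_left_mono)
   have "norm (g q - g (z t)) \<le> B * norm (q - z t)" using zin[of t] t by (intro g_lip pq) auto
   also have "norm (q - z t) \<le> norm (p - q)" using t by (simp add: z_def mult_left_le_one_le)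
   finally show "norm (g q - g (z t)) \<le> B * norm (p - q)" using B by simp
  qed simp
  finally have "\<bar>(p - q) \<bullet> g q\<bar> \<le> B * (norm (p - q))\<^sup>2" by (simp add: power2_eq_square mult_ac)
  then have "\<bar>(p - q) \<bullet> \<nu> q\<bar> \<le> B * (norm (p - q))\<^sup>2 / m"
   using gm[OF pq(4)] m unfolding \<nu>(2) by (simp add: divide_inverse[symmetric] mult.commute[of "inverse _"]) (intro frac_le; simp)
  also have "... \<le> 2 * B / m * (norm (p - q))\<^sup>2" using B m by (simp add: field_simps)
  finally show "normal_bound \<nu> (2 * B / m) p q" using 1 by (simp add: normal_bound_def)
 qed
qed

lemma surface_constants:
 assumes C: "C2_surface G \<nu>" and comp: "compact G"
 obtains K where "1 \<le> K" "!!p q. p \<in> G ==> q \<in> G ==> norm (\<nu> p - \<nu> q) \<le> K * norm (p - q)"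
  "!!p q. p \<in> G ==> q \<in> G ==> \<bar>(p - q) \<bullet> \<nu> q\<bar> \<le> K * (norm (p - q))\<^sup>2"
proof -
 have "\<forall>x. \<exists>r k. x \<in> G --> 0 < r \<and> 0 \<le> k \<and> (\<forall>p \<in> G \<inter> ball x r. \<forall>q \<in> G \<inter> ball x r. normal_bound \<nu> k p q)"
  using normal_bound_local[OF C] by simp
 then obtain r k where f: "!!x. x \<in> G ==> 0 < r x \<and> 0 \<le> k x" and
  nb: "!!x p q. x \<in> G ==> p \<in> G \<inter> ball x (r x) ==> q \<in> G \<inter> ball x (r x) ==> normal_bound \<nu> (k x) p q"
  by (metis (no_types, lifting))
 obtain P where P: "P \<subseteq> G" "finite P" "G \<subseteq> (\<Union>p\<in>P. ball p (r p))"
  by (rule compactE_image[OF comp, of G "\<lambda>p. ball p (r p)"]) (use f in force)+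
 obtain e where e: "0 < e" "!!x. x \<in> G ==> \<exists>Y\<in>(\<lambda>p. ball p (r p)) ` P. ball x e \<subseteq> Y"
  by (rule Heine_Borel_lemma[OF comp, of "(\<lambda>p. ball p (r p)) ` P"]) (use P in auto)
 \<comment> \<open>\<open>e\<close> is a Lebesgue number of the cover: pairs closer than
   \<open>e\<close> share a ball and obey its local constant. For the others the trivial bounds 2
   and \<open>norm (p - q)\<close> are absorbed by \<open>2 / e\<close> and
   \<open>1 / e\<close>.\<close>
 define K where "K = 1 + 2 / e + sum k P"
 have sum0: "0 \<le> sum k P" using f P(1) by (intro sum_nonneg) auto
 have Kp: "k p \<le> K" if "p \<in> P" for p
 proof -
  have "k p \<le> sum k P" using f P(1,2) that by (intro member_le_sum) auto
  then show ?thesis using e by (simp add: K_def add_increasing)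
 qed
 have K: "1 \<le> K" "2 / e \<le> K" "1 / e \<le> K" using e sum0 by (auto simp: K_def field_simps)
 have main: "normal_bound \<nu> K p q" if pq: "p \<in> G" "q \<in> G" for p q
 proof (cases "dist q p < e")
  case True
  obtain x where x: "x \<in> P" "ball q e \<subseteq> ball x (r x)" using e(2)[OF pq(2)] by auto
  then have "p \<in> ball x (r x)" "q \<in> ball x (r x)" using True e(1) by (auto simp: subset_iff)
  then have "normal_bound \<nu> (k x) p q" using nb[of x p q] P(1) x(1) pq by auto
  then show ?thesis using Kp[OF x(1)] unfolding normal_bound_def
   by (meson mult_right_mono norm_ge_zero order_trans zero_le_power2)
 next
  case False
  then have d: "e \<le> norm (p - q)" by (simp add: dist_norm norm_minus_commute)
  have n: "norm (\<nu> p) = 1" "norm (\<nu> q) = 1" using C2_surface_norm[OF C] pq by auto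
  have "norm (\<nu> p - \<nu> q) \<le> 2" using norm_triangle_ineq4[of "\<nu> p" "\<nu> q"] n by simp
  also have "... \<le> 2 / e * norm (p - q)" using d e by (simp add: field_simps)
  also have "... \<le> K * norm (p - q)" using K by (intro mult_right_mono) auto
  finally have 1: "norm (\<nu> p - \<nu> q) \<le> K * norm (p - q)" .
  have "\<bar>(p - q) \<bullet> \<nu> q\<bar> \<le> norm (p - q)" using Cauchy_Schwarz_ineq2[of "p - q" "\<nu> q"] n by simp
  also have "... \<le> 1 / e * (norm (p - q))\<^sup>2" using d e by (simp add: field_simps power2_eq_square mult_right_mono)
  also have "... \<le> K * (norm (p - q))\<^sup>2" using K by (intro mult_right_mono) auto
  finally show ?thesis using 1 by (simp add: normal_bound_def)
 qed
 show ?thesis by (rule that[OF K(1)]) (use main in \<open>auto simp: normal_bound_def\<close>)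
qed

text \<open>The derivative of the squared distance along a chart vanishes at a nearest point, so
  \<open>x - p\<close> is orthogonal to the tangent plane.\<close>

lemma nearest_point_normal:
 assumes C: "C2_surface G \<nu>" and p: "p \<in> G" and near: "!!q. q \<in> G ==> dist x p \<le> dist x q"
 shows "x = p + ((x - p) \<bullet> \<nu> p) *\<^sub>R \<nu> p"
proof -
 obtain e1 e2 U V F where c: "surface_chart G \<nu> p e1 e2 U V F" using surface_chart_exists[OF C p] .
 note ch = surface_chartD[OF c]
 define y where "y = chart_coord e1 e2 p p"
 have y: "y \<in> V" "F y = p" using surface_chart_inverse[OF c p ch(2)] by (auto simp: y_def)
 have fr: "frame e1 e2 (\<nu> p)" by (rule ch(5))
 let ?T = "chart_deriv e1 e2 (\<nu> p) (\<nu> (F y))"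
 have d: "((\<lambda>y. (x - F y) \<bullet> (x - F y)) has_derivative (\<lambda>v. (x - F y) \<bullet> (0 - ?T v) + (0 - ?T v) \<bullet> (x - F y))) (at y)"
  by (intro derivative_intros ch(9)[OF y(1)])
 have le: "(x - F y) \<bullet> (x - F y) \<le> (x - F z) \<bullet> (x - F z)" if "z \<in> V" for z
  using near[OF ch(10)[OF that]] y(2) by (simp add: dist_norm norm_le)
 have "(\<lambda>v. (x - F y) \<bullet> (0 - ?T v) + (0 - ?T v) \<bullet> (x - F y)) = (\<lambda>v. 0)"
  by (rule differential_zero_maxmin[OF y(1) ch(4) d]) (use le in auto)
 then have "(x - F y) \<bullet> (0 - ?T v) + (0 - ?T v) \<bullet> (x - F y) = 0" for v by (rule fun_cong)
 then have z: "(x - p) \<bullet> ?T v = 0" for v using y(2) by (simp add: inner_commute)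
 have "?T (1, 0) = e1" "?T (0, 1) = e2"
  using fr y(2) by (auto simp: chart_deriv_def frame_def inner_commute)
 then have "(x - p) \<bullet> e1 = 0" "(x - p) \<bullet> e2 = 0" using z[of "(1, 0)"] z[of "(0, 1)"] by auto
 moreover have "x - p = ((x - p) \<bullet> e1) *\<^sub>R e1 + ((x - p) \<bullet> e2) *\<^sub>R e2 + ((x - p) \<bullet> \<nu> p) *\<^sub>R \<nu> p"
  using fr unfolding frame_def by simp
 ultimately have "x - p = ((x - p) \<bullet> \<nu> p) *\<^sub>R \<nu> p" by simp
 then show ?thesis by auto
qed

lemma fermi_proj_eq:
 assumes "fermi_stripe G \<nu> \<delta> U" "x \<in> U" "p \<in> G" "\<bar>s\<bar> < \<delta>" "x = p + s *\<^sub>R \<nu> p"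
 shows "fermi_proj G \<nu> \<delta> x = p"
proof -
 have "\<exists>!(p, s). p \<in> G \<and> \<bar>s\<bar> < \<delta> \<and> x = p + s *\<^sub>R \<nu> p" using assms by (auto simp: fermi_stripe_def)
 then have "p' = p" if "p' \<in> G" "\<bar>s'\<bar> < \<delta>" "x = p' + s' *\<^sub>R \<nu> p'" for p' s' using assms that by blast
 then show ?thesis unfolding fermi_proj_def using assms by auto
qed

text \<open>If \<open>h < \<delta>\<close>, a nearest point of \<open>G\<close> gives a
  decomposition with \<open>\<bar>s\<bar> \<le> h < \<delta>\<close>, which by uniqueness is the one
  selected by \<open>fermi_proj\<close>. Otherwise \<open>\<bar>s\<bar> < \<delta> \<le> h\<close>
  holds anyway. Thus the height is bounded independently of the width of the stripe.\<close>

lemma fermi_decomposition: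
 assumes C: "C2_surface G \<nu>" and F: "fermi_stripe G \<nu> \<delta> U" and x: "x \<in> U" and q: "q \<in> G" "dist x q \<le> h"
 obtains s where "fermi_proj G \<nu> \<delta> x \<in> G" "x = fermi_proj G \<nu> \<delta> x + s *\<^sub>R \<nu> (fermi_proj G \<nu> \<delta> x)" "\<bar>s\<bar> < \<delta>" "\<bar>s\<bar> \<le> h"
proof (cases "h < \<delta>")
 case False
 have "\<exists>!(p, s). p \<in> G \<and> \<bar>s\<bar> < \<delta> \<and> x = p + s *\<^sub>R \<nu> p" using F x by (auto simp: fermi_stripe_def)
 then obtain p s where "p \<in> G" "\<bar>s\<bar> < \<delta>" "x = p + s *\<^sub>R \<nu> p" by auto
 then show ?thesis using fermi_proj_eq[OF F x] that False by auto
next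
 case True
 have "closed G" using C by (simp add: C2_surface_def)
 then obtain p where p: "p \<in> G" "!!y. y \<in> G ==> dist x p \<le> dist x y"
  using distance_attains_inf[of G x] q(1) by auto
 define s where "s = (x - p) \<bullet> \<nu> p"
 have xs: "x = p + s *\<^sub>R \<nu> p" unfolding s_def by (rule nearest_point_normal[OF C p])
 have "\<bar>s\<bar> \<le> norm (x - p)" using Cauchy_Schwarz_ineq2[of "x - p" "\<nu> p"] C2_surface_norm[OF C p(1)] by (simp add: s_def)
 then have "\<bar>s\<bar> \<le> h" using p(2)[OF q(1)] q(2) by (simp add: dist_norm)
 then show ?thesis using fermi_proj_eq[OF F x p(1) _ xs] that p(1) xs True by auto
qed

subsection \<open>Polygons\<close>

lemma poly_edge_subset_hull: "i < length ps ==> poly_edge ps i \<subseteq> convex hull (set ps)"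
 unfolding poly_edge_def by (intro closed_segment_subset_convex_hull hull_inc) (auto intro!: nth_mem mod_less_divisor)

lemma poly_boundary_subset_hull: "poly_boundary ps \<subseteq> convex hull (set ps)"
 using poly_edge_subset_hull unfolding poly_boundary_def poly_edges_def by auto

lemma compact_poly_boundary: "compact (poly_boundary ps)"
 unfolding poly_boundary_def poly_edges_def by (auto simp: poly_edge_def)

lemma vertices_subset_boundary: "set ps \<subseteq> poly_boundary ps"
 unfolding poly_boundary_def poly_edges_def poly_edge_def by (force simp: in_set_conv_nth)

lemma poly_region_subset_affine: "poly_region ps \<subseteq> affine hull (set ps)"
 using poly_boundary_subset_hull convex_hull_subset_affine_hull unfolding poly_region_def by auto

text \<open>From a point of the plane outside the hull, the ray away from its nearest hull point
  never meets the hull. It stays in one component of the complement of the boundary, which is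
  therefore unbounded.\<close>

lemma poly_region_subset_hull:
 assumes "set ps \<noteq> {}" shows "poly_region ps \<subseteq> convex hull (set ps)"
proof
 fix x assume x: "x \<in> poly_region ps"
 show "x \<in> convex hull (set ps)"
 proof (rule ccontr)
  let ?C = "convex hull (set ps)" and ?A = "affine hull (set ps)" and ?B = "poly_boundary ps"
  assume xC: "x \<notin> ?C"
  then have xA: "x \<in> ?A - ?B" and bd: "bounded (connected_component_set (?A - ?B) x)"
   using x poly_boundary_subset_hull by (auto simp: poly_region_def)
  have cC: "compact ?C" by (simp add: compact_convex_hull finite_imp_compact)
  obtain c where c: "c \<in> ?C" "!!y. y \<in> ?C ==> dist x c \<le> dist x y"
   using distance_attains_inf[OF compact_imp_closed[OF cC], of x] assms by auto
  define r where "r t = x + t *\<^sub>R (x - c)" for t :: real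
  have nz: "x - c \<noteq> 0" using c(1) xC by auto
  have sep: "(x - c) \<bullet> (y - c) \<le> 0" if "y \<in> ?C" for y
   using any_closest_point_dot[OF convex_convex_hull compact_imp_closed[OF cC] c(1) that, of x] c(2) by simp
  have rC: "r t \<notin> ?C" if "0 \<le> t" for t
  proof
   assume "r t \<in> ?C"
   from sep[OF this] have "(1 + t) * ((x - c) \<bullet> (x - c)) \<le> 0"
    by (simp add: r_def algebra_simps)
   moreover have "0 < (1 + t) * ((x - c) \<bullet> (x - c))" using that nz by auto
   ultimately show False by simp
  qed
  have rA: "r t \<in> ?A" for t
  proof -
   have "r t = (1 + t) *\<^sub>R x + (- t) *\<^sub>R c" by (simp add: r_def algebra_simps)
   moreover have "c \<in> ?A" using c(1) convex_hull_subset_affine_hull by auto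
   ultimately show ?thesis using mem_affine[OF affine_affine_hull, of x "set ps" c "1 + t" "- t"] xA by simp
  qed
  have "connected (r ` {0..})" unfolding r_def[abs_def] by (intro connected_continuous_image continuous_intros) auto
  moreover have "r ` {0..} \<subseteq> ?A - ?B" using rA rC poly_boundary_subset_hull by auto
  moreover have "x \<in> r ` {0..}" by (rule) (auto simp: r_def)
  ultimately have "r ` {0..} \<subseteq> connected_component_set (?A - ?B) x" by (intro connected_component_maximal)
  then have "bounded (r ` {0..})" using bd bounded_subset by auto
  then obtain M where M: "!!t. 0 \<le> t ==> norm (r t) \<le> M" unfolding bounded_iff by auto
  define t where "t = (\<bar>M\<bar> + norm x + 1) / norm (x - c)"
  have "norm (t *\<^sub>R (x - c)) \<le> norm (r t) + norm x" using norm_triangle_ineq4[of "r t" x] by (simp add: r_def)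
  moreover have "norm (t *\<^sub>R (x - c)) = \<bar>M\<bar> + norm x + 1" using nz by (simp add: t_def)
  moreover have "norm (r t) \<le> M" using M[of t] by (simp add: t_def)
  ultimately show False by simp
 qed
qed

text \<open>Components of a relatively open set in the plane are open. The predicate
  \<open>P\<close> is instantiated with boundedness for the inside and with its negation for the
  outside.\<close>

lemma poly_complement_components_open:
 "openin (top_of_set (affine hull (set ps))) {x \<in> affine hull (set ps) - poly_boundary ps.
   P (connected_component_set (affine hull (set ps) - poly_boundary ps) x)}" (is "openin (top_of_set ?A) ?G")
proof (subst openin_subopen, intro ballI)
 let ?B = "poly_boundary ps"
 have oAB: "openin (top_of_set ?A) (?A - ?B)"
  using compact_imp_closed[OF compact_poly_boundary] by (metis Diff_eq open_Compl openin_open_Int)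
 have lc: "locally connected (?A - ?B)"
  by (rule locally_open_subset[OF convex_imp_locally_connected[OF affine_imp_convex[OF affine_affine_hull]] oAB])
 fix x assume x: "x \<in> ?G"
 let ?c = "connected_component_set (?A - ?B) x"
 have "openin (top_of_set (?A - ?B)) ?c" using lc openin_connected_component_locally_connected by auto
 then have "openin (top_of_set ?A) ?c" by (rule openin_trans[OF _ oAB])
 moreover have "x \<in> ?c" using x by simp
 moreover have "?c \<subseteq> ?G"
 proof
  fix y assume y: "y \<in> ?c"
  then have "connected_component_set (?A - ?B) y = ?c" by (metis connected_component_eq)
  moreover have "y \<in> ?A - ?B" using y connected_component_subset by auto
  ultimately show "y \<in> ?G" using x by simp
 qed
 ultimately show "\<exists>c. openin (top_of_set ?A) c \<and> x \<in> c \<and> c \<subseteq> ?G" by auto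
qed

lemma poly_region_minus_boundary_open:
 "openin (top_of_set (affine hull (set ps))) (poly_region ps - poly_boundary ps)"
proof -
 have "poly_region ps - poly_boundary ps = {x \<in> affine hull (set ps) - poly_boundary ps.
   bounded (connected_component_set (affine hull (set ps) - poly_boundary ps) x)}"
  by (auto simp: poly_region_def)
 then show ?thesis using poly_complement_components_open[of ps bounded] by simp
qed

lemma closed_poly_region: "closed (poly_region ps)"
proof -
 have "affine hull (set ps) - poly_region ps = {x \<in> affine hull (set ps) - poly_boundary ps.
   \<not> bounded (connected_component_set (affine hull (set ps) - poly_boundary ps) x)}"
  by (auto simp: poly_region_def)
 then have "closedin (top_of_set (affine hull (set ps))) (poly_region ps)"
  using poly_complement_components_open[of ps "\<lambda>c. \<not> bounded c"] poly_region_subset_affine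
  by (simp add: closedin_def)
 then show ?thesis by (rule closedin_closed_trans) simp
qed

lemma simple_polygon_nonempty: "simple_polygon ps ==> set ps \<noteq> {}"
 by (auto simp: simple_polygon_def)

lemma compact_poly_region: "simple_polygon ps ==> compact (poly_region ps)"
proof -
 assume "simple_polygon ps"
 then have "poly_region ps \<subseteq> convex hull (set ps)" by (rule poly_region_subset_hull[OF simple_polygon_nonempty])
 moreover have "bounded (convex hull (set ps))"
  by (rule compact_imp_bounded[OF compact_convex_hull[OF finite_imp_compact[OF finite_set]]])
 ultimately show ?thesis using closed_poly_region bounded_subset compact_eq_bounded_closed by blast
qed

lemma affine_hull_poly_region: "affine hull (poly_region ps) = affine hull (set ps)"
proof
 show "affine hull (poly_region ps) \<subseteq> affine hull (set ps)"
  using poly_region_subset_affine by (simp add: hull_minimal)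
 have "set ps \<subseteq> poly_region ps" using vertices_subset_boundary by (auto simp: poly_region_def)
 then show "affine hull (set ps) \<subseteq> affine hull (poly_region ps)" by (rule hull_mono)
qed

text \<open>The boundary curve is a null set for area, so these inclusions make integrals over
  \<open>poly_interior ps\<close> the same as over the region minus its boundary.\<close>

lemma poly_interior_bounds:
 "poly_region ps - poly_boundary ps \<subseteq> poly_interior ps" "poly_interior ps \<subseteq> poly_region ps"
proof -
 show "poly_interior ps \<subseteq> poly_region ps" by (rule rel_interior_subset)
 show "poly_region ps - poly_boundary ps \<subseteq> poly_interior ps"
  by (rule rel_interior_maximal) (use poly_region_minus_boundary_open affine_hull_poly_region in auto)
qed

lemma poly_normal:
 assumes "simple_polygon ps" "x0 \<in> set ps"
 shows "norm (poly_normal ps) = 1" "affine hull (set ps) = {x. (x - x0) \<bullet> poly_normal ps = 0}"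
proof -
 have ad: "aff_dim (set ps) = 2" using assms(1) by (simp add: simple_polygon_def)
 obtain a b where ab: "a \<noteq> 0" "set ps \<subseteq> {x. a \<bullet> x = b}"
  by (rule aff_lowdim_subset_hyperplane[of "set ps"]) (use ad in auto)
 have "\<exists>n. norm n = 1 \<and> (\<forall>x\<in>set ps. \<forall>y\<in>set ps. n \<bullet> (x - y) = 0)"
  using ab by (intro exI[of _ "a /\<^sub>R norm a"]) (auto simp: inner_diff_right)
 from someI_ex[OF this] have n: "norm (poly_normal ps) = 1" "\<forall>x\<in>set ps. \<forall>y\<in>set ps. poly_normal ps \<bullet> (x - y) = 0"
  unfolding poly_normal_def by auto
 show "norm (poly_normal ps) = 1" by (rule n)
 have hp: "{x. (x - x0) \<bullet> poly_normal ps = 0} = {x. poly_normal ps \<bullet> x = poly_normal ps \<bullet> x0}"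
  by (auto simp: inner_diff_left inner_commute[of "poly_normal ps"])
 show "affine hull (set ps) = {x. (x - x0) \<bullet> poly_normal ps = 0}"
  unfolding hp
 proof (rule affine_dim_equal[OF affine_affine_hull affine_hyperplane])
  show "affine hull (set ps) \<noteq> {}" using assms(2) by auto
  show "affine hull (set ps) \<subseteq> {x. poly_normal ps \<bullet> x = poly_normal ps \<bullet> x0}"
  proof (rule hull_minimal[where S = affine, OF _ affine_hyperplane])
   show "set ps \<subseteq> {x. poly_normal ps \<bullet> x = poly_normal ps \<bullet> x0}"
    using n(2)[rule_format, OF _ assms(2)] by (auto simp: inner_diff_right)
  qed
  have "poly_normal ps \<noteq> 0" using n(1) by auto
  then show "aff_dim (affine hull (set ps)) = aff_dim {x. poly_normal ps \<bullet> x = poly_normal ps \<bullet> x0}"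
   using ad by simp
 qed
qed

section \<open>Derivatives and adjoints of near isometries\<close>

lemma derivative_norm_le:
 fixes f :: "'a::real_normed_vector => 'b::real_normed_vector" and g :: "'a => 'c::real_normed_vector"
 assumes f: "(f has_derivative f') (at y)" and g: "(g has_derivative g') (at y)"
  and le: "eventually (\<lambda>z. norm (f z - f y) \<le> L * norm (g z - g y)) (at y)"
 shows "norm (f' w) \<le> L * norm (g' w)"
proof (cases "w = 0")
 case True
 then show ?thesis using linear_0[OF has_derivative_linear[OF f]] linear_0[OF has_derivative_linear[OF g]] by simp
next
 case w: False
 define z where "z t = y + t *\<^sub>R w" for t :: real
 have dz: "(z has_derivative (\<lambda>t. t *\<^sub>R w)) (at 0)" unfolding z_def[abs_def] by (auto intro!: derivative_eq_intros)
 have lim: "((\<lambda>t. norm (k (z t) - k y) / \<bar>t\<bar>) \<longlongrightarrow> norm (k' w)) (at 0)"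
  if k: "(k has_derivative k') (at y)" for k :: "'a => 'd::real_normed_vector" and k'
 proof -
  have "((\<lambda>t. k (z t)) has_derivative (\<lambda>t. k' (t *\<^sub>R w))) (at 0)"
   by (rule has_derivative_compose[OF dz]) (use k in \<open>simp add: z_def\<close>)
  then have "((\<lambda>t. k (z t)) has_vector_derivative k' w) (at 0)"
   unfolding has_vector_derivative_def linear_scale[OF has_derivative_linear[OF k]] .
  then have "((\<lambda>t. norm (k (z t) - k (z 0) - (t - 0) *\<^sub>R k' w) / norm (t - 0)) \<longlongrightarrow> 0) (at 0)"
   unfolding has_vector_derivative_def has_derivative_iff_norm by auto
  moreover have "eventually (\<lambda>t. norm (k (z t) - k (z 0) - (t - 0) *\<^sub>R k' w) / norm (t - 0)
    = norm ((k (z t) - k (z 0)) /\<^sub>R (t - 0) - k' w)) (at 0)"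
  proof (rule eventually_mono[OF eventually_neq_at_within[of 0]])
   fix t :: real assume t: "t \<noteq> 0"
   have "(k (z t) - k (z 0)) /\<^sub>R (t - 0) - k' w = (1 / t) *\<^sub>R (k (z t) - k (z 0) - (t - 0) *\<^sub>R k' w)"
    using t by (simp add: scaleR_diff_right inverse_eq_divide)
   then show "norm (k (z t) - k (z 0) - (t - 0) *\<^sub>R k' w) / norm (t - 0) = norm ((k (z t) - k (z 0)) /\<^sub>R (t - 0) - k' w)"
    by simp
  qed
  ultimately have "((\<lambda>t. norm ((k (z t) - k (z 0)) /\<^sub>R (t - 0) - k' w)) \<longlongrightarrow> 0) (at 0)"
   by (rule Lim_transform_eventually)
  then have "((\<lambda>t. (k (z t) - k (z 0)) /\<^sub>R (t - 0)) \<longlongrightarrow> k' w) (at 0)"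
   by (rule LIM_zero_cancel[OF tendsto_norm_zero_cancel])
  then have "((\<lambda>t. norm ((k (z t) - k (z 0)) /\<^sub>R (t - 0))) \<longlongrightarrow> norm (k' w)) (at 0)" by (rule tendsto_norm)
  then show ?thesis by (simp add: z_def divide_inverse mult.commute)
 qed
 have "filterlim z (at y) (at 0)"
 proof -
  have "(z \<longlongrightarrow> z 0) (at 0)" using has_derivative_continuous[OF dz] by (simp add: isCont_def)
  then show ?thesis unfolding filterlim_at using w by (auto simp: z_def eventually_at_filter)
 qed
 from eventually_compose_filterlim[OF le this]
 have "eventually (\<lambda>t. norm (f (z t) - f y) / \<bar>t\<bar> \<le> L * (norm (g (z t) - g y) / \<bar>t\<bar>)) (at 0)"
 proof eventually_elim
  case (elim t)
  from divide_right_mono[OF this abs_ge_zero[of t]] show ?case by simp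
 qed
 then show ?thesis
  by (intro tendsto_le[OF _ tendsto_mult_left[OF lim[OF g]] lim[OF f]]) simp_all
qed

text \<open>The first bound is the adjoint relation tested with \<open>gx\<close> itself. For the
  reverse one \<open>x\<close> has to be written as \<open>T v\<close>: injectivity and equal
  dimensions make \<open>T\<close> map the plane orthogonal to \<open>u\<close> onto the plane
  orthogonal to \<open>n\<close>.\<close>

lemma adjoint_near_isometry:
 fixes T :: "point \<Rightarrow>\<^sub>L point"
 assumes u: "norm u = 1" and n: "norm n = 1" and L: "1 \<le> L"
  and T: "!!v. v \<bullet> u = 0 ==> T v \<bullet> n = 0" "!!v. v \<bullet> u = 0 ==> norm (T v) \<le> L * norm v" "!!v. v \<bullet> u = 0 ==> norm v \<le> L * norm (T v)"
  and x: "x \<bullet> n = 0" "gx \<bullet> u = 0" "!!v. v \<bullet> u = 0 ==> gx \<bullet> v = x \<bullet> T v"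
 shows "norm gx \<le> L * norm x" "norm x \<le> L * norm gx"
proof -
 have "(norm gx)\<^sup>2 = x \<bullet> T gx" using x(3)[OF x(2)] by (simp add: power2_norm_eq_inner)
 also have "... \<le> norm x * norm (T gx)" by (rule norm_cauchy_schwarz)
 also have "... \<le> norm x * (L * norm gx)" using T(2)[OF x(2)] by (intro mult_left_mono) auto
 finally have "norm gx * norm gx \<le> (L * norm x) * norm gx" by (simp add: power2_eq_square mult_ac)
 then show "norm gx \<le> L * norm x" using L by (cases "norm gx = 0") auto
 let ?V = "{v. u \<bullet> v = 0}" and ?W = "{w. n \<bullet> w = 0}"
 have nz: "u \<noteq> 0" "n \<noteq> 0" using u n by auto
 have lin: "linear T" by (simp add: blinfun.bounded_linear_right bounded_linear.linear)
 have inj: "inj_on T (span ?V)"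
 proof (rule inj_onI)
  fix a b assume "a \<in> span ?V" "b \<in> span ?V" "T a = T b"
  moreover have "span ?V = ?V" by (simp add: subspace_hyperplane)
  ultimately have "u \<bullet> a = 0" "u \<bullet> b = 0" "T (a - b) = 0" by (auto simp: blinfun.diff_right)
  then have "(a - b) \<bullet> u = 0" "T (a - b) = 0" by (simp_all add: inner_diff_right inner_commute[of _ u])
  then show "a = b" using T(3)[of "a - b"] by simp
 qed
 have "T ` ?V = ?W"
 proof (rule subspace_dim_equal)
  show "subspace (T ` ?V)" by (rule linear_subspace_image[OF lin subspace_hyperplane])
  show "T ` ?V \<subseteq> ?W" using T(1) by (auto simp: inner_commute)
  show "dim ?W \<le> dim (T ` ?V)" unfolding dim_image_eq[OF lin inj] using nz by (simp add: dim_hyperplane)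
 qed (rule subspace_hyperplane)
 moreover have "x \<in> ?W" using x(1) by (simp add: inner_commute)
 ultimately obtain v where "v \<in> ?V" "x = T v" by auto
 then have v: "v \<bullet> u = 0" "x = T v" by (simp_all add: inner_commute)
 have "(norm x)\<^sup>2 = gx \<bullet> v" using x(3)[OF v(1)] v(2) by (simp add: power2_norm_eq_inner)
 also have "... \<le> norm gx * norm v" by (rule norm_cauchy_schwarz)
 also have "... \<le> norm gx * (L * norm x)" using T(3)[OF v(1)] v(2) by (intro mult_left_mono) auto
 finally have "norm x * norm x \<le> (L * norm gx) * norm x" by (simp add: power2_eq_square mult_ac)
 then show "norm x \<le> L * norm gx" using L by (cases "norm x = 0") auto
qed

text \<open>Polarisation on unit vectors: the errors in the squared norms of \<open>a + b\<close>
  and \<open>a - b\<close> add up, and by the parallelogram law these squares sum to 4, so the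
  factor \<open>L\<^sup>2 - 1\<close> is preserved.\<close>

lemma near_isometry_inner:
 fixes G :: "'a::real_inner => 'b::real_inner"
 assumes V: "subspace V" and G: "!!a b. a \<in> V ==> b \<in> V ==> G (a + b) = G a + G b" "!!a c. a \<in> V ==> G (c *\<^sub>R a) = c *\<^sub>R G a" 
  and L: "1 \<le> L" and iso: "!!a. a \<in> V ==> norm (G a) \<le> L * norm a" "!!a. a \<in> V ==> norm a \<le> L * norm (G a)"
  and ab: "a \<in> V" "b \<in> V"
 shows "\<bar>G a \<bullet> G b - a \<bullet> b\<bar> \<le> (L\<^sup>2 - 1) * norm a * norm b"
proof -
 have Q: "\<bar>(norm (G c))\<^sup>2 - (norm c)\<^sup>2\<bar> \<le> (L\<^sup>2 - 1) * (norm c)\<^sup>2" if c: "c \<in> V" for c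
 proof -
  have 1: "(norm (G c))\<^sup>2 \<le> L\<^sup>2 * (norm c)\<^sup>2" using power_mono[OF iso(1)[OF c], of 2] by (simp add: power_mult_distrib)
  have 2: "(norm c)\<^sup>2 \<le> L\<^sup>2 * (norm (G c))\<^sup>2" using power_mono[OF iso(2)[OF c], of 2] by (simp add: power_mult_distrib)
  show ?thesis
  proof (cases "(norm c)\<^sup>2 \<le> (norm (G c))\<^sup>2")
   case True
   then show ?thesis using 1 by (simp add: algebra_simps)
  next
   case False
   have "(L\<^sup>2 - 1) * (norm (G c))\<^sup>2 \<le> (L\<^sup>2 - 1) * (norm c)\<^sup>2"
    using False L by (intro mult_left_mono) auto
   then show ?thesis using 2 False by (simp add: algebra_simps)
  qed
 qed
 have unit: "\<bar>G a \<bullet> G b - a \<bullet> b\<bar> \<le> L\<^sup>2 - 1" if ab: "a \<in> V" "b \<in> V" "norm a = 1" "norm b = 1" for a b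
 proof -
  have V': "a + b \<in> V" "a + (-1) *\<^sub>R b \<in> V" using V ab by (auto simp: subspace_add subspace_scale simp del: scaleR_minus_left scaleR_minus1_left)
  have Gm: "G (a + (-1) *\<^sub>R b) = G a - G b" "G (a + b) = G a + G b"
   using G(1)[OF ab(1) subspace_scale[OF V ab(2), of "-1"]] G(2)[OF ab(2), of "-1"] G(1)[OF ab(1,2)] by auto
  have e1: "4 * (G a \<bullet> G b) = (norm (G a + G b))\<^sup>2 - (norm (G a - G b))\<^sup>2" "4 * (a \<bullet> b) = (norm (a + b))\<^sup>2 - (norm (a - b))\<^sup>2"
   by (simp_all add: power2_norm_eq_inner inner_add_right inner_diff_right inner_commute)
  have e2: "(norm (a + b))\<^sup>2 + (norm (a - b))\<^sup>2 = 4"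
  proof -
   have "(norm (a + b))\<^sup>2 + (norm (a - b))\<^sup>2 = 2 * (norm a)\<^sup>2 + 2 * (norm b)\<^sup>2"
    by (simp add: power2_norm_eq_inner inner_add_right inner_diff_right inner_commute)
   then show ?thesis using ab by simp
  qed
  have "\<bar>4 * (G a \<bullet> G b) - 4 * (a \<bullet> b)\<bar>
    \<le> \<bar>(norm (G a + G b))\<^sup>2 - (norm (a + b))\<^sup>2\<bar> + \<bar>(norm (G a - G b))\<^sup>2 - (norm (a - b))\<^sup>2\<bar>"
   unfolding e1 by simp
  also have "... \<le> (L\<^sup>2 - 1) * (norm (a + b))\<^sup>2 + (L\<^sup>2 - 1) * (norm (a - b))\<^sup>2"
   using Q[OF V'(1)] Q[OF V'(2)] unfolding Gm by simp
  also have "\<bar>4 * (G a \<bullet> G b) - 4 * (a \<bullet> b)\<bar> = 4 * \<bar>G a \<bullet> G b - a \<bullet> b\<bar>" by (simp add: abs_if)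
  finally have "4 * \<bar>G a \<bullet> G b - a \<bullet> b\<bar> \<le> (L\<^sup>2 - 1) * (norm (a + b))\<^sup>2 + (L\<^sup>2 - 1) * (norm (a - b))\<^sup>2" .
  also have "(L\<^sup>2 - 1) * (norm (a + b))\<^sup>2 + (L\<^sup>2 - 1) * (norm (a - b))\<^sup>2 = (L\<^sup>2 - 1) * 4" unfolding distrib_left[symmetric] e2 ..
  finally show ?thesis by simp
 qed
 show ?thesis
 proof (cases "a = 0 \<or> b = 0")
  case True
  moreover have "G 0 = 0" using iso(1)[OF subspace_0[OF V]] by simp
  ultimately show ?thesis by auto
 next
  case False
  then have nz: "0 < norm a" "0 < norm b" by auto
  let ?a = "(1 / norm a) *\<^sub>R a" and ?b = "(1 / norm b) *\<^sub>R b"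
  have "\<bar>G ?a \<bullet> G ?b - ?a \<bullet> ?b\<bar> \<le> L\<^sup>2 - 1"
   using nz by (intro unit subspace_scale[OF V] ab) auto
  then have "\<bar>(G a \<bullet> G b - a \<bullet> b) / (norm a * norm b)\<bar> \<le> L\<^sup>2 - 1"
   unfolding G(2)[OF ab(1)] G(2)[OF ab(2)] by (simp add: diff_divide_distrib mult.commute)
  then show ?thesis using nz by (simp add: pos_divide_le_eq abs_mult)
 qed
qed

section \<open>Geometry of a single inscribed polygon\<close>

locale inscribed =
 fixes G :: "point set" and \<nu> :: "point => point" and \<delta> :: real and U :: "point set" and ps :: "point list"
  and h K \<gamma> \<rho> :: real
 assumes C: "C2_surface G \<nu>" and comp: "compact G" and fermi: "fermi_stripe G \<nu> \<delta> U"
  and K: "1 \<le> K" and Klip: "!!p q. p \<in> G ==> q \<in> G ==> norm (\<nu> p - \<nu> q) \<le> K * norm (p - q)"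
  and Kquad: "!!p q. p \<in> G ==> q \<in> G ==> \<bar>(p - q) \<bullet> \<nu> q\<bar> \<le> K * (norm (p - q))\<^sup>2"
  and poly: "simple_polygon ps" and verts: "set ps \<subseteq> G" and EU: "poly_region ps \<subseteq> U"
  and diam: "diameter (poly_region ps) \<le> h" and \<gamma>: "0 < \<gamma>" and \<rho>: "\<gamma> * diameter (poly_region ps) \<le> \<rho>"
  and star: "star_shaped_wrt_ball (poly_region ps) \<rho>"
  and h: "0 < h" "20 * (K + 16 * K / \<gamma>) * h \<le> 1"
  and inj: "inj_on (fermi_proj G \<nu> \<delta>) (poly_region ps)"
begin

abbreviation "a \<equiv> fermi_proj G \<nu> \<delta>"
abbreviation "E \<equiv> poly_region ps"
abbreviation "B \<equiv> poly_boundary ps"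
abbreviation "Q \<equiv> poly_region ps - poly_boundary ps"
abbreviation "n \<equiv> poly_normal ps"
definition "x0 = hd ps"
text \<open>The sum of the curvature constant and of the tilt constant found in \<open>tilt\<close>,
  so that one constant serves all estimates.\<close>

definition "M = K + 16 * K / \<gamma>"
text \<open>With 57, \<open>L\<^sup>2\<close> is at least \<open>1 + 114 * w\<close> for
  \<open>w = M\<^sup>2 * h\<^sup>2\<close>, which absorbs the second-order errors with factors 93
  and 44 in \<open>bilipschitz\<close>.\<close>

definition "L = 1 + 57 * M\<^sup>2 * h\<^sup>2"
text \<open>The tilt is a height divided by the radius of a ball comparable to the diameter of this
  very polygon, so heights have to be bounded by \<open>hE\<close> and not just by
  \<open>h\<close>.\<close>

definition "hE = diameter E"

lemma x0: "x0 \<in> set ps" using simple_polygon_nonempty[OF poly] by (simp add: x0_def)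

lemma plane: "affine hull (set ps) = {x. (x - x0) \<bullet> n = 0}" and norm_n: "norm n = 1"
 using poly_normal[OF poly x0] by auto

lemma E_plane: "x \<in> E ==> (x - x0) \<bullet> n = 0"
 using poly_region_subset_affine plane by auto

lemma verts_E: "set ps \<subseteq> E" using vertices_subset_boundary by (auto simp: poly_region_def)

lemma BE: "B \<subseteq> E" by (auto simp: poly_region_def)

lemma compE: "compact E" by (rule compact_poly_region[OF poly])

lemma M: "1 \<le> M" "K \<le> M" "16 * K / \<gamma> \<le> M" "M * h \<le> 1 / 20" and L1: "1 \<le> L"
proof -
 have "0 \<le> 16 * K / \<gamma>" using K \<gamma> by simp
 then show "1 \<le> M" "K \<le> M" "16 * K / \<gamma> \<le> M" using K by (simp_all add: M_def)
 have "20 * (M * h) \<le> 1" using h(2) by (simp only: M_def)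
 then show "M * h \<le> 1 / 20" by simp
 show "1 \<le> L" by (simp add: L_def)
qed

lemma hE: "0 < hE" "hE \<le> h" "!!x y. x \<in> E ==> y \<in> E ==> dist x y \<le> hE"
proof -
 show "hE \<le> h" using diam by (simp add: hE_def)
 show d: "dist x y \<le> hE" if "x \<in> E" "y \<in> E" for x y
  unfolding hE_def by (rule diameter_bounded_bound[OF compact_imp_bounded[OF compE] that])
 have "3 \<le> length ps" using poly by (simp add: simple_polygon_def)
 moreover have "0 < length ps --> ps ! 0 \<noteq> ps ! (Suc 0 mod length ps)" using poly unfolding simple_polygon_def by auto
 ultimately have "3 \<le> length ps" "ps ! 0 \<noteq> ps ! (Suc 0 mod length ps)" by auto
 moreover then have "ps ! 0 \<in> E" "ps ! (Suc 0 mod length ps) \<in> E" using verts_E by (auto intro!: nth_mem)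
 ultimately show "0 < hE" using d[of "ps ! 0" "ps ! (Suc 0 mod length ps)"] by (metis dist_pos_lt less_le_trans)
qed

text \<open>The vertices lie on \<open>G\<close> and hence within \<open>K * m\<^sup>2\<close> of
  the tangent plane at \<open>p\<close>; the slab is convex, so it contains the hull and with it the
  polygon.\<close>

lemma slab:
 assumes p: "p \<in> G" and m: "!!q. q \<in> set ps ==> norm (q - p) \<le> m" and y: "y \<in> E"
 shows "\<bar>(y - p) \<bullet> \<nu> p\<bar> \<le> K * m\<^sup>2"
proof -
 have v: "\<bar>(q - p) \<bullet> \<nu> p\<bar> \<le> K * m\<^sup>2" if "q \<in> set ps" for q
 proof -
  have "\<bar>(q - p) \<bullet> \<nu> p\<bar> \<le> K * (norm (q - p))\<^sup>2" using Kquad[of q p] verts that p by auto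
  also have "... \<le> K * m\<^sup>2" using m[OF that] K by (intro mult_left_mono power_mono) auto
  finally show ?thesis .
 qed
 have v': "\<nu> p \<bullet> q \<le> \<nu> p \<bullet> p + K * m\<^sup>2 \<and> \<nu> p \<bullet> q \<ge> \<nu> p \<bullet> p - K * m\<^sup>2" if "q \<in> set ps" for q
  using v[OF that] by (simp add: inner_diff_right inner_commute[of _ "\<nu> p"] abs_le_iff)
 have "convex hull (set ps) \<subseteq> {y. \<nu> p \<bullet> y \<le> \<nu> p \<bullet> p + K * m\<^sup>2}"
  by (rule hull_minimal[where S=convex, OF _ convex_halfspace_le]) (use v' in blast)
 moreover have "convex hull (set ps) \<subseteq> {y. \<nu> p \<bullet> y \<ge> \<nu> p \<bullet> p - K * m\<^sup>2}"
  by (rule hull_minimal[where S=convex, OF _ convex_halfspace_ge]) (use v' in blast)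
 moreover have "y \<in> convex hull (set ps)" using y poly_region_subset_hull[OF simple_polygon_nonempty[OF poly]] by auto
 ultimately have "\<nu> p \<bullet> y \<le> \<nu> p \<bullet> p + K * m\<^sup>2" "\<nu> p \<bullet> y \<ge> \<nu> p \<bullet> p - K * m\<^sup>2" by auto
 then show ?thesis by (simp add: inner_diff_right inner_commute[of _ "\<nu> p"])
qed

text \<open>The height is bounded in two rounds. From \<open>\<bar>s\<bar> \<le> h\<close> the slab
  gives a quadratic inequality for \<open>\<bar>s\<bar>\<close> whose coefficient
  \<open>2 * M * h\<close> is at most 1/10, so \<open>\<bar>s\<bar> \<le> hE\<close>. Then all
  vertices are within \<open>2 * hE\<close> of the foot point, and the slab yields
  \<open>4 * K * hE\<^sup>2\<close>.\<close>

lemma foot: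
 assumes x: "x \<in> E"
 obtains s where "a x \<in> G" "x = a x + s *\<^sub>R \<nu> (a x)" "\<bar>s\<bar> < \<delta>" "\<bar>s\<bar> \<le> h" "\<bar>s\<bar> \<le> 4 * K * hE\<^sup>2"
  "!!y. y \<in> E ==> \<bar>(y - a x) \<bullet> \<nu> (a x)\<bar> \<le> 4 * K * hE\<^sup>2"
proof -
 have "x0 \<in> G" "dist x x0 \<le> h" using x0 verts hE(2) hE(3)[OF x, of x0] verts_E by auto
 then obtain s where s: "a x \<in> G" "x = a x + s *\<^sub>R \<nu> (a x)" "\<bar>s\<bar> < \<delta>" "\<bar>s\<bar> \<le> h"
  using fermi_decomposition[OF C fermi, of x x0 h] EU x by auto
 have n1: "\<nu> (a x) \<bullet> \<nu> (a x) = 1" "norm (\<nu> (a x)) = 1" using C2_surface_norm[OF C s(1)] by (auto simp: norm_eq_1)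
 have xa: "norm (x - a x) = \<bar>s\<bar>" using s(2) n1 by (metis add_diff_cancel_left' mult.right_neutral norm_scaleR)
 have q: "norm (q - a x) \<le> hE + \<bar>s\<bar>" if "q \<in> set ps" for q
  using norm_triangle_ineq[of "q - x" "x - a x"] hE(3)[of q x] x that verts_E xa by (auto simp: dist_norm)
 have "(x - a x) \<bullet> \<nu> (a x) = s" using s(2) n1 by (metis add_diff_cancel_left' inner_scaleR_left mult.right_neutral)
 then have "\<bar>s\<bar> \<le> K * (hE + \<bar>s\<bar>)\<^sup>2" using slab[OF s(1) q x] by simp
 also have "... = K * (hE + \<bar>s\<bar>) * (hE + \<bar>s\<bar>)" by (simp add: power2_eq_square)
 also have "... \<le> M * (h + h) * (hE + \<bar>s\<bar>)"
  using s(4) hE(1,2) M by (intro mult_mono) auto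
 also have "... = 2 * (M * h) * (hE + \<bar>s\<bar>)" by simp
 also have "... \<le> 2 * (1 / 20) * (hE + \<bar>s\<bar>)" using M hE(1) by (intro mult_right_mono) auto
 finally have sE: "\<bar>s\<bar> \<le> hE" by auto
 have q2: "norm (q - a x) \<le> 2 * hE" if "q \<in> set ps" for q using q[OF that] sE by simp
 have all: "\<bar>(y - a x) \<bullet> \<nu> (a x)\<bar> \<le> 4 * K * hE\<^sup>2" if "y \<in> E" for y
  using slab[OF s(1) q2 that] by simp
 then have "\<bar>s\<bar> \<le> 4 * K * hE\<^sup>2" using \<open>(x - a x) \<bullet> \<nu> (a x) = s\<close> x by auto
 then show ?thesis using that s all by simp
qed

lemma foot_h:
 assumes x: "x \<in> E"
 obtains s where "a x \<in> G" "x = a x + s *\<^sub>R \<nu> (a x)" "\<bar>s\<bar> < \<delta>" "\<bar>s\<bar> \<le> h" "\<bar>s\<bar> \<le> 4 * M * h\<^sup>2"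
proof -
 have "4 * K * hE\<^sup>2 \<le> 4 * M * h\<^sup>2" using M K hE by (intro mult_mono) auto
 moreover obtain s where s: "a x \<in> G" "x = a x + s *\<^sub>R \<nu> (a x)" "\<bar>s\<bar> < \<delta>" "\<bar>s\<bar> \<le> h" "\<bar>s\<bar> \<le> 4 * K * hE\<^sup>2" by (rule foot[OF x])
 ultimately show ?thesis by (intro that[OF s(1-4)]) simp
qed

lemma a_in: "x \<in> E ==> a x \<in> G" using foot by auto

text \<open>Shape regularity provides a segment of length \<open>\<gamma> * hE / 2\<close> in
  direction \<open>t\<close> inside the polygon. Both ends have height at most
  \<open>4 * K * hE\<^sup>2\<close> over the tangent plane, so the slope is at most the quotient
  \<open>16 * K / \<gamma> * hE\<close>.\<close>

lemma tilt:
 assumes x: "x \<in> E" and t: "t \<bullet> n = 0" shows "\<bar>t \<bullet> \<nu> (a x)\<bar> \<le> M * h * norm t"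
proof (cases "t = 0")
 case False
 obtain s where s: "!!y. y \<in> E ==> \<bar>(y - a x) \<bullet> \<nu> (a x)\<bar> \<le> 4 * K * hE\<^sup>2" using foot[OF x] by auto
 obtain c where c: "c \<in> affine hull E" "!!z y. z \<in> ball c \<rho> \<inter> affine hull E ==> y \<in> E ==> closed_segment z y \<subseteq> E"
  using star unfolding star_shaped_wrt_ball_def by auto
 have in_E: "z \<in> E" if "z \<in> ball c \<rho>" "z \<in> affine hull E" for z
  using c(2)[of z x] that x by auto
 \<comment> \<open>Half the radius, because the ball in the star-shape condition is open.\<close>
 define r where "r = \<gamma> * hE / 2"
 have r: "0 < r" "r < \<rho>" using \<rho> mult_pos_pos[OF \<gamma> hE(1)] by (auto simp: r_def simp flip: hE_def)
 define t' where "t' = (r / norm t) *\<^sub>R t"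
 have nt: "norm t' = r" using False r by (simp add: t'_def)
 have "(c - x0) \<bullet> n = 0" using c(1) plane by (simp add: affine_hull_poly_region)
 then have "c + t' \<in> affine hull E" using t by (simp add: affine_hull_poly_region plane t'_def inner_add_left inner_diff_left)
 then have 1: "c \<in> E" "c + t' \<in> E" using in_E c(1) r nt by (auto simp: dist_norm)
 have "t' \<bullet> \<nu> (a x) = (c + t' - a x) \<bullet> \<nu> (a x) - (c - a x) \<bullet> \<nu> (a x)" by (simp add: inner_diff_left inner_add_left)
 then have "\<bar>t' \<bullet> \<nu> (a x)\<bar> \<le> 8 * K * hE\<^sup>2" using s[OF 1(1)] s[OF 1(2)] by simp
 then have "r / norm t * \<bar>t \<bullet> \<nu> (a x)\<bar> \<le> 8 * K * hE\<^sup>2" using r by (simp add: t'_def abs_mult)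
 then have "\<bar>t \<bullet> \<nu> (a x)\<bar> \<le> 8 * K * hE\<^sup>2 / r * norm t" using False r by (simp add: field_simps)
 also have "8 * K * hE\<^sup>2 / r = 16 * K / \<gamma> * hE" by (simp add: r_def power2_eq_square)
 also have "16 * K / \<gamma> * hE * norm t \<le> M * h * norm t"
  using M hE K by (intro mult_mono) auto
 finally show ?thesis .
qed simp

text \<open>The projection of the normal to the plane of the polygon has squared length equal to its
  product with the normal, which \<open>tilt\<close> bounds by a small multiple of its
  length.\<close>

lemma normal_dot: "x \<in> E ==> 1 / 2 \<le> \<bar>\<nu> (a x) \<bullet> n\<bar>"
proof -
 assume x: "x \<in> E"
 define \<tau> where "\<tau> = tangential n (\<nu> (a x))"
 have nn: "n \<bullet> n = 1" using norm_n by (simp add: norm_eq_1)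
 have \<nu>\<nu>: "\<nu> (a x) \<bullet> \<nu> (a x) = 1" using C2_surface_norm[OF C a_in[OF x]] by (simp add: norm_eq_1)
 have \<tau>n: "\<tau> \<bullet> n = 0" unfolding \<tau>_def by (rule inner_tangential_left[OF nn])
 have sq: "\<tau> \<bullet> \<nu> (a x) = 1 - (\<nu> (a x) \<bullet> n)\<^sup>2" "\<tau> \<bullet> \<tau> = 1 - (\<nu> (a x) \<bullet> n)\<^sup>2"
  by (simp_all add: \<tau>_def tangential_def inner_diff_right inner_commute \<nu>\<nu> nn power2_eq_square)
 have "(norm \<tau>)\<^sup>2 \<le> M * h * norm \<tau>" using tilt[OF x \<tau>n] sq by (simp add: power2_norm_eq_inner)
 also have "... \<le> 1 / 20 * norm \<tau>" using M by (intro mult_right_mono) auto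
 finally have "norm \<tau> \<le> 1 / 20" by (cases "norm \<tau> = 0") (auto simp: power2_eq_square)
 then have "(norm \<tau>)\<^sup>2 \<le> (1 / 20)\<^sup>2" by auto
 then have "(1/2)\<^sup>2 \<le> \<bar>\<nu> (a x) \<bullet> n\<bar>\<^sup>2" using sq by (simp add: power2_norm_eq_inner power_divide)
 then show ?thesis by (rule power2_le_imp_le) simp
qed

text \<open>With foot points \<open>p\<close> and \<open>q\<close> write
  \<open>x - y = (p - q) + e\<close>. The error \<open>e\<close> is of first order in
  \<open>M * h\<close>, but its product with \<open>p - q\<close> is of second order: the height
  \<open>s\<close> is of order \<open>M * h\<^sup>2\<close>, and in the other term both the change
  \<open>d\<close> of height and the normal component of \<open>p - q\<close> are of first order.
  Expanding the square leaves errors of order \<open>M\<^sup>2 * h\<^sup>2\<close>.\<close>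

lemma bilipschitz:
 assumes x: "x \<in> E" and y: "y \<in> E"
 shows "dist x y \<le> L * dist (a x) (a y)" "dist (a x) (a y) \<le> L * dist x y"
proof -
 define p q where "p = a x" and "q = a y"
 define R D where "R = norm (x - y)" and "D = norm (p - q)"
 obtain s where s: "p \<in> G" "x = p + s *\<^sub>R \<nu> p" "\<bar>s\<bar> \<le> h" "\<bar>s\<bar> \<le> 4 * M * h\<^sup>2"
  using foot_h[OF x] unfolding p_def by auto
 obtain t where t: "q \<in> G" "y = q + t *\<^sub>R \<nu> q" "\<bar>t\<bar> \<le> h" "\<bar>t\<bar> \<le> 4 * M * h\<^sup>2"
  using foot_h[OF y] unfolding q_def by auto
 have n1: "norm (\<nu> p) = 1" "norm (\<nu> q) = 1" "\<nu> q \<bullet> \<nu> q = 1" using C2_surface_norm[OF C] s(1) t(1) by (auto simp: norm_eq_1)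
 have RD0: "0 \<le> R" "0 \<le> D" by (auto simp: R_def D_def)
 have Mh: "0 \<le> M" "0 \<le> h" "M * h \<le> 1 / 20" "0 \<le> M * h" using M h by auto
 have Rh: "R \<le> h" using hE(3)[OF x y] hE(2) by (simp add: R_def dist_norm)
 have Dh: "D \<le> 3 * h"
 proof -
  have "p - q = (x - y) - s *\<^sub>R \<nu> p + t *\<^sub>R \<nu> q" using s(2) t(2) by simp
  then have "D \<le> R + \<bar>s\<bar> + \<bar>t\<bar>"
   using norm_triangle_ineq[of "(x - y) - s *\<^sub>R \<nu> p" "t *\<^sub>R \<nu> q"] norm_triangle_ineq4[of "x - y" "s *\<^sub>R \<nu> p"] n1
   by (simp add: D_def R_def)
  then show ?thesis using Rh s(3) t(3) by simp
 qed
 \<comment> \<open>\<open>e\<close> is split into the turning of the normal and the change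
   \<open>d\<close> of height along \<open>\<nu> q\<close>. The latter is controlled by testing
   \<open>x - y\<close> with \<open>\<nu> q\<close>, where \<open>tilt\<close> applies.\<close>
 define d where "d = s - t"
 define e where "e = s *\<^sub>R (\<nu> p - \<nu> q) + d *\<^sub>R \<nu> q"
 have xy: "x - y = (p - q) + e" using s(2) t(2) by (simp add: e_def d_def algebra_simps)
 have \<nu>pq: "norm (\<nu> p - \<nu> q) \<le> M * D"
  using order_trans[OF Klip[OF s(1) t(1)] mult_right_mono[OF M(2)]] by (simp add: D_def)
 have pq\<nu>: "\<bar>(p - q) \<bullet> \<nu> q\<bar> \<le> M * D\<^sup>2"
  using order_trans[OF Kquad[OF s(1) t(1)] mult_right_mono[OF M(2)]] by (simp add: D_def)
 have sM: "\<bar>s\<bar> * (M * D) \<le> M * h * D / 5"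
 proof -
  have "\<bar>s\<bar> * (M * D) \<le> 4 * M * h\<^sup>2 * (M * D)" using s(4) Mh RD0 by (intro mult_right_mono) auto
  also have "... = 4 * (M * h) * (M * h * D)" by (simp add: power2_eq_square)
  also have "... \<le> 4 * (1 / 20) * (M * h * D)" using Mh RD0 by (intro mult_right_mono) auto
  finally show ?thesis by simp
 qed
 have se: "norm (s *\<^sub>R (\<nu> p - \<nu> q)) \<le> M * h * D / 5"
  using order_trans[OF mult_left_mono[OF \<nu>pq abs_ge_zero[of s]] sM] by simp
 have "\<bar>(x - y) \<bullet> \<nu> q\<bar> \<le> M * h * R"
  unfolding R_def q_def by (rule tilt[OF y]) (use E_plane[OF x] E_plane[OF y] in \<open>simp add: inner_diff_left\<close>)
 moreover have "(x - y) \<bullet> \<nu> q = (p - q) \<bullet> \<nu> q + s *\<^sub>R (\<nu> p - \<nu> q) \<bullet> \<nu> q + d"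
  unfolding xy e_def by (simp add: inner_add_left n1)
 moreover have "\<bar>s *\<^sub>R (\<nu> p - \<nu> q) \<bullet> \<nu> q\<bar> \<le> M * h * D / 5"
  using Cauchy_Schwarz_ineq2[of "s *\<^sub>R (\<nu> p - \<nu> q)" "\<nu> q"] se unfolding n1(2) mult_1_right by simp
 moreover have "M * D\<^sup>2 \<le> 3 * (M * h * D)"
 proof -
  have "M * D * D \<le> M * D * (3 * h)" using Dh Mh RD0 by (intro mult_left_mono) auto
  then show ?thesis by (simp add: power2_eq_square mult_ac)
 qed
 ultimately have d: "\<bar>d\<bar> \<le> M * h * R + 4 * (M * h * D)" using pq\<nu> by auto
 have ne: "norm e \<le> M * h * D / 5 + \<bar>d\<bar>"
  unfolding e_def using norm_triangle_ineq[of "s *\<^sub>R (\<nu> p - \<nu> q)" "d *\<^sub>R \<nu> q"] se n1 by simp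
 have MD: "M * h * D \<le> D / 20" "M * h * R \<le> R / 20"
  using mult_right_mono[OF Mh(3) RD0(2)] mult_right_mono[OF Mh(3) RD0(1)] by auto
 \<comment> \<open>A crude comparison of \<open>R\<close> and \<open>D\<close>, so that all errors
   can be expressed by \<open>D\<close>.\<close>
 have RD: "R \<le> 2 * D" "D \<le> 2 * R"
 proof -
  have "\<bar>R - D\<bar> \<le> norm e" unfolding R_def D_def xy using norm_triangle_ineq3[of "p - q + e" "p - q"] by simp
  then have "\<bar>R - D\<bar> \<le> R / 20 + D / 4" using ne d MD by simp
  then show "R \<le> 2 * D" "D \<le> 2 * R" by auto
 qed
 have d6: "\<bar>d\<bar> \<le> 6 * (M * h * D)"
 proof -
  have "M * h * R \<le> M * h * (2 * D)" using RD Mh by (intro mult_left_mono) auto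
  then show ?thesis using d by simp
 qed
 have ne7: "norm e \<le> 7 * (M * h * D)" using ne d6 Mh by simp
 have pe: "\<bar>(p - q) \<bullet> e\<bar> \<le> 22 * (M\<^sup>2 * h\<^sup>2 * D\<^sup>2)"
 proof -
  have "(p - q) \<bullet> e = s * ((p - q) \<bullet> (\<nu> p - \<nu> q)) + d * ((p - q) \<bullet> \<nu> q)"
   by (simp add: e_def inner_add_right)
  then have "\<bar>(p - q) \<bullet> e\<bar> \<le> \<bar>s\<bar> * \<bar>(p - q) \<bullet> (\<nu> p - \<nu> q)\<bar> + \<bar>d\<bar> * \<bar>(p - q) \<bullet> \<nu> q\<bar>"
   by (metis abs_mult abs_triangle_ineq)
  also have "... \<le> 4 * M * h\<^sup>2 * (D * (M * D)) + 6 * (M * h * D) * (M * h * D * 3)"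
  proof (intro add_mono mult_mono)
   show "\<bar>(p - q) \<bullet> (\<nu> p - \<nu> q)\<bar> \<le> D * (M * D)"
    using Cauchy_Schwarz_ineq2[of "p - q" "\<nu> p - \<nu> q"] mult_left_mono[OF \<nu>pq RD0(2)] by (simp add: D_def)
   show "\<bar>(p - q) \<bullet> \<nu> q\<bar> \<le> M * h * D * 3" using pq\<nu> \<open>M * D\<^sup>2 \<le> 3 * (M * h * D)\<close> by simp
  qed (use s(4) d6 Mh RD0 in auto)
  finally show ?thesis by (simp add: power2_eq_square algebra_simps)
 qed
 define u where "u = M\<^sup>2 * h\<^sup>2 * D\<^sup>2"
 have e2: "(norm e)\<^sup>2 \<le> 49 * u"
  using power_mono[OF ne7, of 2] by (simp add: u_def power_mult_distrib)
 have pe': "\<bar>(p - q) \<bullet> e\<bar> \<le> 22 * u" using pe by (simp only: u_def)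
 have R2: "R\<^sup>2 = D\<^sup>2 + 2 * ((p - q) \<bullet> e) + (norm e)\<^sup>2"
  unfolding R_def D_def xy by (simp add: power2_norm_eq_inner inner_add_right inner_commute)
 have u0: "0 \<le> u" by (simp add: u_def)
 \<comment> \<open>93 is \<open>2 * 22 + 49\<close>, and 44 below is \<open>2 * 22\<close>.\<close>
 have up: "R\<^sup>2 \<le> D\<^sup>2 + 93 * u" using R2 e2 pe' by simp
 have lo: "D\<^sup>2 - 44 * u \<le> R\<^sup>2" using R2 pe' zero_le_power2[of "norm e"] by linarith
 define w where "w = M\<^sup>2 * h\<^sup>2"
 have w: "0 \<le> w" "w \<le> 1 / 400"
  using power_mono[OF Mh(3) Mh(4), of 2] by (auto simp: w_def power_mult_distrib power_divide)
 have uw: "u = w * D\<^sup>2" by (simp add: u_def w_def)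
 have L2: "1 + 114 * w \<le> L\<^sup>2" by (simp add: L_def w_def power2_sum)
 have "R\<^sup>2 \<le> (1 + 114 * w) * D\<^sup>2" using up u0 by (simp add: uw algebra_simps)
 also have "... \<le> L\<^sup>2 * D\<^sup>2" using L2 by (intro mult_right_mono) auto
 finally have "R\<^sup>2 \<le> (L * D)\<^sup>2" by (simp add: power_mult_distrib)
 then show "dist x y \<le> L * dist (a x) (a y)"
  using L1 by (auto simp: dist_norm R_def D_def p_def q_def)
 \<comment> \<open>The lower bound for \<open>R\<^sup>2\<close> is inverted: the product of the two
   factors is at least 1 for \<open>w \<le> 1 / 400\<close>.\<close>
 have "D\<^sup>2 * ((1 - 44 * w) * (1 + 114 * w)) \<ge> D\<^sup>2 * 1"
 proof (rule mult_left_mono)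
  have "44 * 114 * w * w \<le> 44 * 114 * (1 / 400) * w" using w by (intro mult_right_mono) auto
  then show "1 \<le> (1 - 44 * w) * (1 + 114 * w)" using w by (simp add: algebra_simps)
 qed simp
 then have "D\<^sup>2 \<le> (D\<^sup>2 - 44 * u) * (1 + 114 * w)" by (simp add: uw algebra_simps)
 also have "... \<le> R\<^sup>2 * L\<^sup>2" using lo L2 w by (intro mult_mono) auto
 finally have "D\<^sup>2 \<le> (L * R)\<^sup>2" by (simp add: power_mult_distrib mult.commute)
 then show "dist (a x) (a y) \<le> L * dist x y"
  using L1 by (auto simp: dist_norm R_def D_def p_def q_def)
qed

lemma continuous_a: "continuous_on E a"
proof -
 have "L-lipschitz_on E a" using bilipschitz(2) L1 by (intro lipschitz_onI) auto
 then show ?thesis by (rule lipschitz_on_continuous_on)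
qed

text \<open>The inverse of \<open>a\<close> on the polygon: moving \<open>p\<close> along its normal into the plane of the polygon.\<close>

definition "tb p = ((x0 - p) \<bullet> n) / (\<nu> p \<bullet> n)"
definition "b p = p + tb p *\<^sub>R \<nu> p"
definition "Gn = {p\<in>G. \<nu> p \<bullet> n \<noteq> 0}"
definition "Dt p = (- (1 / (\<nu> p \<bullet> n))) *\<^sub>R blinfun_inner_left n -
 (((x0 - p) \<bullet> n) / (\<nu> p \<bullet> n)\<^sup>2) *\<^sub>R (blinfun_inner_left n o\<^sub>L shape_op G \<nu> p)"
definition "Db p = id_blinfun + product_deriv tb Dt \<nu> (shape_op G \<nu>) p"

lemma b_plane: "p \<in> Gn ==> b p \<in> affine hull (set ps)"
 by (auto simp: plane b_def tb_def Gn_def inner_diff_left inner_add_left)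

lemma a_Gn: "x \<in> E ==> a x \<in> Gn" using normal_dot a_in by (force simp: Gn_def)

lemma b_a: assumes x: "x \<in> E" shows "b (a x) = x" "\<bar>tb (a x)\<bar> < \<delta>"
proof -
 obtain s where s: "x = a x + s *\<^sub>R \<nu> (a x)" "\<bar>s\<bar> < \<delta>" using foot[OF x] by metis
 have nz: "\<nu> (a x) \<bullet> n \<noteq> 0" using a_Gn[OF x] by (simp add: Gn_def)
 have "(x0 - a x) \<bullet> n = (x - a x) \<bullet> n" using E_plane[OF x] by (simp add: inner_diff_left)
 also have "... = s * (\<nu> (a x) \<bullet> n)" using s(1) by (metis add_diff_cancel_left' inner_scaleR_left)
 finally have "tb (a x) = s" using nz by (simp add: tb_def)
 then show "b (a x) = x" "\<bar>tb (a x)\<bar> < \<delta>" using s by (auto simp: b_def)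
qed

lemma b_derivative: "p \<in> Gn ==> (b has_derivative blinfun_apply (Db p)) (at p within G)"
 and continuous_Db: "continuous_on Gn Db" and continuous_b: "continuous_on Gn b" "continuous_on Gn tb"
proof -
 have sub: "Gn \<subseteq> G" by (auto simp: Gn_def)
 have c\<nu>: "continuous_on Gn \<nu>" and cS: "continuous_on Gn (shape_op G \<nu>)"
  using continuous_on_normal[OF C] shape_op_continuous[OF C] sub by (auto intro: continuous_on_subset)
 show ct: "continuous_on Gn tb" unfolding tb_def[abs_def] by (intro continuous_intros c\<nu>) (auto simp: Gn_def)
 then show "continuous_on Gn b" unfolding b_def[abs_def] by (intro continuous_intros c\<nu>)
 have cDt: "continuous_on Gn Dt"
  unfolding Dt_def[abs_def] by (intro continuous_intros c\<nu> cS) (auto simp: Gn_def)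
 show "continuous_on Gn Db"
  unfolding Db_def[abs_def] by (intro continuous_intros continuous_on_product_deriv ct cDt c\<nu> cS)
 show "(b has_derivative blinfun_apply (Db p)) (at p within G)" if p: "p \<in> Gn"
 proof -
  have p': "p \<in> G" "\<nu> p \<bullet> n \<noteq> 0" using p by (auto simp: Gn_def)
  have 1: "((\<lambda>p. (x0 - p) \<bullet> n) has_derivative (\<lambda>v. (0 - v) \<bullet> n)) (at p within G)" by (intro derivative_intros)
  have 2: "((\<lambda>p. \<nu> p \<bullet> n) has_derivative (\<lambda>v. shape_op G \<nu> p v \<bullet> n)) (at p within G)"
   by (intro derivative_intros shape_op_derivative[OF C p'(1)])
  have "(tb has_derivative (\<lambda>v. - ((x0 - p) \<bullet> n) * (inverse (\<nu> p \<bullet> n) * (shape_op G \<nu> p v \<bullet> n) * inverse (\<nu> p \<bullet> n)) + ((0 - v) \<bullet> n) / (\<nu> p \<bullet> n))) (at p within G)"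
   unfolding tb_def[abs_def] by (rule has_derivative_divide[OF 1 2 p'(2)])
  then have "(tb has_derivative blinfun_apply (Dt p)) (at p within G)"
   by (rule has_derivative_eq_rhs) (simp add: fun_eq_iff Dt_def blinfun.diff_left blinfun.scaleR_left blinfun.minus_left divide_inverse power2_eq_square)
  from has_derivative_add[OF has_derivative_ident product_deriv_has_derivative[where f=tb and Df=Dt and Y=\<nu> and D="shape_op G \<nu>" and x=p, OF this shape_op_derivative[OF C p'(1)]]]
  show ?thesis unfolding b_def[abs_def]
   by (rule has_derivative_eq_rhs) (simp add: fun_eq_iff Db_def blinfun.add_left)
 qed
qed

text \<open>Near \<open>a x\<close> the map \<open>b\<close> stays inside the polygon, which is open
  in its plane, and moves points by less than \<open>\<delta>\<close>. Uniqueness of the Fermi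
  decomposition then makes \<open>b p\<close> the preimage of \<open>p\<close>; hence the lifted
  polygon is open in \<open>G\<close>.\<close>

lemma open_image:
 assumes x: "x \<in> Q"
 obtains W where "open W" "a x \<in> W" "G \<inter> W \<subseteq> Gn" "!!p. p \<in> G \<inter> W ==> b p \<in> Q \<and> a (b p) = p"
proof -
 have xE: "x \<in> E" using x by simp
 let ?p = "a x"
 have pn: "?p \<in> Gn" by (rule a_Gn[OF xE])
 obtain T where T: "open T" "Q = affine hull (set ps) \<inter> T"
  using poly_region_minus_boundary_open[of ps] by (auto simp: openin_open)
 have "openin (top_of_set G) Gn"
 proof -
  have "openin (top_of_set G) (G \<inter> (\<lambda>p. \<nu> p \<bullet> n) -` (- {0}))"
   by (intro continuous_openin_preimage_gen continuous_intros continuous_on_normal[OF C])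
  moreover have "G \<inter> (\<lambda>p. \<nu> p \<bullet> n) -` (- {0}) = Gn" by (auto simp: Gn_def)
  ultimately show ?thesis by simp
 qed
 moreover have "openin (top_of_set Gn) (Gn \<inter> b -` T)" "openin (top_of_set Gn) (Gn \<inter> tb -` {-\<delta><..<\<delta>})"
  by (intro continuous_openin_preimage_gen continuous_b T(1) open_greaterThanLessThan)+
 ultimately have "openin (top_of_set G) ((Gn \<inter> b -` T) \<inter> (Gn \<inter> tb -` {-\<delta><..<\<delta>}))"
  by (meson openin_Int openin_trans)
 then obtain W where W: "open W" "(Gn \<inter> b -` T) \<inter> (Gn \<inter> tb -` {-\<delta><..<\<delta>}) = G \<inter> W"
  by (auto simp: openin_open)
 have "?p \<in> G \<inter> W" unfolding W(2)[symmetric] using pn b_a[OF xE] x T(2) by auto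
 then have pW: "?p \<in> W" by simp
 have main: "b p \<in> Q \<and> a (b p) = p" if "p \<in> G \<inter> W" for p
 proof -
  have p: "p \<in> Gn" "b p \<in> T" "\<bar>tb p\<bar> < \<delta>" using that unfolding W(2)[symmetric] by auto
  then have "b p \<in> Q" using T(2) b_plane by simp
  moreover have "a (b p) = p"
   by (rule fermi_proj_eq[OF fermi _ _ p(3)]) (use calculation EU p(1) in \<open>auto simp: b_def Gn_def\<close>)
  ultimately show ?thesis ..
 qed
 show ?thesis by (rule that[OF W(1) pW _ main]) (use W(2) in auto)
qed

text \<open>Near \<open>a x\<close> the map \<open>b\<close> takes values in the plane of the
  polygon and is bi-Lipschitz with constant \<open>L\<close>. Both facts pass to the derivative
  along a chart.\<close>

lemma Db_near_isometry:
 assumes x: "x \<in> Q" and v: "v \<bullet> \<nu> (a x) = 0"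
 shows "Db (a x) v \<bullet> n = 0" "norm (Db (a x) v) \<le> L * norm v" "norm v \<le> L * norm (Db (a x) v)"
proof -
 have xE: "x \<in> E" using x by simp
 let ?p = "a x"
 have p: "?p \<in> Gn" "?p \<in> G" using a_Gn[OF xE] by (auto simp: Gn_def)
 obtain W where W: "open W" "?p \<in> W" "G \<inter> W \<subseteq> Gn" "!!q. q \<in> G \<inter> W ==> b q \<in> Q \<and> a (b q) = q"
  by (rule open_image[OF x]) blast
 have "((\<lambda>q. b q \<bullet> n) has_derivative (\<lambda>v. Db ?p v \<bullet> n)) (at ?p within G)"
  by (intro derivative_intros b_derivative p)
 moreover have "((\<lambda>q. b q \<bullet> n) has_derivative (\<lambda>v. 0)) (at ?p within G)"
 proof (rule has_derivative_within_cong[OF has_derivative_const W(1,2) p(2), of "x0 \<bullet> n"])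
  fix q assume "q \<in> G \<inter> W"
  then have "b q \<in> E" using W(4) by auto
  then show "x0 \<bullet> n = b q \<bullet> n" using E_plane by (simp add: inner_diff_left)
 qed
 ultimately show "Db ?p v \<bullet> n = 0" using tangential_derivative_unique[OF C p(2) v] by auto
 obtain e1 e2 U V F where c: "surface_chart G \<nu> ?p e1 e2 U V F" using surface_chart_exists[OF C p(2)] .
 note ch = surface_chartD[OF c]
 define y where "y = chart_coord e1 e2 ?p ?p"
 have y: "y \<in> V" "F y = ?p" using surface_chart_inverse[OF c p(2) ch(2)] by (auto simp: y_def)
 let ?T = "chart_deriv e1 e2 (\<nu> ?p) (\<nu> (F y))"
 have dF: "(F has_derivative ?T) (at y)" by (rule ch(9)[OF y(1)])
 have dbF: "((\<lambda>y. b (F y)) has_derivative (\<lambda>v. Db ?p (?T v))) (at y)"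
  by (rule surface_chart_compose[OF c y(1)]) (use b_derivative[OF p(1)] y(2) in simp)
 have v': "v = ?T (v \<bullet> e1, v \<bullet> e2)"
 proof -
  have "v = (v \<bullet> e1) *\<^sub>R e1 + (v \<bullet> e2) *\<^sub>R e2 + (v \<bullet> \<nu> ?p) *\<^sub>R \<nu> ?p"
   using ch(5) unfolding frame_def by auto
  then show ?thesis using ch(5) v y(2) by (simp add: chart_deriv_def frame_def inner_commute)
 qed
 have "open (F -` W \<inter> V)"
  using continuous_on_open_vimage[OF ch(4), THEN iffD1, OF chart_continuous(1)[OF C c]] W(1) by blast
 then have "eventually (\<lambda>z. z \<in> F -` W \<inter> V) (at y)"
  using y W(2) by (intro eventually_at_in_open') auto
 then have ev: "eventually (\<lambda>z. F z \<in> G \<inter> W) (at y)" by eventually_elim (use ch(10) in auto)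
 have bq: "dist (b q) (b ?p) \<le> L * dist q ?p \<and> dist q ?p \<le> L * dist (b q) (b ?p)" if "q \<in> G \<inter> W" for q
  using W(4)[OF that] bilipschitz[of "b q" x] xE b_a(1)[OF xE] by auto
 have "norm (Db ?p (?T (v \<bullet> e1, v \<bullet> e2))) \<le> L * norm (?T (v \<bullet> e1, v \<bullet> e2))"
  by (rule derivative_norm_le[OF dbF dF]) (use ev in eventually_elim, use bq y(2) in \<open>auto simp: dist_norm\<close>)
 then show "norm (Db ?p v) \<le> L * norm v" using v' by simp
 have "norm (?T (v \<bullet> e1, v \<bullet> e2)) \<le> L * norm (Db ?p (?T (v \<bullet> e1, v \<bullet> e2)))"
  by (rule derivative_norm_le[OF dF dbF]) (use ev in eventually_elim, use bq y(2) in \<open>auto simp: dist_norm\<close>)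
 then show "norm v \<le> L * norm (Db ?p v)" using v' by simp
qed

text \<open>The sum over \<open>Basis\<close> is the adjoint of \<open>Db p\<close> applied to
  \<open>\<xi>\<close>, which is then projected to the tangent plane.\<close>

definition "lift_grad p \<xi> = tangential (\<nu> p) (\<Sum>i\<in>Basis. (\<xi> \<bullet> Db p i) *\<^sub>R i)"

lemma lift_grad_adjoint: "v \<bullet> \<nu> p = 0 ==> lift_grad p \<xi> \<bullet> v = \<xi> \<bullet> Db p v"
proof -
 assume v: "v \<bullet> \<nu> p = 0"
 have "lift_grad p \<xi> \<bullet> v = (\<Sum>i\<in>Basis. (\<xi> \<bullet> Db p i) *\<^sub>R i) \<bullet> v"
  unfolding lift_grad_def inner_tangential_sym tangential_tangent[OF v] ..
 also have "... = (\<Sum>i\<in>Basis. (blinfun_inner_left \<xi> o\<^sub>L Db p) i * (v \<bullet> i))"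
  unfolding inner_sum_left by (simp add: inner_commute[of _ v] inner_commute[of \<xi>])
 also have "... = \<xi> \<bullet> Db p v" by (simp only: sum_blinfun_inner_Basis) (simp add: inner_commute)
 finally show ?thesis .
qed

lemma lift_grad_linear: "lift_grad p (\<xi> + \<zeta>) = lift_grad p \<xi> + lift_grad p \<zeta>" "lift_grad p (c *\<^sub>R \<xi>) = c *\<^sub>R lift_grad p \<xi>"
 unfolding lift_grad_def linear_add[OF linear_tangential, symmetric] linear_scale[OF linear_tangential, symmetric]
 by (simp_all add: inner_add_left scaleR_add_left sum.distrib scaleR_sum_right)

lemma lift_grad_near_isometry:
 assumes x: "x \<in> Q" and \<xi>: "\<xi> \<bullet> n = 0"
 shows "norm (lift_grad (a x) \<xi>) \<le> L * norm \<xi>" "norm \<xi> \<le> L * norm (lift_grad (a x) \<xi>)"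
proof -
 have \<nu>1: "norm (\<nu> (a x)) = 1" using C2_surface_norm[OF C a_in] x by simp
 have t: "lift_grad (a x) \<xi> \<bullet> \<nu> (a x) = 0"
  unfolding lift_grad_def by (rule inner_tangential_left) (use \<nu>1 in \<open>simp add: norm_eq_1\<close>)
 show "norm (lift_grad (a x) \<xi>) \<le> L * norm \<xi>" "norm \<xi> \<le> L * norm (lift_grad (a x) \<xi>)"
  by (rule adjoint_near_isometry[OF \<nu>1 norm_n L1 Db_near_isometry[OF x] \<xi> t lift_grad_adjoint]; assumption)+
qed

lemma lift_grad_inner:
 assumes x: "x \<in> Q" and "\<xi> \<bullet> n = 0" "\<zeta> \<bullet> n = 0"
 shows "\<bar>lift_grad (a x) \<xi> \<bullet> lift_grad (a x) \<zeta> - \<xi> \<bullet> \<zeta>\<bar> \<le> (L\<^sup>2 - 1) * norm \<xi> * norm \<zeta>"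
 by (rule near_isometry_inner[of "{w. w \<bullet> n = 0}"])
   (use assms lift_grad_near_isometry[OF x] L1 lift_grad_linear in \<open>auto simp: subspace_def inner_add_left\<close>)

lemma Q_borel: "Q \<in> sets borel" "a ` Q \<in> sets borel" "a ` Q \<subseteq> G"
proof -
 show "Q \<in> sets borel" using compE compact_poly_boundary[of ps] by (auto simp: compact_imp_closed)
 \<comment> \<open>Injectivity of \<open>a\<close> presents the lifted open polygon as a difference
   of two compact sets.\<close>
 have "a ` Q = a ` E - a ` B" using inj_on_image_set_diff[OF inj _ BE] by auto
 moreover have "compact (a ` E)" "compact (a ` B)"
  by (intro compact_continuous_image continuous_a compE compact_poly_boundary continuous_on_subset[OF continuous_a BE])+
 ultimately show "a ` Q \<in> sets borel" by (auto simp: compact_imp_closed)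
 show "a ` Q \<subseteq> G" using a_in by auto
qed

lemma pair: "bilipschitz_pair 2 Q (a ` Q) a b L" "bilipschitz_pair 2 (a ` Q) Q b a L"
proof -
 have "\<H> 2 (a ` Q) < top"
  using outer_mono[OF Q_borel(3), of 2] hausdorff_surface_finite[OF C comp] by auto
 moreover have "b ` a ` Q = Q" using b_a(1) by (auto simp: image_iff)
 ultimately show 1: "bilipschitz_pair 2 (a ` Q) Q b a L"
  using Q_borel bilipschitz b_a(1) L1 by unfold_locales (auto intro!: lipschitz_onI)
 show "bilipschitz_pair 2 Q (a ` Q) a b L" by (rule bilipschitz_pair.flip[OF 1])
qed

end

section \<open>Hausdorff measure of segments and polygon boundaries\<close>

lemma outer_finite_UN:
 assumes k: "0 < k" and I: "finite I"
 shows "(!!i. i \<in> I ==> \<H> k (A i) < top) ==> \<H> k (\<Union>i\<in>I. A i) < top"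
  and "(!!i. i \<in> I ==> \<H> k (A i) = 0) ==> \<H> k (\<Union>i\<in>I. A i) = 0"
proof -
 have "\<H> k (\<Union>i\<in>I. A i) \<le> (\<Sum>i\<in>I. \<H> k (A i))"
  using I
 proof (induction I)
  case (insert i I)
  have "\<H> k (\<Union>i\<in>insert i I. A i) \<le> \<H> k (A i) + \<H> k (\<Union>i\<in>I. A i)"
   using outer_Un[OF k, of "A i" "\<Union>i\<in>I. A i"] by simp
  then show ?case using insert by (auto intro: order_trans)
 qed (use k in simp)
 then show "(!!i. i \<in> I ==> \<H> k (A i) < top) ==> \<H> k (\<Union>i\<in>I. A i) < top"
  "(!!i. i \<in> I ==> \<H> k (A i) = 0) ==> \<H> k (\<Union>i\<in>I. A i) = 0"
  by (auto intro: le_less_trans simp: I)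
qed

lemma
 fixes x y :: "'a::real_inner"
 shows outer_1_segment_finite: "\<H> 1 (closed_segment x y) < top"
  and outer_2_segment: "\<H> 2 (closed_segment x y) = 0"
  and outer_1_segment_ge: "ennreal (dist x y) \<le> \<H> 1 (closed_segment x y)"
proof -
 have lip: "(dist x y)-lipschitz_on {0..1} (\<lambda>u. (1 - u) *\<^sub>R x + u *\<^sub>R y)"
 proof (rule lipschitz_onI)
  fix s t :: real
  have "((1 - s) *\<^sub>R x + s *\<^sub>R y) - ((1 - t) *\<^sub>R x + t *\<^sub>R y) = (s - t) *\<^sub>R (y - x)" by (simp add: algebra_simps)
  then show "dist ((1 - s) *\<^sub>R x + s *\<^sub>R y) ((1 - t) *\<^sub>R x + t *\<^sub>R y) \<le> dist x y * dist s t"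
   unfolding dist_norm by (simp add: norm_minus_commute)
 qed simp
 show "\<H> 1 (closed_segment x y) < top"
  using outer_lipschitz[OF _ lip, of 1] outer_1_unit_interval
  by (auto simp: closed_segment_image_interval ennreal_mult_less_top intro: le_less_trans)
 show "\<H> 2 (closed_segment x y) = 0"
  using outer_lipschitz[OF _ lip, of 2] outer_2_unit_interval
  by (auto simp: closed_segment_image_interval)
 show "ennreal (dist x y) \<le> \<H> 1 (closed_segment x y)"
 proof (cases "x = y")
  case False
  define u where "u = (y - x) /\<^sub>R norm (y - x)"
  have u: "norm u = 1" using False by (simp add: u_def)
  have l1: "1-lipschitz_on (closed_segment x y) (\<lambda>z. (z - x) \<bullet> u)"
  proof (rule lipschitz_onI)
   fix z w
   have "(z - x) \<bullet> u - (w - x) \<bullet> u = (z - w) \<bullet> u" by (simp add: inner_diff_left)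
   then show "dist ((z - x) \<bullet> u) ((w - x) \<bullet> u) \<le> 1 * dist z w"
    using Cauchy_Schwarz_ineq2[of "z - w" u] u by (simp add: dist_norm)
  qed simp
  have "{0..dist x y} \<subseteq> (\<lambda>z. (z - x) \<bullet> u) ` closed_segment x y"
  proof
   fix t assume t: "t \<in> {0..dist x y}"
   have "x + t *\<^sub>R u = (1 - t / norm (y - x)) *\<^sub>R x + (t / norm (y - x)) *\<^sub>R y"
    by (simp add: u_def algebra_simps divide_inverse)
   then have "x + t *\<^sub>R u \<in> closed_segment x y" unfolding in_segment
    using t False by (intro exI[of _ "t / norm (y - x)"]) (auto simp: dist_norm norm_minus_commute)
   then show "t \<in> (\<lambda>z. (z - x) \<bullet> u) ` closed_segment x y" using u by (intro image_eqI[of _ _ "x + t *\<^sub>R u"]) (auto simp: norm_eq_1)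
  qed
  from outer_mono[OF this, of 1] outer_lipschitz[OF _ l1, of 1] outer_1_interval_ge[of 0 "dist x y"]
  show ?thesis by auto
 qed simp
qed

lemma poly_boundary_hausdorff: "\<H> 1 (poly_boundary ps) < top" "\<H> 2 (poly_boundary ps) = 0"
 unfolding poly_boundary_def poly_edges_def poly_edge_def
 by (intro outer_finite_UN outer_1_segment_finite outer_2_segment; simp)+

text \<open>A lower Riemann sum for the integral along an edge. Only the first half of each of the
  \<open>N\<close> subintervals is used: the closed halves are disjoint, so their indicators can be
  added, at the cost of a factor 2.\<close>

lemma segment_riemann:
 fixes P P' :: point and g :: "point => real"
 assumes ne: "P \<noteq> P'" and N: "0 < N" and S: "compact S" "\<H> 1 S < top" "closed_segment P P' \<subseteq> S"
  and g: "continuous_on S g" "!!x. x \<in> S ==> 0 \<le> g x"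
  and osc: "!!x z. x \<in> S ==> z \<in> S ==> dist x z \<le> dist P P' / real N ==> \<bar>g x - g z\<bar> \<le> \<omega>"
 shows "dist P P' / (2 * real N) * (\<Sum>j<N. g (P + (real j / real N) *\<^sub>R (P' - P)) - \<omega>) \<le> (LINT x|haus 1 S. g x)"
proof -
 let ?M = "haus 1 S"
 define x where "x j = P + (real j / real N) *\<^sub>R (P' - P)" for j
 define x' where "x' j = P + ((real j + 1 / 2) / real N) *\<^sub>R (P' - P)" for j
 define s where "s j = closed_segment (x j) (x' j)" for j
 define c where "c j = max 0 (g (x j) - \<omega>)" for j
 have S_sets: "S \<in> sets (hausdorff_measure 1)" using S(1) by (intro borel_in_sets_hausdorff) (auto simp: compact_imp_closed)
 interpret finite_measure ?M by (rule finite_measure_haus[OF _ S_sets S(2)]) simp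
 have s_param: "\<exists>t. real j \<le> t \<and> t < real j + 1 \<and> z = P + (t / real N) *\<^sub>R (P' - P) \<and> \<bar>t - real j\<bar> \<le> 1 / 2" if "z \<in> s j" for z j
 proof -
  obtain u where u: "0 \<le> u" "u \<le> 1" "z = (1 - u) *\<^sub>R x j + u *\<^sub>R x' j" using \<open>z \<in> s j\<close> by (auto simp: s_def in_segment)
  have "x' j - x j = (1 / (2 * real N)) *\<^sub>R (P' - P)" by (simp add: x_def x'_def add_divide_distrib scaleR_add_left)
  moreover have "z = x j + u *\<^sub>R (x' j - x j)" using u(3) by (simp add: algebra_simps)
  ultimately have "z = P + ((real j + u / 2) / real N) *\<^sub>R (P' - P)" by (simp add: x_def add_divide_distrib scaleR_add_left)
  then show ?thesis using u(1,2) by (intro exI[of _ "real j + u / 2"]) simp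
 qed
 have sS: "s j \<subseteq> S" if j: "j < N" for j
 proof
  fix z assume "z \<in> s j"
  then obtain t where t: "real j \<le> t" "t < real j + 1" "z = P + (t / real N) *\<^sub>R (P' - P)" using s_param by auto
  have "t \<le> real N" using t(2) j by auto
  then have "z \<in> closed_segment P P'" unfolding in_segment
   using t N by (intro exI[of _ "t / real N"]) (auto simp: algebra_simps)
  then show "z \<in> S" using S(3) by auto
 qed
 have xs: "x j \<in> s j" for j by (simp add: s_def)
 have step: "(\<Sum>j<N. c j * indicator (s j) z) \<le> g z" if z: "z \<in> S" for z
 proof (cases "\<exists>j<N. z \<in> s j")
  case True
  then obtain j where j: "j < N" "z \<in> s j" by auto
  obtain t where t: "real j \<le> t" "t < real j + 1" "z = P + (t / real N) *\<^sub>R (P' - P)" "\<bar>t - real j\<bar> \<le> 1 / 2" using s_param[OF j(2)] by auto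
  have "z \<notin> s i" if "i \<noteq> j" for i
  proof
   assume "z \<in> s i"
   then obtain t' where t': "real i \<le> t'" "t' < real i + 1" "z = P + (t' / real N) *\<^sub>R (P' - P)" using s_param by auto
   have "t = t'" using t(3) t'(3) ne N by simp
   then show False using t t' that by simp
  qed
  then have "(\<Sum>j<N. c j * indicator (s j) z) = (\<Sum>i\<in>{j}. c i * indicator (s i) z)"
   using j by (intro sum.mono_neutral_right) auto
  also have "... = c j" using j by simp
  also have "... \<le> g z"
  proof -
   have "x j - z = ((real j - t) / real N) *\<^sub>R (P' - P)" by (simp add: x_def t(3) scaleR_diff_left diff_divide_distrib)
   then have "dist (x j) z = \<bar>t - real j\<bar> / real N * dist P P'" by (simp add: dist_norm norm_minus_commute abs_minus_commute)
   also have "... \<le> 1 / real N * dist P P'" using t(4) by (intro mult_right_mono divide_right_mono) auto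
   finally have "\<bar>g (x j) - g z\<bar> \<le> \<omega>" using osc[of "x j" z] xs[of j] sS[OF j(1)] z by auto
   then show ?thesis using g(2)[OF z] by (auto simp: c_def)
  qed
  finally show ?thesis .
 next
  case False
  then show ?thesis using g(2)[OF z] by simp
 qed
 have sm: "s j \<in> sets ?M" if "j < N" for j
  using sS[OF that] S_sets by (auto simp: sets_restrict_space_iff s_def intro!: borel_in_sets_hausdorff)
 have si: "integrable ?M (indicator (s j) :: point => real)" if "j < N" for j
  by (rule integrable_real_indicator[OF sm[OF that]]) (simp only: infinity_ennreal_def emeasure_eq_measure ennreal_less_top)
 have ms: "dist P P' / (2 * real N) \<le> measure ?M (s j)" if j: "j < N" for j
 proof -
  have "x' j - x j = (1 / (2 * real N)) *\<^sub>R (P' - P)" by (simp add: x_def x'_def add_divide_distrib scaleR_add_left)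
  then have "dist (x j) (x' j) = dist P P' / (2 * real N)" by (simp add: dist_norm norm_minus_commute)
  then have "ennreal (dist P P' / (2 * real N)) \<le> \<H> 1 (s j)" using outer_1_segment_ge[of "x j" "x' j"] by (simp add: s_def)
  also have "... = emeasure ?M (s j)"
   using sm[OF j] S_sets by (simp add: emeasure_restrict_space emeasure_hausdorff sets_restrict_space_iff)
  finally show ?thesis by (simp only: emeasure_eq_measure ennreal_le_iff[OF measure_nonneg])
 qed
 have "dist P P' / (2 * real N) * (\<Sum>j<N. g (P + (real j / real N) *\<^sub>R (P' - P)) - \<omega>) = (\<Sum>j<N. (dist P P' / (2 * real N)) * (g (x j) - \<omega>))"
  by (simp add: sum_distrib_left x_def)
 also have "... \<le> (\<Sum>j<N. c j * measure ?M (s j))"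
 proof (rule sum_mono)
  fix j assume "j \<in> {..<N}"
  then have "(dist P P' / (2 * real N)) * c j \<le> measure ?M (s j) * c j" using ms by (intro mult_right_mono) (auto simp: c_def)
  moreover have "(dist P P' / (2 * real N)) * (g (x j) - \<omega>) \<le> (dist P P' / (2 * real N)) * c j" by (intro mult_left_mono) (auto simp: c_def)
  ultimately show "(dist P P' / (2 * real N)) * (g (x j) - \<omega>) \<le> c j * measure ?M (s j)" by (simp add: mult.commute)
 qed
 also have "... = (LINT z|?M. (\<Sum>j<N. c j * indicator (s j) z))"
  using sm si by (subst Bochner_Integration.integral_sum) auto
 also have "... \<le> (LINT z|?M. g z)"
 proof (rule integral_mono)
  show "integrable ?M (\<lambda>z. \<Sum>j<N. c j * indicator (s j) z)" using si by fastforce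
  show "integrable ?M g"
   using set_integrable_hausdorff_continuous[OF _ S(1,2) g(1)] S_sets by (simp add: integrable_restrict_space set_integrable_def)
 qed (use step S_sets in \<open>auto simp: space_restrict_space\<close>)
 finally show ?thesis .
qed

section \<open>Extension by zero and cutoffs along the edges\<close>

lemma C1_within_extend:
 fixes f :: "point => 'b::real_normed_vector"
 assumes op: "!!p. p \<in> A ==> \<exists>W. open W \<and> p \<in> W \<and> G \<inter> W \<subseteq> A" and A: "A \<subseteq> G"
  and f: "!!p. p \<in> A ==> (f has_derivative blinfun_apply (Df p)) (at p within G)" "continuous_on A Df"
  and z: "!!p. p \<in> G - A ==> \<exists>W. open W \<and> p \<in> W \<and> (\<forall>q\<in>A \<inter> W. f q = 0 \<and> Df q = 0)"
 shows "C1_within G (\<lambda>p. if p \<in> A then f p else 0) (\<lambda>p. if p \<in> A then Df p else 0)"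
 unfolding C1_within_def continuous_on_def
proof (intro conjI ballI)
 fix p assume p: "p \<in> G"
 let ?f = "\<lambda>p. if p \<in> A then f p else 0" and ?D = "\<lambda>p. if p \<in> A then Df p else 0"
 have "(?f has_derivative blinfun_apply (?D p)) (at p within G) \<and> (?D \<longlongrightarrow> ?D p) (at p within G)"
 proof (cases "p \<in> A")
  case True
  obtain W where W: "open W" "p \<in> W" "G \<inter> W \<subseteq> A" using op[OF True] by auto
  have "(?f has_derivative blinfun_apply (?D p)) (at p within G)"
  proof (rule has_derivative_within_cong[OF _ W(1,2) p])
   show "(f has_derivative blinfun_apply (?D p)) (at p within G)" using f(1)[OF True] True by simp
  qed (use W(3) in auto)
  moreover have "(Df \<longlongrightarrow> ?D p) (at p within G)"
  proof -
   have "at p within A = at p within G" by (rule at_within_nhd[OF W(2,1)]) (use W(3) A in auto)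
   then show ?thesis using f(2) True by (auto simp: continuous_on_def)
  qed
  then have "(?D \<longlongrightarrow> ?D p) (at p within G)"
   by (rule Lim_transform_eventually) (use W in \<open>auto simp: eventually_at_topological intro!: exI[of _ W]\<close>)
  ultimately show ?thesis ..
 next
  case False
  then obtain W where W: "open W" "p \<in> W" "\<forall>q\<in>A \<inter> W. f q = 0 \<and> Df q = 0" using z p by auto
  have "(?f has_derivative blinfun_apply 0) (at p within G)"
  proof (rule has_derivative_within_cong[OF _ W(1,2) p])
   show "((\<lambda>_. 0) has_derivative blinfun_apply 0) (at p within G)" unfolding zero_blinfun.rep_eq by simp
  qed (use W(3) in auto)
  moreover have "(?D \<longlongrightarrow> 0) (at p within G)"
   by (rule) (use W in \<open>auto simp: eventually_at_topological intro!: exI[of _ W]\<close>)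
  ultimately show ?thesis using False by simp
 qed
 then show "(?f has_derivative blinfun_apply (?D p)) (at p within G)" "(?D \<longlongrightarrow> ?D p) (at p within G)" by auto
qed

text \<open>A product of complementary bumps is C1 and vanishes around every net point, and its
  gradient lives in the balls of radius \<open>2 * r\<close>.\<close>

definition cutoff :: "'i set => ('i => point) => real => point => real" where
 "cutoff J y r x = (\<Prod>j\<in>J. 1 - bump (y j) r x)"

definition cutoff_grad :: "'i set => ('i => point) => real => point => point" where
 "cutoff_grad J y r x = - (\<Sum>j\<in>J. (\<Prod>i\<in>J - {j}. 1 - bump (y i) r x) *\<^sub>R bump_grad (y j) r x)"

lemma cutoff_deriv: "(cutoff J y r has_derivative (\<lambda>v. v \<bullet> cutoff_grad J y r x)) (at x)"
proof -
 have "((\<lambda>x. \<Prod>j\<in>J. 1 - bump (y j) r x) has_derivative (\<lambda>v. \<Sum>j\<in>J. (0 - v \<bullet> bump_grad (y j) r x) * (\<Prod>i\<in>J - {j}. 1 - bump (y i) r x))) (at x)"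
  by (intro has_derivative_prod has_derivative_diff has_derivative_const bump_deriv)
 then show ?thesis unfolding cutoff_def[abs_def] by (rule has_derivative_eq_rhs) (simp add: cutoff_grad_def inner_sum_right sum_negf mult.commute)
qed

lemma continuous_on_bump: "continuous_on S (bump p r)"
 by (rule has_derivative_continuous_on) (rule has_derivative_at_withinI[OF bump_deriv])

lemma continuous_on_cutoff: "continuous_on S (cutoff J y r)" "continuous_on S (cutoff_grad J y r)"
 unfolding cutoff_def[abs_def] cutoff_grad_def[abs_def]
 by (intro continuous_intros continuous_on_bump continuous_on_bump_grad)+

lemma cutoff_bounds: "0 \<le> cutoff J y r x" "cutoff J y r x \<le> 1"
 unfolding cutoff_def using bump_bounds by (auto intro!: prod_nonneg prod_le_1)

lemma cutoff_eq_0: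
 assumes J: "finite J" "j \<in> J" and r: "0 < r" "dist x (y j) < r"
 shows "cutoff J y r x = 0" "cutoff_grad J y r x = 0"
proof -
 have 1: "bump (y j) r x = 1" using r by (intro bump_eq_1) simp
 have "(norm (x - y j))\<^sup>2 \<le> r\<^sup>2" using r by (intro power_mono) (auto simp: dist_norm)
 then have 2: "bump_grad (y j) r x = 0" using r by (simp add: bump_grad_def)
 show "cutoff J y r x = 0" using J 1 by (auto simp: cutoff_def)
 have "(\<Prod>i\<in>J - {k}. 1 - bump (y i) r x) *\<^sub>R bump_grad (y k) r x = 0" if "k \<in> J" for k
  using J 1 2 by auto
 then show "cutoff_grad J y r x = 0" unfolding cutoff_grad_def by (subst sum.neutral) auto
qed

lemma cutoff_eq_1: "0 < r ==> (!!j. j \<in> J ==> 2 * r \<le> dist x (y j)) ==> cutoff J y r x = 1"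
 by (simp add: cutoff_def bump_eq_0)

lemma cutoff_grad_bound:
 assumes r: "0 < r" shows "\<bar>v \<bullet> cutoff_grad J y r x\<bar> \<le> (\<Sum>j\<in>J. 16 / r * norm v * indicator (ball (y j) (2 * r)) x)"
proof -
 have "v \<bullet> cutoff_grad J y r x = - (\<Sum>j\<in>J. (\<Prod>i\<in>J - {j}. 1 - bump (y i) r x) * (v \<bullet> bump_grad (y j) r x))"
  by (simp add: cutoff_grad_def inner_sum_right)
 then have "\<bar>v \<bullet> cutoff_grad J y r x\<bar> \<le> (\<Sum>j\<in>J. \<bar>(\<Prod>i\<in>J - {j}. 1 - bump (y i) r x) * (v \<bullet> bump_grad (y j) r x)\<bar>)"
  by simp
 also have "... \<le> (\<Sum>j\<in>J. 16 / r * norm v * indicator (ball (y j) (2 * r)) x)"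
 proof (rule sum_mono)
  fix j
  show "\<bar>(\<Prod>i\<in>J - {j}. 1 - bump (y i) r x) * (v \<bullet> bump_grad (y j) r x)\<bar> \<le> 16 / r * norm v * indicator (ball (y j) (2 * r)) x"
  proof (cases "x \<in> ball (y j) (2 * r)")
   case True
   have "\<bar>\<Prod>i\<in>J - {j}. 1 - bump (y i) r x\<bar> \<le> 1" using cutoff_bounds[of "J - {j}" y r x] by (simp add: cutoff_def)
   moreover have "\<bar>v \<bullet> bump_grad (y j) r x\<bar> \<le> norm v * (16 / r)"
    by (rule order_trans[OF Cauchy_Schwarz_ineq2 mult_left_mono[OF bump_grad_bound[OF r]]]) simp
   ultimately have "\<bar>\<Prod>i\<in>J - {j}. 1 - bump (y i) r x\<bar> * \<bar>v \<bullet> bump_grad (y j) r x\<bar> \<le> 1 * (norm v * (16 / r))"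
    by (intro mult_mono) auto
   then show ?thesis using True by (simp add: abs_mult mult.commute)
  next
   case False
   then have "bump_grad (y j) r x = 0" using r by (intro bump_eq_0) (auto simp: dist_commute)
   then show ?thesis using r by simp
  qed
 qed
 finally show ?thesis .
qed

text \<open>The surface divergence of the field \<open>f X\<close> for tangential
  \<open>X\<close>.\<close>

definition flux_div :: "(point => point) => (point => point) => (point => point \<Rightarrow>\<^sub>L point) => (point => real) => (point => point \<Rightarrow>\<^sub>L real) => point => real" where
 "flux_div \<nu> X D f Df p = f p * surface_div \<nu> D p + Df p (X p)"

lemma surface_div_product_tangential:
 "X p \<bullet> \<nu> p = 0 ==> surface_div \<nu> (product_deriv f Df X D) p = flux_div \<nu> X D f Df p"
 by (simp add: surface_div_product flux_div_def)

context inscribed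
begin

lemma aE: "compact (a ` E)" "a ` E \<subseteq> G" "a ` E \<subseteq> Gn" "\<H> 2 (a ` E) < top"
proof -
 show "compact (a ` E)" by (intro compact_continuous_image continuous_a compE)
 show "a ` E \<subseteq> G" "a ` E \<subseteq> Gn" using a_in a_Gn by auto
 then show "\<H> 2 (a ` E) < top"
  using outer_mono[of "a ` E" G 2] hausdorff_surface_finite[OF C comp] by simp
qed

lemma lipschitz_a: "S \<subseteq> E ==> L-lipschitz_on S a"
 using bilipschitz(2) L1 by (intro lipschitz_onI) auto

lemma hausdorff_aB: "\<H> 2 (a ` B) = 0"
 using outer_lipschitz[OF _ lipschitz_a[OF BE], of 2] poly_boundary_hausdorff(2) by simp

lemma integrable_piece:
 fixes u :: "point => 'b::{banach, second_countable_topology}"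
 assumes "continuous_on (a ` E) u" shows "integrable (haus 2 (a ` Q)) u"
proof -
 have "set_integrable (hausdorff_measure 2) (a ` E) u"
  by (rule set_integrable_hausdorff_continuous[OF _ aE(1,4) assms]) simp
 then have "set_integrable (hausdorff_measure 2) (a ` Q) u"
  by (rule set_integrable_subset) (use Q_borel in \<open>auto intro: borel_in_sets_hausdorff\<close>)
 then show ?thesis
  using borel_in_sets_hausdorff[OF _ Q_borel(2), of 2] by (simp add: integrable_restrict_space set_integrable_def)
qed

lemma open_piece: assumes "p \<in> a ` Q" shows "\<exists>W. open W \<and> p \<in> W \<and> G \<inter> W \<subseteq> a ` Q"
proof -
 obtain x where x: "x \<in> Q" "p = a x" using assms by auto
 obtain W where W: "open W" "a x \<in> W" "!!q. q \<in> G \<inter> W ==> b q \<in> Q \<and> a (b q) = q"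
  by (rule open_image[OF x(1)]) blast
 have "G \<inter> W \<subseteq> a ` Q" using W(3) by force
 then show ?thesis using W x by auto
qed

text \<open>Regularity up to the boundary of the lifted polygon: \<open>Gn\<close> is relatively
  open in \<open>G\<close>, contains the closed piece, and is where \<open>b\<close> is
  differentiable. Functions composed with \<open>b\<close> are of this kind without being C1 on all
  of \<open>G\<close>.\<close>

definition C1_near :: "(point => real) => (point => point \<Rightarrow>\<^sub>L real) => bool" where
 "C1_near f Df \<longleftrightarrow> (\<forall>p\<in>Gn. (f has_derivative blinfun_apply (Df p)) (at p within G)) \<and> continuous_on Gn Df"

lemma C1_near_continuous:
 assumes "C1_near f Df" shows "continuous_on (a ` E) f" "continuous_on (a ` E) Df"
proof -
 have "!!p. p \<in> Gn ==> (f has_derivative blinfun_apply (Df p)) (at p within Gn)"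
  using assms by (auto simp: C1_near_def Gn_def intro: has_derivative_subset)
 then have "continuous_on Gn f" by (rule has_derivative_continuous_on)
 then show "continuous_on (a ` E) f" using aE(3) by (rule continuous_on_subset)
 show "continuous_on (a ` E) Df" using assms aE(3) by (auto simp: C1_near_def intro: continuous_on_subset)
qed

lemma continuous_flux:
 assumes "C1_within G X D" "C1_near f Df" shows "continuous_on (a ` E) (flux_div \<nu> X D f Df)"
 unfolding flux_div_def[abs_def]
 by (intro continuous_intros C1_near_continuous[OF assms(2)]
   continuous_on_subset[OF _ aE(2)] continuous_on_surface_div C1_withinD[OF assms(1)] continuous_on_normal[OF C])

text \<open>The cut-off field extends by 0 to a C1 field on \<open>G\<close>, so the divergence
  theorem turns the integral into minus that of \<open>f\<close> times \<open>X\<close> against the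
  gradient of the cutoff. Each bump contributes at most \<open>16 / r\<close> on a ball of area at
  most \<open>Kb * (2 * r)\<^sup>2\<close>, hence the 64.\<close>

lemma cutoff_estimate:
 assumes X: "C1_within G X D" "!!p. p \<in> G ==> X p \<bullet> \<nu> p = 0" "!!p. p \<in> G ==> norm (X p) \<le> Xm"
  and f: "C1_near f Df"
  and J: "finite J" and r: "0 < r" and cover: "!!x. x \<in> B ==> \<exists>j\<in>J. dist (a x) (y j) < r"
  and Kb: "!!p r. 0 \<le> r ==> \<H> 2 (G \<inter> ball p r) \<le> ennreal (Kb * r\<^sup>2)" "0 \<le> Kb"
  and c: "!!j p. j \<in> J ==> p \<in> a ` E ==> dist p (y j) < 2 * r ==> \<bar>f p\<bar> \<le> c j" "!!j. j \<in> J ==> 0 \<le> c j"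
 shows "\<bar>LINT p|haus 2 (a ` Q). cutoff J y r p * flux_div \<nu> X D f Df p\<bar> \<le> (\<Sum>j\<in>J. c j) * (64 * Kb * Xm * r)"
proof -
 let ?A = "a ` Q" and ?\<eta> = "cutoff J y r" and ?g = "cutoff_grad J y r"
 let ?M = "haus 2 ?A"
 have AE: "?A \<subseteq> a ` E" by auto
 have A_sets: "?A \<in> sets (hausdorff_measure 2)" using Q_borel(2) by (intro borel_in_sets_hausdorff) simp
 interpret finite_measure ?M
  using finite_measure_haus[OF _ A_sets] outer_mono[OF AE, of 2] aE(4) by auto
 have ball_sets: "ball (y j) (2 * r) \<inter> ?A \<in> sets (hausdorff_measure 2)" for j
  by (rule sets.Int[OF borel_in_sets_hausdorff A_sets]) auto
 have ball_int: "integrable ?M (indicator (ball (y j) (2 * r)) :: point => real)" for j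
  using ball_sets[of j] A_sets by (auto simp: integrable_indicator_iff less_top[symmetric] sets_restrict_space_iff)
 define f' where "f' p = ?\<eta> p * f p" for p
 define Df' where "Df' p = ?\<eta> p *\<^sub>R Df p + f p *\<^sub>R blinfun_inner_left (?g p)" for p
 let ?\<zeta> = "\<lambda>p. if p \<in> ?A then f' p else 0" and ?D\<zeta> = "\<lambda>p. if p \<in> ?A then Df' p else 0"
 have \<zeta>: "C1_within G ?\<zeta> ?D\<zeta>"
 proof (rule C1_within_extend[OF open_piece Q_borel(3)])
  fix p assume p: "p \<in> ?A"
  then have "(f has_derivative blinfun_apply (Df p)) (at p within G)" using f aE(3) by (auto simp: C1_near_def)
  from has_derivative_mult[OF has_derivative_at_withinI[OF cutoff_deriv] this]
  show "(f' has_derivative blinfun_apply (Df' p)) (at p within G)" unfolding f'_def[abs_def] by (rule has_derivative_eq_rhs) (simp add: fun_eq_iff Df'_def blinfun.add_left blinfun.scaleR_left)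
 next
  show "continuous_on ?A Df'" unfolding Df'_def[abs_def]
   by (intro continuous_intros continuous_on_cutoff continuous_on_subset[OF C1_near_continuous(1)[OF f] AE] continuous_on_subset[OF C1_near_continuous(2)[OF f] AE])
 next
  fix p assume p: "p \<in> G - ?A"
  show "\<exists>W. open W \<and> p \<in> W \<and> (\<forall>q\<in>?A \<inter> W. f' q = 0 \<and> Df' q = 0)"
  proof (cases "p \<in> a ` E")
   case True
   then obtain x where "x \<in> B" "p = a x" using p by auto
   then obtain j where j: "j \<in> J" "dist p (y j) < r" using cover by auto
   have z: "blinfun_inner_left (0 :: point) = 0" by (rule blinfun_eqI) simp
   have "f' q = 0 \<and> Df' q = 0" if "q \<in> ball (y j) r" for q
    using cutoff_eq_0[OF J j(1) r, of q] that by (simp add: f'_def Df'_def z dist_commute)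
   then show ?thesis using j(2) by (intro exI[of _ "ball (y j) r"]) (auto simp: dist_commute)
  next
   case False
   then show ?thesis using aE(1) by (intro exI[of _ "- (a ` E)"]) (auto simp: compact_imp_closed)
  qed
 qed
 have "0 = (LINT p:G|hausdorff_measure 2. surface_div \<nu> (product_deriv ?\<zeta> ?D\<zeta> X D) p)"
  by (rule divergence_surface[OF C comp C1_within_product[OF \<zeta> X(1)], symmetric]) (use X(2) in simp)
 also have "... = (LINT p:?A|hausdorff_measure 2. ?\<eta> p * flux_div \<nu> X D f Df p + f p * (X p \<bullet> ?g p))"
 proof (rule set_integral_hausdorff_cong)
  fix p assume p: "p \<in> G" "p \<in> ?A"
  then show "surface_div \<nu> (product_deriv ?\<zeta> ?D\<zeta> X D) p = ?\<eta> p * flux_div \<nu> X D f Df p + f p * (X p \<bullet> ?g p)"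
   by (subst surface_div_product_tangential[where X=X and p=p and \<nu>=\<nu>, OF X(2)[OF p(1)]]) (simp add: flux_div_def f'_def Df'_def blinfun.add_left blinfun.scaleR_left distrib_left)
 next
  fix p assume p: "p \<in> G - ?A"
  then show "surface_div \<nu> (product_deriv ?\<zeta> ?D\<zeta> X D) p = 0"
   using X(2)[of p] by (subst surface_div_product_tangential[where X=X and p=p and \<nu>=\<nu>]) (auto simp: flux_div_def)
 qed (use Q_borel(3) in auto)
 also have "... = (LINT p|?M. ?\<eta> p * flux_div \<nu> X D f Df p) + (LINT p|?M. f p * (X p \<bullet> ?g p))"
  unfolding set_integral_haus[OF A_sets]
  by (intro Bochner_Integration.integral_add integrable_piece continuous_intros continuous_on_cutoff continuous_flux[OF X(1) f]
    C1_near_continuous[OF f] continuous_on_subset[OF C1_withinD(3)[OF X(1)] aE(2)])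
 finally have "\<bar>LINT p|?M. ?\<eta> p * flux_div \<nu> X D f Df p\<bar> = \<bar>LINT p|?M. f p * (X p \<bullet> ?g p)\<bar>" by simp
 also have "... \<le> (LINT p|?M. \<bar>f p * (X p \<bullet> ?g p)\<bar>)" by auto
 also have "... \<le> (LINT p|?M. (\<Sum>j\<in>J. c j * (16 / r * Xm) * indicator (ball (y j) (2 * r)) p))"
 proof (rule integral_mono)
  show "integrable ?M (\<lambda>p. \<bar>f p * (X p \<bullet> ?g p)\<bar>)"
   by (intro integrable_piece continuous_intros continuous_on_cutoff
    C1_near_continuous[OF f] continuous_on_subset[OF C1_withinD(3)[OF X(1)] aE(2)])
  show "integrable ?M (\<lambda>p. \<Sum>j\<in>J. c j * (16 / r * Xm) * indicator (ball (y j) (2 * r)) p)"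
   by (intro Bochner_Integration.integrable_sum integrable_mult_right ball_int)
  fix p assume "p \<in> space ?M"
  then have p: "p \<in> ?A" "p \<in> a ` E" "p \<in> G" using A_sets Q_borel(3) by auto
  have "\<bar>f p * (X p \<bullet> ?g p)\<bar> \<le> \<bar>f p\<bar> * (\<Sum>j\<in>J. 16 / r * norm (X p) * indicator (ball (y j) (2 * r)) p)"
   unfolding abs_mult by (intro mult_left_mono cutoff_grad_bound[OF r]) simp
  also have "... = (\<Sum>j\<in>J. \<bar>f p\<bar> * (16 / r * norm (X p) * indicator (ball (y j) (2 * r)) p))" by (rule sum_distrib_left)
  also have "... \<le> (\<Sum>j\<in>J. c j * (16 / r * Xm) * indicator (ball (y j) (2 * r)) p)"
  proof (rule sum_mono)
   fix j assume j: "j \<in> J"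
   show "\<bar>f p\<bar> * (16 / r * norm (X p) * indicator (ball (y j) (2 * r)) p) \<le> c j * (16 / r * Xm) * indicator (ball (y j) (2 * r)) p"
   proof (cases "p \<in> ball (y j) (2 * r)")
    case True
    then have "\<bar>f p\<bar> \<le> c j" using c(1)[OF j p(2)] by (simp add: dist_commute)
    then have "\<bar>f p\<bar> * (16 / r * norm (X p)) \<le> c j * (16 / r * Xm)"
     using r X(3)[OF p(3)] by (intro mult_mono) auto
    then show ?thesis using True by simp
   qed simp
  qed
  finally show "\<bar>f p * (X p \<bullet> ?g p)\<bar> \<le> (\<Sum>j\<in>J. c j * (16 / r * Xm) * indicator (ball (y j) (2 * r)) p)" .
 qed
 also have "... = (\<Sum>j\<in>J. c j * (16 / r * Xm) * measure ?M (ball (y j) (2 * r) \<inter> ?A))"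
  using A_sets ball_int by simp
 also have "... \<le> (\<Sum>j\<in>J. c j * (64 * Kb * Xm * r))"
 proof (rule sum_mono)
  fix j assume j: "j \<in> J"
  have Xm: "0 \<le> Xm" if "G \<noteq> {}" using that X(3) norm_ge_zero order_trans by blast
  have "emeasure ?M (ball (y j) (2 * r) \<inter> ?A) = \<H> 2 (ball (y j) (2 * r) \<inter> ?A)"
   using A_sets ball_sets by (simp add: emeasure_restrict_space emeasure_hausdorff)
  also have "... \<le> \<H> 2 (G \<inter> ball (y j) (2 * r))" using Q_borel(3) by (intro outer_mono) auto
  also have "... \<le> ennreal (Kb * (2 * r)\<^sup>2)" using r by (intro Kb) simp
  finally have m: "measure ?M (ball (y j) (2 * r) \<inter> ?A) \<le> Kb * (2 * r)\<^sup>2"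
   unfolding emeasure_eq_measure using Kb(2) by simp
  have "c j * (16 / r * Xm) * measure ?M (ball (y j) (2 * r) \<inter> ?A) \<le> c j * (16 / r * Xm) * (Kb * (2 * r)\<^sup>2)"
   using m c(2)[OF j] r Xm verts x0 by (intro mult_left_mono mult_nonneg_nonneg) auto
  also have "... = c j * (64 * Kb * Xm * r)" by (simp add: power2_eq_square)
  finally show "c j * (16 / r * Xm) * measure ?M (ball (y j) (2 * r) \<inter> ?A) \<le> c j * (64 * Kb * Xm * r)" .
 qed
 also have "... = (\<Sum>j\<in>J. c j) * (64 * Kb * Xm * r)" by (rule sum_distrib_right[symmetric])
 finally show ?thesis .
qed

definition "edge_net N ij = ps ! fst ij + (real (snd ij) / real N) *\<^sub>R (ps ! (Suc (fst ij) mod length ps) - ps ! fst ij)"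

lemma edges: "i < length ps ==> poly_edge ps i \<subseteq> B" "i < length ps ==> ps ! i \<noteq> ps ! (Suc i mod length ps)"
 "i < length ps ==> dist (ps ! i) (ps ! (Suc i mod length ps)) \<le> hE"
proof -
 assume i: "i < length ps"
 show "poly_edge ps i \<subseteq> B" using i by (auto simp: poly_boundary_def poly_edges_def)
 show "ps ! i \<noteq> ps ! (Suc i mod length ps)" using poly i by (simp add: simple_polygon_def)
 have "Suc i mod length ps < length ps" using i by (intro mod_less_divisor) auto
 then show "dist (ps ! i) (ps ! (Suc i mod length ps)) \<le> hE" using i verts_E by (intro hE(3)) auto
qed

lemma edge_net_in: "i < length ps ==> j < N ==> edge_net N (i, j) \<in> B"
proof -
 assume i: "i < length ps" and j: "j < N"
 have "edge_net N (i, j) \<in> poly_edge ps i" unfolding poly_edge_def in_segment edge_net_def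
  using j by (intro exI[of _ "real j / real N"]) (auto simp: algebra_simps)
 then show ?thesis using edges(1)[OF i] by auto
qed

lemma edge_net_cover:
 assumes N: "0 < N" and x: "x \<in> B"
 shows "\<exists>ij\<in>{..<length ps} \<times> {..<N}. dist x (edge_net N ij) \<le> hE / real N"
proof -
 obtain i where i: "i < length ps" "x \<in> poly_edge ps i" using x by (auto simp: poly_boundary_def poly_edges_def)
 let ?d = "ps ! (Suc i mod length ps) - ps ! i"
 obtain t where t: "0 \<le> t" "t \<le> 1" "x = (1 - t) *\<^sub>R ps ! i + t *\<^sub>R ps ! (Suc i mod length ps)"
  using i(2) by (auto simp: poly_edge_def in_segment)
 \<comment> \<open>The parameter \<open>t = 1\<close> has floor \<open>N\<close>, one past the last
   net point of the edge, hence the \<open>min\<close>; the distance is still at most one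
   step.\<close>
 define j where "j = min (N - 1) (nat \<lfloor>t * real N\<rfloor>)"
 have j: "j < N" "\<bar>t * real N - real j\<bar> \<le> 1"
 proof -
  show "j < N" using N by (simp add: j_def min_def) linarith
  have tN: "0 \<le> t * real N" "t * real N \<le> real N" using t by (auto simp: mult_left_le_one_le)
  have fl: "real (nat \<lfloor>t * real N\<rfloor>) \<le> t * real N" "t * real N < real (nat \<lfloor>t * real N\<rfloor>) + 1" using tN(1) by auto
  have N1: "real (N - 1) = real N - 1" using N by auto
  show "\<bar>t * real N - real j\<bar> \<le> 1"
  proof (cases "N - 1 \<le> nat \<lfloor>t * real N\<rfloor>")
   case True
   then have "real (N - 1) \<le> real (nat \<lfloor>t * real N\<rfloor>)" "j = N - 1" by (simp_all only: j_def if_True)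
   then show ?thesis using tN by linarith
  next
   case False
   then have "j = nat \<lfloor>t * real N\<rfloor>" by (simp add: j_def)
   then show ?thesis using fl by linarith
  qed
 qed
 have "x - edge_net N (i, j) = ((t * real N - real j) / real N) *\<^sub>R ?d"
  using N by (simp add: t(3) edge_net_def diff_divide_distrib algebra_simps)
 then have "dist x (edge_net N (i, j)) = \<bar>t * real N - real j\<bar> / real N * norm ?d" by (simp add: dist_norm)
 also have "... \<le> 1 / real N * hE"
  using j(2) edges(3)[OF i(1)] by (intro mult_mono divide_right_mono) (auto simp: dist_norm norm_minus_commute)
 finally show ?thesis using i(1) j(1) by auto
qed

text \<open>The lifted boundary is compact and disjoint from the lifted open polygon, so at each
  point of the latter the cutoff is eventually 1, and dominated convergence applies.\<close>

lemma cutoff_limit: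
 assumes X: "C1_within G X D" and f: "C1_near f Df" and r: "!!N. 0 < r N" "r \<longlonglongrightarrow> 0"
  and net: "!!N j. j \<in> J N ==> y N j \<in> a ` B"
 shows "(\<lambda>N. LINT p|haus 2 (a ` Q). cutoff (J N) (y N) (r N) p * flux_div \<nu> X D f Df p)
  \<longlonglongrightarrow> (LINT p|haus 2 (a ` Q). flux_div \<nu> X D f Df p)"
proof (rule integral_dominated_convergence)
 let ?M = "haus 2 (a ` Q)"
 have i: "integrable ?M (flux_div \<nu> X D f Df)" by (rule integrable_piece[OF continuous_flux[OF X f]])
 then show "flux_div \<nu> X D f Df \<in> borel_measurable ?M" "integrable ?M (\<lambda>p. norm (flux_div \<nu> X D f Df p))" by auto
 show "(\<lambda>p. cutoff (J N) (y N) (r N) p * flux_div \<nu> X D f Df p) \<in> borel_measurable ?M" for N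
  by (intro borel_measurable_integrable integrable_piece continuous_intros continuous_on_cutoff continuous_flux[OF X f])
 show "AE p in ?M. norm (cutoff (J N) (y N) (r N) p * flux_div \<nu> X D f Df p) \<le> norm (flux_div \<nu> X D f Df p)" for N
  using cutoff_bounds[of "J N" "y N" "r N"] by (intro AE_I2) (auto simp: abs_mult intro: mult_left_le_one_le)
 show "AE p in ?M. (\<lambda>N. cutoff (J N) (y N) (r N) p * flux_div \<nu> X D f Df p) \<longlonglongrightarrow> flux_div \<nu> X D f Df p"
 proof (rule AE_I2)
  fix p assume "p \<in> space ?M"
  then have p: "p \<in> a ` Q" by (auto simp: space_restrict_space)
  have "p \<notin> a ` B" using p BE by (auto dest!: inj_onD[OF inj])
  moreover have "closed (a ` B)"
   by (intro compact_imp_closed compact_continuous_image compact_poly_boundary continuous_on_subset[OF continuous_a BE])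
  ultimately obtain e where e: "0 < e" "!!q. q \<in> a ` B ==> e \<le> dist p q"
   using separate_point_closed[of "a ` B" p] by auto
  have "eventually (\<lambda>N. r N < e / 2) sequentially" using order_tendstoD(2)[OF r(2), of "e / 2"] e(1) by simp
  then have "eventually (\<lambda>N. flux_div \<nu> X D f Df p = cutoff (J N) (y N) (r N) p * flux_div \<nu> X D f Df p) sequentially"
  proof eventually_elim
   case (elim N)
   have "cutoff (J N) (y N) (r N) p = 1" using elim e(2)[OF net] by (intro cutoff_eq_1 r(1)) fastforce
   then show ?case by simp
  qed
  then show "(\<lambda>N. cutoff (J N) (y N) (r N) p * flux_div \<nu> X D f Df p) \<longlonglongrightarrow> flux_div \<nu> X D f Df p"
   by (rule Lim_transform_eventually[OF tendsto_const])
 qed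
qed
end

lemma integral_norm_le_L2:
 fixes u :: "'a => 'b::{real_inner, second_countable_topology, banach}"
 assumes M: "finite_measure M" and u: "sq_int M u"
 shows "integrable M (\<lambda>x. norm (u x))" "(LINT x|M. norm (u x)) \<le> sqrt (measure M (space M)) * sqrt (LINT x|M. (norm (u x))\<^sup>2)"
  "integrable M u"
proof -
 interpret finite_measure M by (rule M)
 have u': "sq_int M (\<lambda>x. norm (u x))" using u by (auto simp: sq_int_def)
 have 1: "sq_int M (\<lambda>x. 1 :: real)" by (simp add: sq_int_def)
 show i: "integrable M (\<lambda>x. norm (u x))" using sq_int_inner(1)[OF 1 u'] by simp
 then show "integrable M u" using u by (simp add: sq_int_def integrable_norm_iff)
 show "(LINT x|M. norm (u x)) \<le> sqrt (measure M (space M)) * sqrt (LINT x|M. (norm (u x))\<^sup>2)"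
  using Cauchy_Schwarz_integral[OF 1 u'] by simp
qed

context inscribed
begin

text \<open>The balls have radius proportional to \<open>1 / Suc N\<close> and there are
  \<open>Suc N\<close> of them per edge, so the bound of \<open>cutoff_estimate\<close> is a Riemann
  sum of \<open>\<bar>f (a x)\<bar>\<close> over the edges. The constant is independent of
  \<open>f\<close>, so it survives approximation.\<close>

lemma boundary_estimate:
 assumes X: "C1_within G X D" "!!p. p \<in> G ==> X p \<bullet> \<nu> p = 0"
 obtains c where "0 \<le> c" "!!f Df. C1_near f Df ==>
  \<bar>LINT p|haus 2 (a ` Q). flux_div \<nu> X D f Df p\<bar> \<le> c * (LINT x|haus 1 B. \<bar>f (a x)\<bar>)"
proof -
 obtain Xm where Xm: "!!p. p \<in> G ==> norm (X p) \<le> Xm"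
  using compact_imp_bounded[OF compact_continuous_image[OF C1_withinD(3)[OF X(1)] comp]] by (auto simp: bounded_iff)
 obtain Kb where Kb: "0 \<le> Kb" "!!p r. 0 \<le> r ==> \<H> 2 (G \<inter> ball p r) \<le> ennreal (Kb * r\<^sup>2)"
  by (rule hausdorff_surface_ball[OF C comp]) blast
 have Xm0: "0 \<le> Xm" using order_trans[OF norm_ge_zero Xm] verts x0 by auto
 let ?m = "length ps"
 define l where "l i = dist (ps ! i) (ps ! (Suc i mod ?m))" for i
 \<comment> \<open>The shortest edge: \<open>segment_riemann\<close> bounds the mean over an edge by
   the integral divided by its length.\<close>
 define \<kappa> where "\<kappa> = Min (l ` {..<?m})"
 have m: "0 < ?m" using x0 by auto
 have \<kappa>: "0 < \<kappa>" "!!i. i < ?m ==> \<kappa> \<le> l i"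
 proof -
  have fin: "finite (l ` {..<?m})" "l ` {..<?m} \<noteq> {}" using m by auto
  show "0 < \<kappa>" unfolding \<kappa>_def Min_gr_iff[OF fin] using edges(2) by (auto simp: l_def)
  show "\<kappa> \<le> l i" if "i < ?m" for i unfolding \<kappa>_def using that by simp
 qed
 \<comment> \<open>With this choice \<open>r N\<close> is twice \<open>L * (hE / Suc N)\<close>,
   which bounds the distance from a lifted boundary point to the lifted net, so the open balls
   cover.\<close>
 define R where "R = 2 * L * hE"
 have R: "0 < R" using L1 hE(1) by (simp add: R_def)
 define c0 where "c0 = real ?m * (2 / \<kappa>) * (64 * Kb * Xm * R)"
 have c0: "0 \<le> c0" using \<kappa>(1) Kb(1) Xm0 R by (simp add: c0_def)
 \<comment> \<open>\<open>\<omega>\<close> bounds the oscillation of \<open>f\<close> at the scale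
   of the net; it is sent to 0 only after the limit in \<open>N\<close>.\<close>
 have main: "\<bar>LINT p|haus 2 (a ` Q). flux_div \<nu> X D f Df p\<bar> \<le> c0 * (LINT x|haus 1 B. \<bar>f (a x)\<bar>) + c0 * \<kappa> * \<omega>"
  if f: "C1_near f Df" and \<omega>: "0 < \<omega>" for f Df \<omega>
 proof -
  let ?I = "LINT x|haus 1 B. \<bar>f (a x)\<bar>"
  obtain d where d: "0 < d" "!!p q. p \<in> a ` E ==> q \<in> a ` E ==> dist p q < d ==> \<bar>f p - f q\<bar> < \<omega>"
   using compact_uniformly_continuous[OF C1_near_continuous(1)[OF f] aE(1)] \<omega> unfolding uniformly_continuous_on_def dist_real_def by force
  define r where "r N = R / real (Suc N)" for N
  define J where "J N = {..<?m} \<times> {..<Suc N}" for N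
  define y where "y N = (\<lambda>ij. a (edge_net (Suc N) ij))" for N
  have r: "0 < r N" for N using R by (simp add: r_def)
  have r0: "r \<longlonglongrightarrow> 0" unfolding r_def[abs_def] by (rule LIMSEQ_Suc[OF lim_const_over_n])
  have net: "y N j \<in> a ` B" "y N j \<in> a ` E" if "j \<in> J N" for N j
   using that edge_net_in BE by (fastforce simp: J_def y_def)+
  have lim: "(\<lambda>N. \<bar>LINT p|haus 2 (a ` Q). cutoff (J N) (y N) (r N) p * flux_div \<nu> X D f Df p\<bar>)
   \<longlonglongrightarrow> \<bar>LINT p|haus 2 (a ` Q). flux_div \<nu> X D f Df p\<bar>"
   by (intro tendsto_rabs cutoff_limit X(1) f r r0 net)
  have "eventually (\<lambda>N. r N < d / 2) sequentially" using order_tendstoD(2)[OF r0, of "d / 2"] d(1) by simp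
  then have "eventually (\<lambda>N. \<bar>LINT p|haus 2 (a ` Q). cutoff (J N) (y N) (r N) p * flux_div \<nu> X D f Df p\<bar> \<le> c0 * ?I + c0 * \<kappa> * \<omega>) sequentially"
  proof eventually_elim
   case (elim N)
   define c where "c j = \<bar>f (y N j)\<bar> + \<omega>" for j
   have "0 < L * (hE / real (Suc N))" using L1 hE(1) by auto
   moreover have "r N = 2 * (L * (hE / real (Suc N)))" by (simp add: r_def R_def)
   ultimately have rN: "L * (hE / real (Suc N)) < r N" by auto
   have adist: "dist (a x) (a z) < d" if "x \<in> B" "z \<in> B" "dist x z \<le> hE / real (Suc N)" for x z
   proof -
    have "dist (a x) (a z) \<le> L * dist x z" using bilipschitz(2) that BE by auto
    also have "... \<le> L * (hE / real (Suc N))" using that L1 by (intro mult_left_mono) auto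
    also note rN
    finally show ?thesis using elim d(1) by simp
   qed
   have "\<bar>LINT p|haus 2 (a ` Q). cutoff (J N) (y N) (r N) p * flux_div \<nu> X D f Df p\<bar> \<le> (\<Sum>j\<in>J N. c j) * (64 * Kb * Xm * r N)"
   proof (rule cutoff_estimate[OF X Xm f _ r _ Kb(2,1)])
    fix x assume x: "x \<in> B"
    then obtain ij where ij: "ij \<in> J N" "dist x (edge_net (Suc N) ij) \<le> hE / real (Suc N)"
     using edge_net_cover[of "Suc N" x] by (auto simp: J_def)
    then have "edge_net (Suc N) ij \<in> B" using edge_net_in by (auto simp: J_def)
    then have "dist (a x) (y N ij) \<le> L * dist x (edge_net (Suc N) ij)" unfolding y_def using x BE by (intro bilipschitz(2)) auto
    also have "... \<le> L * (hE / real (Suc N))" using ij L1 by (intro mult_left_mono) auto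
    also note rN
    finally show "\<exists>j\<in>J N. dist (a x) (y N j) < r N" using ij(1) by auto
   next
    fix j p assume j: "j \<in> J N" "p \<in> a ` E" "dist p (y N j) < 2 * r N"
    then show "\<bar>f p\<bar> \<le> c j" using d(2)[OF j(2) net(2)[OF j(1)]] elim by (simp add: c_def)
   qed (use \<omega> in \<open>auto simp: c_def J_def\<close>)
   also have "(\<Sum>j\<in>J N. c j) = (\<Sum>i<?m. \<Sum>j<Suc N. c (i, j))" unfolding J_def sum.cartesian_product by auto
   also have "... \<le> (\<Sum>i<?m. (2 / \<kappa> * ?I + 2 * \<omega>) * real (Suc N))"
   proof (rule sum_mono)
    fix i assume "i \<in> {..<?m}"
    then have i: "i < ?m" by simp
    have "l i / (2 * real (Suc N)) * (\<Sum>j<Suc N. \<bar>f (a (ps ! i + (real j / real (Suc N)) *\<^sub>R (ps ! (Suc i mod ?m) - ps ! i)))\<bar> - \<omega>) \<le> ?I"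
     unfolding l_def
    proof (rule segment_riemann[OF edges(2)[OF i] _ compact_poly_boundary poly_boundary_hausdorff(1)])
     show "closed_segment (ps ! i) (ps ! (Suc i mod ?m)) \<subseteq> B" using edges(1)[OF i] by (simp add: poly_edge_def)
     show "continuous_on B (\<lambda>x. \<bar>f (a x)\<bar>)"
      by (intro continuous_intros continuous_on_compose2[OF C1_near_continuous(1)[OF f] continuous_on_subset[OF continuous_a BE]]) (use BE in auto)
     fix x z assume xz: "x \<in> B" "z \<in> B" "dist x z \<le> dist (ps ! i) (ps ! (Suc i mod ?m)) / real (Suc N)"
     have "dist (ps ! i) (ps ! (Suc i mod ?m)) / real (Suc N) \<le> hE / real (Suc N)" using edges(3)[OF i] by (intro divide_right_mono) auto
     then have "\<bar>f (a x) - f (a z)\<bar> < \<omega>" using adist[OF xz(1,2)] xz BE by (intro d(2)) auto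
     then show "\<bar>\<bar>f (a x)\<bar> - \<bar>f (a z)\<bar>\<bar> \<le> \<omega>" by auto
    qed auto
    then have 1: "l i / (2 * real (Suc N)) * (\<Sum>j<Suc N. \<bar>f (y N (i, j))\<bar> - \<omega>) \<le> ?I" by (simp add: y_def edge_net_def)
    have li: "0 < l i" "\<kappa> \<le> l i" using \<kappa> i by (auto intro: less_le_trans)
    have "(\<Sum>j<Suc N. \<bar>f (y N (i, j))\<bar> - \<omega>) \<le> 2 * real (Suc N) / l i * ?I"
     using 1 li(1) by (simp add: field_simps)
    also have "... \<le> 2 * real (Suc N) / \<kappa> * ?I"
     using li \<kappa>(1) by (intro mult_right_mono divide_left_mono) auto
    also have "... = 2 / \<kappa> * ?I * real (Suc N)" by auto
    finally have "(\<Sum>j<Suc N. \<bar>f (y N (i, j))\<bar> - \<omega>) \<le> 2 / \<kappa> * ?I * real (Suc N)" .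
    moreover have "(\<Sum>j<Suc N. c (i, j)) = (\<Sum>j<Suc N. \<bar>f (y N (i, j))\<bar> - \<omega>) + 2 * \<omega> * real (Suc N)"
     by (simp add: c_def sum.distrib sum_subtractf)
    ultimately show "(\<Sum>j<Suc N. c (i, j)) \<le> (2 / \<kappa> * ?I + 2 * \<omega>) * real (Suc N)" by (simp only: distrib_right)
   qed
   also have "(\<Sum>i<?m. (2 / \<kappa> * ?I + 2 * \<omega>) * real (Suc N)) * (64 * Kb * Xm * r N) = real ?m * (2 / \<kappa> * ?I + 2 * \<omega>) * (64 * Kb * Xm * (real (Suc N) * r N))"
    by simp
   also have "real (Suc N) * r N = R" by (simp add: r_def)
   also have "real ?m * (2 / \<kappa> * ?I + 2 * \<omega>) * (64 * Kb * Xm * R) = c0 * ?I + c0 * \<kappa> * \<omega>" using \<kappa>(1) by (simp add: c0_def algebra_simps)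
   finally show ?case using r[of N] Kb(1) Xm0 by (simp add: mult_right_mono)
  qed
  then show ?thesis by (rule tendsto_upperbound[OF lim]) simp
 qed
 show ?thesis
 proof (rule that[OF c0], rule field_le_epsilon)
  fix f Df and e :: real assume f: "C1_near f Df" and e: "0 < e"
  have pos: "0 < c0 * \<kappa> + 1" using c0 \<kappa>(1) by (simp add: add_nonneg_pos)
  have "c0 * \<kappa> * (e / (c0 * \<kappa> + 1)) \<le> e" using pos e by (simp add: field_simps)
  then show "\<bar>LINT p|haus 2 (a ` Q). flux_div \<nu> X D f Df p\<bar> \<le> c0 * (LINT x|haus 1 B. \<bar>f (a x)\<bar>) + e"
   using main[OF f, of "e / (c0 * \<kappa> + 1)"] e pos by simp
 qed
qed

section \<open>Lifting Sobolev functions from a polygon\<close>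

lemma C1_near_restrict: "C1_within G f Df ==> C1_near f Df"
 by (auto simp: C1_near_def C1_within_def Gn_def intro: continuous_on_subset)

lemma C1_near_diff: "C1_near f Df ==> C1_near f' Df' ==> C1_near (\<lambda>p. f p - f' p) (\<lambda>p. Df p - Df' p)"
 unfolding C1_near_def minus_blinfun.rep_eq by (auto intro!: continuous_intros)

lemma C1_near_compose:
 assumes "C1_function \<phi> D\<phi>"
 shows "C1_near (\<lambda>p. \<phi> (b p)) (\<lambda>p. blinfun_inner_left (D\<phi> (b p)) o\<^sub>L Db p)"
 unfolding C1_near_def
proof (intro conjI ballI)
 have D: "(\<phi> has_derivative (\<lambda>v. v \<bullet> D\<phi> x)) (at x)" "continuous_on UNIV D\<phi>" for x
  using assms by (auto simp: C1_function_def gderiv_def)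
 show "continuous_on Gn (\<lambda>p. blinfun_inner_left (D\<phi> (b p)) o\<^sub>L Db p)"
  by (intro continuous_intros continuous_Db continuous_on_compose2[OF D(2) continuous_b(1)]) auto
 fix p assume "p \<in> Gn"
 from has_derivative_compose[OF b_derivative[OF this] D(1)]
 show "((\<lambda>p. \<phi> (b p)) has_derivative blinfun_apply (blinfun_inner_left (D\<phi> (b p)) o\<^sub>L Db p)) (at p within G)"
  by (rule has_derivative_eq_rhs) (simp add: fun_eq_iff)
qed

text \<open>The flux of \<open>u X\<close> with \<open>\<xi>\<close> in the place of the gradient of
  \<open>u\<close> on the polygon, an integrand that makes sense for Sobolev functions.\<close>

definition "lifted_flux X D u \<xi> p = u (b p) * surface_div \<nu> D p + lift_grad p (\<xi> (b p)) \<bullet> X p"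

text \<open>\<open>Db p (X p)\<close> lies in the plane of the polygon, so only the tangential part
  of the gradient contributes.\<close>

lemma flux_compose:
 assumes p: "p \<in> a ` Q" and X: "X p \<bullet> \<nu> p = 0"
 shows "flux_div \<nu> X D (\<lambda>p. \<phi> (b p)) (\<lambda>p. blinfun_inner_left (D\<phi> (b p)) o\<^sub>L Db p) p = lifted_flux X D \<phi> (\<lambda>x. tangential n (D\<phi> x)) p"
proof -
 obtain x where x: "x \<in> Q" "p = a x" using p by auto
 have "Db p (X p) \<bullet> n = 0" using Db_near_isometry(1)[OF x(1)] X x(2) by simp
 then show ?thesis unfolding lifted_flux_def flux_div_def lift_grad_adjoint[OF X] inner_tangential_sym
  by (simp add: tangential_tangent inner_commute)
qed

lemma finite_measure_Q: "finite_measure (haus 2 Q)" "finite_measure (haus 2 (a ` Q))"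
 "Q \<in> sets (hausdorff_measure 2)" "a ` Q \<in> sets (hausdorff_measure 2)" "\<H> 2 Q < top"
proof -
 show *: "Q \<in> sets (hausdorff_measure 2)" "a ` Q \<in> sets (hausdorff_measure 2)" using Q_borel(1,2) by (auto intro: borel_in_sets_hausdorff)
 show **: "\<H> 2 Q < top" using pair(1) by (simp add: bilipschitz_pair_def)
 show "finite_measure (haus 2 Q)" using finite_measure_haus[OF _ *(1) **] by simp
 have "\<H> 2 (a ` Q) < top" using pair(2) by (simp add: bilipschitz_pair_def)
 then show "finite_measure (haus 2 (a ` Q))" using finite_measure_haus[OF _ *(2)] by simp
qed

lemma sq_int_lift:
 fixes u :: "point => 'b::{real_inner, second_countable_topology, banach}"
 assumes "sq_int (haus 2 Q) u"
 shows "sq_int (haus 2 (a ` Q)) (\<lambda>p. u (b p))"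
 using assms bilipschitz_pair.measurable_map[OF pair(2)] bilipschitz_pair.integrable_comp[OF pair(2), of "\<lambda>x. (norm (u x))\<^sup>2"] by (auto simp: sq_int_def)

lemma integral_lift_le:
 fixes u :: "point => 'b::{real_inner, second_countable_topology, banach}"
 assumes u: "sq_int (haus 2 Q) u"
 shows "(LINT p|haus 2 (a ` Q). norm (u (b p)))
  \<le> L\<^sup>2 * sqrt (measure (haus 2 Q) (space (haus 2 Q))) * sqrt (LINT x|haus 2 Q. (norm (u x))\<^sup>2)"
proof -
 have "(LINT p|haus 2 (a ` Q). norm (u (b p))) \<le> L\<^sup>2 * (LINT x|haus 2 Q. norm (u (b (a x))))"
  by (rule bilipschitz_pair.integral_le[OF pair(1)])
    (simp_all add: integral_norm_le_L2(1)[OF finite_measure_Q(2) sq_int_lift[OF u]])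
 also have "(LINT x|haus 2 Q. norm (u (b (a x)))) = (LINT x|haus 2 Q. norm (u x))"
  using finite_measure_Q(3) b_a(1) by (intro Bochner_Integration.integral_cong) auto
 also have "L\<^sup>2 * (LINT x|haus 2 Q. norm (u x)) \<le> L\<^sup>2 * (sqrt (measure (haus 2 Q) (space (haus 2 Q))) * sqrt (LINT x|haus 2 Q. (norm (u x))\<^sup>2))"
  by (intro mult_left_mono integral_norm_le_L2(2) finite_measure_Q(1) u) simp
 finally show ?thesis by auto
qed

lemma sq_int_lift_grad:
 assumes \<xi>: "sq_int (haus 2 Q) \<xi>" and n: "!!x. x \<in> Q ==> \<xi> x \<bullet> n = 0"
 shows "sq_int (haus 2 (a ` Q)) (\<lambda>p. lift_grad p (\<xi> (b p)))"
proof (rule sq_int_bound)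
 show s: "sq_int (haus 2 (a ` Q)) (\<lambda>p. L *\<^sub>R \<xi> (b p))"
  by (intro sq_int_scaleR sq_int_lift \<xi>)
 have m [measurable]: "(\<lambda>p. \<xi> (b p)) \<in> borel_measurable (haus 2 (a ` Q))"
  using sq_int_lift[OF \<xi>] by (simp add: sq_int_def)
 have sub: "a ` Q \<subseteq> Gn" "a ` Q \<subseteq> G" using aE(3) Q_borel(3) by auto
 have [measurable]: "(\<lambda>p. Db p i) \<in> borel_measurable (haus 2 (a ` Q))" "\<nu> \<in> borel_measurable (haus 2 (a ` Q))" for i
  by (intro cont_measurable_haus Q_borel(2) continuous_intros continuous_on_subset[OF continuous_Db sub(1)]
    continuous_on_subset[OF continuous_on_normal[OF C] sub(2)]; simp)+
 show "(\<lambda>p. lift_grad p (\<xi> (b p))) \<in> borel_measurable (haus 2 (a ` Q))"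
  unfolding lift_grad_def tangential_def by simp
 show "AE p in haus 2 (a ` Q). norm (lift_grad p (\<xi> (b p))) \<le> norm (L *\<^sub>R \<xi> (b p))"
  using lift_grad_near_isometry(1) n b_a(1) L1 finite_measure_Q(4) by force
qed

text \<open>Continuity of the flux in the H^1 norm of the polygon, for passing from C1
  approximations to the function itself.\<close>

lemma lifted_flux_integral:
 assumes X: "C1_within G X D" and u: "sq_int (haus 2 Q) u" and \<xi>: "sq_int (haus 2 Q) \<xi>" 
  and n: "!!x. x \<in> Q ==> \<xi> x \<bullet> n = 0" and bd: "!!p. p \<in> G ==> norm (X p) \<le> c" "!!p. p \<in> G ==> \<bar>surface_div \<nu> D p\<bar> \<le> c"
 shows "integrable (haus 2 (a ` Q)) (\<lambda>p. u (b p) * surface_div \<nu> D p)"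
  "integrable (haus 2 (a ` Q)) (\<lambda>p. lift_grad p (\<xi> (b p)) \<bullet> X p)"
  "\<bar>LINT p|haus 2 (a ` Q). lifted_flux X D u \<xi> p\<bar> \<le> c * (L\<^sup>2 * sqrt (measure (haus 2 Q) (space (haus 2 Q)))) * 
   (sqrt (LINT x|haus 2 Q. (norm (u x))\<^sup>2) + L * sqrt (LINT x|haus 2 Q. (norm (\<xi> x))\<^sup>2))"
proof -
 let ?M = "haus 2 (a ` Q)" and ?S = "L\<^sup>2 * sqrt (measure (haus 2 Q) (space (haus 2 Q)))"
 have sub: "a ` Q \<subseteq> G" by (rule Q_borel(3))
 have sp: "space ?M = a ` Q" using finite_measure_Q(4) by simp
 have c: "0 \<le> c" using order_trans[OF norm_ge_zero bd(1)] verts x0 by auto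
 have [measurable]: "X \<in> borel_measurable ?M" "surface_div \<nu> D \<in> borel_measurable ?M"
  by (intro cont_measurable_haus Q_borel(2) continuous_on_subset[OF C1_withinD(3)[OF X] sub]
    continuous_on_subset[OF continuous_on_surface_div[OF C1_withinD(2)[OF X] continuous_on_normal[OF C]] sub]; simp)+
 have Xs: "sq_int ?M X" "sq_int ?M (surface_div \<nu> D)"
  using bd a_in sp by (auto intro!: sq_int_bounded[OF finite_measure_Q(2), of _ c])
 note lu = sq_int_lift[OF u] and l\<xi> = sq_int_lift[OF \<xi>] and lg = sq_int_lift_grad[OF \<xi> n]
 show i1: "integrable ?M (\<lambda>p. u (b p) * surface_div \<nu> D p)" using sq_int_inner(1)[OF lu Xs(2)] by simp
 show i2: "integrable ?M (\<lambda>p. lift_grad p (\<xi> (b p)) \<bullet> X p)" by (rule sq_int_inner(1)[OF lg Xs(1)])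
 have n1: "integrable ?M (\<lambda>p. norm (u (b p)))" "integrable ?M (\<lambda>p. norm (\<xi> (b p)))"
  by (rule integral_norm_le_L2(1)[OF finite_measure_Q(2)], fact)+
 have "\<bar>LINT p|?M. lifted_flux X D u \<xi> p\<bar> \<le> (LINT p|?M. \<bar>lifted_flux X D u \<xi> p\<bar>)" by auto
 also have "... \<le> (LINT p|?M. c * (norm (u (b p)) + L * norm (\<xi> (b p))))"
 proof (rule integral_mono)
  show "integrable ?M (\<lambda>p. \<bar>lifted_flux X D u \<xi> p\<bar>)" unfolding lifted_flux_def using i1 i2 by simp
  show "integrable ?M (\<lambda>p. c * (norm (u (b p)) + L * norm (\<xi> (b p))))" using n1 by simp
  fix p assume "p \<in> space ?M"
  then obtain x where x: "x \<in> Q" "p = a x" and p: "p \<in> G" using sp sub by auto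
  have "norm (lift_grad p (\<xi> (b p))) \<le> L * norm (\<xi> (b p))"
   using lift_grad_near_isometry(1)[OF x(1), of "\<xi> x"] n[OF x(1)] b_a(1)[of x] x by simp
  then have "\<bar>lift_grad p (\<xi> (b p)) \<bullet> X p\<bar> \<le> L * norm (\<xi> (b p)) * c"
   using bd(1)[OF p] by (intro order_trans[OF Cauchy_Schwarz_ineq2] mult_mono) (use L1 in auto)
  moreover have "\<bar>u (b p) * surface_div \<nu> D p\<bar> \<le> norm (u (b p)) * c"
   using bd(2)[OF p] by (simp add: abs_mult mult_left_mono)
  ultimately show "\<bar>lifted_flux X D u \<xi> p\<bar> \<le> c * (norm (u (b p)) + L * norm (\<xi> (b p)))"
   unfolding lifted_flux_def by (simp add: algebra_simps)
 qed
 also have "... = c * ((LINT p|?M. norm (u (b p))) + L * (LINT p|?M. norm (\<xi> (b p))))" using n1 by simp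
 also have "... \<le> c * (?S * sqrt (LINT x|haus 2 Q. (norm (u x))\<^sup>2) + L * (?S * sqrt (LINT x|haus 2 Q. (norm (\<xi> x))\<^sup>2)))"
  using integral_lift_le[OF u] integral_lift_le[OF \<xi>] L1 c by (intro mult_left_mono add_mono) auto
 finally show "\<bar>LINT p|?M. lifted_flux X D u \<xi> p\<bar> \<le> c * ?S * (sqrt (LINT x|haus 2 Q. (norm (u x))\<^sup>2) + L * sqrt (LINT x|haus 2 Q. (norm (\<xi> x))\<^sup>2))"
  by (simp add: algebra_simps)
qed
end

section \<open>Integration over pieces that cover up to a null set, and traces\<close>

lemma set_integrable_hausdorff_iff:
 fixes f :: "'a::metric_space => 'b::{banach, second_countable_topology}"
 shows "S \<in> sets (hausdorff_measure k) ==> set_integrable (hausdorff_measure k) S f \<longleftrightarrow> integrable (haus k S) f"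
 by (simp add: set_integrable_def integrable_restrict_space)

lemma restrict_haus:
 assumes "A \<subseteq> S" "S \<in> sets (hausdorff_measure k)" "A \<in> sets (hausdorff_measure k)"
 shows "restrict_space (haus k S) A = haus k A"
proof -
 have "S \<inter> A = A" using assms(1) by auto
 then show ?thesis using assms by (subst restrict_restrict_space) auto
qed

lemma integrable_hausdorff_subset:
 fixes f :: "'a::metric_space => 'b::{banach, second_countable_topology}"
 assumes f: "integrable (haus k S) f" and A: "A \<subseteq> S" "S \<in> sets (hausdorff_measure k)" "A \<in> sets (hausdorff_measure k)"
 shows "integrable (haus k A) f"
 using set_integrable_subset[of "hausdorff_measure k" S f A] assms by (simp add: set_integrable_hausdorff_iff)

lemma sq_int_subset:
 fixes f :: "'a::metric_space => 'b::{real_inner, second_countable_topology, banach}"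
 assumes f: "sq_int (haus k S) f" and A: "A \<subseteq> S" "S \<in> sets (hausdorff_measure k)" "A \<in> sets (hausdorff_measure k)"
 shows "sq_int (haus k A) f"
 unfolding sq_int_def
proof
 show "f \<in> borel_measurable (haus k A)"
  using measurable_restrict_space1[of f "haus k S" borel A] f unfolding restrict_haus[OF A] sq_int_def by simp
 show "integrable (haus k A) (\<lambda>x. (norm (f x))\<^sup>2)"
  using f by (intro integrable_hausdorff_subset[OF _ A]) (simp add: sq_int_def)
qed

text \<open>On the null remainder \<open>f\<close> is arbitrary; completeness of the measure makes
  it measurable there.\<close>

lemma hausdorff_pieces:
 fixes f :: "'a::metric_space => 'b::{banach, second_countable_topology}"
 assumes k: "0 < k" and T: "finite T" and S: "S \<in> sets (hausdorff_measure k)"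
  and A: "!!i. i \<in> T ==> A i \<in> sets (hausdorff_measure k)" "!!i. i \<in> T ==> A i \<subseteq> S"
  and disj: "!!i j. i \<in> T ==> j \<in> T ==> i \<noteq> j ==> A i \<inter> A j = {}" and null: "\<H> k (S - (\<Union>i\<in>T. A i)) = 0"
 shows "(!!i. i \<in> T ==> f \<in> borel_measurable (haus k (A i))) ==> f \<in> borel_measurable (haus k S)"
  and "(!!i. i \<in> T ==> integrable (haus k (A i)) f) ==> integrable (haus k S) f"
  and "(!!i. i \<in> T ==> integrable (haus k (A i)) f) ==> (LINT x|haus k S. f x) = (\<Sum>i\<in>T. LINT x|haus k (A i). f x)"
proof -
 let ?H = "hausdorff_measure k :: 'a measure"
 define N where "N = S - (\<Union>i\<in>T. A i)"
 have N: "N \<in> null_sets ?H" unfolding N_def by (rule hausdorff_null_sets[OF k null])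
 then have Ns: "N \<in> sets ?H" by auto
 have fN: "f \<in> borel_measurable (haus k N)"
 proof (rule measurableI)
  fix V :: "'b set"
  have "f -` V \<inter> N \<in> sets ?H"
   using complete_measure.complete[OF complete_measure_hausdorff[OF k], of "f -` V \<inter> N" N] N by auto
  then show "f -` V \<inter> space (haus k N) \<in> sets (haus k N)"
   using Ns by (auto simp: sets_restrict_space_iff)
 qed simp
 show meas: "f \<in> borel_measurable (haus k S)" if f: "!!i. i \<in> T ==> f \<in> borel_measurable (haus k (A i))"
 proof (rule measurable_piecewise_restrict[where C = "insert N (A ` T)"])
  show "countable (insert N (A ` T))" using T by (simp add: countable_finite)
  show "space (haus k S) \<subseteq> \<Union> (insert N (A ` T))" by (auto simp: space_restrict_space N_def)
  fix \<Omega> assume \<Omega>: "\<Omega> \<in> insert N (A ` T)"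
  then have \<Omega>': "\<Omega> \<subseteq> S" "\<Omega> \<in> sets ?H" using A Ns by (auto simp: N_def)
  then show "\<Omega> \<inter> space (haus k S) \<in> sets (haus k S)" using S by (auto simp: sets_restrict_space_iff)
  show "f \<in> borel_measurable (restrict_space (haus k S) \<Omega>)"
   unfolding restrict_haus[OF \<Omega>'(1) S \<Omega>'(2)] using \<Omega> f fN by auto
 qed
 assume f: "!!i. i \<in> T ==> integrable (haus k (A i)) f"
 have fi: "set_integrable ?H (A i) f" if "i \<in> T" for i using f[OF that] A(1)[OF that] by (simp add: set_integrable_hausdorff_iff)
 have U: "set_integrable ?H (\<Union>i\<in>T. A i) f" by (rule set_integrable_UN[OF T fi A(1)])
 have AEN: "AE x in ?H. indicator N x *\<^sub>R f x = 0" using AE_not_in[OF N] by auto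
 have mN: "(\<lambda>x. indicator N x *\<^sub>R f x) \<in> borel_measurable ?H" using fN Ns by (simp add: borel_measurable_restrict_space_iff)
 have iN: "set_integrable ?H N f" unfolding set_integrable_def
  using integrable_cong_AE[OF mN borel_measurable_const AEN] by simp
 have S': "S = (\<Union>i\<in>T. A i) \<union> N" using A(2) by (auto simp: N_def)
 have Us: "(\<Union>i\<in>T. A i) \<in> sets ?H" using T A(1) by auto
 have "set_integrable ?H S f" unfolding S' by (rule set_integrable_Un[OF U iN Us Ns])
 then show "integrable (haus k S) f" using S by (simp add: set_integrable_hausdorff_iff)
 have "(LINT x|haus k S. f x) = (LINT x:(\<Union>i\<in>T. A i) \<union> N|?H. f x)"
  unfolding set_integral_haus[OF S, symmetric] S'[symmetric] ..
 also have "... = (LINT x:(\<Union>i\<in>T. A i)|?H. f x) + (LINT x:N|?H. f x)"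
  by (rule set_integral_Un[OF _ U iN]) (auto simp: N_def)
 also have "(LINT x:N|?H. f x) = 0" unfolding set_lebesgue_integral_def by (rule integral_eq_zero_AE[OF AEN])
 also have "(LINT x:(\<Union>i\<in>T. A i)|?H. f x) = (\<Sum>i\<in>T. LINT x:A i|?H. f x)"
  by (rule set_integral_finite_UN_AE[OF T _ A(1) fi]) (use disj in blast)
 finally show "(LINT x|haus k S. f x) = (\<Sum>i\<in>T. LINT x|haus k (A i). f x)"
  using A(1) by (simp add: set_integral_haus)
qed

context inscribed
begin

lemma hausdorff_interior: "poly_interior ps \<in> sets (hausdorff_measure 2)" "\<H> 2 (poly_interior ps - Q) = 0"
proof -
 have "poly_interior ps - Q \<subseteq> B" using poly_interior_bounds(2) by auto
 from outer_mono[OF this, of 2] show 0: "\<H> 2 (poly_interior ps - Q) = 0" by (simp add: poly_boundary_hausdorff)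
 have "poly_interior ps = Q \<union> (poly_interior ps - Q)" using poly_interior_bounds(1) by auto
 then show "poly_interior ps \<in> sets (hausdorff_measure 2)"
  using finite_measure_Q(3) hausdorff_null_sets[OF _ 0] by (metis null_setsD2 pos2 sets.Un)
qed

lemma interior_integral:
 fixes f :: "point => 'b::{banach, second_countable_topology}"
 shows "integrable (haus 2 Q) f ==> (LINT x|haus 2 (poly_interior ps). f x) = (LINT x|haus 2 Q. f x)"
 using hausdorff_pieces(3)[where T="{()}" and A="\<lambda>_. Q" and S="poly_interior ps" and k=2 and f=f]
  hausdorff_interior finite_measure_Q(3) poly_interior_bounds(1) by simp

lemma L2_norm_interior:
 fixes f :: "point => 'b::{real_inner, second_countable_topology, banach}"
 shows "sq_int (haus 2 Q) f ==> L2_norm 2 (poly_interior ps) f = sqrt (LINT x|haus 2 Q. (norm (f x))\<^sup>2)"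
 unfolding L2_norm_eq[OF hausdorff_interior(1)] by (simp add: interior_integral sq_int_def)

lemma L2_interior:
 fixes f :: "point => 'b::{real_inner, second_countable_topology, banach}"
 shows "L2_on 2 (poly_interior ps) f ==> sq_int (haus 2 Q) f"
 unfolding L2_on_iff[OF hausdorff_interior(1)]
 by (rule sq_int_subset[OF _ poly_interior_bounds(1) hausdorff_interior(1) finite_measure_Q(3)])

lemma H1_polygon:
 assumes "H1_on (poly_interior ps) (\<lambda>_. n) v"
 shows "sq_int (haus 2 Q) v" "sq_int (haus 2 Q) (poly_grad ps v)"
  "!!x. x \<in> Q ==> poly_grad ps v x \<bullet> n = 0"
proof -
 have "is_weak_grad (poly_interior ps) (\<lambda>_. n) v (poly_grad ps v)"
  using assms someI_ex[of "is_weak_grad (poly_interior ps) (\<lambda>_. n) v"] by (simp add: H1_on_def poly_grad_def weak_grad_def)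
 then show "sq_int (haus 2 Q) (poly_grad ps v)" "!!x. x \<in> Q ==> poly_grad ps v x \<bullet> n = 0"
  using poly_interior_bounds(1)[of ps] by (auto simp: is_weak_grad_def intro: L2_interior)
 show "sq_int (haus 2 Q) v" using assms by (auto simp: H1_on_def intro: L2_interior)
qed

lemma lift_grad_diff: "lift_grad p (\<xi> - \<zeta>) = lift_grad p \<xi> - lift_grad p \<zeta>"
 using lift_grad_linear(1)[of p "\<xi> - \<zeta>" \<zeta>] by simp

text \<open>The boundary estimate is applied to \<open>\<phi> k\<close> composed with
  \<open>b\<close>, minus \<open>F\<close>. The fluxes converge by the H^1 convergence of
  \<open>\<phi> k\<close>, and the boundary integrals because L^2 convergence implies L^1
  convergence on a boundary of finite length.\<close>

lemma trace_estimate: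
 assumes X: "C1_within G X D" "!!p. p \<in> G ==> X p \<bullet> \<nu> p = 0"
  and c: "0 \<le> c" "!!f Df. C1_near f Df ==> \<bar>LINT p|haus 2 (a ` Q). flux_div \<nu> X D f Df p\<bar> \<le> c * (LINT x|haus 1 B. \<bar>f (a x)\<bar>)"
  and v: "H1_on (poly_interior ps) (\<lambda>_. n) v" and tr: "has_trace ps v g" and F: "C1_within G F DF"
 shows "\<bar>(LINT p|haus 2 (a ` Q). lifted_flux X D v (poly_grad ps v) p) - (LINT p|haus 2 (a ` Q). flux_div \<nu> X D F DF p)\<bar>
  \<le> c * (LINT x|haus 1 B. \<bar>g x - F (a x)\<bar>)"
proof -
 let ?M = "haus 2 (a ` Q)" and ?M1 = "haus 1 B" and ?Y = "poly_grad ps v"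
 note H1 = H1_polygon[OF v]
 obtain \<phi> D\<phi> where \<phi>: "!!k::nat. C1_function (\<phi> k) (D\<phi> k)"
  and l1: "(\<lambda>k. L2_norm 2 (poly_interior ps) (\<lambda>x. \<phi> k x - v x)) \<longlonglongrightarrow> 0"
  and l2: "(\<lambda>k. L2_norm 2 (poly_interior ps) (\<lambda>x. tangential n (D\<phi> k x) - ?Y x)) \<longlonglongrightarrow> 0"
  and l3: "(\<lambda>k. L2_norm 1 B (\<lambda>x. \<phi> k x - g x)) \<longlonglongrightarrow> 0" and g: "L2_on 1 B g"
  using tr unfolding has_trace_def by auto
 have c\<phi>: "continuous_on S (\<phi> k)" "continuous_on S (D\<phi> k)" for S k
  using \<phi>[of k] has_derivative_continuous_on[of UNIV "\<phi> k" "\<lambda>x v. v \<bullet> D\<phi> k x"]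
  by (auto simp: C1_function_def gderiv_def intro: continuous_on_subset)
 have ct: "continuous_on S (\<lambda>x. tangential n (D\<phi> k x))" for S k
  unfolding tangential_def by (intro continuous_intros c\<phi>)
 have s\<phi>: "sq_int (haus 2 Q) (\<phi> k)" "sq_int (haus 2 Q) (\<lambda>x. tangential n (D\<phi> k x))" for k
  by (rule sq_int_continuous[OF _ compE _ _ Q_borel(1) finite_measure_Q(5)], use c\<phi> ct in auto)+
 have nn: "n \<bullet> n = 1" using norm_n by (simp add: norm_eq_1)
 define u \<xi> where "u k x = \<phi> k x - v x" and "\<xi> k x = tangential n (D\<phi> k x) - ?Y x" for k x
 have su: "sq_int (haus 2 Q) (u k)" "sq_int (haus 2 Q) (\<xi> k)" for k
  unfolding u_def[abs_def] \<xi>_def[abs_def] by (intro sq_int_diff s\<phi> H1)+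
 have \<xi>n: "\<xi> k x \<bullet> n = 0" if "x \<in> Q" for k x
  using H1(3)[OF that] inner_tangential_left[OF nn] by (simp add: \<xi>_def inner_diff_left)
 obtain c1 where c1: "!!p. p \<in> G ==> norm (X p) \<le> c1" 
  using compact_imp_bounded[OF compact_continuous_image[OF C1_withinD(3)[OF X(1)] comp]] by (auto simp: bounded_iff)
 obtain c2 where c2: "!!p. p \<in> G ==> norm (surface_div \<nu> D p) \<le> c2" 
  using compact_imp_bounded[OF compact_continuous_image[OF continuous_on_surface_div[OF C1_withinD(2)[OF X(1)] continuous_on_normal[OF C]] comp]]
  by (auto simp: bounded_iff)
 define c' where "c' = max c1 c2"
 have c': "!!p. p \<in> G ==> norm (X p) \<le> c'" "!!p. p \<in> G ==> \<bar>surface_div \<nu> D p\<bar> \<le> c'"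
  using c1 c2 by (auto simp: c'_def intro: max.coboundedI1 max.coboundedI2)
 let ?S = "c' * (L\<^sup>2 * sqrt (measure (haus 2 Q) (space (haus 2 Q))))"
 define A where "A k = (LINT p|?M. lifted_flux X D (u k) (\<xi> k) p)" for k
 have "A \<longlonglongrightarrow> 0"
 proof (rule Lim_null_comparison)
  show "\<forall>\<^sub>F k in sequentially. norm (A k) \<le> ?S * (L2_norm 2 (poly_interior ps) (u k) + L * L2_norm 2 (poly_interior ps) (\<xi> k))"
   using lifted_flux_integral(3)[OF X(1) su(1) su(2) \<xi>n c'] by (auto simp: A_def L2_norm_interior su)
  show "(\<lambda>k. ?S * (L2_norm 2 (poly_interior ps) (u k) + L * L2_norm 2 (poly_interior ps) (\<xi> k))) \<longlonglongrightarrow> 0"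
   using tendsto_mult_left[OF tendsto_add[OF l1 tendsto_mult_left[OF l2, of L]], of ?S] by (simp add: u_def[abs_def] \<xi>_def[abs_def])
 qed
 define I where "I = (LINT p|?M. lifted_flux X D v ?Y p) - (LINT p|?M. flux_div \<nu> X D F DF p)"
 define f Df where "f k p = \<phi> k (b p) - F p" and "Df k p = (blinfun_inner_left (D\<phi> k (b p)) o\<^sub>L Db p) - DF p" for k p
 have f: "C1_near (f k) (Df k)" for k
  unfolding f_def[abs_def] Df_def[abs_def] by (intro C1_near_diff C1_near_compose \<phi> C1_near_restrict F)
 have fl: "(LINT p|?M. flux_div \<nu> X D (f k) (Df k) p) = A k + I" for k
 proof -
  have "(LINT p|?M. flux_div \<nu> X D (f k) (Df k) p) = (LINT p|?M. lifted_flux X D (u k) (\<xi> k) p + (lifted_flux X D v ?Y p - flux_div \<nu> X D F DF p))"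
  proof (rule Bochner_Integration.integral_cong[OF refl])
   fix p assume "p \<in> space ?M"
   then have p: "p \<in> a ` Q" "p \<in> G" using finite_measure_Q(4) a_in by auto
   have "flux_div \<nu> X D (f k) (Df k) p = flux_div \<nu> X D (\<lambda>p. \<phi> k (b p)) (\<lambda>p. blinfun_inner_left (D\<phi> k (b p)) o\<^sub>L Db p) p - flux_div \<nu> X D F DF p"
    by (simp add: flux_div_def f_def Df_def blinfun.diff_left algebra_simps)
   then show "flux_div \<nu> X D (f k) (Df k) p = lifted_flux X D (u k) (\<xi> k) p + (lifted_flux X D v ?Y p - flux_div \<nu> X D F DF p)"
    unfolding flux_compose[where X=X and p=p, OF p(1) X(2)[OF p(2)]] lifted_flux_def u_def \<xi>_def lift_grad_diff inner_diff_left by (simp add: algebra_simps)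
  qed
  also have "... = A k + I"
  proof -
   have "integrable ?M (lifted_flux X D w \<zeta>)"
    if "sq_int (haus 2 Q) w" "sq_int (haus 2 Q) \<zeta>" "!!x. x \<in> Q ==> \<zeta> x \<bullet> n = 0" for w \<zeta>
    unfolding lifted_flux_def[abs_def] using lifted_flux_integral(1,2)[OF X(1) that c'] by simp
   from this[OF su(1,2) \<xi>n, of k k] this[OF H1] integrable_piece[OF continuous_flux[OF X(1) C1_near_restrict[OF F]]]
   show ?thesis by (simp add: A_def I_def)
  qed
  finally show ?thesis .
 qed
 have Bs: "B \<in> sets (hausdorff_measure 1)" "B \<in> sets borel"
  using compact_poly_boundary[of ps] by (auto simp: compact_imp_closed intro!: borel_in_sets_hausdorff)
 have sB: "sq_int ?M1 w" if "continuous_on B w" for w :: "point => real"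
  by (rule sq_int_continuous[OF _ compact_poly_boundary that order_refl Bs(2) poly_boundary_hausdorff(1)]) simp
 have sg: "sq_int ?M1 g" using g by (simp only: L2_on_iff[OF Bs(1)])
 have fM1: "finite_measure ?M1" by (rule finite_measure_haus[OF _ Bs(1) poly_boundary_hausdorff(1)]) simp
 have cF: "continuous_on B (\<lambda>x. F (a x))"
  by (rule continuous_on_compose2[OF C1_withinD(3)[OF F] continuous_on_subset[OF continuous_a BE]]) (use BE a_in in auto)
 define m1 where "m1 = sqrt (measure ?M1 (space ?M1))"
 have "\<bar>A k + I\<bar> \<le> c * (m1 * L2_norm 1 B (\<lambda>x. \<phi> k x - g x) + (LINT x|?M1. \<bar>g x - F (a x)\<bar>))" for k
 proof -
  have s1: "sq_int ?M1 (\<lambda>x. \<phi> k x - g x)" "sq_int ?M1 (\<lambda>x. g x - F (a x))"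
   by (intro sq_int_diff sB sg c\<phi> cF)+
  note n1 = integral_norm_le_L2[OF fM1 s1(1), folded m1_def] and n2 = integral_norm_le_L2(1)[OF fM1 s1(2)]
  have "\<bar>A k + I\<bar> \<le> c * (LINT x|?M1. \<bar>f k (a x)\<bar>)" unfolding fl[symmetric] by (rule c(2)[OF f])
  also have "... \<le> c * (LINT x|?M1. \<bar>\<phi> k x - g x\<bar> + \<bar>g x - F (a x)\<bar>)"
  proof (intro mult_left_mono c(1) integral_mono)
   have "continuous_on B (\<lambda>x. f k (a x))" 
    by (rule continuous_on_compose2[OF C1_near_continuous(1)[OF f] continuous_on_subset[OF continuous_a BE]]) (use BE in auto)
   from integral_norm_le_L2(1)[OF fM1 sB[OF this]] show "integrable ?M1 (\<lambda>x. \<bar>f k (a x)\<bar>)" by simp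
   show "integrable ?M1 (\<lambda>x. \<bar>\<phi> k x - g x\<bar> + \<bar>g x - F (a x)\<bar>)" using n1(1) n2 by simp
   fix x assume "x \<in> space ?M1"
   then have "x \<in> E" using BE Bs(1) by auto
   then show "\<bar>f k (a x)\<bar> \<le> \<bar>\<phi> k x - g x\<bar> + \<bar>g x - F (a x)\<bar>" by (simp add: f_def b_a(1))
  qed
  also have "(LINT x|?M1. \<bar>\<phi> k x - g x\<bar> + \<bar>g x - F (a x)\<bar>) = (LINT x|?M1. \<bar>\<phi> k x - g x\<bar>) + (LINT x|?M1. \<bar>g x - F (a x)\<bar>)"
   using n1(1) n2 by simp
  also have "c * ... \<le> c * (m1 * L2_norm 1 B (\<lambda>x. \<phi> k x - g x) + (LINT x|?M1. \<bar>g x - F (a x)\<bar>))"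
   using n1(2) c(1) unfolding L2_norm_eq[OF Bs(1)] by (intro mult_left_mono) simp_all
  finally show ?thesis .
 qed
 moreover have "(\<lambda>k. \<bar>A k + I\<bar>) \<longlonglongrightarrow> \<bar>0 + I\<bar>" by (intro tendsto_intros \<open>A \<longlonglongrightarrow> 0\<close>)
 moreover have "(\<lambda>k. c * (m1 * L2_norm 1 B (\<lambda>x. \<phi> k x - g x) + (LINT x|?M1. \<bar>g x - F (a x)\<bar>)))
   \<longlonglongrightarrow> c * (m1 * 0 + (LINT x|?M1. \<bar>g x - F (a x)\<bar>))"
  by (intro tendsto_intros l3)
 ultimately have "\<bar>0 + I\<bar> \<le> c * (m1 * 0 + (LINT x|?M1. \<bar>g x - F (a x)\<bar>))" by (intro LIMSEQ_le) auto
 then show ?thesis by (simp add: I_def)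
qed

lemma pairB: "bilipschitz_pair 1 B (a ` B) a b L"
proof
 show "B \<in> sets borel" using compact_poly_boundary[of ps] by (simp add: compact_imp_closed)
 show "a ` B \<in> sets borel"
  using compact_continuous_image[OF continuous_on_subset[OF continuous_a BE] compact_poly_boundary] by (simp add: compact_imp_closed)
 show "L-lipschitz_on B a" by (rule lipschitz_a[OF BE])
 show "L-lipschitz_on (a ` B) b" using bilipschitz(1) b_a(1) L1 BE by (intro lipschitz_onI) (auto simp: subset_iff)
qed (use b_a(1) BE poly_boundary_hausdorff in auto)
end

section \<open>Common edges of neighbouring polygons\<close>

lemma segment_on_line:
 fixes P d :: "'a::real_vector"
 assumes d: "d \<noteq> 0" and "\<alpha> \<le> \<beta>"
 shows "P + t *\<^sub>R d \<in> closed_segment (P + \<alpha> *\<^sub>R d) (P + \<beta> *\<^sub>R d) \<longleftrightarrow> \<alpha> \<le> t \<and> t \<le> \<beta>"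
  "P + t *\<^sub>R d \<in> open_segment (P + \<alpha> *\<^sub>R d) (P + \<beta> *\<^sub>R d) \<longleftrightarrow> \<alpha> < t \<and> t < \<beta>"
proof -
 have inj: "P + s *\<^sub>R d = P + t *\<^sub>R d \<longleftrightarrow> s = t" for s t using d by simp
 have "closed_segment (P + \<alpha> *\<^sub>R d) (P + \<beta> *\<^sub>R d) = (\<lambda>t. P + t *\<^sub>R d) ` {\<alpha>..\<beta>}"
  using closed_segment_linear_image[of "\<lambda>t. t *\<^sub>R d" \<alpha> \<beta>] closed_segment_translation[of P "\<alpha> *\<^sub>R d" "\<beta> *\<^sub>R d"] assms(2) by (simp add: closed_segment_eq_real_ivl image_image)
 then show 1: "P + t *\<^sub>R d \<in> closed_segment (P + \<alpha> *\<^sub>R d) (P + \<beta> *\<^sub>R d) \<longleftrightarrow> \<alpha> \<le> t \<and> t \<le> \<beta>" for t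
  using inj by auto
 show "P + t *\<^sub>R d \<in> open_segment (P + \<alpha> *\<^sub>R d) (P + \<beta> *\<^sub>R d) \<longleftrightarrow> \<alpha> < t \<and> t < \<beta>"
  unfolding open_segment_def Diff_iff 1 insert_iff empty_iff inj by auto
qed

text \<open>Two common points put both segments on one line, where they become parameter intervals
  containing 0 and 1. Since no end of one lies strictly inside the other, the end parameters
  coincide.\<close>

lemma segments_equal:
 fixes P P' R R' :: "'a::real_vector"
 assumes z: "z \<noteq> z'" "z \<in> closed_segment P P'" "z \<in> closed_segment R R'" "z' \<in> closed_segment P P'" "z' \<in> closed_segment R R'"
  and v: "P \<notin> open_segment R R'" "P' \<notin> open_segment R R'" "R \<notin> open_segment P P'" "R' \<notin> open_segment P P'"
 shows "closed_segment P P' = closed_segment R R'"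
proof -
 let ?d = "z' - z"
 have d: "?d \<noteq> 0" using z(1) by simp
 have line: "\<exists>\<alpha> \<beta>. \<alpha> \<le> 0 \<and> 1 \<le> \<beta> \<and> closed_segment A A' = closed_segment (z + \<alpha> *\<^sub>R ?d) (z + \<beta> *\<^sub>R ?d) \<and>
   open_segment A A' = open_segment (z + \<alpha> *\<^sub>R ?d) (z + \<beta> *\<^sub>R ?d) \<and> {A, A'} = {z + \<alpha> *\<^sub>R ?d, z + \<beta> *\<^sub>R ?d}"
  if A: "z \<in> closed_segment A A'" "z' \<in> closed_segment A A'" for A A'
 proof -
  obtain s s' where s: "0 \<le> s" "s \<le> 1" "z = (1 - s) *\<^sub>R A + s *\<^sub>R A'" "0 \<le> s'" "s' \<le> 1" "z' = (1 - s') *\<^sub>R A + s' *\<^sub>R A'"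
   using A by (auto simp: in_segment)
  have ne: "s \<noteq> s'" using s z(1) by auto
  have d': "?d = (s' - s) *\<^sub>R (A' - A)" unfolding s(3,6) by (simp add: algebra_simps)
  have e: "A' - A = (1 / (s' - s)) *\<^sub>R ?d" using ne by (simp add: d')
  have "A = z - s *\<^sub>R (A' - A)" "A' = z + (1 - s) *\<^sub>R (A' - A)" using s(3) by (simp_all add: algebra_simps)
  then have AA: "A = z + (- s / (s' - s)) *\<^sub>R ?d" "A' = z + ((1 - s) / (s' - s)) *\<^sub>R ?d"
   unfolding e by auto
  show ?thesis
  proof (cases "s < s'")
   case True
   then have "- s / (s' - s) \<le> 0" "1 \<le> (1 - s) / (s' - s)" using s by auto
   then show ?thesis using AA by blast
  next
   case False
   then have "1 \<le> - s / (s' - s)" "(1 - s) / (s' - s) \<le> 0" using s ne by (auto simp: field_simps)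
   then show ?thesis using AA
    by (intro exI[of _ "(1 - s) / (s' - s)"] exI[of _ "- s / (s' - s)"]) (auto simp: closed_segment_commute open_segment_commute)
  qed
 qed
 obtain \<alpha> \<beta> where 1: "\<alpha> \<le> 0" "1 \<le> \<beta>" "closed_segment P P' = closed_segment (z + \<alpha> *\<^sub>R ?d) (z + \<beta> *\<^sub>R ?d)"
  "open_segment P P' = open_segment (z + \<alpha> *\<^sub>R ?d) (z + \<beta> *\<^sub>R ?d)" "{P, P'} = {z + \<alpha> *\<^sub>R ?d, z + \<beta> *\<^sub>R ?d}"
  using line[OF z(2,4)] by auto
 obtain \<alpha>' \<beta>' where 2: "\<alpha>' \<le> 0" "1 \<le> \<beta>'" "closed_segment R R' = closed_segment (z + \<alpha>' *\<^sub>R ?d) (z + \<beta>' *\<^sub>R ?d)"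
  "open_segment R R' = open_segment (z + \<alpha>' *\<^sub>R ?d) (z + \<beta>' *\<^sub>R ?d)" "{R, R'} = {z + \<alpha>' *\<^sub>R ?d, z + \<beta>' *\<^sub>R ?d}"
  using line[OF z(3,5)] by auto
 have "\<forall>w\<in>{P, P'}. w \<notin> open_segment R R'" "\<forall>w\<in>{R, R'}. w \<notin> open_segment P P'" using v by auto
 then have n: "z + \<alpha> *\<^sub>R ?d \<notin> open_segment R R'" "z + \<beta> *\<^sub>R ?d \<notin> open_segment R R'" "z + \<alpha>' *\<^sub>R ?d \<notin> open_segment P P'" "z + \<beta>' *\<^sub>R ?d \<notin> open_segment P P'"
  unfolding 1(5) 2(5) by auto
 have le: "\<alpha> \<le> \<beta>" "\<alpha>' \<le> \<beta>'" using 1(1,2) 2(1,2) by auto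
 have "\<alpha> = \<alpha>'" "\<beta> = \<beta>'"
  using n[unfolded 1(4) 2(4) segment_on_line(2)[OF d le(1)] segment_on_line(2)[OF d le(2)]] 1(1,2) 2(1,2) by auto
 then show ?thesis using 1(3) 2(3) by simp
qed

text \<open>Vertex \<open>j\<close> belongs to the half-open edge \<open>j\<close>, and the
  half-open edges of a simple polygon are disjoint.\<close>

lemma vertex_notin_open_edge:
 assumes ps: "simple_polygon ps" and v: "v \<in> set ps" and i: "i < length ps"
 shows "v \<notin> open_segment (ps ! i) (ps ! (Suc i mod length ps))"
proof
 assume o: "v \<in> open_segment (ps ! i) (ps ! (Suc i mod length ps))"
 obtain j where j: "j < length ps" "v = ps ! j" using v by (auto simp: in_set_conv_nth)
 have ne: "i \<noteq> j" using o j(2) by (auto simp: open_segment_def)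
 have "v \<in> poly_edge ps i - {ps ! (Suc i mod length ps)}" using o by (auto simp: poly_edge_def open_segment_def)
 moreover have "v \<in> poly_edge ps j - {ps ! (Suc j mod length ps)}" using ps j by (auto simp: poly_edge_def simple_polygon_def)
 ultimately show False using ps i j(1) ne unfolding simple_polygon_def by auto
qed

lemma outer_null_subset: "A \<subseteq> S ==> \<H> k S = 0 ==> \<H> k A = 0"
 using outer_mono[of A S k] by simp

lemma outer_finite_set: "finite (S :: 'a::real_normed_vector set) ==> \<H> 1 S = 0"
proof -
 assume S: "finite S"
 have "\<H> 1 {x} = 0" for x :: 'a
 proof -
  have "\<H> 1 ((\<lambda>_::real. x) ` {0..1}) \<le> ennreal (0 ^ 1) * \<H> 1 {0..1::real}"
   by (rule outer_lipschitz) (auto intro: lipschitz_onI)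
  moreover have "(\<lambda>_::real. x) ` {0..1} = {x}" by force
  ultimately show ?thesis by simp
 qed
 then have "\<H> 1 (\<Union>x\<in>S. {x}) = 0" by (intro outer_finite_UN(2) S) auto
 then show ?thesis by simp
qed

text \<open>\<open>H1_mesh\<close> compares traces only on edges listed by both polygons. As hanging
  nodes are listed as vertices, no vertex of one polygon lies inside an edge of the other, so two
  edges either coincide or share at most one point.\<close>

lemma edge_overlap:
 assumes ps: "simple_polygon ps" and qs: "simple_polygon qs" and hang: "set qs \<inter> poly_region ps \<subseteq> set ps" "set ps \<inter> poly_region qs \<subseteq> set qs"
  and e: "e \<in> poly_edges ps" "e' \<in> poly_edges qs"
 shows "e = e' \<or> \<H> 1 (e \<inter> e') = 0"
proof -
 obtain i j where i: "i < length ps" "e = closed_segment (ps ! i) (ps ! (Suc i mod length ps))"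
  and j: "j < length qs" "e' = closed_segment (qs ! j) (qs ! (Suc j mod length qs))"
  using e by (auto simp: poly_edges_def poly_edge_def)
 have len: "0 < length ps" "0 < length qs" using ps qs by (auto simp: simple_polygon_def)
 have mem: "ps ! i \<in> set ps" "ps ! (Suc i mod length ps) \<in> set ps" "qs ! j \<in> set qs" "qs ! (Suc j mod length qs) \<in> set qs"
  using i(1) j(1) len by auto
 have out: "w \<notin> open_segment (ps ! i) (ps ! (Suc i mod length ps))" if "w \<in> set qs" for w
 proof
  assume w: "w \<in> open_segment (ps ! i) (ps ! (Suc i mod length ps))"
  then have "w \<in> poly_region ps"
   using i(1) by (auto simp: poly_region_def poly_boundary_def poly_edges_def poly_edge_def open_segment_def)
  then show False using vertex_notin_open_edge[OF ps _ i(1)] w that hang(1) by auto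
 qed
 have out': "w \<notin> open_segment (qs ! j) (qs ! (Suc j mod length qs))" if "w \<in> set ps" for w
 proof
  assume w: "w \<in> open_segment (qs ! j) (qs ! (Suc j mod length qs))"
  then have "w \<in> poly_region qs"
   using j(1) by (auto simp: poly_region_def poly_boundary_def poly_edges_def poly_edge_def open_segment_def)
  then show False using vertex_notin_open_edge[OF qs _ j(1)] w that hang(2) by auto
 qed
 show ?thesis
 proof (cases "\<exists>z z'. z \<noteq> z' \<and> z \<in> e \<inter> e' \<and> z' \<in> e \<inter> e'")
  case True
  then obtain z z' where z: "z \<noteq> z'" "z \<in> e" "z \<in> e'" "z' \<in> e" "z' \<in> e'" by auto
  have "e = e'" unfolding i(2) j(2)
   by (rule segments_equal[OF z[unfolded i(2) j(2)] out'[OF mem(1)] out'[OF mem(2)] out[OF mem(3)] out[OF mem(4)]])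
  then show ?thesis ..
 next
  case False
  then have "e \<inter> e' = {} \<or> (\<exists>z. e \<inter> e' = {z})" by blast
  then have "finite (e \<inter> e')" by auto
  then show ?thesis by (intro disjI2 outer_finite_set)
 qed
qed

section \<open>Gluing the pieces of a mesh\<close>

locale inscribed_mesh =
 fixes G :: "point set" and \<nu> :: "point => point" and \<delta> :: real and U :: "point set" and T :: "point list set" and h K \<gamma> :: real
 assumes C: "C2_surface G \<nu>" and comp: "compact G" and T: "finite T"
  and polygon: "!!ps. ps \<in> T ==> \<exists>\<rho>. inscribed G \<nu> \<delta> U ps h K \<gamma> \<rho>"
  and interiors: "!!ps qs. ps \<in> T ==> qs \<in> T ==> ps \<noteq> qs ==> poly_interior ps \<inter> poly_interior qs = {}"
  and hanging: "!!ps qs. ps \<in> T ==> qs \<in> T ==> set qs \<inter> poly_region ps \<subseteq> set ps"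
  and bij: "bij_betw (fermi_proj G \<nu> \<delta>) (mesh_surface T) G"
begin

abbreviation "piece ps \<rho> \<equiv> inscribed G \<nu> \<delta> U ps h K \<gamma> \<rho>"
abbreviation "a \<equiv> fermi_proj G \<nu> \<delta>"
abbreviation "E \<equiv> poly_region"
abbreviation "B \<equiv> poly_boundary"
abbreviation "Q ps \<equiv> poly_region ps - poly_boundary ps"
abbreviation "b \<equiv> inscribed.b \<nu>"
abbreviation "L \<equiv> inscribed.L h K \<gamma>"
abbreviation "lift_grad \<equiv> inscribed.lift_grad G \<nu>"
abbreviation "lifted_flux \<equiv> inscribed.lifted_flux G \<nu>"

lemma a_inj: "ps \<in> T ==> qs \<in> T ==> x \<in> E ps ==> y \<in> E qs ==> a x = a y ==> x = y"
 using bij by (auto simp: bij_betw_def mesh_surface_def dest!: inj_onD)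

lemma b_a: "ps \<in> T ==> x \<in> E ps ==> b ps (a x) = x"
 using polygon[of ps] inscribed.b_a(1) by auto

lemma BE: "B ps \<subseteq> E ps" by (auto simp: poly_region_def)

lemma Q_disjoint: "ps \<in> T ==> qs \<in> T ==> ps \<noteq> qs ==> Q ps \<inter> Q qs = {}"
 using interiors[of ps qs] poly_interior_bounds(1) by auto

lemma aQ_disjoint: "ps \<in> T ==> qs \<in> T ==> ps \<noteq> qs ==> a ` Q ps \<inter> a ` Q qs = {}"
 using Q_disjoint[of ps qs] a_inj[of ps qs] by auto

lemma aE_cover: "(\<Union>ps\<in>T. a ` E ps) = G"
 using bij unfolding bij_betw_def mesh_surface_def image_UN by auto

lemma G_sets: "G \<in> sets (hausdorff_measure 2)" using comp by (intro borel_in_sets_hausdorff) (auto simp: compact_imp_closed)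

lemma Q_sets: "ps \<in> T ==> Q ps \<in> sets (hausdorff_measure 2)" "ps \<in> T ==> a ` Q ps \<in> sets (hausdorff_measure 2)"
 "ps \<in> T ==> a ` Q ps \<subseteq> G"
proof -
 assume "ps \<in> T"
 then obtain \<rho> where "piece ps \<rho>" using polygon by auto
 then interpret P: inscribed G \<nu> \<delta> U ps h K \<gamma> \<rho> .
 show "Q ps \<in> sets (hausdorff_measure 2)" "a ` Q ps \<in> sets (hausdorff_measure 2)" "a ` Q ps \<subseteq> G"
  by (rule P.finite_measure_Q(3,4) P.Q_borel(3))+
qed

lemma mesh_sets: "mesh_surface T \<in> sets (hausdorff_measure 2)"
proof -
 have "compact (E ps)" if "ps \<in> T" for ps using polygon[OF that] inscribed.compE by auto
 then have "compact (mesh_surface T)" unfolding mesh_surface_def using T by auto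
 then show ?thesis by (intro borel_in_sets_hausdorff) (auto simp: compact_imp_closed)
qed

lemma
 fixes f :: "point => 'b::{banach, second_countable_topology}"
 shows surface_measurable: "(!!ps. ps \<in> T ==> f \<in> borel_measurable (haus 2 (a ` Q ps))) ==> f \<in> borel_measurable (haus 2 G)"
  and surface_integrable: "(!!ps. ps \<in> T ==> integrable (haus 2 (a ` Q ps)) f) ==> integrable (haus 2 G) f"
  and surface_integral: "(!!ps. ps \<in> T ==> integrable (haus 2 (a ` Q ps)) f) ==>
   (LINT p|haus 2 G. f p) = (\<Sum>ps\<in>T. LINT p|haus 2 (a ` Q ps). f p)"
proof -
 have "\<H> 2 (a ` B ps) = 0" if "ps \<in> T" for ps using polygon[OF that] inscribed.hausdorff_aB by auto
 then have 0: "\<H> 2 (\<Union>ps\<in>T. a ` B ps) = 0" by (intro outer_finite_UN(2) T) auto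
 have "G - (\<Union>ps\<in>T. a ` Q ps) \<subseteq> (\<Union>ps\<in>T. a ` B ps)"
 proof
  fix p assume p: "p \<in> G - (\<Union>ps\<in>T. a ` Q ps)"
  then have "p \<in> (\<Union>ps\<in>T. a ` E ps)" using aE_cover by auto
  then show "p \<in> (\<Union>ps\<in>T. a ` B ps)" using p by auto
 qed
 from outer_null_subset[OF this 0] have "\<H> 2 (G - (\<Union>ps\<in>T. a ` Q ps)) = 0" .
 note pieces = hausdorff_pieces[where A="\<lambda>ps. a ` Q ps", OF pos2 T G_sets Q_sets(2,3) aQ_disjoint this]
 show "(!!ps. ps \<in> T ==> f \<in> borel_measurable (haus 2 (a ` Q ps))) ==> f \<in> borel_measurable (haus 2 G)"
  "(!!ps. ps \<in> T ==> integrable (haus 2 (a ` Q ps)) f) ==> integrable (haus 2 G) f"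
  "(!!ps. ps \<in> T ==> integrable (haus 2 (a ` Q ps)) f) ==>
   (LINT p|haus 2 G. f p) = (\<Sum>ps\<in>T. LINT p|haus 2 (a ` Q ps). f p)"
  using pieces by auto
qed

lemma mesh_integral:
 fixes f :: "point => 'b::{banach, second_countable_topology}"
 assumes "!!ps. ps \<in> T ==> integrable (haus 2 (Q ps)) f"
 shows "(LINT x|haus 2 (mesh_surface T). f x) = (\<Sum>ps\<in>T. LINT x|haus 2 (Q ps). f x)"
proof (rule hausdorff_pieces(3)[where A=Q, OF pos2 T mesh_sets Q_sets(1) _ Q_disjoint _ assms])
 have 0: "\<H> 2 (\<Union>ps\<in>T. B ps) = 0" by (intro outer_finite_UN(2) T) (auto simp: poly_boundary_hausdorff)
 have "mesh_surface T - (\<Union>ps\<in>T. Q ps) \<subseteq> (\<Union>ps\<in>T. B ps)" by (auto simp: mesh_surface_def)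
 from outer_null_subset[OF this 0] show "\<H> 2 (mesh_surface T - (\<Union>ps\<in>T. Q ps)) = 0" .
qed (auto simp: mesh_surface_def)

lemma traces_agree:
 assumes g: "!!e. e \<in> poly_edges ps \<inter> poly_edges qs ==> AE x in hausdorff_measure 1. x \<in> e --> g ps x = g qs x"
  and ps: "ps \<in> T" "qs \<in> T"
 shows "AE x in hausdorff_measure 1. x \<in> B ps \<inter> B qs --> g ps x = g qs x"
proof -
 have fin: "finite (poly_edges ps)" "finite (poly_edges qs)" by (auto simp: poly_edges_def)
 have simple: "simple_polygon ps" "simple_polygon qs"
  using polygon[OF ps(1)] polygon[OF ps(2)] by (auto simp: inscribed_def)
 have "AE x in hausdorff_measure 1. x \<in> e \<inter> e' --> g ps x = g qs x" if e: "e \<in> poly_edges ps" "e' \<in> poly_edges qs" for e e'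
  using edge_overlap[OF simple hanging[OF ps(1,2)] hanging[OF ps(2,1)] e]
 proof (elim disjE)
  assume "e = e'"
  then show ?thesis using g[of e] e by simp
 next
  assume "\<H> 1 (e \<inter> e') = 0"
  then have "e \<inter> e' \<in> null_sets (hausdorff_measure 1)" by (intro hausdorff_null_sets) auto
  from AE_not_in[OF this] show ?thesis by auto
 qed
 then have "AE x in hausdorff_measure 1. \<forall>e\<in>poly_edges ps. \<forall>e'\<in>poly_edges qs. x \<in> e \<inter> e' --> g ps x = g qs x"
  unfolding AE_ball_countable[OF countable_finite[OF fin(1)]] AE_ball_countable[OF countable_finite[OF fin(2)]] by auto
 then show ?thesis by (auto simp: poly_boundary_def)
qed
end

lemma sq_int_cong:
 assumes "!!x. x \<in> space M ==> f x = g x"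
 shows "sq_int M f \<longleftrightarrow> sq_int M g"
 unfolding sq_int_def using assms
 by (intro conj_cong measurable_cong Bochner_Integration.integrable_cong) auto

context inscribed_mesh
begin

text \<open>The traces are glued to one function \<open>u\<close> on the lifted skeleton, where
  density of polynomials applies once for all polygons. On a common boundary \<open>u\<close> is
  taken from one polygon, and agreement almost everywhere makes this choice harmless for the
  other.\<close>

lemma trace_approximation:
 assumes g: "!!ps. ps \<in> T ==> L2_on 1 (B ps) (g ps)"
  and agree: "!!ps qs. ps \<in> T ==> qs \<in> T ==> AE x in hausdorff_measure 1. x \<in> B ps \<inter> B qs --> g ps x = g qs x"
  and e: "0 < e"
 obtains q where "real_polynomial_function q" "!!ps. ps \<in> T ==> (LINT x|haus 1 (B ps). \<bar>g ps x - q (a x)\<bar>) \<le> e"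
proof -
 let ?H = "hausdorff_measure 1 :: point measure"
 define Sk where "Sk = (\<Union>ps\<in>T. a ` B ps)"
 have pairB: "bilipschitz_pair 1 (B ps) (a ` B ps) a (b ps) L" "bilipschitz_pair 1 (a ` B ps) (B ps) (b ps) a L" "1 \<le> L"
  and cB: "compact (a ` B ps)" if ps: "ps \<in> T" for ps
 proof -
  obtain \<rho> where "piece ps \<rho>" using polygon ps by auto
  then interpret P: inscribed G \<nu> \<delta> U ps h K \<gamma> \<rho> .
  show "bilipschitz_pair 1 (B ps) (a ` B ps) a (b ps) L" by (rule P.pairB)
  then show "bilipschitz_pair 1 (a ` B ps) (B ps) (b ps) a L" by (rule bilipschitz_pair.flip)
  show "1 \<le> L" by (rule P.L1)
  show "compact (a ` B ps)" by (intro compact_continuous_image continuous_on_subset[OF P.continuous_a P.BE] compact_poly_boundary)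
 qed
 have cSk: "compact Sk" unfolding Sk_def using T cB by auto
 have aB_fin: "\<H> 1 (a ` B ps) < top" if "ps \<in> T" for ps using pairB(2)[OF that] by (simp add: bilipschitz_pair_def)
 have fSk: "\<H> 1 Sk < top" unfolding Sk_def by (intro outer_finite_UN(1) T aB_fin) auto
 have sets1: "compact S ==> S \<in> sets ?H" for S by (intro borel_in_sets_hausdorff) (auto simp: compact_imp_closed)
 \<comment> \<open>An enumeration of \<open>T\<close> decides which polygon defines \<open>u\<close>
   at points shared by several.\<close>
 obtain idx :: "point list => nat" where idx: "inj_on idx T" using finite_imp_inj_to_nat_seg[OF T] by auto
 define W where "W ps = a ` B ps - (\<Union>qs\<in>{qs\<in>T. idx qs < idx ps}. a ` B qs)" for ps
 have Ws: "W ps \<in> sets ?H" if "ps \<in> T" for ps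
  unfolding W_def using T that cB by (intro sets.Diff sets1) auto
 have W_sub: "W ps \<subseteq> a ` B ps" for ps by (auto simp: W_def)
 have W_disj: "W ps \<inter> W qs = {}" if "ps \<in> T" "qs \<in> T" "ps \<noteq> qs" for ps qs
 proof -
  have "idx ps \<noteq> idx qs" using idx that by (auto dest: inj_onD)
  then have "idx ps < idx qs \<or> idx qs < idx ps" by auto
  then show ?thesis using that by (auto simp: W_def)
 qed
 have W_cover: "\<exists>ps\<in>T. p \<in> W ps" if p: "p \<in> Sk" for p
 proof -
  obtain qs where "qs \<in> T \<and> p \<in> a ` B qs" using p by (auto simp: Sk_def)
  from ex_has_least_nat[where P="\<lambda>qs. qs \<in> T \<and> p \<in> a ` B qs" and m=idx, OF this]
  obtain ps where ps: "ps \<in> T" "p \<in> a ` B ps" "!!qs. qs \<in> T ==> p \<in> a ` B qs ==> idx ps \<le> idx qs" by auto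
  then have "p \<in> W ps" by (fastforce simp: W_def)
  then show ?thesis using ps(1) by auto
 qed
 define u where "u p = (let ps = SOME ps. ps \<in> T \<and> p \<in> W ps in g ps (b ps p))" for p
 have u: "u p = g ps (b ps p)" if "ps \<in> T" "p \<in> W ps" for ps p
 proof -
  have "(SOME ps. ps \<in> T \<and> p \<in> W ps) = ps" by (rule) (use that W_disj in blast)+
  then show ?thesis by (simp add: u_def)
 qed
 have Bs: "B ps \<in> sets ?H" for ps by (rule sets1[OF compact_poly_boundary])
 have gs: "sq_int (haus 1 (B ps)) (g ps)" if "ps \<in> T" for ps
  using g[OF that] by (simp only: L2_on_iff[OF Bs])
 have us: "sq_int (haus 1 (W ps)) u" if ps: "ps \<in> T" for ps
 proof -
  have "sq_int (haus 1 (a ` B ps)) (\<lambda>p. g ps (b ps p))"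
   using gs[OF ps] bilipschitz_pair.measurable_comp[OF pairB(2)[OF ps]] bilipschitz_pair.integrable_comp[OF pairB(2)[OF ps], of "\<lambda>x. (norm (g ps x))\<^sup>2"] unfolding sq_int_def by auto
  from sq_int_subset[OF this W_sub sets1[OF cB[OF ps]] Ws[OF ps]]
  show ?thesis by (rule sq_int_cong[THEN iffD1, rotated]) (simp add: u[OF ps] space_restrict_space)
 qed
 have sub: "W ps \<subseteq> Sk" if "ps \<in> T" for ps using W_sub[of ps] that unfolding Sk_def by auto
 have "Sk - (\<Union>ps\<in>T. W ps) = {}" using W_cover by auto
 then have null: "\<H> 1 (Sk - (\<Union>ps\<in>T. W ps)) = 0" by (simp only: outer_empty)
 have uSk: "sq_int (haus 1 Sk) u" unfolding sq_int_def
  using us by (intro conjI hausdorff_pieces(1,2)[where A=W and k=1, OF zero_less_one T sets1[OF cSk] Ws sub W_disj null])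
   (auto simp: sq_int_def)
 let ?M = "haus 1 Sk"
 have fM: "finite_measure ?M" by (rule finite_measure_haus[OF _ sets1[OF cSk] fSk]) simp
 \<comment> \<open>The bound \<open>1 \<le> L\<close> comes only with a polygon of the mesh;
   \<open>max 1 L\<close> is positive also for empty \<open>T\<close>.\<close>
 have sp: "space ?M \<subseteq> Sk" "(\<lambda>x. x) \<in> borel_measurable ?M" and em: "0 < e / max 1 L"
  using e cSk by (auto simp: space_restrict_space compact_imp_closed intro: cont_measurable_haus)
 obtain q where q: "real_polynomial_function q" "integrable ?M q" "(LINT x|?M. \<bar>u x - q x\<bar>) < e / max 1 L"
  using polynomials_dense[OF fM cSk sp haus_regular[OF zero_less_one sets1[OF cSk] fSk] integral_norm_le_L2(3)[OF fM uSk] em] by auto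
 have uq: "integrable ?M (\<lambda>p. \<bar>u p - q p\<bar>)" using q(2) integral_norm_le_L2(3)[OF fM uSk] by simp
 show ?thesis
 proof (rule that[OF q(1)])
  fix ps assume ps: "ps \<in> T"
  let ?B = "haus 1 (B ps)" and ?A = "haus 1 (a ` B ps)"
  have aBs: "a ` B ps \<in> sets ?H" "a ` B ps \<subseteq> Sk" using sets1[OF cB[OF ps]] ps by (auto simp: Sk_def)
  note subA = integrable_hausdorff_subset[OF _ aBs(2) sets1[OF cSk] aBs(1)]
  have intA: "integrable ?A (\<lambda>p. \<bar>u p - q p\<bar>)" by (rule subA[OF uq])
  have intB: "integrable ?B (\<lambda>x. \<bar>u (a x) - q (a x)\<bar>)" by (rule bilipschitz_pair.integrable_comp[OF pairB(1)[OF ps] intA])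
  have mq: "(\<lambda>x. q (a x)) \<in> borel_measurable ?B"
   using bilipschitz_pair.measurable_comp[OF pairB(1)[OF ps]] subA[OF q(2)] by auto
  have mg: "g ps \<in> borel_measurable ?B" using gs[OF ps] by (simp add: sq_int_def)
  have "AE x in ?H. \<forall>qs\<in>T. x \<in> B ps \<inter> B qs --> g ps x = g qs x"
   unfolding AE_ball_countable[OF countable_finite[OF T]] using agree ps by simp
  then have AE: "AE x in ?B. \<bar>g ps x - q (a x)\<bar> = \<bar>u (a x) - q (a x)\<bar>"
   unfolding AE_restrict_space_iff[OF sets.Int_space_eq2[OF Bs, THEN ssubst, of "\<lambda>S. S \<in> sets ?H", OF Bs]]
  proof eventually_elim
   case (elim x)
   show ?case
   proof
    assume x: "x \<in> B ps"
    obtain qs where qs: "qs \<in> T" "a x \<in> W qs" using W_cover[of "a x"] x ps by (auto simp: Sk_def)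
    then obtain y where y: "y \<in> B qs" "a x = a y" using W_sub by auto
    have xy: "x = y" using a_inj[OF ps qs(1) _ _ y(2)] x y(1) BE by auto
    then have "u (a x) = g qs x" using u[OF qs] b_a[OF qs(1) subsetD[OF BE y(1)]] by simp
    then show "\<bar>g ps x - q (a x)\<bar> = \<bar>u (a x) - q (a x)\<bar>" using elim qs(1) x y(1) xy by auto
   qed
  qed
  have "(LINT x|?B. \<bar>g ps x - q (a x)\<bar>) = (LINT x|?B. \<bar>u (a x) - q (a x)\<bar>)"
   using mg mq intB by (intro integral_cong_AE AE) auto
  also have "... \<le> L ^ 1 * (LINT p|?A. \<bar>u (a (b ps p)) - q (a (b ps p))\<bar>)"
   by (rule bilipschitz_pair.integral_le[OF pairB(2)[OF ps] intB]) simp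
  also have "(LINT p|?A. \<bar>u (a (b ps p)) - q (a (b ps p))\<bar>) = (LINT p|?A. \<bar>u p - q p\<bar>)"
   using b_a[OF ps] BE by (intro Bochner_Integration.integral_cong) (auto simp: space_restrict_space subset_iff)
  also have "L ^ 1 * ... \<le> max 1 L * (e / max 1 L)"
  proof -
   have "(LINT p|?A. \<bar>u p - q p\<bar>) \<le> (LINT p|?M. \<bar>u p - q p\<bar>)"
    unfolding set_integral_haus[OF aBs(1), symmetric] set_integral_haus[OF sets1[OF cSk], symmetric]
     set_lebesgue_integral_def
    using intA uq aBs sets1[OF cSk] by (intro integral_mono) (auto simp: integrable_restrict_space indicator_def)
   then have "(LINT p|?A. \<bar>u p - q p\<bar>) \<le> e / max 1 L" using q(3) by simp
   then show ?thesis by (intro mult_mono) auto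
  qed
  also have "... = e" by auto
  finally show "(LINT x|?B. \<bar>g ps x - q (a x)\<bar>) \<le> e" .
 qed
qed

text \<open>The constants \<open>c\<close> are fixed before the polynomial is chosen, so the error
  of the trace approximation can be sent to 0. For the polynomial itself the pieces add up to the
  integral of a divergence over the whole surface.\<close>

lemma lifted_flux_sum:
 assumes X: "C1_within G X D" "!!p. p \<in> G ==> X p \<bullet> \<nu> p = 0" and v: "H1_mesh T v"
 shows "(\<Sum>ps\<in>T. LINT p|haus 2 (a ` Q ps). lifted_flux ps X D v (poly_grad ps v) p) = 0"
proof -
 define J where "J ps = (LINT p|haus 2 (a ` Q ps). lifted_flux ps X D v (poly_grad ps v) p)" for ps
 obtain g where g': "\<forall>ps\<in>T. has_trace ps v (g ps)" "\<forall>ps\<in>T. \<forall>qs\<in>T. ps \<noteq> qs -->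
   (\<forall>e \<in> poly_edges ps \<inter> poly_edges qs. AE x in hausdorff_measure 1. x \<in> e --> g ps x = g qs x)"
  using v unfolding H1_mesh_def by auto
 then have tr: "!!ps. ps \<in> T ==> has_trace ps v (g ps)"
  and ag: "!!ps qs e. ps \<in> T ==> qs \<in> T ==> ps \<noteq> qs ==> e \<in> poly_edges ps \<inter> poly_edges qs ==> AE x in hausdorff_measure 1. x \<in> e --> g ps x = g qs x"
  by auto
 have g: "L2_on 1 (B ps) (g ps)" if "ps \<in> T" for ps using tr[OF that] by (simp add: has_trace_def)
 have agree: "AE x in hausdorff_measure 1. x \<in> B ps \<inter> B qs --> g ps x = g qs x" if "ps \<in> T" "qs \<in> T" for ps qs
  using traces_agree[of ps qs g] ag that by auto
 have "\<forall>ps\<in>T. \<exists>c. 0 \<le> c \<and> (\<forall>F DF. C1_within G F DF -->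
   \<bar>J ps - (LINT p|haus 2 (a ` Q ps). flux_div \<nu> X D F DF p)\<bar> \<le> c * (LINT x|haus 1 (B ps). \<bar>g ps x - F (a x)\<bar>))"
 proof
  fix ps assume ps: "ps \<in> T"
  then obtain \<rho> where "piece ps \<rho>" using polygon by auto
  then interpret P: inscribed G \<nu> \<delta> U ps h K \<gamma> \<rho> .
  have H: "H1_on (poly_interior ps) (\<lambda>_. poly_normal ps) v" using v ps by (simp add: H1_mesh_def)
  obtain c where c: "0 \<le> c" "!!f Df. P.C1_near f Df ==> \<bar>LINT p|haus 2 (a ` Q ps). flux_div \<nu> X D f Df p\<bar> \<le> c * (LINT x|haus 1 (B ps). \<bar>f (a x)\<bar>)"
   by (rule P.boundary_estimate[OF X]; (assumption | (rule that; assumption)))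
  show "\<exists>c. 0 \<le> c \<and> (\<forall>F DF. C1_within G F DF -->
   \<bar>J ps - (LINT p|haus 2 (a ` Q ps). flux_div \<nu> X D F DF p)\<bar> \<le> c * (LINT x|haus 1 (B ps). \<bar>g ps x - F (a x)\<bar>))"
   unfolding J_def using P.trace_estimate[OF X c H tr[OF ps]] c(1) by auto
 qed
 from bchoice[OF this] obtain c where "\<forall>ps\<in>T. 0 \<le> c ps \<and> (\<forall>F DF. C1_within G F DF -->
   \<bar>J ps - (LINT p|haus 2 (a ` Q ps). flux_div \<nu> X D F DF p)\<bar> \<le> c ps * (LINT x|haus 1 (B ps). \<bar>g ps x - F (a x)\<bar>))" by auto
 then have c: "!!ps. ps \<in> T ==> 0 \<le> c ps" "!!ps F DF. ps \<in> T ==> C1_within G F DF ==>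
   \<bar>J ps - (LINT p|haus 2 (a ` Q ps). flux_div \<nu> X D F DF p)\<bar> \<le> c ps * (LINT x|haus 1 (B ps). \<bar>g ps x - F (a x)\<bar>)"
  by auto
 define s where "s = sum c T"
 have s: "0 \<le> s" unfolding s_def by (intro sum_nonneg c)
 have small: "\<bar>sum J T\<bar> \<le> s * e" if e: "0 < e" for e
 proof -
  obtain q where q: "real_polynomial_function q" "!!ps. ps \<in> T ==> (LINT x|haus 1 (B ps). \<bar>g ps x - q (a x)\<bar>) \<le> e"
   by (rule trace_approximation[OF g agree e]; (assumption | (rule that; assumption)))
  obtain Dq where Dq: "C1_within G q Dq" using real_polynomial_C1[OF q(1)] by auto
  have fl: "surface_div \<nu> (product_deriv q Dq X D) p = flux_div \<nu> X D q Dq p" if "p \<in> G" for p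
   by (rule surface_div_product_tangential[where X=X and p=p and \<nu>=\<nu>, OF X(2)[OF that]])
  have "0 = (LINT p:G|hausdorff_measure 2. surface_div \<nu> (product_deriv q Dq X D) p)"
   by (rule divergence_surface[OF C comp C1_within_product[OF Dq X(1)], symmetric]) (simp add: X(2))
  also have "... = (LINT p|haus 2 G. flux_div \<nu> X D q Dq p)"
   unfolding set_integral_haus[OF G_sets] using G_sets fl by (intro Bochner_Integration.integral_cong refl) simp
  also have "... = (\<Sum>ps\<in>T. LINT p|haus 2 (a ` Q ps). flux_div \<nu> X D q Dq p)"
  proof (rule surface_integral)
   fix ps assume ps: "ps \<in> T"
   then obtain \<rho> where "piece ps \<rho>" using polygon by auto
   then interpret P: inscribed G \<nu> \<delta> U ps h K \<gamma> \<rho> .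
   show "integrable (haus 2 (a ` Q ps)) (flux_div \<nu> X D q Dq)"
    by (rule P.integrable_piece[OF P.continuous_flux[OF X(1) P.C1_near_restrict[OF Dq]]])
  qed
  finally have "sum J T = (\<Sum>ps\<in>T. J ps - (LINT p|haus 2 (a ` Q ps). flux_div \<nu> X D q Dq p))" by (simp add: sum_subtractf)
  also have "\<bar>...\<bar> \<le> (\<Sum>ps\<in>T. \<bar>J ps - (LINT p|haus 2 (a ` Q ps). flux_div \<nu> X D q Dq p)\<bar>)" by auto
  also have "... \<le> (\<Sum>ps\<in>T. c ps * e)"
   by (rule sum_mono) (use c Dq q(2) in \<open>blast intro: order_trans mult_left_mono\<close>)
  finally show ?thesis by (simp add: s_def sum_distrib_right)
 qed
 have "\<bar>sum J T\<bar> \<le> 0"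
 proof (rule field_le_epsilon)
  fix e :: real assume e: "0 < e"
  have "s * (e / (s + 1)) \<le> e" using s e by (simp add: field_simps)
  then show "\<bar>sum J T\<bar> \<le> 0 + e" using small[of "e / (s + 1)"] s e by simp
 qed
 then show ?thesis by (simp add: J_def)
qed
end

section \<open>Comparison of inner products on one polygon\<close>

context inscribed
begin

lemma lift_grad_tangential: "p \<in> G ==> lift_grad p \<xi> \<bullet> \<nu> p = 0"
 unfolding lift_grad_def using C2_surface_norm[OF C, of p] by (intro inner_tangential_left) (simp add: norm_eq_1)

lemma inner_estimate:
 fixes u w :: "point => 'b::{real_inner, second_countable_topology, banach}"
 assumes u: "sq_int (haus 2 Q) u" and w: "sq_int (haus 2 Q) w"
 shows "\<bar>(LINT p|haus 2 (a ` Q). u (b p) \<bullet> w (b p)) - (LINT x|haus 2 Q. u x \<bullet> w x)\<bar>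
  \<le> (L\<^sup>2 - 1) * (LINT p|haus 2 (a ` Q). norm (u (b p)) * norm (w (b p)))"
proof -
 let ?M = "haus 2 (a ` Q)"
 note i = sq_int_inner[OF sq_int_lift[OF u] sq_int_lift[OF w]]
 have "(LINT x|haus 2 Q. u (b (a x)) \<bullet> w (b (a x))) = (LINT x|haus 2 Q. u x \<bullet> w x)"
  using finite_measure_Q(3) b_a(1) by (intro Bochner_Integration.integral_cong) auto
 then have "\<bar>(LINT p|?M. u (b p) \<bullet> w (b p)) - (LINT x|haus 2 Q. u x \<bullet> w x)\<bar> \<le> (L\<^sup>2 - 1) * (LINT p|?M. \<bar>u (b p) \<bullet> w (b p)\<bar>)"
  using bilipschitz_pair.integral_diff[OF pair(1) i(1) L1] by simp
 also have "... \<le> (L\<^sup>2 - 1) * (LINT p|?M. norm (u (b p)) * norm (w (b p)))"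
  using L1 i by (intro mult_left_mono integral_mono Cauchy_Schwarz_ineq2) auto
 finally show ?thesis .
qed

text \<open>Three losses: \<open>L\<^sup>2 - 1\<close> for the inner product under
  \<open>lift_grad\<close>, \<open>L\<^sup>2 - 1\<close> for the change of measure, and
  \<open>L\<^sup>2\<close> for expressing the result by the lifted gradients.\<close>

lemma grad_estimate:
 assumes \<xi>: "sq_int (haus 2 Q) \<xi>" "!!x. x \<in> Q ==> \<xi> x \<bullet> n = 0"
  and \<zeta>: "sq_int (haus 2 Q) \<zeta>" "!!x. x \<in> Q ==> \<zeta> x \<bullet> n = 0"
 shows "\<bar>(LINT p|haus 2 (a ` Q). lift_grad p (\<xi> (b p)) \<bullet> lift_grad p (\<zeta> (b p))) - (LINT x|haus 2 Q. \<xi> x \<bullet> \<zeta> x)\<bar>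
  \<le> 2 * (L\<^sup>2 - 1) * L\<^sup>2 * (LINT p|haus 2 (a ` Q). norm (lift_grad p (\<xi> (b p))) * norm (lift_grad p (\<zeta> (b p))))"
proof -
 let ?M = "haus 2 (a ` Q)"
 define N where "N = (LINT p|?M. norm (\<xi> (b p)) * norm (\<zeta> (b p)))"
 define I where "I = (LINT p|?M. \<xi> (b p) \<bullet> \<zeta> (b p))"
 define Y where "Y = (LINT p|?M. lift_grad p (\<xi> (b p)) \<bullet> lift_grad p (\<zeta> (b p)))"
 note i = sq_int_inner[OF sq_int_lift[OF \<xi>(1)] sq_int_lift[OF \<zeta>(1)]]
 note j = sq_int_inner[OF sq_int_lift_grad[OF \<xi>] sq_int_lift_grad[OF \<zeta>]]
 have sp: "\<exists>x\<in>Q. p = a x \<and> b p = x" if "p \<in> space ?M" for p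
  using that finite_measure_Q(4) b_a(1) by auto
 have "\<bar>Y - I\<bar> \<le> (L\<^sup>2 - 1) * N"
 proof -
  have "\<bar>Y - I\<bar> = \<bar>LINT p|?M. lift_grad p (\<xi> (b p)) \<bullet> lift_grad p (\<zeta> (b p)) - \<xi> (b p) \<bullet> \<zeta> (b p)\<bar>"
   unfolding Y_def I_def using i j by simp
  also have "... \<le> (LINT p|?M. \<bar>lift_grad p (\<xi> (b p)) \<bullet> lift_grad p (\<zeta> (b p)) - \<xi> (b p) \<bullet> \<zeta> (b p)\<bar>)" by auto
  also have "... \<le> (LINT p|?M. (L\<^sup>2 - 1) * (norm (\<xi> (b p)) * norm (\<zeta> (b p))))"
  proof (rule integral_mono)
   fix p assume "p \<in> space ?M"
   then obtain x where x: "x \<in> Q" "p = a x" "b p = x" using sp by blast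
   show "\<bar>lift_grad p (\<xi> (b p)) \<bullet> lift_grad p (\<zeta> (b p)) - \<xi> (b p) \<bullet> \<zeta> (b p)\<bar> \<le> (L\<^sup>2 - 1) * (norm (\<xi> (b p)) * norm (\<zeta> (b p)))"
    using lift_grad_inner[OF x(1) \<xi>(2)[OF x(1)] \<zeta>(2)[OF x(1)]] x(2,3) by simp
  qed (use i j in auto)
  finally show ?thesis by (simp add: N_def)
 qed
 moreover have "\<bar>I - (LINT x|haus 2 Q. \<xi> x \<bullet> \<zeta> x)\<bar> \<le> (L\<^sup>2 - 1) * N"
  unfolding I_def N_def by (rule inner_estimate[OF \<xi>(1) \<zeta>(1)])
 ultimately have "\<bar>Y - (LINT x|haus 2 Q. \<xi> x \<bullet> \<zeta> x)\<bar> \<le> 2 * (L\<^sup>2 - 1) * N" by linarith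
 also have "N \<le> L\<^sup>2 * (LINT p|?M. norm (lift_grad p (\<xi> (b p))) * norm (lift_grad p (\<zeta> (b p))))"
  unfolding N_def integral_mult_right_zero[symmetric]
 proof (rule integral_mono)
  fix p assume "p \<in> space ?M"
  then obtain x where x: "x \<in> Q" "p = a x" "b p = x" using sp by blast
  have "norm (\<xi> (b p)) * norm (\<zeta> (b p)) \<le> (L * norm (lift_grad p (\<xi> (b p)))) * (L * norm (lift_grad p (\<zeta> (b p))))"
   using lift_grad_near_isometry(2)[OF x(1) \<xi>(2)[OF x(1)]] lift_grad_near_isometry(2)[OF x(1) \<zeta>(2)[OF x(1)]] x(2,3) L1
   by (intro mult_mono) auto
  then show "norm (\<xi> (b p)) * norm (\<zeta> (b p)) \<le> L\<^sup>2 * (norm (lift_grad p (\<xi> (b p))) * norm (lift_grad p (\<zeta> (b p))))"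
   by (simp add: power2_eq_square mult_ac)
 qed (use i j in auto)
 finally show ?thesis using L1 by (simp add: Y_def mult_left_mono)
qed

end

section \<open>The weak gradient of the lift and the estimates on the whole mesh\<close>

context inscribed_mesh
begin

text \<open>The value 0 is assigned on the image of the edges, a null set; elsewhere the chosen
  polygon is unique because the lifted open polygons are disjoint.\<close>

definition "lift_field v p = (if \<exists>ps\<in>T. p \<in> a ` Q ps
 then let ps = SOME ps. ps \<in> T \<and> p \<in> a ` Q ps in lift_grad ps p (poly_grad ps v (b ps p)) else 0)"

lemma lift_field_eq: "ps \<in> T ==> p \<in> a ` Q ps ==> lift_field v p = lift_grad ps p (poly_grad ps v (b ps p))"
proof -
 assume p: "ps \<in> T" "p \<in> a ` Q ps"
 have "(SOME ps. ps \<in> T \<and> p \<in> a ` Q ps) = ps"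
  by (rule) (use p aQ_disjoint in blast)+
 then show ?thesis using p by (auto simp: lift_field_def)
qed

lemma lift_eq: "ps \<in> T ==> p \<in> a ` Q ps ==> lift G \<nu> \<delta> T v p = v (b ps p)"
proof -
 assume ps: "ps \<in> T" "p \<in> a ` Q ps"
 then obtain x where x: "x \<in> E ps" "p = a x" by auto
 have "inv_into (mesh_surface T) a p = x" unfolding x(2)
  by (rule inv_into_f_f) (use bij ps(1) x(1) in \<open>auto simp: bij_betw_def mesh_surface_def\<close>)
 then show ?thesis using b_a[OF ps(1) x(1)] x(2) by (simp add: lift_def)
qed

lemma lift_pieces:
 assumes v: "H1_mesh T v" and ps: "ps \<in> T"
 shows "sq_int (haus 2 (Q ps)) v" "sq_int (haus 2 (Q ps)) (poly_grad ps v)"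
  "!!x. x \<in> Q ps ==> poly_grad ps v x \<bullet> poly_normal ps = 0"
  "sq_int (haus 2 (a ` Q ps)) (lift G \<nu> \<delta> T v)"
  "sq_int (haus 2 (a ` Q ps)) (lift_field v)"
proof -
 obtain \<rho> where "piece ps \<rho>" using polygon ps by auto
 then interpret P: inscribed G \<nu> \<delta> U ps h K \<gamma> \<rho> .
 have H: "H1_on (poly_interior ps) (\<lambda>_. poly_normal ps) v" using v ps by (simp add: H1_mesh_def)
 note H1 = P.H1_polygon[OF H]
 show "sq_int (haus 2 (Q ps)) v" "sq_int (haus 2 (Q ps)) (poly_grad ps v)"
  "!!x. x \<in> Q ps ==> poly_grad ps v x \<bullet> poly_normal ps = 0" by (fact)+
 show "sq_int (haus 2 (a ` Q ps)) (lift G \<nu> \<delta> T v)"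
  using P.sq_int_lift[OF H1(1)] Q_sets(2)[OF ps] by (subst sq_int_cong[of _ _ "\<lambda>p. v (b ps p)"]) (simp_all add: lift_eq[OF ps])
 show "sq_int (haus 2 (a ` Q ps)) (lift_field v)"
  using P.sq_int_lift_grad[OF H1(2,3)] Q_sets(2)[OF ps] by (subst sq_int_cong[of _ _ "\<lambda>p. lift_grad ps p (poly_grad ps v (b ps p))"]) (simp_all add: lift_field_eq[OF ps])
qed

lemma sq_int_surface:
 fixes f :: "point => 'b::{real_inner, second_countable_topology, banach}"
 shows "(!!ps. ps \<in> T ==> sq_int (haus 2 (a ` Q ps)) f) ==> sq_int (haus 2 G) f"
 unfolding sq_int_def using surface_measurable[of f] surface_integrable[of "\<lambda>x. (norm (f x))\<^sup>2"] by blast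

lemma lift_L2:
 assumes v: "H1_mesh T v" shows "L2_on 2 G (lift G \<nu> \<delta> T v)" "L2_on 2 G (lift_field v)"
 unfolding L2_on_iff[OF G_sets]
 by (rule sq_int_surface[OF lift_pieces(4)[OF v]] sq_int_surface[OF lift_pieces(5)[OF v]]; assumption)+

text \<open>For a test field the two integrals of the defining identity add up to the sum of the
  lifted fluxes, which vanishes by \<open>lifted_flux_sum\<close>.\<close>

lemma lift_weak_grad:
 assumes v: "H1_mesh T v" shows "is_weak_grad G \<nu> (lift G \<nu> \<delta> T v) (lift_field v)"
 unfolding is_weak_grad_def
proof (intro conjI ballI allI impI)
 let ?v = "lift G \<nu> \<delta> T v"
 show "L2_on 2 G (lift_field v)" by (rule lift_L2[OF v])
 show "lift_field v p \<bullet> \<nu> p = 0" if "p \<in> G" for p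
 proof (cases "\<exists>ps\<in>T. p \<in> a ` Q ps")
  case True
  then obtain ps where ps: "ps \<in> T" "p \<in> a ` Q ps" by auto
  then obtain \<rho> where "piece ps \<rho>" using polygon by auto
  from inscribed.lift_grad_tangential[OF this \<open>p \<in> G\<close>] show ?thesis unfolding lift_field_eq[OF ps] .
 qed (simp add: lift_field_def)
 fix X D assume "tangential_test_field G \<nu> X D"
 then have X: "C1_within G X D" "!!p. p \<in> G ==> X p \<bullet> \<nu> p = 0"
  by (auto simp: tangential_test_field_def C1_within_def intro: has_derivative_at_withinI continuous_on_subset)
 have fin: "\<H> 2 G < top" by (rule hausdorff_surface_finite[OF C comp])
 have Gb: "G \<in> sets borel" using comp by (simp add: compact_imp_closed)
 have Xs: "sq_int (haus 2 G) X" "sq_int (haus 2 G) (surface_div \<nu> D)"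
  by (rule sq_int_continuous[OF _ comp _ order_refl Gb fin];
    simp add: C1_withinD(3)[OF X(1)] continuous_on_surface_div[OF C1_withinD(2)[OF X(1)] continuous_on_normal[OF C]])+
 have I: "integrable (haus 2 G) (\<lambda>p. ?v p * surface_div \<nu> D p)" "integrable (haus 2 G) (\<lambda>p. lift_field v p \<bullet> X p)"
  using sq_int_inner(1)[OF _ Xs(2), of ?v] sq_int_inner(1)[OF _ Xs(1), of "lift_field v"] lift_L2[OF v]
  by (simp_all add: L2_on_iff[OF G_sets])
 have "(LINT p|haus 2 G. ?v p * surface_div \<nu> D p) + (LINT p|haus 2 G. lift_field v p \<bullet> X p)
   = (LINT p|haus 2 G. ?v p * surface_div \<nu> D p + lift_field v p \<bullet> X p)"
  using I by simp
 also have "... = (\<Sum>ps\<in>T. LINT p|haus 2 (a ` Q ps). ?v p * surface_div \<nu> D p + lift_field v p \<bullet> X p)"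
 proof (rule surface_integral)
  fix ps assume ps: "ps \<in> T"
  have "sq_int (haus 2 (a ` Q ps)) X" "sq_int (haus 2 (a ` Q ps)) (surface_div \<nu> D)"
   by (rule sq_int_subset[OF _ Q_sets(3)[OF ps] G_sets Q_sets(2)[OF ps]], rule Xs)+
  from sq_int_inner(1)[OF lift_pieces(5)[OF v ps] this(1)] sq_int_inner(1)[OF lift_pieces(4)[OF v ps] this(2)]
  show "integrable (haus 2 (a ` Q ps)) (\<lambda>p. ?v p * surface_div \<nu> D p + lift_field v p \<bullet> X p)" by simp
 qed
 also have "... = (\<Sum>ps\<in>T. LINT p|haus 2 (a ` Q ps). lifted_flux ps X D v (poly_grad ps v) p)"
 proof (intro sum.cong refl Bochner_Integration.integral_cong)
  fix ps p assume ps: "ps \<in> T" and "p \<in> space (haus 2 (a ` Q ps))"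
  then have p: "p \<in> a ` Q ps" using Q_sets(2)[OF ps] by simp
  obtain \<rho> where P: "piece ps \<rho>" using polygon ps by auto
  show "?v p * surface_div \<nu> D p + lift_field v p \<bullet> X p = lifted_flux ps X D v (poly_grad ps v) p"
   unfolding inscribed.lifted_flux_def[OF P] lift_eq[OF ps p] lift_field_eq[OF ps p] ..
 qed
 also have "... = 0" by (rule lifted_flux_sum[OF X v])
 finally show "(LINT p:G|hausdorff_measure 2. ?v p * surface_div \<nu> D p) = - (LINT p:G|hausdorff_measure 2. lift_field v p \<bullet> X p)"
  unfolding set_integral_haus[OF G_sets] by simp
qed

lemma weak_grad_lift:
 assumes v: "H1_mesh T v"
 shows "L2_on 2 G (weak_grad G \<nu> (lift G \<nu> \<delta> T v))" "AE p in haus 2 G. weak_grad G \<nu> (lift G \<nu> \<delta> T v) p = lift_field v p"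
proof -
 have w: "is_weak_grad G \<nu> (lift G \<nu> \<delta> T v) (weak_grad G \<nu> (lift G \<nu> \<delta> T v))"
  unfolding weak_grad_def by (rule someI[of "is_weak_grad G \<nu> (lift G \<nu> \<delta> T v)"]) (rule lift_weak_grad[OF v])
 then show "L2_on 2 G (weak_grad G \<nu> (lift G \<nu> \<delta> T v))" by (simp add: is_weak_grad_def)
 show "AE p in haus 2 G. weak_grad G \<nu> (lift G \<nu> \<delta> T v) p = lift_field v p"
  by (rule weak_grad_unique[OF C comp w lift_weak_grad[OF v]])
qed

lemma L2_inner_weak_grad:
 assumes v: "H1_mesh T v" and w: "H1_mesh T w"
 shows "L2_inner 2 G (weak_grad G \<nu> (lift G \<nu> \<delta> T v)) (weak_grad G \<nu> (lift G \<nu> \<delta> T w)) = L2_inner 2 G (lift_field v) (lift_field w)"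
 unfolding L2_inner_eq[OF G_sets]
proof (rule integral_cong_AE)
 show "AE p in haus 2 G. weak_grad G \<nu> (lift G \<nu> \<delta> T v) p \<bullet> weak_grad G \<nu> (lift G \<nu> \<delta> T w) p = lift_field v p \<bullet> lift_field w p"
  using weak_grad_lift(2)[OF v] weak_grad_lift(2)[OF w] by auto
qed (use weak_grad_lift(1)[OF v] weak_grad_lift(1)[OF w] lift_L2[OF v] lift_L2[OF w] in
  \<open>auto simp: L2_on_iff[OF G_sets] sq_int_def intro: borel_measurable_inner\<close>)

text \<open>The \<open>max 0\<close> appears because \<open>1 \<le> L\<close> is known only once the
  mesh contains a polygon.\<close>

lemma L2_estimate:
 assumes v: "H1_mesh T v" and w: "H1_mesh T w"
 shows "\<bar>L2_inner 2 G (lift G \<nu> \<delta> T v) (lift G \<nu> \<delta> T w) - L2_inner 2 (mesh_surface T) v w\<bar>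
  \<le> max 0 (L\<^sup>2 - 1) * (L2_norm 2 G (lift G \<nu> \<delta> T v) * L2_norm 2 G (lift G \<nu> \<delta> T w))"
proof -
 let ?v = "lift G \<nu> \<delta> T v" and ?w = "lift G \<nu> \<delta> T w"
 have piece: "\<bar>(LINT p|haus 2 (a ` Q ps). ?v p \<bullet> ?w p) - (LINT x|haus 2 (Q ps). v x \<bullet> w x)\<bar>
   \<le> (L\<^sup>2 - 1) * (LINT p|haus 2 (a ` Q ps). norm (?v p) * norm (?w p))" if ps: "ps \<in> T" for ps
 proof -
  obtain \<rho> where P: "piece ps \<rho>" using polygon ps by auto
  have eq: "(LINT p|haus 2 (a ` Q ps). f (?v p) (?w p)) = (LINT p|haus 2 (a ` Q ps). f (v (b ps p)) (w (b ps p)))" for f :: "real => real => real"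
   by (intro Bochner_Integration.integral_cong refl) (simp add: space_restrict_space lift_eq[OF ps])
  show ?thesis
   using inscribed.inner_estimate[OF P lift_pieces(1)[OF v ps] lift_pieces(1)[OF w ps]]
   unfolding eq[of "\<lambda>x y. x \<bullet> y"] eq[of "\<lambda>x y. norm x * norm y"] .
 qed
 have "L2_inner 2 G ?v ?w = (\<Sum>ps\<in>T. LINT p|haus 2 (a ` Q ps). ?v p \<bullet> ?w p)"
  unfolding L2_inner_eq[OF G_sets] by (intro surface_integral sq_int_inner(1) lift_pieces(4) v w)
 moreover have "L2_inner 2 (mesh_surface T) v w = (\<Sum>ps\<in>T. LINT x|haus 2 (Q ps). v x \<bullet> w x)"
  unfolding L2_inner_eq[OF mesh_sets] by (intro mesh_integral sq_int_inner(1) lift_pieces(1) v w)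
 ultimately have "\<bar>L2_inner 2 G ?v ?w - L2_inner 2 (mesh_surface T) v w\<bar>
   = \<bar>\<Sum>ps\<in>T. (LINT p|haus 2 (a ` Q ps). ?v p \<bullet> ?w p) - (LINT x|haus 2 (Q ps). v x \<bullet> w x)\<bar>"
  by (simp only: sum_subtractf)
 also have "... \<le> (\<Sum>ps\<in>T. \<bar>(LINT p|haus 2 (a ` Q ps). ?v p \<bullet> ?w p) - (LINT x|haus 2 (Q ps). v x \<bullet> w x)\<bar>)" by auto
 also have "... \<le> (\<Sum>ps\<in>T. (L\<^sup>2 - 1) * (LINT p|haus 2 (a ` Q ps). norm (?v p) * norm (?w p)))" by (rule sum_mono[OF piece])
 also have "... = (L\<^sup>2 - 1) * (LINT p|haus 2 G. norm (?v p) * norm (?w p))"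
  by (subst surface_integral[OF sq_int_inner(2)[OF lift_pieces(4)[OF v] lift_pieces(4)[OF w]]]) (simp_all add: sum_distrib_left)
 also have "... \<le> max 0 (L\<^sup>2 - 1) * (LINT p|haus 2 G. norm (?v p) * norm (?w p))"
  by (intro mult_right_mono) auto
 also have "... \<le> max 0 (L\<^sup>2 - 1) * (L2_norm 2 G ?v * L2_norm 2 G ?w)"
  by (intro mult_left_mono L2_inner_le[OF G_sets] lift_L2 v w) simp
 finally show ?thesis .
qed

lemma energy_estimate:
 assumes v: "H1_mesh T v" and w: "H1_mesh T w"
 defines "Y \<equiv> \<lambda>v. weak_grad G \<nu> (lift G \<nu> \<delta> T v)"
 shows "\<bar>a_form G \<nu> (lift G \<nu> \<delta> T v) (lift G \<nu> \<delta> T w) - a_bar T v w\<bar>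
  \<le> max 0 (2 * (L\<^sup>2 - 1) * L\<^sup>2) * (L2_norm 2 G (Y v) * L2_norm 2 G (Y w))"
proof -
 let ?v = "lift_field v" and ?w = "lift_field w" and ?c = "2 * (L\<^sup>2 - 1) * L\<^sup>2"
 let ?J = "\<lambda>ps. LINT x|haus 2 (Q ps). poly_grad ps v x \<bullet> poly_grad ps w x"
 have piece: "\<bar>(LINT p|haus 2 (a ` Q ps). ?v p \<bullet> ?w p) - ?J ps\<bar> \<le> ?c * (LINT p|haus 2 (a ` Q ps). norm (?v p) * norm (?w p))" if ps: "ps \<in> T" for ps
 proof -
  obtain \<rho> where P: "piece ps \<rho>" using polygon ps by auto
  have eq: "(LINT p|haus 2 (a ` Q ps). f (?v p) (?w p)) = (LINT p|haus 2 (a ` Q ps).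
    f (lift_grad ps p (poly_grad ps v (b ps p))) (lift_grad ps p (poly_grad ps w (b ps p))))" for f :: "point => point => real"
   by (intro Bochner_Integration.integral_cong refl) (simp add: space_restrict_space lift_field_eq[OF ps])
  show ?thesis
   using inscribed.grad_estimate[OF P lift_pieces(2,3)[OF v ps] lift_pieces(2,3)[OF w ps]]
   unfolding eq[of "\<lambda>x y. x \<bullet> y"] eq[of "\<lambda>x y. norm x * norm y"] .
 qed
 have "a_form G \<nu> (lift G \<nu> \<delta> T v) (lift G \<nu> \<delta> T w) = (\<Sum>ps\<in>T. LINT p|haus 2 (a ` Q ps). ?v p \<bullet> ?w p)"
  unfolding a_form_def L2_inner_weak_grad[OF v w]
  unfolding L2_inner_eq[OF G_sets] by (intro surface_integral sq_int_inner(1) lift_pieces(5) v w)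
 moreover have "a_bar T v w = (\<Sum>ps\<in>T. ?J ps)" unfolding a_bar_def
 proof (rule sum.cong[OF refl])
  fix ps assume ps: "ps \<in> T"
  obtain \<rho> where P: "piece ps \<rho>" using polygon ps by auto
  show "L2_inner 2 (poly_interior ps) (poly_grad ps v) (poly_grad ps w) = ?J ps"
   unfolding L2_inner_eq[OF inscribed.hausdorff_interior(1)[OF P]]
   by (rule inscribed.interior_integral[OF P sq_int_inner(1)[OF lift_pieces(2)[OF v ps] lift_pieces(2)[OF w ps]]])
 qed
 ultimately have "\<bar>a_form G \<nu> (lift G \<nu> \<delta> T v) (lift G \<nu> \<delta> T w) - a_bar T v w\<bar>
   = \<bar>\<Sum>ps\<in>T. (LINT p|haus 2 (a ` Q ps). ?v p \<bullet> ?w p) - ?J ps\<bar>"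
  by (simp only: sum_subtractf)
 also have "... \<le> (\<Sum>ps\<in>T. \<bar>(LINT p|haus 2 (a ` Q ps). ?v p \<bullet> ?w p) - ?J ps\<bar>)" by auto
 also have "... \<le> (\<Sum>ps\<in>T. ?c * (LINT p|haus 2 (a ` Q ps). norm (?v p) * norm (?w p)))" by (rule sum_mono[OF piece])
 also have "... = ?c * (LINT p|haus 2 G. norm (?v p) * norm (?w p))"
  by (subst surface_integral[OF sq_int_inner(2)[OF lift_pieces(5)[OF v] lift_pieces(5)[OF w]]]) (simp_all add: sum_distrib_left)
 also have "... \<le> max 0 ?c * (LINT p|haus 2 G. norm (?v p) * norm (?w p))"
  by (intro mult_right_mono) auto
 also have "... \<le> max 0 ?c * (L2_norm 2 G ?v * L2_norm 2 G ?w)"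
  by (intro mult_left_mono L2_inner_le[OF G_sets] lift_L2 v w) simp
 finally show ?thesis
  unfolding L2_norm_def Y_def L2_inner_weak_grad[OF v v] L2_inner_weak_grad[OF w w] .
qed
end

section \<open>From the mesh hypotheses to the final constants\<close>

lemma L2_norm_nonneg: "0 \<le> L2_norm k S f"
 by (simp add: L2_norm_def L2_inner_def set_lebesgue_integral_def)

lemma L2_norm_empty: "L2_norm k {} f = 0"
 by (simp add: L2_norm_def L2_inner_def set_lebesgue_integral_def)

text \<open>A finite mesh surface is compact, and each point of \<open>G\<close> lies within
  \<open>\<bar>\<delta>\<bar>\<close> of it along a normal; closedness of \<open>G\<close> is part
  of \<open>C2_surface\<close>.\<close>

lemma surface_mesh_compact:
 assumes C: "C2_surface G \<nu>" and mesh: "surface_mesh G \<nu> \<delta> U \<gamma>\<^sub>1 \<gamma>\<^sub>2 h T" and fermi: "fermi_stripe G \<nu> \<delta> U"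
 shows "compact G"
proof -
 have T: "finite T" "!!ps. ps \<in> T ==> simple_polygon ps" and U: "mesh_surface T \<subseteq> U"
  and bij: "bij_betw (fermi_proj G \<nu> \<delta>) (mesh_surface T) G"
  using mesh by (auto simp: surface_mesh_def)
 have "compact (mesh_surface T)" unfolding mesh_surface_def using T by (intro compact_UN compact_poly_region)
 then have "bounded (mesh_surface T)" by (rule compact_imp_bounded)
 then obtain R where R: "!!x. x \<in> mesh_surface T ==> norm x \<le> R" by (auto simp: bounded_iff)
 have "norm p \<le> R + \<bar>\<delta>\<bar>" if p: "p \<in> G" for p
 proof -
  obtain x where x: "x \<in> mesh_surface T" "p = fermi_proj G \<nu> \<delta> x" using bij p by (auto simp: bij_betw_def)
  then have "\<exists>!(p, s). p \<in> G \<and> \<bar>s\<bar> < \<delta> \<and> x = p + s *\<^sub>R \<nu> p" using fermi U unfolding fermi_stripe_def by blast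
  then obtain q s where q: "q \<in> G" "\<bar>s\<bar> < \<delta>" "x = q + s *\<^sub>R \<nu> q" by auto
  have "p = q" unfolding x(2) by (rule fermi_proj_eq[OF fermi _ q]) (use x U in auto)
  then have "p = x - s *\<^sub>R \<nu> q" using q(3) by simp
  then have "norm p \<le> norm x + \<bar>s\<bar>" using norm_triangle_ineq4[of x "s *\<^sub>R \<nu> q"] C2_surface_norm[OF C q(1)] by simp
  then show ?thesis using R[OF x(1)] q(2) by auto
 qed
 then have "bounded G" by (auto simp: bounded_iff)
 then show ?thesis using C by (simp add: C2_surface_def compact_eq_bounded_closed)
qed

lemma surface_mesh_inscribed:
 assumes C: "C2_surface G \<nu>" and mesh: "surface_mesh G \<nu> \<delta> U \<gamma>\<^sub>1 \<gamma>\<^sub>2 h T" and fermi: "fermi_stripe G \<nu> \<delta> U"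
  and K: "1 \<le> K" "!!p q. p \<in> G ==> q \<in> G ==> norm (\<nu> p - \<nu> q) \<le> K * norm (p - q)"
   "!!p q. p \<in> G ==> q \<in> G ==> \<bar>(p - q) \<bullet> \<nu> q\<bar> \<le> K * (norm (p - q))\<^sup>2"
  and \<gamma>: "0 < \<gamma>\<^sub>1" and h: "0 < h" "20 * (K + 16 * K / \<gamma>\<^sub>1) * h \<le> 1"
 shows "inscribed_mesh G \<nu> \<delta> U T h K \<gamma>\<^sub>1"
proof
 have inj: "inj_on (fermi_proj G \<nu> \<delta>) (mesh_surface T)" using mesh by (auto simp: surface_mesh_def bij_betw_def)
 show comp: "compact G" by (rule surface_mesh_compact[OF C mesh fermi])
 show "\<exists>\<rho>. inscribed G \<nu> \<delta> U ps h K \<gamma>\<^sub>1 \<rho>" if ps: "ps \<in> T" for ps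
 proof -
  obtain \<rho> where \<rho>: "\<gamma>\<^sub>1 * diameter (poly_region ps) \<le> \<rho>" "star_shaped_wrt_ball (poly_region ps) \<rho>"
   using mesh ps by (auto simp: surface_mesh_def)
  have sub: "poly_region ps \<subseteq> mesh_surface T" using ps by (auto simp: mesh_surface_def)
  have "inscribed G \<nu> \<delta> U ps h K \<gamma>\<^sub>1 \<rho>"
   by (rule inscribed.intro[OF C comp fermi K _ _ _ _ \<gamma> \<rho> h inj_on_subset[OF inj sub]])
     (use mesh ps in \<open>auto simp: surface_mesh_def mesh_surface_def\<close>)
  then show ?thesis ..
 qed
qed (use C mesh in \<open>auto simp: surface_mesh_def\<close>)

theorem lemma4:
  fixes \<Gamma> :: "point set" and \<nu> :: "point \<Rightarrow> point" and \<gamma>\<^sub>1 \<gamma>\<^sub>2 :: real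
  assumes "C2_surface \<Gamma> \<nu>" and "\<gamma>\<^sub>1 > 0" and "\<gamma>\<^sub>2 > 0"
  shows "\<exists>C>0. \<exists>h\<^sub>0>0. \<forall>\<delta> U h T v w.
     fermi_stripe \<Gamma> \<nu> \<delta> U \<longrightarrow> 0 < h \<longrightarrow> h \<le> h\<^sub>0 \<longrightarrow> surface_mesh \<Gamma> \<nu> \<delta> U \<gamma>\<^sub>1 \<gamma>\<^sub>2 h T \<longrightarrow>
     H1_mesh T v \<longrightarrow> H1_mesh T w \<longrightarrow>
     (let v' = lift \<Gamma> \<nu> \<delta> T v; w' = lift \<Gamma> \<nu> \<delta> T w in
        \<bar>L2_inner 2 \<Gamma> v' w' - L2_inner 2 (mesh_surface T) v w\<bar>
          \<le> C * h\<^sup>2 * L2_norm 2 \<Gamma> v' * L2_norm 2 \<Gamma> w' \<and>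
        \<bar>a_form \<Gamma> \<nu> v' w' - a_bar T v w\<bar>
          \<le> C * h\<^sup>2 * L2_norm 2 \<Gamma> (weak_grad \<Gamma> \<nu> v') * L2_norm 2 \<Gamma> (weak_grad \<Gamma> \<nu> w'))"
proof (cases "compact \<Gamma>")
 \<comment> \<open>Without compactness no mesh exists, and any constants will do.\<close>
 case False
 then have "\<not> (fermi_stripe \<Gamma> \<nu> \<delta> U \<and> surface_mesh \<Gamma> \<nu> \<delta> U \<gamma>\<^sub>1 \<gamma>\<^sub>2 h T)" for \<delta> U h T
  using surface_mesh_compact[OF assms(1)] by blast
 then show ?thesis by (intro exI[of _ 1] conjI allI impI) auto
next
 case True
 obtain K where K: "1 \<le> K" "!!p q. p \<in> \<Gamma> ==> q \<in> \<Gamma> ==> norm (\<nu> p - \<nu> q) \<le> K * norm (p - q)"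
   "!!p q. p \<in> \<Gamma> ==> q \<in> \<Gamma> ==> \<bar>(p - q) \<bullet> \<nu> q\<bar> \<le> K * (norm (p - q))\<^sup>2"
  by (rule surface_constants[OF assms(1) True]; (assumption | (rule that; assumption)))
 define M where "M = K + 16 * K / \<gamma>\<^sub>1"
 have M: "0 < M" using K(1) assms(2) by (simp add: M_def add_pos_pos)
 show ?thesis
 \<comment> \<open>\<open>1 / (20 * M)\<close> is the smallness condition of
   \<open>inscribed\<close>. The factor 500 exceeds \<open>2 * 123 * 2\<close>, from
   \<open>L\<^sup>2 - 1 \<le> 123 * z\<close> and \<open>L\<^sup>2 \<le> 2\<close> in the energy
   estimate.\<close>
 proof (rule exI[of _ "500 * M\<^sup>2"], rule conjI[OF _ exI[of _ "1 / (20 * M)"]], goal_cases)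
  case 1
  show ?case using M by simp
 next
  case 2
  show ?case
  proof (intro conjI allI impI)
  show "0 < 1 / (20 * M)" using M by simp
  fix \<delta> U h T v w
  assume fermi: "fermi_stripe \<Gamma> \<nu> \<delta> U" and h: "0 < h" "h \<le> 1 / (20 * M)"
   and mesh: "surface_mesh \<Gamma> \<nu> \<delta> U \<gamma>\<^sub>1 \<gamma>\<^sub>2 h T" and v: "H1_mesh T v" and w: "H1_mesh T w"
  have h': "20 * M * h \<le> 1" using h M by (simp add: field_simps)
  interpret inscribed_mesh \<Gamma> \<nu> \<delta> U T h K \<gamma>\<^sub>1
   by (rule surface_mesh_inscribed[OF assms(1) mesh fermi K assms(2) h(1) h'[unfolded M_def]])
  define z where "z = M\<^sup>2 * h\<^sup>2"
  have z: "0 \<le> z" "z \<le> 1 / 400"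
   using power_mono[of "20 * M * h" 1 2] h' h(1) M by (auto simp: z_def power_mult_distrib)
  \<comment> \<open>\<open>L\<^sup>2 - 1\<close> is \<open>114 * z + 57\<^sup>2 * z\<^sup>2\<close>,
    and \<open>z \<le> 1 / 400\<close> makes the last term at most \<open>9 * z\<close>.\<close>
  have L_bounds: "L\<^sup>2 - 1 \<le> 123 * z \<and> 0 \<le> L\<^sup>2 - 1" if T: "T \<noteq> {}"
  proof -
   obtain ps \<rho> where P: "inscribed \<Gamma> \<nu> \<delta> U ps h K \<gamma>\<^sub>1 \<rho>" using polygon T by blast
   have L: "L = 1 + 57 * z"
    unfolding inscribed.L_def[OF P] inscribed.M_def[OF P] z_def M_def by simp
   have "z * z \<le> 1 / 400 * z" using z by (intro mult_right_mono) auto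
   then show ?thesis using z by (simp add: L power2_eq_square algebra_simps)
  qed
  have c1: "max 0 (L\<^sup>2 - 1) \<le> 500 * z" and c2: "max 0 (2 * (L\<^sup>2 - 1) * L\<^sup>2) \<le> 500 * z" if T: "T \<noteq> {}"
  proof -
   show "max 0 (L\<^sup>2 - 1) \<le> 500 * z" using L_bounds[OF T] z by simp
   have "(L\<^sup>2 - 1) * L\<^sup>2 \<le> (123 * z) * 2" using L_bounds[OF T] z by (intro mult_mono) auto
   then have "2 * (L\<^sup>2 - 1) * L\<^sup>2 \<le> 500 * z" using z(1) unfolding mult.assoc by linarith
   then show "max 0 (2 * (L\<^sup>2 - 1) * L\<^sup>2) \<le> 500 * z" using z(1) by simp
  qed
  \<comment> \<open>An empty mesh forces an empty surface, on which all norms vanish.\<close>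
  have \<Gamma>_empty: "\<Gamma> = {}" if "T = {}" using aE_cover that by simp
  have est: "s \<le> 500 * M\<^sup>2 * h\<^sup>2 * x * y"
   if "s \<le> c * (x * y)" "T \<noteq> {} ==> c \<le> 500 * z" "0 \<le> x" "0 \<le> y" "T = {} ==> x = 0" for s c x y
  proof (cases "T = {}")
   case False
   from order_trans[OF that(1) mult_right_mono[OF that(2)[OF False] mult_nonneg_nonneg[OF that(3,4)]]]
   show ?thesis by (simp add: z_def mult.assoc)
  qed (use that in simp)
  show "let v' = lift \<Gamma> \<nu> \<delta> T v; w' = lift \<Gamma> \<nu> \<delta> T w in
    \<bar>L2_inner 2 \<Gamma> v' w' - L2_inner 2 (mesh_surface T) v w\<bar>
     \<le> 500 * M\<^sup>2 * h\<^sup>2 * L2_norm 2 \<Gamma> v' * L2_norm 2 \<Gamma> w' \<and>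
    \<bar>a_form \<Gamma> \<nu> v' w' - a_bar T v w\<bar>
     \<le> 500 * M\<^sup>2 * h\<^sup>2 * L2_norm 2 \<Gamma> (weak_grad \<Gamma> \<nu> v') * L2_norm 2 \<Gamma> (weak_grad \<Gamma> \<nu> w')"
   unfolding Let_def
   by (intro conjI est[OF L2_estimate[OF v w] c1] est[OF energy_estimate[OF v w] c2] L2_norm_nonneg)
     (simp_all add: \<Gamma>_empty L2_norm_empty)
  qed
 qed
qed

end
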